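(* Let $n\ge2$ and let $M^n\hookrightarrow\Sigma^{2n}$ be a (connected) $C^3$ nonlinear CR-flat submanifold of CR dimension $n$ and CR codimension $n$. Then $M$ is congruent to a part of the Whitney submanifold up to an automorphism of $\Sigma^{2n}$; that is, after applying an automorphism of $\Sigma^{2n}$, $M$ is contained in the image of the Whitney submanifold $\Gamma_n:\Sigma^n\to\Sigma^{2n}$.
   Context: For $n\ge1$ let $V^{n+2}=\mathbb{C}^{n+1,1}$ be $\mathbb{C}^{n+2}$ with coordinates $\xi=(\xi^0,\xi^i,\xi^{n+1})$, $1\le i\le n$, and Hermitian form $Q_n(\xi,\bar\xi)=\sum_i\xi^i\bar\xi^i+\mathrm{i}(\xi^0\bar\xi^{n+1}-\xi^{n+1}\bar\xi^0)$. $\Sigma^n\subset\mathbb{C}P^{n+1}$ is the real hypersurface of $Q_n$-null lines, with its induced CR structure; it is CR equivalent to the unit sphere $S^{2n+1}\subset\mathbb{C}^{n+1}$, and its automorphisms are induced by $SU(n+1,1)$, the unimodular linear maps preserving $Q_n$. Let $\mathcal{H}$ denote the contact hyperplane field of the CR structure of $\Sigma^m$. A CR submanifold of CR dimension $n$ of $\Sigma^m$ is an immersion $f:M\hookrightarrow\Sigma^m$ of a manifold of real dimension $2n+1$ such that $f_*T_pM\cap\mathcal{H}_{f(p)}$ is a complex subspace of $\mathcal{H}_{f(p)}$ of complex dimension $n$ for each $p$; its CR codimension is $m-n$. It is CR-flat if the induced CR structure on $M$ is locally CR equivalent to $\Sigma^n$. It is linear if it is a part of a linearly embedded $\Sigma^n\subset\Sigma^m$,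 i.e. its image lies in the projectivization of an $(n+2)$-dimensional complex linear subspace (equivalently, its second fundamental form vanishes identically), and nonlinear otherwise. The Whitney submanifold $\Gamma_n:\Sigma^n\to\Sigma^{2n}$ is the immersion induced by the quadratic map $V^{n+2}\to V^{2n+2}$, $\xi\mapsto\mu=(\mu^0,\mu^i,\mu^{n+i},\mu^{2n+1})$, $1\le i\le n$, given by $$\mu^0=2\xi^0\xi^{n+1},\quad \mu^{2n+1}=(\xi^{n+1})^2-(\xi^0)^2,\quad \mu^i=\xi^i(\mathrm{i}\xi^0+\xi^{n+1}),\quad \mu^{n+i}=\xi^i(-\mathrm{i}\xi^0+\xi^{n+1}),$$ which pulls $Q_{2n}$ back to $2(\xi^0\bar\xi^0+\xi^{n+1}\bar\xi^{n+1})Q_n$. *)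

theory Defs
  imports "HOL-Analysis.Analysis"
begin

section \<open>Manifolds given by atlases\<close>

text \<open>Class \<open>C\<^sup>k\<close> on an open set; in finite dimension, differentiability with all directional
  derivatives of class \<open>C\<^sup>k\<close> is the usual class \<open>C\<^sup>k\<^sup>+\<^sup>1\<close>.\<close>

primrec Ck_open :: "nat \<Rightarrow> 'a::real_normed_vector set \<Rightarrow> ('a \<Rightarrow> 'b::real_normed_vector) \<Rightarrow> bool"
where
  "Ck_open 0 S f \<longleftrightarrow> continuous_on S f"
| "Ck_open (Suc k) S f \<longleftrightarrow> (\<forall>x\<in>S. f differentiable (at x)) \<and>
     (\<forall>v. Ck_open k S (\<lambda>x. frechet_derivative f (at x) v))"

text \<open>On an arbitrary set, class \<open>C\<^sup>k\<close> means having local \<open>C\<^sup>k\<close> extensions to the ambient space.\<close>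

definition Ck_on :: "nat \<Rightarrow> 'a::real_normed_vector set \<Rightarrow> ('a \<Rightarrow> 'b::real_normed_vector) \<Rightarrow> bool"
where
  "Ck_on k S f \<longleftrightarrow>
     (\<forall>x\<in>S. \<exists>U g. open U \<and> x \<in> U \<and> Ck_open k U g \<and> (\<forall>y\<in>S \<inter> U. g y = f y))"

text \<open>A chart is a domain together with a coordinate map. Abstract manifolds have charts with open
  image; the charts used below for projective space and its hypersurfaces take values in
  submanifolds of a Euclidean space.\<close>

type_synonym ('p, 'e) chart = "'p set \<times> ('p \<Rightarrow> 'e)"

definition carrier_of :: "('p, 'e) chart set \<Rightarrow> 'p set" where
  "carrier_of A = (\<Union>c\<in>A. fst c)"

definition atlas_open :: "('p, 'e::topological_space) chart set \<Rightarrow> 'p set \<Rightarrow> bool" where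
  "atlas_open A W \<longleftrightarrow> W \<subseteq> carrier_of A \<and>
     (\<forall>(U, \<phi>)\<in>A. openin (top_of_set (\<phi> ` U)) (\<phi> ` (U \<inter> W)))"

definition atlas_topology :: "('p, 'e::topological_space) chart set \<Rightarrow> 'p topology" where
  "atlas_topology A = topology (atlas_open A)"

definition restrict_atlas :: "('p, 'e) chart set \<Rightarrow> 'p set \<Rightarrow> ('p, 'e) chart set" where
  "restrict_atlas A W = (\<lambda>(U, \<phi>). (U \<inter> W, \<phi>)) ` A"

definition Ck_manifold :: "nat \<Rightarrow> ('p, 'e::euclidean_space) chart set \<Rightarrow> bool" where
  "Ck_manifold k A \<longleftrightarrow>
     (\<forall>(U, \<phi>)\<in>A. inj_on \<phi> U \<and> open (\<phi> ` U)) \<and>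
     (\<forall>(U, \<phi>)\<in>A. \<forall>(V, \<psi>)\<in>A.
        open (\<phi> ` (U \<inter> V)) \<and> Ck_on k (\<phi> ` (U \<inter> V)) (\<psi> \<circ> inv_into U \<phi>)) \<and>
     Hausdorff_space (atlas_topology A) \<and> second_countable (atlas_topology A)"

definition local_rep :: "('p, 'e) chart \<Rightarrow> ('q, 'd) chart \<Rightarrow> ('p \<Rightarrow> 'q) \<Rightarrow> 'e \<Rightarrow> 'd" where
  "local_rep c d f = snd d \<circ> f \<circ> inv_into (fst c) (snd c)"

definition Ck_map ::
  "nat \<Rightarrow> ('p, 'e::real_normed_vector) chart set \<Rightarrow> ('q, 'd::real_normed_vector) chart set \<Rightarrow>
   ('p \<Rightarrow> 'q) \<Rightarrow> bool" where
  "Ck_map k A B f \<longleftrightarrow> f ` carrier_of A \<subseteq> carrier_of B \<and>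
     (\<forall>c\<in>A. \<forall>d\<in>B.
        openin (top_of_set (snd c ` fst c)) (snd c ` {p \<in> fst c. f p \<in> fst d}) \<and>
        Ck_on k (snd c ` {p \<in> fst c. f p \<in> fst d}) (local_rep c d f))"

definition Ck_diffeo ::
  "nat \<Rightarrow> ('p, 'e::real_normed_vector) chart set \<Rightarrow> ('q, 'd::real_normed_vector) chart set \<Rightarrow>
   ('p \<Rightarrow> 'q) \<Rightarrow> bool" where
  "Ck_diffeo k A B f \<longleftrightarrow> bij_betw f (carrier_of A) (carrier_of B) \<and>
     Ck_map k A B f \<and> Ck_map k B A (inv_into (carrier_of A) f)"

text \<open>The differential of \<open>f\<close> at \<open>p\<close> read in the charts \<open>c\<close> (with open image) and \<open>d\<close>.\<close>

definition chart_deriv ::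
  "('p, 'e::real_normed_vector) chart \<Rightarrow> ('q, 'd::real_normed_vector) chart \<Rightarrow>
   ('p \<Rightarrow> 'q) \<Rightarrow> 'p \<Rightarrow> 'e \<Rightarrow> 'd" where
  "chart_deriv c d f p = frechet_derivative (local_rep c d f) (at (snd c p))"


section \<open>Projective space and the null hypersurface\<close>

text \<open>Coordinate indices of the space \<open>V\<close> of dimension \<open>m + 2\<close>, where \<open>m = CARD('m)\<close>:
  \<open>First\<close> is \<open>0\<close>, \<open>Final\<close> is \<open>m + 1\<close>, and \<open>Mid i\<close> are the indices \<open>1, \<dots>, m\<close>.\<close>

datatype 'm idx = First | Mid 'm | Final

instance idx :: (finite) finite
proof
  have "(UNIV :: 'a idx set) = insert First (insert Final (range Mid))"
    using idx.exhaust by auto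
  then show "finite (UNIV :: 'a idx set)"
    by (metis finite finite_imageI finite_insert)
qed

type_synonym 'm V = "complex ^ 'm idx"

definition herm :: "'m::finite V \<Rightarrow> 'm V \<Rightarrow> complex" where
  "herm x y = (\<Sum>i\<in>UNIV. x $ Mid i * cnj (y $ Mid i)) +
     \<i> * (x $ First * cnj (y $ Final) - x $ Final * cnj (y $ First))"

definition CP :: "'m::finite V set set" where
  "CP = {L. vec.subspace L \<and> vec.dim L = 1}"

text \<open>The affine chart \<open>[v] \<mapsto> v / v\<^sub>j\<close>; its image is the complex affine hyperplane \<open>v\<^sub>j = 1\<close>.\<close>

definition affine_chart :: "'m::finite idx \<Rightarrow> ('m V set, 'm V) chart" where
  "affine_chart j = ({L \<in> CP. \<exists>v\<in>L. v $ j \<noteq> 0}, \<lambda>L. THE v. v \<in> L \<and> v $ j = 1)"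

definition CP_atlas :: "('m::finite V set, 'm V) chart set" where
  "CP_atlas = range affine_chart"

definition Sigma_null :: "'m::finite V set set" where
  "Sigma_null = {L \<in> CP. \<forall>x\<in>L. herm x x = 0}"

text \<open>The tangent space of \<open>Sigma_null\<close> at \<open>L\<close>, read in the affine chart \<open>j\<close>: there the
  hypersurface is the regular zero set of the real-valued function \<open>x \<mapsto> herm x x\<close>.
  The chart is holomorphic, so the complex structure is multiplication by \<open>\<i>\<close>.\<close>

definition Sigma_tangent :: "'m::finite idx \<Rightarrow> 'm V set \<Rightarrow> 'm V set" where
  "Sigma_tangent j L =
     {w. w $ j = 0 \<and> frechet_derivative (\<lambda>x. herm x x) (at (snd (affine_chart j) L)) w = 0}"

definition contact_plane :: "'m::finite idx \<Rightarrow> 'm V set \<Rightarrow> 'm V set" where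
  "contact_plane j L = {w \<in> Sigma_tangent j L. \<i> *s w \<in> Sigma_tangent j L}"

definition SU :: "('m::finite V ^ 'm idx) set" where
  "SU = {T. det T = 1 \<and> (\<forall>x y. herm (T *v x) (T *v y) = herm x y)}"

definition Sigma_automorphisms :: "('m::finite V set \<Rightarrow> 'm V set) set" where
  "Sigma_automorphisms = {(\<lambda>L. (\<lambda>x. T *v x) ` L) | T. T \<in> SU}"


section \<open>CR submanifolds\<close>

definition CR_submanifold ::
  "nat \<Rightarrow> nat \<Rightarrow> ('p, 'e::euclidean_space) chart set \<Rightarrow> ('p \<Rightarrow> 'm::finite V set) \<Rightarrow> bool" where
  "CR_submanifold k n A f \<longleftrightarrow>
     Ck_manifold k A \<and> DIM('e) = 2 * n + 1 \<and>
     Ck_map k A CP_atlas f \<and> f ` carrier_of A \<subseteq> Sigma_null \<and>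
     (\<forall>c\<in>A. \<forall>p\<in>fst c. \<forall>j. f p \<in> fst (affine_chart j) \<longrightarrow>
        (let df = chart_deriv c (affine_chart j) f p;
             D = range df \<inter> contact_plane j (f p)
         in inj df \<and> vec.subspace D \<and> vec.dim D = n))"

text \<open>The CR structure induced by \<open>f\<close>, in a chart \<open>c\<close> at \<open>p\<close>: the distribution
  of those \<open>X\<close> with \<open>f\<^sub>* X \<in> H\<close>, and the endomorphism \<open>J\<close> with \<open>f\<^sub>* (J X) = \<i> f\<^sub>* X\<close> on it.\<close>

definition CR_plane ::
  "('p, 'e::euclidean_space) chart \<Rightarrow> 'm::finite idx \<Rightarrow> ('p \<Rightarrow> 'm V set) \<Rightarrow> 'p \<Rightarrow> 'e set" where
  "CR_plane c j f p = {X. chart_deriv c (affine_chart j) f p X \<in> contact_plane j (f p)}"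

definition CR_J ::
  "('p, 'e::euclidean_space) chart \<Rightarrow> 'm::finite idx \<Rightarrow> ('p \<Rightarrow> 'm V set) \<Rightarrow> 'p \<Rightarrow> 'e \<Rightarrow> 'e" where
  "CR_J c j f p X = (THE Y. chart_deriv c (affine_chart j) f p Y =
     \<i> *s chart_deriv c (affine_chart j) f p X)"

text \<open>\<open>h\<close> is a \<open>C\<^sup>k\<close> CR equivalence from the open set \<open>W\<close> of the manifold, with the CR structure
  induced by \<open>f\<close>, onto the open subset \<open>h ` W\<close> of \<open>Sigma_null\<close>: the CR structure that \<open>f\<close>
  induces on \<open>W\<close> is the pullback by \<open>h\<close> of the one of \<open>Sigma_null\<close>.\<close>

definition CR_equivalence ::
  "nat \<Rightarrow> ('p, 'e::euclidean_space) chart set \<Rightarrow> ('p \<Rightarrow> 'm::finite V set) \<Rightarrow> 'p set \<Rightarrow>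
   ('p \<Rightarrow> 'n::finite V set) \<Rightarrow> bool" where
  "CR_equivalence k A f W h \<longleftrightarrow>
     openin (atlas_topology A) W \<and>
     openin (atlas_topology (restrict_atlas CP_atlas Sigma_null)) (h ` W) \<and>
     Ck_diffeo k (restrict_atlas A W) (restrict_atlas CP_atlas (h ` W)) h \<and>
     (\<forall>c\<in>A. \<forall>p\<in>fst c \<inter> W. \<forall>i j.
        f p \<in> fst (affine_chart i) \<longrightarrow> h p \<in> fst (affine_chart j) \<longrightarrow>
        CR_plane c i f p = CR_plane c j h p \<and>
        (\<forall>X\<in>CR_plane c i f p. CR_J c i f p X = CR_J c j h p X))"

text \<open>The \<open>itself\<close> argument names the model \<open>Sigma_null\<close> of CR dimension \<open>CARD('n)\<close>.\<close>

definition CR_flat ::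
  "'n::finite itself \<Rightarrow> nat \<Rightarrow> ('p, 'e::euclidean_space) chart set \<Rightarrow>
   ('p \<Rightarrow> 'm::finite V set) \<Rightarrow> bool" where
  "CR_flat _ k A f \<longleftrightarrow>
     (\<forall>p\<in>carrier_of A. \<exists>W (h :: 'p \<Rightarrow> 'n V set). p \<in> W \<and> CR_equivalence k A f W h)"

definition CR_linear :: "nat \<Rightarrow> ('p, 'e) chart set \<Rightarrow> ('p \<Rightarrow> 'm::finite V set) \<Rightarrow> bool" where
  "CR_linear n A f \<longleftrightarrow>
     (\<exists>E. vec.subspace E \<and> vec.dim E = n + 2 \<and> (\<forall>p\<in>carrier_of A. f p \<subseteq> E))"


section \<open>The Whitney submanifold\<close>

text \<open>The indices \<open>i\<close> and \<open>n + i\<close> are \<open>Mid (Inl i)\<close> and \<open>Mid (Inr i)\<close>.\<close>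

definition whitney_quadratic :: "'n::finite V \<Rightarrow> ('n + 'n) V" where
  "whitney_quadratic x = (\<chi> a. case a of
       First \<Rightarrow> 2 * x $ First * x $ Final
     | Final \<Rightarrow> (x $ Final)\<^sup>2 - (x $ First)\<^sup>2
     | Mid b \<Rightarrow> (case b of
           Inl i \<Rightarrow> x $ Mid i * (\<i> * x $ First + x $ Final)
         | Inr i \<Rightarrow> x $ Mid i * (- \<i> * x $ First + x $ Final)))"

definition whitney :: "'n::finite V set \<Rightarrow> ('n + 'n) V set" where
  "whitney L = vec.span (whitney_quadratic ` L)"

end

theory Submission
  imports Defs "HOL-Complex_Analysis.Complex_Analysis"
begin

text \<open>
  Flatness makes \<open>f\<close> locally a CR map \<open>u\<close> from the Heisenberg group into the null cone. Comparing
  the 3-jet of \<open>u\<close> with the equation \<open>herm u u = 0\<close> in codimension \<open>n\<close>, the second fundamental form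
  vanishes on a hyperplane, whose orthogonal complement is spanned by a vector field \<open>y\<close>, and the
  hyperplane extends to a hyperplane \<open>L = ker ll\<close> of the source space \<open>V\<close> such that, up to scale, both
  \<open>L\<close> and the linear map \<open>MM = phi1 + sig u\<close> restricted to it have derivatives proportional to
  \<open>ll\<close>. If \<open>y = 0\<close> then \<open>MM\<close> is constant and \<open>u\<close> is linear. Otherwise \<open>L\<close> and \<open>MM\<close> depend
  holomorphically on one complex parameter \<open>z\<close>, and polarisation of the induced Hermitian form gives
  isometries up to scale \<open>M z : L z \<rightarrow> V\<close> with \<open>herm (M z x) (M w x') = \<rho> z w * herm x x'\<close>. A dimension
  count shows that \<open>\<rho>\<close> has rank two, and the Gram matrix of the vectors \<open>M z x\<close> is then that of the
  Whitney map; Witt's theorem turns this into a congruence.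

  The local forms are polynomial in Heisenberg coordinates, so each of them spreads over the connected
  manifold by analytic continuation. Across points where the second fundamental form vanishes the
  Whitney form is propagated by continuity: a limit of Whitney pieces has vanishing second fundamental
  form only on a subset of codimension at least two, which does not separate.
\<close>

text \<open>The map is only of class C^3, and no holomorphic extension to a full neighbourhood of
  the null cone is assumed. Its place is taken by complex derivatives along the cone, linear because
  of the CR equations, and by one recurring device: a relation between jets is differentiated along
  a (0,1) vector. The jets themselves are blind to such a vector; it acts through the Levi form of
  the source, that is through the transverse component \<open>NN\<close> in the derivative of a
  contact vector. So no derivative of higher order appears, and since \<open>phi2\<close> is still
  of class C^1 this can be applied to every relation between \<open>phi1\<close> and
  \<open>phi2\<close>. The codimension n matters because u, its first jet and the vectors
  \<open>BB f e\<close> exhaust the target of dimension 2n + 2: no further normal direction is left.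
  The rank of \<open>\<rho>\<close> exceeds one because a kernel of rank one would put all values of
  the family into a space of dimension n + 2, and its second eigenvalue is positive because the
  target has only one negative direction.\<close>

no_notation fps_nth (infixl \<open>$\<close> 75)

abbreviation FD :: "('a::real_normed_vector => 'b::real_normed_vector) => 'a => 'a => 'b" where
  "FD f x \<equiv> frechet_derivative f (at x)"
abbreviation cor :: "real => complex" where "cor \<equiv> complex_of_real"
abbreviation wq :: "'n::finite V => ('n + 'n) V" where "wq \<equiv> whitney_quadratic"

section \<open>Hermitian forms\<close>

definition clin :: "(complex^'a => complex^'b) => bool" where
  "clin f \<longleftrightarrow> (\<forall>x y. f (x + y) = f x + f y) \<and> (\<forall>c x. f (c *s x) = c *s f x)"

definition clinf :: "(complex^'a => complex) => bool" where
  "clinf f \<longleftrightarrow> (\<forall>x y. f (x + y) = f x + f y) \<and> (\<forall>c x. f (c *s x) = c * f x)"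

definition hermitian :: "(complex^'a => complex^'a => complex) => bool" where
  "hermitian h \<longleftrightarrow> (\<forall>x y z. h (x + y) z = h x z + h y z) \<and>
     (\<forall>c x z. h (c *s x) z = c * h x z) \<and> (\<forall>x y. cnj (h x y) = h y x)"

lemma mult_cnj_cmod: "z * cnj z = cor ((cmod z)\<^sup>2)"
  using complex_norm_square[of z] by simp

lemma clin_imp_linear: "clin f ==> Vector_Spaces.linear (*s) (*s) f"
  unfolding clin_def by (simp add: Vector_Spaces.linear_iff vec.vector_space_axioms)

lemma linear_imp_clin: "Vector_Spaces.linear (*s) (*s) f ==> clin f"
  unfolding clin_def by (simp add: Vector_Spaces.linear_iff)

lemma clinI: "[|!!x y. f (x + y) = f x + f y; !!c x. f (c *s x) = c *s f x|] ==> clin f"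
  by (simp add: clin_def)

lemma clinfI: "[|!!x y. f (x + y) = f x + f y; !!c x. f (c *s x) = c * f x|] ==> clinf f"
  by (simp add: clinf_def)

lemma scaleR_eq_vec: "r *\<^sub>R (x :: complex^'a) = cor r *s x"
  by (simp add: vec_eq_iff scaleR_conv_of_real[where 'a=complex])

context
  fixes f :: "complex^'a => complex^'b"
  assumes f: "clin f"
begin
lemma clin_add: "f (x + y) = f x + f y" using f by (simp add: clin_def)
lemma clin_scale: "f (c *s x) = c *s f x" using f by (simp add: clin_def)
lemma clin_zero: "f 0 = 0" using clin_scale[of 0 0] by simp
lemma clin_minus: "f (- x) = - f x" using clin_scale[of "-1" x] by (simp add: vec.scale_minus_left)
lemma clin_diff: "f (x - y) = f x - f y" using clin_add[of x "- y"] clin_minus by simp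
lemma clin_scaleR: "f (r *\<^sub>R x) = r *\<^sub>R f x" by (simp add: scaleR_eq_vec clin_scale)
lemma clin_sum: "f (sum g I) = (\<Sum>i\<in>I. f (g i))"
  by (induction I rule: infinite_finite_induct) (simp_all add: clin_zero clin_add)
end

context
  fixes f :: "complex^'a => complex"
  assumes f: "clinf f"
begin
lemma clinf_add: "f (x + y) = f x + f y" using f by (simp add: clinf_def)
lemma clinf_scale: "f (c *s x) = c * f x" using f by (simp add: clinf_def)
lemma clinf_zero: "f 0 = 0" using clinf_scale[of 0 0] by simp
lemma clinf_minus: "f (- x) = - f x" using clinf_scale[of "-1" x] by (simp add: vec.scale_minus_left)
lemma clinf_diff: "f (x - y) = f x - f y" using clinf_add[of x "- y"] clinf_minus by simp
lemma clinf_sum: "f (sum g I) = (\<Sum>i\<in>I. f (g i))"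
  by (induction I rule: infinite_finite_induct) (simp_all add: clinf_zero clinf_add)
end

context
  fixes h :: "complex^'a => complex^'a => complex"
  assumes h: "hermitian h"
begin
lemma hermitian_cnj: "cnj (h x y) = h y x" using h by (simp add: hermitian_def)
lemma hermitian_add_left: "h (x + y) z = h x z + h y z" using h by (simp add: hermitian_def)
lemma hermitian_scale_left: "h (c *s x) z = c * h x z" using h by (simp add: hermitian_def)
lemma hermitian_add_right: "h z (x + y) = h z x + h z y"
  by (metis hermitian_cnj hermitian_add_left complex_cnj_add)
lemma hermitian_scale_right: "h z (c *s x) = cnj c * h z x"
  by (metis hermitian_cnj hermitian_scale_left complex_cnj_mult)
lemma hermitian_clinf: "clinf (%x. h x z)"
  by (simp add: clinf_def hermitian_add_left hermitian_scale_left)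
lemmas hermitian_zero_left = clinf_zero[OF hermitian_clinf]
lemmas hermitian_minus_left = clinf_minus[OF hermitian_clinf]
lemmas hermitian_diff_left = clinf_diff[OF hermitian_clinf]
lemmas hermitian_sum_left = clinf_sum[OF hermitian_clinf]
lemma hermitian_zero_right: "h z 0 = 0" using hermitian_scale_right[of z 0 0] by simp
lemma hermitian_minus_right: "h z (- x) = - h z x"
  using hermitian_scale_right[of z "-1" x] by (simp add: vec.scale_minus_left)
lemma hermitian_diff_right: "h z (x - y) = h z x - h z y"
  using hermitian_add_right[of z x "- y"] hermitian_minus_right by simp
lemma hermitian_sum_right: "h z (sum g I) = (\<Sum>i\<in>I. h z (g i))"
  by (induction I rule: infinite_finite_induct) (simp_all add: hermitian_zero_right hermitian_add_right)
lemmas hermitian_simps = hermitian_add_left hermitian_add_right hermitian_scale_left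
  hermitian_scale_right hermitian_zero_left hermitian_zero_right hermitian_minus_left
  hermitian_minus_right hermitian_diff_left hermitian_diff_right
lemma hermitian_real: "h x x = cor (Re (h x x))"
  using hermitian_cnj[of x x] by (simp add: complex_eq_iff)
end

definition cip :: "complex^'k::finite => complex^'k => complex" where
  "cip x y = (\<Sum>i\<in>UNIV. x $ i * cnj (y $ i))"

lemma hermitian_herm: "hermitian (herm :: 'm::finite V => _)"
  unfolding hermitian_def herm_def
  by (simp add: algebra_simps sum.distrib sum_distrib_left)

lemma hermitian_cip: "hermitian cip"
  unfolding hermitian_def cip_def by (simp add: algebra_simps sum.distrib sum_distrib_left)

lemmas herm_simps = hermitian_simps[OF hermitian_herm]
lemmas herm_cnj = hermitian_cnj[OF hermitian_herm]
lemmas herm_sum_left = hermitian_sum_left[OF hermitian_herm]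
lemmas herm_sum_right = hermitian_sum_right[OF hermitian_herm]
lemmas cip_simps = hermitian_simps[OF hermitian_cip]
lemmas cip_cnj = hermitian_cnj[OF hermitian_cip]

lemma cip_self: "cip x x = cor ((norm x)\<^sup>2)"
proof -
  have "(norm x)\<^sup>2 = (\<Sum>i\<in>UNIV. (norm (x $ i))\<^sup>2)"
    by (simp add: norm_vec_def L2_set_def sum_nonneg)
  then show ?thesis
    unfolding cip_def by (simp add: mult_cnj_cmod)
qed

lemma cip_self_eq_0: "cip x x = 0 \<longleftrightarrow> x = 0"
  by (simp add: cip_self)

lemma norm_vec_scale: "norm (c *s (x :: complex^'k::finite)) = cmod c * norm x"
proof -
  have "cor ((norm (c *s x))\<^sup>2) = cor ((cmod c * norm x)\<^sup>2)"
    unfolding cip_self[symmetric] cip_simps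
    by (simp add: cip_self mult.assoc[symmetric] mult_cnj_cmod mult.commute[of "cnj c"] power_mult_distrib)
  then have "(norm (c *s x))\<^sup>2 = (cmod c * norm x)\<^sup>2" using of_real_eq_iff by blast
  then show ?thesis by (simp add: power2_eq_iff_nonneg)
qed

lemma cip_axis: "cip x (axis i 1) = x $ i" "cip (axis i 1) x = cnj (x $ i)"
  by (simp_all add: cip_def axis_def if_distrib[of cnj] if_distrib[of "%u. _ * u"] if_distrib[of "%u. u * _"]
      cong: if_cong)

text \<open>The coordinates \<open>tco\<close> and \<open>sco\<close> diagonalise the hyperbolic part of \<open>herm\<close>, which has
  signature \<open>(m + 1, 1)\<close>.\<close>

definition tco :: "'m::finite V => complex" where "tco v = v $ First + \<i> * v $ Final"
definition sco :: "'m::finite V => complex" where "sco v = v $ First - \<i> * v $ Final"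

lemma herm_tco_sco:
  "herm x y = (\<Sum>i\<in>UNIV. x $ Mid i * cnj (y $ Mid i)) + (sco x * cnj (sco y) - tco x * cnj (tco y)) / 2"
  unfolding herm_def tco_def sco_def by (simp add: field_simps)

lemma idx_eqI: "[|x $ First = y $ First; x $ Final = y $ Final; !!i. x $ Mid i = y $ Mid i|] ==> x = (y :: 'm::finite V)"
  by (simp add: vec_eq_iff) (metis idx.exhaust)

lemma tco_sco_eqI:
  assumes "tco x = tco y" "sco x = sco y" "!!i. x $ Mid i = y $ Mid i"
  shows "x = y"
proof (rule idx_eqI)
  have "2 * x $ First = 2 * y $ First" "2 * \<i> * x $ Final = 2 * \<i> * y $ Final"
    using assms(1,2) unfolding tco_def sco_def by algebra+
  then show "x $ First = y $ First" "x $ Final = y $ Final" by simp_all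
qed (use assms in auto)

lemma tco_clinf: "clinf tco" and sco_clinf: "clinf sco"
  by (auto simp: clinf_def tco_def sco_def algebra_simps)

lemma herm_self: "herm x x = cor
    ((\<Sum>i\<in>UNIV. (cmod (x $ Mid i))\<^sup>2) + ((cmod (sco x))\<^sup>2 - (cmod (tco x))\<^sup>2) / 2)"
  unfolding herm_tco_sco by (simp add: mult_cnj_cmod)

lemma herm_pos:
  assumes "tco s = 0" shows "0 \<le> Re (herm s s)" and "Re (herm s s) = 0 ==> s = 0"
proof -
  show "0 \<le> Re (herm s s)"
    unfolding herm_self using assms by (simp add: sum_nonneg)
  assume "Re (herm s s) = 0"
  then have "(\<Sum>i\<in>UNIV. (cmod (s $ Mid i))\<^sup>2) + (cmod (sco s))\<^sup>2 / 2 = 0"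
    unfolding herm_self using assms by simp
  moreover have "0 \<le> (\<Sum>i\<in>UNIV. (cmod (s $ Mid i))\<^sup>2)" by (simp add: sum_nonneg)
  ultimately have *: "(\<Sum>i\<in>UNIV. (cmod (s $ Mid i))\<^sup>2) = 0" "(cmod (sco s))\<^sup>2 = 0"
    by (smt (verit) zero_le_power2 divide_nonneg_nonneg half_gt_zero)+
  then show "s = 0"
    using assms by (intro tco_sco_eqI) (auto simp: sum_nonneg_eq_0_iff tco_def sco_def)
qed

text \<open>The form has a single negative direction: it is positive definite on the kernel of
  \<open>tco\<close>. The combination of u and v lying in that kernel has non-positive norm, because
  the mixed terms vanish, so it is zero.\<close>

lemma lorentz:
  assumes v: "v ~= 0" "Re (herm v v) \<le> 0" and u: "herm u v = 0" "Re (herm u u) \<le> 0"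
  obtains c where "u = c *s v"
proof -
  have tv: "tco v ~= 0" using v herm_pos[of v] by (metis order_antisym)
  define s where "s = tco v *s u - tco u *s v"
  have vu: "herm v u = 0" using herm_cnj[of u v] u(1) by simp
  have "herm s s = (tco v * cnj (tco v)) * herm u u + (tco u * cnj (tco u)) * herm v v"
    unfolding s_def using u(1) vu by (simp add: herm_simps)
  then have "Re (herm s s) = (cmod (tco v))\<^sup>2 * Re (herm u u) + (cmod (tco u))\<^sup>2 * Re (herm v v)"
    by (simp add: mult_cnj_cmod del: of_real_power)
  also have "\<dots> \<le> 0" using v(2) u(2)
    by (simp add: add_nonpos_nonpos mult_nonneg_nonpos)
  finally have "Re (herm s s) \<le> 0" .
  moreover have "tco s = 0" unfolding s_def
    by (simp add: clinf_diff[OF tco_clinf] clinf_scale[OF tco_clinf])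
  ultimately have "s = 0" using herm_pos[of s] by (metis order_antisym)
  then have "tco v *s u = tco u *s v" unfolding s_def by simp
  then have "u = (tco u / tco v) *s v"
    using tv by (metis (no_types, lifting) divide_inverse_commute left_inverse vec.scale_one vec.scale_scale)
  then show ?thesis using that by blast
qed

lemma herm_nondeg:
  assumes "!!y. herm x y = 0" shows "x = 0"
proof (rule idx_eqI)
  have ax: "herm x (axis First 1) = - \<i> * x $ Final" "herm x (axis Final 1) = \<i> * x $ First"
    by (simp_all add: herm_def axis_def)
  have "herm x (axis (Mid i) 1) = x $ Mid i" for i
    by (simp add: herm_def axis_def if_distrib[of cnj] if_distrib[of "%u. _ * u"] cong: if_cong)
  then show "x $ Mid i = 0 $ Mid i" for i using assms by simp
  show "x $ First = 0 $ First" "x $ Final = 0 $ Final" using ax assms by simp_all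
qed

section \<open>Linear algebra\<close>

lemma card_idx: "CARD('m::finite idx) = CARD('m) + 2"
proof -
  have *: "(UNIV :: 'm idx set) = insert First (insert Final (range Mid))"
    using idx.exhaust by auto
  have "card (range (Mid :: 'm => 'm idx)) = CARD('m)"
    by (simp add: card_image inj_def)
  then show ?thesis by (subst *) (simp add: card_insert_if image_iff)
qed

lemma clin_injI: "[|clin f; !!x. f x = 0 ==> x = 0|] ==> inj f"
proof (rule injI)
  fix x y assume f: "clin f" and i: "!!x. f x = 0 ==> x = 0" and e: "f x = f y"
  have "f (x - y) = 0" using clin_diff[OF f, of x y] e by simp
  then show "x = y" using i[of "x - y"] by simp
qed

lemma vec_span_basis:
  fixes W :: "(complex^'b) set"
  obtains B where "B \<subseteq> W" "vec.independent B" "vec.span B = vec.span W"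
proof -
  obtain B where B: "B \<subseteq> W" "vec.independent B" "W \<subseteq> vec.span B"
    by (rule vec.maximal_independent_subset[of W])
  have "vec.span W \<subseteq> vec.span B" using B(3) vec.span_minimal vec.subspace_span by blast
  moreover have "vec.span B \<subseteq> vec.span W" using B(1) by (rule vec.span_mono)
  ultimately show ?thesis using that B by blast
qed

lemma clin_kernel:
  fixes f :: "complex^'a::finite => complex^'b::finite"
  assumes f: "clin f" and c: "CARD('b) < CARD('a)"
  obtains x where "x ~= 0" "f x = 0"
proof -
  note lf = clin_imp_linear[OF f]
  have "\<not> inj f"
  proof
    assume "inj f"
    then have "vec.dim (f ` UNIV) = vec.dim (UNIV :: (complex^'a) set)"
      by (intro vec.dim_image_eq[OF lf]) (auto intro: inj_on_subset)
    moreover have "vec.dim (f ` UNIV) \<le> CARD('b)" using vec.dim_subset_UNIV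
      by (metis vec_dim_card vec.dim_subset subset_UNIV)
    ultimately show False using c by (simp add: vec_dim_card card_cart_basis)
  qed
  then show ?thesis using that clin_injI[OF f] by blast
qed

lemma clin_inj_surj:
  fixes f :: "complex^'a::finite => complex^'a"
  assumes f: "clin f" and i: "!!x. f x = 0 ==> x = 0"
  shows "surj f"
proof -
  have "inj f" using clin_injI[OF f i] by blast
  then show ?thesis using vec.linear_injective_imp_surjective clin_imp_linear[OF f] by blast
qed

lemma clin_surj_card:
  fixes f :: "complex^'a::finite => complex^'b::finite"
  assumes f: "clin f" and "surj f"
  shows "CARD('b) \<le> CARD('a)"
  using vec.dim_image_le[OF clin_imp_linear[OF f], of UNIV] assms(2) by (simp add: vec_dim_card card_cart_basis)

text \<open>A family spanning a non-degenerate space is a linear image of any family with the same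
  Gram matrix, because a relation on the latter gives a vector orthogonal to everything.\<close>

lemma gram_extension:
  fixes v :: "'i => 'm::finite V" and w :: "'i => complex^'b::finite"
    and S :: "complex^'b => complex^'b => complex"
  assumes span: "!!x. (!!i. i \<in> I ==> herm x (v i) = 0) ==> x = 0"
    and S: "hermitian S"
    and gram: "!!i j. [|i \<in> I; j \<in> I|] ==> herm (v i) (v j) = S (w i) (w j)"
  obtains f where "clin f" "!!i. i \<in> I ==> f (w i) = v i"
proof -
  obtain B where B: "B \<subseteq> w ` I" "vec.independent B" "vec.span B = vec.span (w ` I)"
    by (rule vec_span_basis)
  have "\<forall>b\<in>B. \<exists>i. i \<in> I \<and> w i = b" using B(1) by blast
  then have "\<exists>g. \<forall>b\<in>B. g b \<in> I \<and> w (g b) = b" by (rule bchoice)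
  then obtain g where g: "!!b. b \<in> B ==> g b \<in> I \<and> w (g b) = b" by blast
  obtain f where f: "Vector_Spaces.linear (*s) (*s) f" "!!b. b \<in> B ==> f b = v (g b)"
    using vec.linear_independent_extend[OF B(2), of "%b. v (g b)"] by blast
  note cf = linear_imp_clin[OF f(1)]
  have finB: "finite B" using B(2) vec.finiteI_independent by blast
  have "f (w i) = v i" if i: "i \<in> I" for i
  proof -
    have "w i \<in> vec.span B" using i B(3) by (simp add: vec.span_base)
    then obtain r where r: "w i = (\<Sum>b\<in>B. r b *s b)"
      using vec.span_finite[OF finB] by auto
    have "f (w i) - v i = 0"
    proof (rule span)
      fix j assume j: "j \<in> I"
      have "herm (f (w i)) (v j) = (\<Sum>b\<in>B. r b * herm (v (g b)) (v j))"
        unfolding r by (simp add: clin_sum[OF cf] clin_scale[OF cf] f(2) herm_sum_left herm_simps)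
      also have "\<dots> = (\<Sum>b\<in>B. r b * S b (w j))"
        using g j gram by (intro sum.cong) auto
      also have "\<dots> = S (w i) (w j)"
        unfolding r by (simp add: hermitian_sum_left[OF S] hermitian_scale_left[OF S])
      also have "\<dots> = herm (v i) (v j)" using gram i j by simp
      finally show "herm (f (w i) - v i) (v j) = 0" by (simp add: herm_simps)
    qed
    then show ?thesis by simp
  qed
  then show ?thesis using that cf by blast
qed

text \<open>A linear functional that vanishes on W but not at some z outside the span is represented
  by a vector: by non-degeneracy the map from vectors to functionals is injective, hence
  onto.\<close>

lemma herm_orth_exists:
  fixes W :: "(complex^'b::finite) set" and S
  assumes S: "hermitian S" and nd: "!!x. (!!y. S x y = 0) ==> x = 0"
    and ns: "vec.span W ~= UNIV"
  obtains a where "a ~= 0" "!!w. w \<in> W ==> S w a = 0"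
proof -
  obtain z where z: "z \<notin> vec.span W" using ns by blast
  obtain B where B': "B \<subseteq> W" "vec.independent B" "vec.span B = vec.span W"
    by (rule vec_span_basis)
  then have B: "B \<subseteq> vec.span W" "vec.independent B" "vec.span B = vec.span W"
    using vec.span_superset by blast+
  have ind: "vec.independent (insert z B)" using z B by (simp add: vec.independent_insert)
  obtain f :: "complex^'b => complex^1" where f: "Vector_Spaces.linear (*s) (*s) f"
     "!!b. b \<in> insert z B ==> f b = (if b = z then 1 else 0)"
    using vec.linear_independent_extend[OF ind, of "%b. (if b = z then 1 else 0) :: complex^1"] by blast
  note cf = linear_imp_clin[OF f(1)]
  have f0: "f b = 0" if "b \<in> vec.span W" for b
  proof -
    have "b \<in> vec.span B" using that B by simp
    then show ?thesis
    proof (induction rule: vec.span_induct_alt)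
      case base then show ?case by (simp add: clin_zero[OF cf])
    next
      case (step c x y)
      then have "x ~= z" using z B(1) by blast
      then show ?case using step f(2)[of x] by (simp add: clin_add[OF cf] clin_scale[OF cf])
    qed
  qed
  \<comment> \<open>The conjugation of a makes this map complex linear instead of conjugate
    linear.\<close>
  define R where "R = (%a. \<chi> i. S (axis i 1) (\<chi> j. cnj (a $ j)))"
  have R: "R a $ i = S (axis i 1) (\<chi> j. cnj (a $ j))" for a i by (simp add: R_def)
  have cR: "clin R"
  proof (rule clinI)
    fix x y :: "complex^'b" and c
    have 1: "(\<chi> j. cnj ((x + y) $ j)) = (\<chi> j. cnj (x $ j)) + (\<chi> j. cnj (y $ j))" by (simp add: vec_eq_iff)
    have 2: "(\<chi> j. cnj ((c *s x) $ j)) = cnj c *s (\<chi> j. cnj (x $ j))" by (simp add: vec_eq_iff)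
    show "R (x + y) = R x + R y" by (simp only: vec_eq_iff R 1 hermitian_add_right[OF S]) (simp add: R)
    show "R (c *s x) = c *s R x" by (simp only: vec_eq_iff R 2 hermitian_scale_right[OF S]) (simp add: R)
  qed
  have exp: "x = (\<Sum>i\<in>UNIV. x $ i *s axis i 1)" for x :: "complex^'b"
    by (simp add: vec_eq_iff axis_def if_distrib cong: if_cong)
  have "surj R"
  proof (rule clin_inj_surj[OF cR])
    fix x assume "R x = 0"
    then have *: "S (axis i 1) (\<chi> j. cnj (x $ j)) = 0" for i using R[of x i] by simp
    have "S y (\<chi> j. cnj (x $ j)) = 0" for y
      by (subst exp[of y]) (simp add: hermitian_sum_left[OF S] hermitian_scale_left[OF S] *)
    then have "S (\<chi> j. cnj (x $ j)) y = 0" for y using hermitian_cnj[OF S] by (metis complex_cnj_zero)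
    then have "(\<chi> j. cnj (x $ j)) = 0" using nd by blast
    then show "x = 0" by (simp add: vec_eq_iff)
  qed
  then obtain a where a: "R a = (\<chi> i. f (axis i 1) $ 1)" by (metis surjD)
  define a' where "a' = (\<chi> j. cnj (a $ j))"
  have Sa: "S (axis i 1) a' = f (axis i 1) $ 1" for i
    using R[of a i] unfolding a a'_def by simp
  have Sf: "S x a' = f x $ 1" for x
  proof -
    have "S x a' = (\<Sum>i\<in>UNIV. x $ i * f (axis i 1) $ 1)"
      by (subst exp[of x]) (simp add: hermitian_sum_left[OF S] hermitian_scale_left[OF S] Sa)
    also have "\<dots> = f x $ 1"
    proof -
      have "f x = f (\<Sum>i\<in>UNIV. x $ i *s axis i 1)" using exp[of x] by simp
      then show ?thesis by (simp add: clin_sum[OF cf] clin_scale[OF cf])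
    qed
    finally show ?thesis .
  qed
  have "a' ~= 0" using Sf[of z] f(2)[of z] hermitian_zero_right[OF S] by auto
  moreover have "S w a' = 0" if "w \<in> W" for w using Sf f0 that by (simp add: vec.span_base)
  ultimately show ?thesis using that by blast
qed

text \<open>Rayleigh quotient: a maximum of the form on the unit sphere is an eigenvector, so its
  direction splits off orthogonally.\<close>

lemma hermitian_max:
  fixes h :: "complex^'k::finite => complex^'k => complex"
  assumes h: "hermitian h"
  obtains f where "cip f f = 1" "!!x. cip x f = 0 ==> h x f = 0" "!!x. Re (h x x) \<le> Re (h f f) * (norm x)\<^sup>2"
proof -
  have exp: "x = (\<Sum>i\<in>UNIV. x $ i *s axis i 1)" for x :: "complex^'k"
    by (simp add: vec_eq_iff axis_def if_distrib cong: if_cong)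
  have hexp: "h x x = (\<Sum>i\<in>UNIV. \<Sum>j\<in>UNIV. x $ i * cnj (x $ j) * h (axis i 1) (axis j 1))" for x
    apply (subst exp[of x], subst (2) exp[of x])
    apply (simp add: hermitian_sum_left[OF h] hermitian_sum_right[OF h] hermitian_scale_left[OF h]
        hermitian_scale_right[OF h] sum_distrib_left mult.assoc mult.left_commute)
    apply (rule sum.swap)
    done
  have cont: "continuous_on UNIV (%x. Re (h x x))"
    by (subst hexp) (intro continuous_intros)
  have "compact (sphere (0::complex^'k) 1)" by simp
  moreover have "sphere (0::complex^'k) 1 ~= {}"
  proof -
    have "cip (axis undefined 1 :: complex^'k) (axis undefined 1) = 1"
      unfolding cip_axis by (simp add: axis_def)
    then have "norm (axis undefined 1 :: complex^'k) = 1"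
      unfolding cip_self by (metis of_real_eq_1_iff norm_ge_zero power2_eq_1_iff neg_0_le_iff_le not_one_le_zero)
    then show ?thesis by (metis mem_sphere_0 empty_iff)
  qed
  moreover have "continuous_on (sphere (0::complex^'k) 1) (%x. Re (h x x))"
    using continuous_on_subset[OF cont] by blast
  ultimately have "\<exists>f\<in>sphere (0::complex^'k) 1. \<forall>x\<in>sphere 0 1. Re (h x x) \<le> Re (h f f)"
    by (rule continuous_attains_sup)
  then obtain f where f: "f \<in> sphere 0 1" "!!x. x \<in> sphere 0 1 ==> Re (h x x) \<le> Re (h f f)"
    by blast
  have nf: "norm f = 1" using f(1) by simp
  then have cf: "cip f f = 1" by (simp add: cip_self)
  have le: "Re (h x x) \<le> Re (h f f) * (norm x)\<^sup>2" for x
  proof (cases "x = 0")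
    case False
    define y where "y = cor (inverse (norm x)) *s x"
    have "norm y = 1" unfolding y_def using False by (simp add: norm_vec_scale norm_inverse)
    then have "Re (h y y) \<le> Re (h f f)" using f(2) by simp
    moreover have "h y y = cor ((inverse (norm x))\<^sup>2) * h x x"
      unfolding y_def by (simp add: hermitian_simps[OF h] power2_eq_square)
    ultimately have "(inverse (norm x))\<^sup>2 * Re (h x x) \<le> Re (h f f)" by (simp del: of_real_power)
    then show ?thesis using False by (simp add: field_simps power_inverse)
  qed (simp add: hermitian_simps[OF h])
  have "h x f = 0" if x: "cip x f = 0" for x
  proof -
    have fx: "cip f x = 0" using cip_cnj[of x f] x by simp
    define c where "c = h f x"
    \<comment> \<open>The maximum is compared with the perturbation of f by \<open>r * c\<close>
      times x, where \<open>c = h f x\<close>: the first order gain is linear in r, the correction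
      quadratic.\<close>
    have quad: "2 * r * (cmod c)\<^sup>2 + r\<^sup>2 * (cmod c)\<^sup>2 * Re (h x x) \<le> r\<^sup>2 * (cmod c)\<^sup>2 * (Re (h f f) * (norm x)\<^sup>2)" for r :: real
    proof -
      define w where "w = cor r * c"
      have "cip (f + w *s x) (f + w *s x) = 1 + w * cnj w * cip x x"
        using x fx cf by (simp add: cip_simps)
      then have "cor ((norm (f + w *s x))\<^sup>2) = cor (1 + (cmod w)\<^sup>2 * (norm x)\<^sup>2)"
        unfolding cip_self by (simp add: mult_cnj_cmod)
      then have n: "(norm (f + w *s x))\<^sup>2 = 1 + (cmod w)\<^sup>2 * (norm x)\<^sup>2" using of_real_eq_iff by blast
      have xf: "h x f = cnj c" unfolding c_def using hermitian_cnj[OF h] by simp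
      have "h (f + w *s x) (f + w *s x) = h f f + cnj w * c + w * cnj c + w * cnj w * h x x"
        by (simp add: hermitian_simps[OF h] xf c_def[symmetric] algebra_simps)
      also have "\<dots> = h f f + cor (2 * r * (cmod c)\<^sup>2) + cor ((cmod w)\<^sup>2) * h x x"
        unfolding w_def by (simp add: complex_norm_square norm_mult power_mult_distrib algebra_simps del: of_real_power)
         (simp add: power2_eq_square)
      finally have "Re (h (f + w *s x) (f + w *s x)) = Re (h f f) + 2 * r * (cmod c)\<^sup>2 + (cmod w)\<^sup>2 * Re (h x x)"
        by (simp del: of_real_power)
      moreover have "(cmod w)\<^sup>2 = r\<^sup>2 * (cmod c)\<^sup>2" unfolding w_def by (simp add: norm_mult power_mult_distrib)
      ultimately show ?thesis using le[of "f + w *s x"] n by (simp add: algebra_simps)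
    qed
    define D where "D = Re (h f f) * (norm x)\<^sup>2 - Re (h x x)"
    have D0: "D \<ge> 0" unfolding D_def using le[of x] by simp
    have *: "2 * r * (cmod c)\<^sup>2 \<le> r\<^sup>2 * (cmod c)\<^sup>2 * D" for r
      using quad[of r] unfolding D_def by (simp add: algebra_simps)
    \<comment> \<open>Any positive r with \<open>r * D < 2\<close> lets the linear term win, unless
      c = 0.\<close>
    define r where "r = 1 / (D + 1)"
    have r: "r > 0" "r * D < 2" using D0 unfolding r_def by (simp_all add: field_simps)
    have "r * ((cmod c)\<^sup>2 * (2 - r * D)) \<le> 0"
      using *[of r] by (simp add: algebra_simps power2_eq_square)
    then have "(cmod c)\<^sup>2 * (2 - r * D) \<le> 0" using r(1) by (simp add: mult_le_0_iff)
    then have "(cmod c)\<^sup>2 \<le> 0" using r(2) by (simp add: mult_le_0_iff)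
    then have "c = 0" by simp
    then show ?thesis unfolding c_def using hermitian_cnj[OF h] by (metis complex_cnj_zero)
  qed
  then show ?thesis using that cf le by blast
qed

section \<open>Isometries\<close>

definition isom :: "('m::finite V => 'm V) => bool" where
  "isom f \<longleftrightarrow> clin f \<and> (\<forall>x y. herm (f x) (f y) = herm x y)"

lemma isomD: "isom f ==> clin f" "isom f ==> herm (f x) (f y) = herm x y"
  by (auto simp: isom_def)

lemma isom_add: "isom f ==> f (x + y) = f x + f y" and isom_sc: "isom f ==> f (c *s x) = c *s f x"
  by (simp_all add: isom_def clin_def)

lemma isom_eq_0: "isom f ==> f x = 0 ==> x = 0"
  using herm_nondeg[of x] isomD[of f] by (metis hermitian_zero_left[OF hermitian_herm])

lemma isom_surj: "isom f ==> surj f"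
  using clin_inj_surj isom_eq_0 isomD by blast

lemma isom_inj: "isom f ==> inj f"
  using clin_injI isom_eq_0 isomD by blast

lemma isom_compose: "isom f ==> isom g ==> isom (%x. f (g x))"
  by (simp add: isom_def clin_def)

lemma isom_scale:
  assumes "isom f" "cmod c = 1" shows "isom (%x. c *s f x)"
proof -
  have cc: "c * cnj c = 1" using assms(2) by (simp add: mult_cnj_cmod)
  have "herm (c *s f x) (c *s f y) = (c * cnj c) * herm x y" for x y
    using isomD(2)[OF assms(1), of x y] by (simp add: herm_simps)
  then show ?thesis using isomD(1)[OF assms(1)] cc
    by (simp add: isom_def clin_def vec.scale_right_distrib vec.scale_left_commute)
qed

lemma isom_inv:
  assumes "isom f" shows "isom (inv f)"
proof -
  have b: "f (inv f x) = x" for x using isom_surj[OF assms] by (simp add: surj_f_inv_f)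
  have "clin (inv f)"
    by (rule clinI; rule injD[OF isom_inj[OF assms]])
      (simp_all add: b isom_add[OF assms] isom_sc[OF assms])
  then show ?thesis unfolding isom_def using isomD(2)[OF assms] b by metis
qed

text \<open>A complex reflection along \<open>d = u - v\<close>. Equality of the two norms gives
  \<open>herm d d = a + cnj a\<close> for \<open>a = herm u d\<close>, which is exactly the
  condition for it to be an isometry.\<close>

lemma unitary_reflection:
  assumes "herm u u = herm v v" "herm u v ~= herm u u"
  obtains f where "isom f" "f u = v" "!!x. herm x (u - v) = 0 ==> f x = x"
proof -
  define d where "d = u - v"
  define a where "a = herm u d"
  have a: "a ~= 0" using assms unfolding a_def d_def by (simp add: herm_simps)
  define f where "f = (%x. x - (herm x d / a) *s d)"
  have dd: "herm d d = a + cnj a"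
    using assms(1) unfolding a_def d_def herm_cnj by (simp add: herm_simps)
  have "herm (f x) (f y) = herm x y" for x y
  proof -
    have "herm (f x) (f y) = herm x y - cnj (herm y d / a) * herm x d - herm x d / a * herm d y
        + herm x d / a * cnj (herm y d / a) * herm d d"
      unfolding f_def by (simp add: herm_simps algebra_simps)
    also have "herm d y = cnj (herm y d)" by (simp add: herm_cnj)
    finally show ?thesis unfolding dd using a by (simp add: field_simps)
  qed
  moreover have "clin f"
    unfolding f_def clin_def
    by (simp add: herm_simps add_divide_distrib vec.scale_left_distrib vec.scale_right_diff_distrib)
  moreover have "f u = v" unfolding f_def using a by (simp add: a_def[symmetric]) (simp add: d_def)
  moreover have "f x = x" if "herm x (u - v) = 0" for x using that unfolding f_def d_def by simp
  ultimately show ?thesis using that unfolding isom_def by blast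
qed

text \<open>If \<open>herm u v = herm u u\<close>, then u - v is orthogonal to u and a reflection
  along it does not move u. The detour through - v avoids this, since the common norm is not
  zero.\<close>

lemma isom_transitive:
  assumes n: "herm u u = herm v v" "herm v v ~= 0"
  obtains f where "isom f" "f u = v"
    "!!x. [|herm x u = 0; herm x v = 0|] ==> f x = x"
proof (cases "herm u v = herm u u")
  case False
  then obtain f where "isom f" "f u = v" "!!x. herm x (u - v) = 0 ==> f x = x"
    using unitary_reflection[OF n(1)] by metis
  then show ?thesis using that by (simp add: herm_simps)
next
  case True
  have "herm u u = herm (- v) (- v)" "herm u (- v) ~= herm u u"
    using n True by (simp_all add: herm_simps)
  then obtain f where f: "isom f" "f u = - v" "!!x. herm x (u - (- v)) = 0 ==> f x = x"
    using unitary_reflection by metis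
  have "herm (- v) (- v) = herm v v" "herm (- v) v ~= herm (- v) (- v)"
    using n by (simp_all add: herm_simps)
  then obtain g where g: "isom g" "g (- v) = v" "!!x. herm x (- v - v) = 0 ==> g x = x"
    using unitary_reflection by metis
  show ?thesis
  proof (rule that[OF isom_compose[OF g(1) f(1)]])
    show "g (f u) = v" using f g by simp
    fix x assume "herm x u = 0" "herm x v = 0"
    then have "f x = x" "g x = x" using f(3)[of x] g(3)[of x] by (simp_all only: herm_simps) simp_all
    then show "g (f x) = x" by simp
  qed
qed

text \<open>Witt extension for an orthogonal pair: the isometry correcting the second vector fixes
  p', because p' is orthogonal both to q' and to the image of q.\<close>

lemma isom_transitive2:
  assumes "herm p p = herm p' p'" "herm p' p' ~= 0" "herm q q = herm q' q'" "herm q' q' ~= 0"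
    "herm q p = 0" "herm q' p' = 0"
  obtains f where "isom f" "f p = p'" "f q = q'"
proof -
  obtain f where f: "isom f" "f p = p'" using isom_transitive[OF assms(1,2)] by metis
  have "herm (f q) (f q) = herm q' q'" using isomD(2)[OF f(1)] assms by simp
  then obtain g where g: "isom g" "g (f q) = q'"
    "!!x. [|herm x (f q) = 0; herm x q' = 0|] ==> g x = x"
    using isom_transitive[of "f q" q'] assms(4) by metis
  have "herm p' q' = 0" using herm_cnj[of q' p'] assms by simp
  moreover have "herm p' (f q) = 0"
    using isomD(2)[OF f(1), of p q] f(2) herm_cnj[of q p] assms by simp
  ultimately have "g p' = p'" using g(3) by blast
  then show ?thesis using that[OF isom_compose[OF g(1) f(1)]] f g by simp
qed

text \<open>The determinant of an isometry has modulus one; multiplying by a root of its inverse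
  makes it one and does not change the action on lines.\<close>

lemma isom_SU:
  fixes f :: "'m::finite V => 'm V"
  assumes "isom f"
  obtains T c where "T \<in> SU" "c ~= 0" "!!x. T *v x = c *s f x"
proof -
  define F where "F = matrix f"
  have F: "F *v x = f x" for x
    unfolding F_def using matrix_works clin_imp_linear isomD(1)[OF assms] by blast
  define d where "d = det F"
  have d0: "d ~= 0"
  proof -
    have "inj ((*v) F)" using isom_inj[OF assms] F by (simp add: inj_def)
    then show ?thesis unfolding d_def
      using invertible_det_nz matrix_left_invertible_injective invertible_left_inverse by metis
  qed
  define J :: "complex^'m idx^'m idx" where "J = (\<chi> i j. herm (axis j 1) (axis i 1))"
  have J: "(J *v x) $ i = herm x (axis i 1)" for x i
  proof -
    have "x = (\<Sum>j\<in>UNIV. x $ j *s axis j 1)"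
      by (simp add: vec_eq_iff axis_def if_distrib cong: if_cong)
    then have "herm x (axis i 1) = (\<Sum>j\<in>UNIV. x $ j * herm (axis j 1) (axis i 1))"
      by (metis (no_types, lifting) herm_sum_left hermitian_scale_left[OF hermitian_herm] sum.cong)
    then show ?thesis unfolding J_def matrix_vector_mult_def by (simp add: mult.commute)
  qed
  define Fh where "Fh = (\<chi> i j. cnj (F $ j $ i))"
  have hJ: "herm x (y :: 'm V) = (\<Sum>i\<in>UNIV. (J *v x) $ i * cnj (y $ i))" for x y
  proof -
    have "y = (\<Sum>j\<in>UNIV. y $ j *s axis j 1)"
      by (simp add: vec_eq_iff axis_def if_distrib cong: if_cong)
    then have "herm x y = (\<Sum>j\<in>UNIV. cnj (y $ j) * herm x (axis j 1))"
      by (metis (no_types, lifting) herm_sum_right hermitian_scale_right[OF hermitian_herm] sum.cong)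
    then show ?thesis by (simp add: J mult.commute)
  qed
  \<comment> \<open>Invariance of the form in matrix terms, with Gram matrix J and adjoint Fh;
    taking determinants gives \<open>cnj d * d = 1\<close>.\<close>
  have "Fh ** (J ** F) = J"
  proof -
    have "((Fh ** (J ** F)) *v x) $ i = (J *v x) $ i" for x i
    proof -
      have "((Fh ** (J ** F)) *v x) $ i = (\<Sum>j\<in>UNIV. (J *v f x) $ j * cnj (F $ j $ i))"
      proof -
        have "(Fh *v w) $ i = (\<Sum>j\<in>UNIV. w $ j * cnj (F $ j $ i))" for w
          by (simp add: Fh_def matrix_vector_mult_def mult.commute)
        then show ?thesis by (simp add: matrix_vector_mul_assoc[symmetric] F)
      qed
      also have "\<dots> = herm (f x) (f (axis i 1))"
        
      proof -
        have "(F *v axis i 1) $ j = F $ j $ i" for j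
          by (simp add: matrix_vector_mult_def axis_def if_distrib cong: if_cong)
        then show ?thesis unfolding hJ F[symmetric] by simp
      qed
      also have "\<dots> = (J *v x) $ i" using isomD(2)[OF assms] by (simp add: J)
      finally show ?thesis .
    qed
    then have "(Fh ** (J ** F)) *v x = J *v x" for x by (simp add: vec_eq_iff)
    then show ?thesis by (simp add: matrix_eq)
  qed
  then have "det Fh * (det J * d) = det J" unfolding d_def by (metis det_mul)
  moreover have "det Fh = cnj d"
  proof -
    have "Fh = transpose (\<chi> i j. cnj (F $ i $ j))" by (simp add: Fh_def transpose_def vec_eq_iff)
    then have "det Fh = det (\<chi> i j. cnj (F $ i $ j))" by (simp add: det_transpose)
    also have "\<dots> = cnj d" unfolding d_def det_def by simp
    finally show ?thesis .
  qed
  moreover have "det J ~= 0"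
  proof -
    have "clin ((*v) J)" by (simp add: clin_def matrix_vector_right_distrib vec.scale)
    moreover have "x = 0" if "J *v x = 0" for x
    proof (rule herm_nondeg)
      show "herm x y = 0" for y unfolding hJ that by simp
    qed
    ultimately have "inj ((*v) J)" using clin_injI by blast
    then show ?thesis
      using invertible_det_nz matrix_left_invertible_injective invertible_left_inverse by metis
  qed
  ultimately have "d * cnj d = 1" by (simp add: mult.commute mult.left_commute)
  then have dn: "cmod d = 1" unfolding mult_cnj_cmod by (metis of_real_eq_1_iff norm_ge_zero power2_eq_1_iff neg_0_le_iff_le not_one_le_zero)
  define N where "N = CARD('m idx)"
  have N: "N > 0" unfolding N_def by simp
  obtain c where c: "c ^ N = inverse d"
  proof -
    have "exp (Ln (inverse d) / of_nat N) ^ N = inverse d"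
      using N d0 by (simp add: exp_of_nat_mult[symmetric])
    then show ?thesis using that by blast
  qed
  have "cmod c ^ N = 1" unfolding norm_power[symmetric] c by (simp add: norm_inverse dn)
  then have cn: "cmod c = 1" using N power_eq_imp_eq_base[of "cmod c" N 1] by simp
  define T where "T = (\<chi> i. c *s row i F)"
  have T: "T *v x = c *s f x" for x
    unfolding F[symmetric] T_def by (simp add: vec_eq_iff matrix_vector_mult_def row_def sum_distrib_left mult.assoc)
  have "det T = c ^ N * det F" unfolding T_def N_def
    using det_rows_mul[of "%_. c" "%i. row i F"] by (simp add: row_def)
  then have "det T = 1" using c d0 d_def by simp
  moreover have "herm (T *v x) (T *v y) = herm x y" for x y
    unfolding T using isomD(2)[OF isom_scale[OF assms cn]] .
  ultimately have "T \<in> SU" unfolding SU_def by blast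
  moreover have "c ~= 0" using cn by auto
  ultimately show ?thesis using that T by blast
qed

section \<open>The Whitney cone\<close>

lemma whitney_quadratic_coords:
  "tco (wq x) = - \<i> * (tco x)\<^sup>2" "sco (wq x) = \<i> * (sco x)\<^sup>2"
  "wq x $ Mid (Inl i) = \<i> * sco x * x $ Mid i"
  "wq x $ Mid (Inr i) = - \<i> * tco x * x $ Mid i"
  unfolding whitney_quadratic_def tco_def sco_def
  by (simp_all add: power2_eq_square algebra_simps)

text \<open>Homogeneous equations satisfied by the Whitney image: the \<open>Inl\<close> and
  \<open>Inr\<close> parts are parallel, and the square of their ratio is tied to \<open>sco\<close>
  and \<open>tco\<close>. As polynomial equations they survive analytic continuation, and on null
  vectors they suffice, by \<open>whitney_cone_null\<close>.\<close>

definition whitney_cone :: "('n::finite + 'n) V set" where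
  "whitney_cone = {v. (\<forall>i k. v $ Mid (Inl i) * v $ Mid (Inr k) = v $ Mid (Inl k) * v $ Mid (Inr i)) \<and>
     (\<forall>i k. tco v * v $ Mid (Inl i) * v $ Mid (Inl k) = - (sco v * v $ Mid (Inr i) * v $ Mid (Inr k)))}"

lemma whitney_quadratic_scale: "wq (c *s x) = c\<^sup>2 *s wq x"
proof (rule tco_sco_eqI)
  fix i
  show "wq (c *s x) $ Mid i = (c\<^sup>2 *s wq x) $ Mid i"
    by (cases i) (simp_all add: whitney_quadratic_coords clinf_scale[OF sco_clinf] clinf_scale[OF tco_clinf] power2_eq_square)
qed (simp_all add: whitney_quadratic_coords clinf_scale[OF sco_clinf] clinf_scale[OF tco_clinf] power2_eq_square)

lemma whitney_quadratic_in_cone: "c *s wq x \<in> whitney_cone"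
  unfolding whitney_cone_def
  by (simp add: whitney_quadratic_coords clinf_scale[OF sco_clinf] clinf_scale[OF tco_clinf] power2_eq_square)

text \<open>A square root a of \<open>\<i> * tco v\<close> is the \<open>tco\<close> of the
  preimage, and the \<open>Inr\<close> part divided by a is, up to a factor, its middle part.
  Nullity of v excludes a = 0 and turns into nullity of the preimage.\<close>

lemma whitney_cone_null:
  fixes v :: "('n::finite + 'n) V"
  assumes v: "v \<in> whitney_cone" "herm v v = 0" "v ~= 0"
  obtains x where "herm x x = 0" "x ~= 0" "v = wq x"
proof -
  have c1: "v $ Mid (Inl i) * v $ Mid (Inr k) = v $ Mid (Inl k) * v $ Mid (Inr i)" for i k
    using v(1) unfolding whitney_cone_def by blast
  have c2: "tco v * v $ Mid (Inl i) * v $ Mid (Inl k) = - (sco v * v $ Mid (Inr i) * v $ Mid (Inr k))" for i k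
    using v(1) unfolding whitney_cone_def by blast
  define L where "L = (\<Sum>i\<in>UNIV. (cmod (v $ Mid (Inl i)))\<^sup>2)"
  define R where "R = (\<Sum>i\<in>UNIV. (cmod (v $ Mid (Inr i)))\<^sup>2)"
  have "(\<Sum>i\<in>UNIV. (cmod (v $ Mid i))\<^sup>2) = L + R"
    unfolding L_def R_def UNIV_sum by (subst sum.union_disjoint) (auto simp: sum.reindex)
  then have null: "L + R + ((cmod (sco v))\<^sup>2 - (cmod (tco v))\<^sup>2) / 2 = 0"
    using v(2) unfolding herm_self by (metis of_real_eq_0_iff)
  have pos: "L \<ge> 0" "R \<ge> 0" unfolding L_def R_def by (simp_all add: sum_nonneg)
  define a where "a = csqrt (\<i> * tco v)"
  have a2: "a\<^sup>2 = \<i> * tco v" unfolding a_def by simp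
  have an: "(cmod a)\<^sup>2 = cmod (tco v)" unfolding norm_power[symmetric] a2 by (simp add: norm_mult)
  obtain b z where bz: "!!i. v $ Mid (Inl i) = \<i> * b * z i" "!!i. v $ Mid (Inr i) = - \<i> * a * z i"
    "sco v = \<i> * b\<^sup>2" "(\<Sum>i\<in>UNIV. (cmod (z i))\<^sup>2) + ((cmod b)\<^sup>2 - (cmod a)\<^sup>2) / 2 = 0" "a ~= 0"
  \<comment> \<open>When the \<open>Inr\<close> part vanishes it does not determine the ratio of
    \<open>sco\<close> to \<open>tco\<close>; then the \<open>Inl\<close> part vanishes as well, and
    a second square root supplies b.\<close>
  proof (cases "\<exists>i0. v $ Mid (Inr i0) ~= 0")
    case False
    then have r0: "v $ Mid (Inr i) = 0" for i by blast
    then have R0: "R = 0" unfolding R_def by simp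
    have t0: "tco v ~= 0"
    proof
      assume "tco v = 0"
      then have "Re (herm v v) = 0" "tco v = 0" using v(2) by simp_all
      then show False using herm_pos(2) v(3) by blast
    qed
    have l0: "v $ Mid (Inl i) = 0" for i using c2[of i i] r0 t0 by simp
    then have L0: "L = 0" unfolding L_def by simp
    define b where "b = csqrt (- \<i> * sco v)"
    have b2: "b\<^sup>2 = - \<i> * sco v" unfolding b_def by simp
    have "(cmod b)\<^sup>2 = cmod (sco v)" unfolding norm_power[symmetric] b2 by (simp add: norm_mult)
    moreover have "cmod (sco v) = cmod (tco v)" using null L0 R0 by simp
    ultimately have "(cmod b)\<^sup>2 - (cmod a)\<^sup>2 = 0" using an by simp
    moreover have "a ~= 0" using a2 t0 by auto
    ultimately show ?thesis
      using that[of b "%_. 0"] l0 r0 b2 by simp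
  next
    case True
    then obtain i0 where i0: "v $ Mid (Inr i0) ~= 0" by blast
    define g where "g = v $ Mid (Inl i0) / v $ Mid (Inr i0)"
    have lg: "v $ Mid (Inl i) = g * v $ Mid (Inr i)" for i
      using c1[of i i0] i0 unfolding g_def by (simp add: field_simps)
    have "tco v * g\<^sup>2 * (v $ Mid (Inr i0))\<^sup>2 = - sco v * (v $ Mid (Inr i0))\<^sup>2"
      using c2[of i0 i0] unfolding lg by (simp add: power2_eq_square algebra_simps)
    then have sg: "sco v = - (g\<^sup>2 * tco v)" 
    proof -
      assume "tco v * g\<^sup>2 * (v $ Mid (Inr i0))\<^sup>2 = - sco v * (v $ Mid (Inr i0))\<^sup>2"
      then have "tco v * g\<^sup>2 = - sco v" using i0 by (simp only: mult_cancel_right) simp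
      then show ?thesis by (simp add: mult.commute)
    qed
    have Lg: "L = (cmod g)\<^sup>2 * R"
      unfolding L_def R_def lg by (simp add: norm_mult power_mult_distrib sum_distrib_left)
    have Rpos: "R > 0" unfolding R_def
      by (rule sum_pos2[of _ i0]) (use i0 in auto)
    have sn: "(cmod (sco v))\<^sup>2 = ((cmod g)\<^sup>2)\<^sup>2 * (cmod (tco v))\<^sup>2"
      unfolding sg by (simp add: norm_mult norm_power power_mult_distrib)
    \<comment> \<open>Up to \<open>(cmod a)\<^sup>2\<close> the common factor is the one by which
      the Whitney map multiplies the form in \<open>whitney_quadratic_null\<close>; cancelling it
      gives nullity of the preimage.\<close>
    have "(1 + (cmod g)\<^sup>2) * R = (1 + (cmod g)\<^sup>2) * ((1 - (cmod g)\<^sup>2) * (cmod (tco v))\<^sup>2 / 2)"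
      using null unfolding sn Lg by (simp add: field_simps power2_eq_square)
    moreover have "1 + (cmod g)\<^sup>2 ~= 0" using zero_le_power2[of "cmod g"] by linarith
    ultimately have Re: "R = (1 - (cmod g)\<^sup>2) * (cmod (tco v))\<^sup>2 / 2" using mult_left_cancel by blast
    have a0: "a ~= 0" using Re Rpos a2 by auto
    define z where "z = (%i. \<i> * v $ Mid (Inr i) / a)"
    define b where "b = - g * a"
    have "\<i> * b * z i = - (\<i> * \<i>) * (g * v $ Mid (Inr i)) * (a / a)" for i
      unfolding b_def z_def by (simp only: divide_inverse) algebra
    then have "v $ Mid (Inl i) = \<i> * b * z i" for i unfolding lg using a0 by simp
    moreover have "v $ Mid (Inr i) = - \<i> * a * z i" for i unfolding z_def using a0 by simp
    moreover have "sco v = \<i> * b\<^sup>2" 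
    proof -
      have "\<i> * b\<^sup>2 = (\<i> * \<i>) * (g\<^sup>2 * tco v)" unfolding b_def
        by (simp only: power_mult_distrib a2 power2_minus mult.assoc mult.left_commute)
      then show ?thesis unfolding sg by simp
    qed
    moreover have "(\<Sum>i\<in>UNIV. (cmod (z i))\<^sup>2) + ((cmod b)\<^sup>2 - (cmod a)\<^sup>2) / 2 = 0"
    proof -
      have "(\<Sum>i\<in>UNIV. (cmod (z i))\<^sup>2) = R / (cmod a)\<^sup>2"
        unfolding R_def z_def by (simp add: norm_divide norm_mult power_divide sum_divide_distrib)
      also have "\<dots> = (1 - (cmod g)\<^sup>2) * (cmod a)\<^sup>2 / 2"
        unfolding Re an[symmetric] using a0 by (simp add: field_simps power2_eq_square)
      finally show ?thesis unfolding b_def by (simp add: norm_mult power_mult_distrib field_simps)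
    qed
    ultimately show ?thesis using that a0 by blast
  qed
  define x :: "'n V" where "x = (\<chi> k. case k of First => (a + b) / 2 | Final => (a - b) / (2 * \<i>) | Mid i => z i)"
  have tx: "tco x = a" and sx: "sco x = b" unfolding tco_def sco_def x_def by (simp_all add: field_simps)
  have mx: "x $ Mid i = z i" for i unfolding x_def by simp
  have "herm x x = 0" unfolding herm_self tx sx mx using bz(4) by simp
  moreover have "x ~= 0" using tx bz(5) clinf_zero[OF tco_clinf] by metis
  moreover have "v = wq x"
  proof (rule tco_sco_eqI)
    fix i show "v $ Mid i = wq x $ Mid i"
      by (cases i) (simp_all add: whitney_quadratic_coords tx sx mx bz)
  qed (simp_all add: whitney_quadratic_coords tx sx bz a2)
  ultimately show ?thesis using that by blast
qed

lemma whitney_quadratic_null: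
  "herm (wq x) (wq x) = cor ((cmod (sco x))\<^sup>2 + (cmod (tco x))\<^sup>2) * herm x x"
proof -
  have "(\<Sum>i\<in>UNIV. (cmod (wq x $ Mid i))\<^sup>2)
      = ((cmod (sco x))\<^sup>2 + (cmod (tco x))\<^sup>2) * (\<Sum>i\<in>UNIV. (cmod (x $ Mid i))\<^sup>2)"
    unfolding UNIV_sum
    by (subst sum.union_disjoint)
      (auto simp: sum.reindex whitney_quadratic_coords norm_mult power_mult_distrib sum_distrib_left distrib_right sum.distrib)
  then show ?thesis unfolding herm_self
    by (simp add: whitney_quadratic_coords norm_mult norm_power algebra_simps power2_eq_square)
qed

section \<open>Isometric families over a family of hyperplanes\<close>

lemma clinf_kernel_dim:
  fixes S :: "(complex^'a::finite) set"
  assumes S: "vec.subspace S" and g: "clinf g"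
  shows "vec.dim S \<le> vec.dim {x \<in> S. g x = 0} + 1"
proof (cases "\<forall>x\<in>S. g x = 0")
  case True
  then have "{x \<in> S. g x = 0} = S" by blast
  then show ?thesis by simp
next
  case False
  then obtain v where v: "v \<in> S" "g v ~= 0" by blast
  let ?K = "{x \<in> S. g x = 0}"
  have "S \<subseteq> vec.span (insert v ?K)"
  proof
    fix x assume x: "x \<in> S"
    define y where "y = x - (g x / g v) *s v"
    have "y \<in> ?K" unfolding y_def using x v S
      by (simp add: vec.subspace_diff vec.subspace_scale clinf_diff[OF g] clinf_scale[OF g])
    then have "y + (g x / g v) *s v \<in> vec.span (insert v ?K)"
      by (intro vec.span_add vec.span_scale vec.span_base) auto
    then show "x \<in> vec.span (insert v ?K)" unfolding y_def by simp
  qed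
  then have "vec.dim S \<le> vec.dim (insert v ?K)" by (rule vec.dim_mono)
  also have "\<dots> \<le> vec.dim ?K + 1" by (simp add: vec.dim_insert)
  finally show ?thesis .
qed

lemma clinf_common_kernel:
  fixes G :: "(complex^'a::finite => complex) set"
  assumes "finite G" "!!g. g \<in> G ==> clinf g" "card G < CARD('a)"
  obtains x where "x ~= 0" "!!g. g \<in> G ==> g x = 0"
proof -
  have "vec.subspace {x. \<forall>g\<in>G. g x = 0} \<and> CARD('a) \<le> vec.dim {x. \<forall>g\<in>G. g x = 0} + card G"
    using assms(1,2)
  proof (induction rule: finite_induct)
    case empty
    then show ?case by (simp add: card_cart_basis)
  next
    case (insert g G)
    let ?S = "{x. \<forall>g\<in>G. g x = 0}"
    have g: "clinf g" using insert.prems by blast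
    have IH: "vec.subspace ?S" "CARD('a) \<le> vec.dim ?S + card G" using insert by auto
    have e: "{x. \<forall>g'\<in>insert g G. g' x = 0} = {x \<in> ?S. g x = 0}" by auto
    have "vec.subspace {x \<in> ?S. g x = 0}" using IH(1)
      unfolding vec.subspace_def by (auto simp: clinf_zero[OF g] clinf_add[OF g] clinf_scale[OF g])
    then show ?case using clinf_kernel_dim[OF IH(1) g] IH(2) insert.hyps unfolding e by simp
  qed
  then have "vec.dim {x. \<forall>g\<in>G. g x = 0} ~= 0" using assms(3) by linarith
  then have "\<not> {x. \<forall>g\<in>G. g x = 0} \<subseteq> {0}" by (simp only: vec.dim_eq_0 not_False_eq_True)
  then show ?thesis using that by blast
qed

lemma spanning_surj:
  fixes f :: "complex^'b::finite => 'm::finite V"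
  assumes f: "clin f" and S: "vec.subspace S" and r: "!!i. i \<in> I ==> v i \<in> f ` S"
    and span: "!!x. (!!i. i \<in> I ==> herm x (v i) = 0) ==> x = 0"
  shows "f ` S = UNIV"
proof (rule ccontr)
  assume n: "f ` S ~= UNIV"
  have "vec.subspace (f ` S)" by (rule vec.linear_subspace_image[OF clin_imp_linear[OF f] S])
  then have sp: "vec.span (f ` S) = f ` S" using vec.span_eq_iff by blast
  have "vec.span (f ` S) ~= UNIV" unfolding sp by (rule n)
  then obtain a where a: "a ~= 0" "!!w. w \<in> f ` S ==> herm w a = 0"
    using herm_orth_exists[OF hermitian_herm herm_nondeg] by metis
  have "herm a (v i) = 0" if "i \<in> I" for i using a(2)[OF r[OF that]] herm_cnj[of "v i" a] by simp
  then show False using span a(1) by blast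
qed

text \<open>Removing from q its component along k leaves a vector orthogonal to k and to the
  complement of k, hence to everything.\<close>

lemma orth_multiple:
  assumes k: "herm k k ~= 0" and o: "!!x. herm x k = 0 ==> herm x q = 0"
  obtains c where "q = c *s k"
proof -
  define c where "c = herm q k / herm k k"
  define d where "d = q - c *s k"
  have dk: "herm d k = 0" unfolding d_def c_def using k by (simp add: herm_simps)
  then have kd: "herm k d = 0" using herm_cnj[of d k] by simp
  have "herm d x = 0" for x
  proof -
    define y where "y = x - (herm x k / herm k k) *s k"
    have yk: "herm y k = 0" unfolding y_def using k by (simp add: herm_simps)
    then have "herm y d = 0" unfolding d_def using o by (simp add: herm_simps)
    then have "herm x d = 0" unfolding y_def using kd by (simp add: herm_simps)
    then show ?thesis using herm_cnj[of x d] by simp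
  qed
  then have "d = 0" using herm_nondeg by blast
  then show ?thesis using that[of c] unfolding d_def by simp
qed

text \<open>\<open>M z\<close> is considered only on the hyperplane orthogonal to \<open>k z\<close>.\<close>

locale hyperplane_family =
  fixes D :: "complex set" and k :: "complex => 'n::finite V"
    and M :: "complex => 'n V => ('n + 'n) V" and \<rho> :: "complex => complex => complex"
  assumes n2: "CARD('n) \<ge> 2"
    and D: "open D" "D ~= {}"
    and M: "!!z. z \<in> D ==> clin (M z)"
    and gram: "!!z w x y. [|z \<in> D; w \<in> D; herm x (k z) = 0; herm y (k w) = 0|]
        ==> herm (M z x) (M w y) = \<rho> z w * herm x y"
    and rho: "!!z w. [|z \<in> D; w \<in> D|] ==> cnj (\<rho> z w) = \<rho> w z"
      "!!z. z \<in> D ==> Re (\<rho> z z) > 0"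
      "!!w. w \<in> D ==> continuous_on D (%z. \<rho> z w)"
    and kk: "!!z w. [|z \<in> D; w \<in> D|] ==> herm (k z) (k w) ~= 0"
      "!!z. z \<in> D ==> Re (herm (k z) (k z)) > 0"
      "!!z w c. [|z \<in> D; w \<in> D; k z = c *s k w|] ==> z = w"
    and null: "!!z. z \<in> D ==> \<exists>x. x ~= 0 \<and> herm x x = 0 \<and> herm x (k z) = 0"
    and span: "!!v. (!!z x. [|z \<in> D; herm x (k z) = 0|] ==> herm v (M z x) = 0) ==> v = 0"
begin

definition I :: "(complex \<times> 'n V) set" where "I = {(z, x). z \<in> D \<and> herm x (k z) = 0}"

lemma spanI:
  assumes "!!i. i \<in> I ==> herm v (case i of (z, x) => M z x) = 0" shows "v = 0"
  using span[of v] assms unfolding I_def by auto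

definition za :: complex where "za = (SOME z. z \<in> D)"
lemma za: "za \<in> D" unfolding za_def using D(2) by (simp add: some_in_eq)

text \<open>Schur complement of the kernel \<open>\<rho>\<close> at the base point za: the part of
  rank one passing through za is removed, so \<open>\<rho>\<close> has rank at most two once all 2
  by 2 minors of \<open>s\<close> vanish.\<close>

definition s :: "complex => complex => complex" where
  "s z w = \<rho> z w - \<rho> z za * \<rho> za w / \<rho> za za"

lemma rho_nz: "z \<in> D ==> \<rho> z z ~= 0" using rho(2) by force

lemma s_cnj: "[|z \<in> D; w \<in> D|] ==> cnj (s z w) = s w z"
  unfolding s_def using rho(1) za by (simp add: mult.commute)

lemma s_1: "s z za = 0" "s za z = 0" unfolding s_def using rho_nz[OF za] by simp_all

text \<open>A non-zero minor would make an underdetermined linear system on triples of vectors uniquely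
  solvable; this is where \<open>n \<ge> 2\<close> enters.\<close>

lemma s_minor:
  assumes d: "x \<in> D" "x' \<in> D" "w \<in> D" "w' \<in> D"
  shows "s x w * s x' w' = s x w' * s x' w"
proof (rule ccontr)
  assume ne: "s x w * s x' w' ~= s x w' * s x' w"
  define x0 :: "complex^('n idx + 'n idx + 'n idx) => 'n V" where "x0 = (%X. \<chi> a. X $ Inl a)"
  define x1 :: "complex^('n idx + 'n idx + 'n idx) => 'n V" where "x1 = (%X. \<chi> a. X $ Inr (Inl a))"
  define x2 :: "complex^('n idx + 'n idx + 'n idx) => 'n V" where "x2 = (%X. \<chi> a. X $ Inr (Inr a))"
  have cx: "clin x0" "clin x1" "clin x2"
    unfolding clin_def x0_def x1_def x2_def by (simp_all add: vec_eq_iff)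
  \<comment> \<open>A triple in the kernel of F is a linear relation between values of M at za, x
    and x'. Pairing it with \<open>M r y\<close> turns it into a single vector \<open>Y r X\<close>,
    orthogonal to the hyperplane of \<open>k r\<close> and therefore proportional to
    \<open>k r\<close>.\<close>
  define F where "F = (%X. M za (x0 X) + M x (x1 X) + M x' (x2 X))"
  have cF: "clin F" unfolding clin_def F_def
    by (simp add: cx[THEN clin_add] cx[THEN clin_scale] M[OF za, THEN clin_add] M[OF za, THEN clin_scale]
       M[OF d(1), THEN clin_add] M[OF d(1), THEN clin_scale] M[OF d(2), THEN clin_add] M[OF d(2), THEN clin_scale]
       vec.scale_right_distrib)
  define Y where "Y = (%w X. \<rho> za w *s x0 X + \<rho> x w *s x1 X + \<rho> x' w *s x2 X)"
  have cY: "clin (Y w)" for w unfolding clin_def Y_def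
    by (simp add: cx[THEN clin_add] cx[THEN clin_scale] vec.scale_right_distrib mult.commute)
  have comp: "clinf (%X. herm (f X) z)" if "clin f" for f :: "complex^('n idx + 'n idx + 'n idx) => 'n V" and z
    using that unfolding clin_def clinf_def by (simp add: herm_simps)
  define G where "G = range (%c X. F X $ c) \<union>
    {%X. herm (x0 X) (k za), %X. herm (x1 X) (k x), %X. herm (x2 X) (k x'),
     %X. herm (Y za X) (k za), %X. herm (Y w' X) (k w')}"
  have "card G \<le> card (range (%c X. F X $ c)) +
     card {%X. herm (x0 X) (k za), %X. herm (x1 X) (k x), %X. herm (x2 X) (k x'),
     %X. herm (Y za X) (k za), %X. herm (Y w' X) (k w')}"
    unfolding G_def by (rule card_Un_le)
  \<comment> \<open>There are (2n + 2) + 5 equations for 3(n + 2) unknowns; the difference is n -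
    1.\<close>
  also have "\<dots> \<le> CARD(('n + 'n) idx) + 5"
    by (intro add_mono card_image_le finite card_insert_le_m1) auto
  also have "\<dots> < CARD('n idx + 'n idx + 'n idx)"
    using n2 by (simp add: card_idx)
  finally have "card G < CARD('n idx + 'n idx + 'n idx)" .
  moreover have "clinf g" if "g \<in> G" for g
    using that cF unfolding G_def by (auto intro!: comp cx cY) (simp add: clin_def clinf_def)
  moreover have "finite G" unfolding G_def by simp
  ultimately obtain X where X: "X ~= 0" "!!g. g \<in> G ==> g X = 0"
    using clinf_common_kernel[of G] by metis
  have FX: "F X = 0" using X(2) unfolding G_def by (auto simp: vec_eq_iff)
  have xk: "herm (x0 X) (k za) = 0" "herm (x1 X) (k x) = 0" "herm (x2 X) (k x') = 0"
    and Yk: "herm (Y za X) (k za) = 0" "herm (Y w' X) (k w') = 0"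
    using X(2) unfolding G_def by auto
  have Yperp: "herm y (Y r X) = 0" if t: "r \<in> D" "herm y (k r) = 0" for y r
  proof -
    have "herm (F X) (M r y) = herm (Y r X) y"
      unfolding F_def Y_def using t xk d za by (simp add: herm_simps gram)
    then have "herm (Y r X) y = 0" using FX by (simp add: herm_simps)
    then show ?thesis using herm_cnj[of "Y r X" y] by simp
  qed
  have kz: "herm (k r) (k r) ~= 0" if "r \<in> D" for r using kk(1) that by blast
  obtain c1 c2 c3 where c: "Y za X = c1 *s k za" "Y w X = c2 *s k w" "Y w' X = c3 *s k w'"
    using orth_multiple[OF kz Yperp] za d by metis
  have Y0: "Y za X = 0" "Y w' X = 0"
    using c Yk kz za d(4) by (auto simp: herm_simps)
  define a where "a = x1 X" define b where "b = x2 X"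
  have x0: "x0 X = - ((\<rho> x za / \<rho> za za) *s a + (\<rho> x' za / \<rho> za za) *s b)"
  proof -
    have "\<rho> za za * (x0 X $ i) = - (\<rho> x za * a $ i + \<rho> x' za * b $ i)" for i
      using arg_cong[OF Y0(1), of "%v. v $ i"] unfolding Y_def a_def b_def
      by (simp add: add_eq_0_iff2 add.assoc)
    then show ?thesis using rho_nz[OF za] by (simp add: vec_eq_iff field_simps)
  qed
  have Ys: "Y r X = s x r *s a + s x' r *s b" for r
    unfolding Y_def x0 s_def a_def[symmetric] b_def[symmetric] by (simp add: vec_eq_iff algebra_simps)
  have e1: "s x w *s a + s x' w *s b = c2 *s k w" using Ys[of w] c(2) by simp
  have e2: "s x w' *s a + s x' w' *s b = 0" using Ys[of w'] Y0(2) by simp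
  define \<Delta> where "\<Delta> = s x w * s x' w' - s x w' * s x' w"
  have \<Delta>: "\<Delta> ~= 0" using ne unfolding \<Delta>_def by simp
  have "\<Delta> *s a = s x' w' *s (s x w *s a + s x' w *s b) - s x' w *s (s x w' *s a + s x' w' *s b)"
    unfolding \<Delta>_def by (simp add: vec_eq_iff algebra_simps)
  then have a: "\<Delta> *s a = (s x' w' * c2) *s k w" unfolding e1 e2 by simp
  have "\<Delta> *s b = s x w *s (s x w' *s a + s x' w' *s b) - s x w' *s (s x w *s a + s x' w *s b)"
    unfolding \<Delta>_def by (simp add: vec_eq_iff algebra_simps)
  then have b: "\<Delta> *s b = (- s x w' * c2) *s k w" unfolding e1 e2 by (simp add: vec.scale_minus_left)
  have "herm (\<Delta> *s a) (k x) = 0" "herm (\<Delta> *s b) (k x') = 0"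
    using xk unfolding a_def b_def by (simp_all add: herm_simps)
  \<comment> \<open>Both vectors are multiples of \<open>k w\<close>, which is orthogonal neither to
    \<open>k x\<close> nor to \<open>k x'\<close>.\<close>
  then have "s x' w' * c2 = 0" "s x w' * c2 = 0"
    unfolding a b using kk(1) d by (auto simp: herm_simps)
  then have "a = 0" "b = 0" using a b \<Delta> by auto
  then have "x0 X = 0" "x1 X = 0" "x2 X = 0" using x0 a_def b_def by auto
  then have "X $ i = 0" for i unfolding x0_def x1_def x2_def by (simp add: vec_eq_iff) (metis sum.exhaust)
  then show False using X(1) by (simp add: vec_eq_iff)
qed

text \<open>If \<open>s\<close> vanished, the vectors \<open>M z x\<close> would have the Gram
  matrix of rescaled vectors x, so they would lie in a linear image of a space of dimension n + 2
  and could not span the target.\<close>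

lemma s_nonzero: "\<exists>c\<in>D. \<exists>v\<in>D. s c v ~= 0"
proof (rule ccontr)
  assume "\<not> ?thesis"
  then have s0: "s c v = 0" if "c \<in> D" "v \<in> D" for c v using that by blast
  define r where "r = cor (sqrt (Re (\<rho> za za)))"
  have "\<rho> za za = cor (Re (\<rho> za za))" using rho(1)[OF za za] by (simp add: complex_eq_iff)
  then have r: "r * r = \<rho> za za" "cnj r = r"
    unfolding r_def using rho(2)[OF za] by (simp_all add: of_real_mult[symmetric] del: of_real_mult)
  define w where "w = (%(c, x :: 'n V). (\<rho> c za / r) *s x)"
  have g: "herm (case i of (c, x) => M c x) (case j of (c, x) => M c x) = herm (w i) (w j)"
    if "i \<in> I" "j \<in> I" for i j
  proof -
    obtain c x v y where ij: "i = (c, x)" "j = (v, y)" by fastforce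
    then have z: "c \<in> D" "v \<in> D" "herm x (k c) = 0" "herm y (k v) = 0" using that unfolding I_def by auto
    have "\<rho> c v = \<rho> c za * \<rho> za v / (r * r)" using s0[OF z(1,2)] unfolding s_def r by simp
    then have "\<rho> c v = \<rho> c za / r * cnj (\<rho> v za / r)" using rho(1)[OF z(2) za] r(2) by simp
    then show ?thesis unfolding ij w_def using gram[OF z] by (simp add: herm_simps mult.commute mult.left_commute)
  qed
  obtain f where f: "clin f" "!!i. i \<in> I ==> f (w i) = (case i of (c, x) => M c x)"
    using gram_extension[of I "%i. case i of (c, x) => M c x" herm w, OF spanI hermitian_herm g] by metis
  have "f ` UNIV = UNIV"
  proof (rule spanning_surj[OF f(1), of UNIV I "%i. case i of (c, x) => M c x"])
    show "(case i of (c, x) => M c x) \<in> f ` UNIV" if "i \<in> I" for i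
      using f(2)[OF that, symmetric] by (rule image_eqI) simp
  qed (use spanI in auto)
  then have "CARD(('n + 'n) idx) \<le> CARD('n idx)" using clin_surj_card[OF f(1)] by blast
  then show False using n2 by (simp add: card_idx)
qed

definition zb :: complex where "zb = (SOME z. z \<in> D \<and> s z z ~= 0)"

lemma zb: "zb \<in> D" "s zb zb ~= 0"
proof -
  obtain x w where z: "x \<in> D" "w \<in> D" "s x w ~= 0" using s_nonzero by blast
  have "s x x * s w w = s x w * s w x" using s_minor[OF z(1,2,1,2)] .
  moreover have "s w x ~= 0" using s_cnj[OF z(1,2)] z(3) by (metis complex_cnj_zero_iff)
  ultimately have "s x x ~= 0" using z(3) by auto
  then have "\<exists>x. x \<in> D \<and> s x x ~= 0" using z(1) by blast
  then show "zb \<in> D" "s zb zb ~= 0" unfolding zb_def by (metis (mono_tags, lifting) someI_ex)+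
qed

definition e :: real where "e = Re (s zb zb)"

lemma e: "s zb zb = cor e"
  unfolding e_def using s_cnj[OF zb(1) zb(1)] by (simp add: complex_eq_iff)

text \<open>For x in both hyperplanes this is the component of \<open>M zb x\<close> orthogonal to
  all \<open>M za y\<close>, because \<open>s zb za\<close> is zero.\<close>

definition m :: "'n V => ('n + 'n) V" where "m x = M zb x - (\<rho> zb za / \<rho> za za) *s M za x"

lemma m:
  assumes x: "herm x (k za) = 0" "herm x (k zb) = 0"
  shows "[|w \<in> D; herm y (k w) = 0|] ==> herm (m x) (M w y) = s zb w * herm x y"
    and "herm (m x) (m x) = cor e * herm x x"
proof -
  show *: "herm (m x) (M w y) = s zb w * herm x y" if "w \<in> D" "herm y (k w) = 0" for w y
    unfolding m_def s_def using gram za zb(1) x that by (simp add: herm_simps field_simps)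
  show "herm (m x) (m x) = cor e * herm x x"
    by (subst (2) m_def) (simp add: herm_simps * za zb(1) x s_1 e)
qed

text \<open>\<open>m x\<close> is orthogonal to the null vector \<open>M za \<xi>\<close> and of
  non-positive norm, hence a multiple of it; since it is also orthogonal to an \<open>M za y\<close>
  that does not annihilate that null vector, it is zero. Pairing with \<open>M zb\<close> then makes
  x a multiple of \<open>k zb\<close>, to which x is orthogonal.\<close>

lemma m_null:
  assumes x: "herm x (k za) = 0" "herm x (k zb) = 0" and h: "e * Re (herm x x) \<le> 0"
  shows "x = 0"
proof -
  obtain \<xi> where xi: "\<xi> ~= 0" "herm \<xi> \<xi> = 0" "herm \<xi> (k za) = 0" using null[OF za] by blast
  obtain y where y: "herm y (k za) = 0" "herm y \<xi> ~= 0"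
  proof (rule ccontr)
    assume "\<not> thesis"
    then have "!!y. herm y (k za) = 0 ==> herm y \<xi> = 0" using that by blast
    then obtain c where c: "\<xi> = c *s k za" using orth_multiple[OF kk(1)[OF za za]] by metis
    then have "c = 0" using xi(3) kk(1)[OF za za] by (simp add: herm_simps)
    then show False using c xi(1) by simp
  qed
  let ?v = "M za \<xi>"
  have vy: "herm (M za y) ?v ~= 0" using gram[OF za za y(1) xi(3)] y(2) rho_nz[OF za] by simp
  then have v0: "?v ~= 0" by (auto simp: herm_simps)
  have vv: "Re (herm ?v ?v) \<le> 0" using gram[OF za za xi(3) xi(3)] xi(2) by simp
  have mv: "herm (m x) ?v = 0" using m(1)[OF x za xi(3)] s_1 by simp
  have mm: "Re (herm (m x) (m x)) \<le> 0" using m(2)[OF x] h by simp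
  obtain c where c: "m x = c *s ?v" using lorentz[OF v0 vv mv mm] by blast
  have "herm (m x) (M za y) = 0" using m(1)[OF x za y(1)] s_1 by simp
  then have "c * herm ?v (M za y) = 0" unfolding c by (simp add: herm_simps)
  moreover have "herm ?v (M za y) ~= 0" using vy herm_cnj[of "M za y" ?v] by auto
  ultimately have m0: "m x = 0" using c by simp
  have "herm z x = 0" if z: "herm z (k zb) = 0" for z
  proof -
    have "s zb zb * herm x z = 0" using m(1)[OF x zb(1) z] m0 by (simp add: herm_simps)
    then show ?thesis using zb(2) herm_cnj[of x z] by simp
  qed
  then obtain d where d: "x = d *s k zb" using orth_multiple[OF kk(1)[OF zb(1) zb(1)]] by metis
  then have "d = 0" using x(2) kk(1)[OF zb(1) zb(1)] by (simp add: herm_simps)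
  then show ?thesis using d by simp
qed

text \<open>Signature argument: n + 2 > 3 leaves a non-zero x in both hyperplanes with
  \<open>tco x = 0\<close>, hence of non-negative norm. For e \<le> 0 such an x would be excluded by
  \<open>m_null\<close>.\<close>

lemma e_pos: "e > 0"
proof (rule ccontr)
  assume "\<not> e > 0"
  define G where "G = {%x. herm x (k za), %x. herm x (k zb), tco}"
  have "card G \<le> 3" unfolding G_def by (simp add: card_insert_le_m1)
  then have "card G < CARD('n idx)" using n2 by (simp add: card_idx)
  moreover have "clinf g" if "g \<in> G" for g
    using that tco_clinf hermitian_clinf[OF hermitian_herm] unfolding G_def by auto
  ultimately obtain x where x: "x ~= 0" "!!g. g \<in> G ==> g x = 0"
    using clinf_common_kernel[of G] unfolding G_def by (metis finite.emptyI finite.insertI)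
  then have xx: "herm x (k za) = 0" "herm x (k zb) = 0" "tco x = 0" unfolding G_def by auto
  have "0 \<le> Re (herm x x)" using herm_pos(1)[OF xx(3)] .
  then have "e * Re (herm x x) \<le> 0" using \<open>\<not> e > 0\<close> by (simp add: mult_nonpos_nonneg)
  then show False using m_null[OF xx(1,2)] x(1) by blast
qed

end

section \<open>A model of the family in two copies of the source space\<close>

definition herm2 :: "complex^('n::finite idx + 'n idx) => complex^('n idx + 'n idx) => complex" where
  "herm2 X Y = herm (\<chi> a. X $ Inl a) (\<chi> a. Y $ Inl a) + herm (\<chi> a. X $ Inr a) (\<chi> a. Y $ Inr a)"

definition pair2 :: "'n::finite V => 'n V => complex^('n idx + 'n idx)" where
  "pair2 x y = (\<chi> a. case a of Inl b => x $ b | Inr b => y $ b)"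

lemma herm2_pair2: "herm2 (pair2 x y) (pair2 x' y') = herm x x' + herm y y'"
  unfolding herm2_def pair2_def by simp

lemma pair2_cases: obtains x y where "X = pair2 x y"
proof
  show "X = pair2 (\<chi> a. X $ Inl a) (\<chi> a. X $ Inr a)"
    unfolding pair2_def vec_eq_iff by (auto split: sum.split)
qed

lemma pair2_linear: "pair2 x y + pair2 x' y' = pair2 (x + x') (y + y')" "c *s pair2 x y = pair2 (c *s x) (c *s y)"
  "pair2 x y = 0 \<longleftrightarrow> x = 0 \<and> y = 0" "pair2 x y = pair2 x' y' \<longleftrightarrow> x = x' \<and> y = y'"
  unfolding pair2_def by (auto simp: vec_eq_iff split: sum.split)

lemma hermitian_herm2: "hermitian (herm2 :: complex^('n::finite idx + 'n idx) => _)"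
  unfolding hermitian_def
proof (intro conjI allI)
  fix x y z :: "complex^('n idx + 'n idx)" and c
  obtain a b a' b' a'' b'' where e: "x = pair2 a b" "y = pair2 a' b'" "z = pair2 a'' b''"
    by (metis pair2_cases)
  show "herm2 (x + y) z = herm2 x z + herm2 y z" "herm2 (c *s x) z = c * herm2 x z" "cnj (herm2 x y) = herm2 y x"
    unfolding e pair2_linear herm2_pair2 by (simp_all add: herm_simps algebra_simps herm_cnj)
qed

lemma herm2_nondeg:
  assumes "!!y. herm2 x y = 0" shows "x = 0"
proof -
  obtain a b where e: "x = pair2 a b" by (rule pair2_cases)
  have "herm a y = 0" "herm b y = 0" for y
    using assms[of "pair2 y 0"] assms[of "pair2 0 y"] unfolding e herm2_pair2 by (simp_all add: herm_simps)
  then show ?thesis unfolding e pair2_linear using herm_nondeg by blast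
qed

context hyperplane_family
begin

text \<open>Positivity of \<open>\<rho> za za\<close> and of e makes both square roots real, so
  \<open>\<rho>\<close> becomes a sum of two squares with positive signs.\<close>

definition t0 :: "complex => complex" where "t0 z = \<rho> z za / cor (sqrt (Re (\<rho> za za)))"
definition t1 :: "complex => complex" where "t1 z = s z zb / cor (sqrt e)"

lemma rho_factor:
  assumes z: "x \<in> D" "w \<in> D"
  shows "\<rho> x w = t0 x * cnj (t0 w) + t1 x * cnj (t1 w)"
proof -
  define r where "r = cor (sqrt (Re (\<rho> za za)))"
  have "\<rho> za za = cor (Re (\<rho> za za))" using rho(1)[OF za za] by (simp add: complex_eq_iff)
  then have r: "r * r = \<rho> za za" "cnj r = r"
    unfolding r_def using rho(2)[OF za] by (simp_all add: of_real_mult[symmetric] del: of_real_mult)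
  define q where "q = cor (sqrt e)"
  have q: "q * q = s zb zb" "cnj q = q"
    unfolding q_def e using e_pos by (simp_all add: of_real_mult[symmetric] del: of_real_mult)
  have "t0 x * cnj (t0 w) = \<rho> x za * \<rho> za w / \<rho> za za"
    unfolding t0_def r_def[symmetric] using r rho(1)[OF z(2) za] by simp
  moreover have "t1 x * cnj (t1 w) = s x zb * s zb w / s zb zb"
    unfolding t1_def q_def[symmetric] using q s_cnj[OF z(2) zb(1)] by simp
  moreover have "s x zb * s zb w / s zb zb = s x w"
    using s_minor[OF z(1) zb(1) z(2) zb(1)] zb(2) by (simp add: field_simps)
  ultimately show ?thesis unfolding s_def by simp
qed

lemma t_values: "t0 za ~= 0" "t1 za = 0" "t1 zb ~= 0"
proof -
  have "Re (\<rho> za za) > 0" using rho(2)[OF za] .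
  then show "t0 za ~= 0" unfolding t0_def using rho_nz[OF za] by simp
  show "t1 za = 0" unfolding t1_def by (simp add: s_1)
  show "t1 zb ~= 0" unfolding t1_def using zb(2) e_pos by simp
qed

lemma t_cont: "continuous_on D t0" "continuous_on D t1"
  unfolding t0_def t1_def s_def
  by (intro continuous_intros rho(3) za zb(1); use e_pos rho(2)[OF za] rho_nz[OF za] in simp)+

lemma t_nz: "z \<in> D ==> t0 z ~= 0 \<or> t1 z ~= 0"
  using rho_factor[of z z] rho_nz[of z] by auto

text \<open>These vectors have the Gram matrix of the \<open>M z x\<close>, but in a space of
  dimension 2n + 4 instead of 2n + 2. The surplus forces a non-zero orthogonal complement of W,
  whose elements \<open>pair2 p1 p2\<close> govern the rest of the argument.\<close>

definition W where "W = (%(z, x). pair2 (t0 z *s x) (t1 z *s x)) ` I"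

lemma W_gram:
  assumes "i \<in> I" "j \<in> I"
  shows "herm (case i of (c, x) => M c x) (case j of (c, x) => M c x)
    = herm2 (case i of (c, x) => pair2 (t0 c *s x) (t1 c *s x)) (case j of (c, x) => pair2 (t0 c *s x) (t1 c *s x))"
proof -
  obtain c x w y where ij: "i = (c, x)" "j = (w, y)" by fastforce
  then have z: "c \<in> D" "w \<in> D" "herm x (k c) = 0" "herm y (k w) = 0" using assms unfolding I_def by auto
  show ?thesis unfolding ij using gram[OF z] rho_factor[OF z(1,2)]
    by (simp add: herm2_pair2 herm_simps algebra_simps)
qed

lemma span_W_gram:
  assumes f: "clin f" "!!i. i \<in> I ==> f (case i of (z, x) => pair2 (t0 z *s x) (t1 z *s x)) = (case i of (z, x) => M z x)"
    and X: "X \<in> vec.span W" and Y: "Y \<in> W"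
  shows "herm2 X Y = herm (f X) (f Y)"
  using X
proof (induction rule: vec.span_induct_alt)
  case base
  then show ?case by (simp add: clin_zero[OF f(1)] herm_simps hermitian_simps[OF hermitian_herm2])
next
  case (step c x y)
  obtain i j where ij: "i \<in> I" "x = (case i of (z, x) => pair2 (t0 z *s x) (t1 z *s x))"
     "j \<in> I" "Y = (case j of (z, x) => pair2 (t0 z *s x) (t1 z *s x))"
    using step(1) Y unfolding W_def by blast
  have "herm2 x Y = herm (f x) (f Y)"
    using W_gram[OF ij(1,3)] f(2)[OF ij(1)] f(2)[OF ij(3)] unfolding ij(2,4) by simp
  then show ?case using step
    by (simp add: clin_add[OF f(1)] clin_scale[OF f(1)] herm_simps hermitian_simps[OF hermitian_herm2])
qed

lemma W_map:
  obtains f where "clin f"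
    "!!i. i \<in> I ==> f (case i of (z, x) => pair2 (t0 z *s x) (t1 z *s x)) = (case i of (z, x) => M z x)"
proof (rule gram_extension[of I "%i. case i of (z, x) => M z x" herm2
     "%i. case i of (z, x) => pair2 (t0 z *s x) (t1 z *s x)"])
  fix f :: "complex^('n idx + 'n idx) => ('n + 'n) V"
  assume "clin f" "!!i. i \<in> I ==> f (case i of (z, x) => pair2 (t0 z *s x) (t1 z *s x)) = (case i of (z, x) => M z x)"
  then show thesis by (rule that)
qed (rule spanI hermitian_herm2 W_gram; assumption?)+

lemma W_orth: "(\<forall>w\<in>W. herm2 w (pair2 p1 p2) = 0) \<longleftrightarrow>
    (\<forall>z\<in>D. \<forall>x. herm x (k z) = 0 \<longrightarrow> t0 z * herm x p1 + t1 z * herm x p2 = 0)"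
  unfolding W_def I_def by (auto simp: herm2_pair2 herm_simps)

lemma orth_k:
  assumes w: "\<forall>w\<in>W. herm2 w (pair2 p1 p2) = 0" and z: "a \<in> D"
  obtains c where "cnj (t0 a) *s p1 + cnj (t1 a) *s p2 = c *s k a"
proof (rule orth_multiple[OF kk(1)[OF z z]])
  fix x assume "herm x (k a) = 0"
  then show "herm x (cnj (t0 a) *s p1 + cnj (t1 a) *s p2) = 0"
    using w z unfolding W_orth by (simp add: herm_simps)
qed

text \<open>Otherwise p would be proportional to \<open>k x\<close> for all x in a non-empty open
  set, against the injectivity of k up to scale.\<close>

lemma orth_independent:
  assumes w: "\<forall>w\<in>W. herm2 w (pair2 p1 p2) = 0" and n: "c1 ~= 0 \<or> c2 ~= 0" and p: "p ~= 0"
    and d: "p1 = c1 *s p" "p2 = c2 *s p"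
  shows False
proof -
  define g where "g x = cnj (t0 x) * c1 + cnj (t1 x) * c2" for x
  have gk: "\<exists>c. p = c *s k x" if z: "x \<in> D" "g x ~= 0" for x
  proof -
    obtain c where "cnj (t0 x) *s p1 + cnj (t1 x) *s p2 = c *s k x" using orth_k[OF w z(1)] by blast
    then have c: "g x *s p = c *s k x" unfolding d g_def by (simp add: vec.scale_left_distrib)
    have "p = inverse (g x) *s (g x *s p)" using z(2) by simp
    then show ?thesis unfolding c vec.scale_scale by blast
  qed
  have "g za ~= 0 \<or> g zb ~= 0"
    using n t_values unfolding g_def by (cases "c1 = 0") auto
  then obtain x where z: "x \<in> D" "g x ~= 0" using za zb(1) by blast
  have "continuous_on D g" unfolding g_def by (intro continuous_intros t_cont)
  then have "open (D \<inter> g -` (- {0}))" using D(1) continuous_open_preimage by blast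
  moreover have "x \<in> D \<inter> g -` (- {0})" using z by simp
  ultimately obtain d where d: "d > 0" "ball x d \<subseteq> D \<inter> g -` (- {0})" by (meson openE)
  define x' where "x' = x + cor (d / 2)"
  have ne: "x' ~= x" unfolding x'_def using d(1) by simp
  have "dist x x' < d" unfolding x'_def dist_norm using d(1) by (simp add: norm_divide)
  then have z': "x' \<in> D" "g x' ~= 0" using d(2) by auto
  obtain a b where ab: "p = a *s k x" "p = b *s k x'" using gk z z' by blast
  have "a ~= 0" using ab(1) p by auto
  then have "k x = (inverse a * b) *s k x'"
    using ab by (metis left_inverse vec.scale_one vec.scale_scale)
  then show False using kk(3)[OF z(1) z'(1)] ne by blast
qed

lemma orth_independent':
  assumes w: "\<forall>w\<in>W. herm2 w (pair2 p1 p2) = 0" and n: "pair2 p1 p2 ~= 0"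
    and c: "c1 *s p1 + c2 *s p2 = 0"
  shows "c1 = 0 \<and> c2 = 0"
proof (rule ccontr)
  assume cn: "\<not> ?thesis"
  show False
  proof (cases "c1 = 0")
    case True
    then have "c2 *s p2 = 0" "c2 ~= 0" using c cn by auto
    then have p2: "p2 = 0" by simp
    then have "p1 ~= 0" using n pair2_linear by metis
    then show False using orth_independent[OF w, of 1 0 p1] p2 by simp
  next
    case False
    have "c1 *s p1 = (- c2) *s p2" using c by (simp add: eq_neg_iff_add_eq_0 vec.scale_minus_left)
    then have "inverse c1 *s (c1 *s p1) = inverse c1 *s ((- c2) *s p2)" by simp
    then have p1: "p1 = (- c2 / c1) *s p2" using False by (simp add: divide_inverse mult.commute)
    then have "p2 ~= 0" using n pair2_linear by (metis vec.scale_zero_right)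
    then show False using orth_independent[OF w, of "- c2 / c1" 1 p2] p1 by simp
  qed
qed

text \<open>The linear map f from the model to the target has a non-zero kernel vector, as 2n + 2 <
  2n + 4. If W spanned everything, f would preserve the form and this vector would be orthogonal to
  the whole model.\<close>

lemma orth_exists:
  obtains p1 p2 where "pair2 p1 p2 ~= 0" "\<forall>w\<in>W. herm2 w (pair2 p1 p2) = 0"
proof -
  obtain f where f: "clin f"
    "!!i. i \<in> I ==> f (case i of (z, x) => pair2 (t0 z *s x) (t1 z *s x)) = (case i of (z, x) => M z x)"
    using W_map by blast
  have "CARD(('n + 'n) idx) < CARD('n idx + 'n idx)" by (simp add: card_idx)
  then obtain a where a: "a ~= 0" "f a = 0" using clin_kernel[OF f(1)] by blast
  have "vec.span W ~= UNIV"
  proof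
    assume U: "vec.span W = UNIV"
    have aw: "herm2 a w = 0" if "w \<in> W" for w
      using span_W_gram[OF f _ that, of a] U a(2) by (simp add: herm_simps)
    have "herm2 y a = 0" for y
    proof -
      have "y \<in> vec.span W" using U by simp
      then show ?thesis
      proof (induction rule: vec.span_induct_alt)
        case (step c x y)
        then show ?case using aw[of x] hermitian_cnj[OF hermitian_herm2, of a x]
          by (simp add: hermitian_simps[OF hermitian_herm2])
      qed (simp add: hermitian_simps[OF hermitian_herm2])
    qed
    then have "a = 0" using herm2_nondeg hermitian_cnj[OF hermitian_herm2] by (metis complex_cnj_zero)
    then show False using a(1) by blast
  qed
  then obtain b where b: "b ~= 0" "!!w. w \<in> W ==> herm2 w b = 0"
    using herm_orth_exists[OF hermitian_herm2 herm2_nondeg] by blast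
  then show ?thesis using that by (metis pair2_cases)
qed

text \<open>An element orthogonal to \<open>W\<close> defines a linear map from \<open>complex^2\<close> having the vectors
  \<open>k z\<close> as values; two such maps agree up to a factor, since they have three pairwise
  independent common eigenvectors.\<close>

lemma orth_unique:
  assumes p: "pair2 p1 p2 ~= 0" "\<forall>w\<in>W. herm2 w (pair2 p1 p2) = 0"
    and q: "\<forall>w\<in>W. herm2 w (pair2 q1 q2) = 0"
  obtains c where "q1 = c *s p1" "q2 = c *s p2"
proof -
  note ind = orth_independent'[OF p(2,1)]
  have ev: "\<exists>r. cnj (t0 ze) *s q1 + cnj (t1 ze) *s q2 = r *s (cnj (t0 ze) *s p1 + cnj (t1 ze) *s p2)"
    if z: "ze \<in> D" for ze
  proof -
    obtain c where c: "cnj (t0 ze) *s p1 + cnj (t1 ze) *s p2 = c *s k ze" using orth_k[OF p(2) z] by blast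
    obtain d where d: "cnj (t0 ze) *s q1 + cnj (t1 ze) *s q2 = d *s k ze" using orth_k[OF q z] by blast
    have "c ~= 0" using c ind[of "cnj (t0 ze)" "cnj (t1 ze)"] t_nz[OF z] by auto
    then have "d *s k ze = (d / c) *s (c *s k ze)" by simp
    then show ?thesis unfolding c d by blast
  qed
  have "\<not> D \<subseteq> {za, zb}"
  proof
    assume "D \<subseteq> {za, zb}"
    then have "finite D" by (rule finite_subset) simp
    then show False using D by (metis empty_interior_finite interior_open)
  qed
  then obtain ze3 where z3: "ze3 \<in> D" "ze3 ~= za" "ze3 ~= zb" by blast
  define u where "u ze = cnj (t0 ze) *s p1 + cnj (t1 ze) *s p2" for ze
  have uk: "\<exists>c. c ~= 0 \<and> u ze = c *s k ze" if z: "ze \<in> D" for ze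
  proof -
    obtain c where c: "u ze = c *s k ze" using orth_k[OF p(2) z] unfolding u_def by blast
    have "c ~= 0" using c ind[of "cnj (t0 ze)" "cnj (t1 ze)"] t_nz[OF z] unfolding u_def by auto
    then show ?thesis using c by blast
  qed
  have upar: "ze = v" if z: "ze \<in> D" "v \<in> D" "u ze = c *s u v" for ze v c
  proof -
    obtain a b where ab: "a ~= 0" "u ze = a *s k ze" "u v = b *s k v" using uk z by blast
    have "inverse a *s (a *s k ze) = inverse a *s (c *s (b *s k v))" using ab z(3) by simp
    then have "k ze = (inverse a * (c * b)) *s k v" using ab(1) by simp
    then show ?thesis using kk(3)[OF z(1,2)] by blast
  qed
  define a where "a = cnj (t0 za)" define b where "b = cnj (t0 zb)" define d where "d = cnj (t1 zb)"
  define x where "x = cnj (t0 ze3)" define y where "y = cnj (t1 ze3)"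
  have a: "a ~= 0" "cnj (t1 za) = 0" and d: "d ~= 0" unfolding a_def d_def using t_values by auto
  have y: "y ~= 0"
  proof
    assume "y = 0"
    then have "u ze3 = (x / a) *s u za" unfolding u_def using a by (simp add: x_def[symmetric] y_def[symmetric] a_def[symmetric])
    then show False using upar[OF z3(1) za] z3(2) by blast
  qed
  have xy: "x * d ~= y * b"
  proof
    assume h: "x * d = y * b"
    have "u ze3 = (y / d) *s u zb"
      unfolding u_def x_def[symmetric] y_def[symmetric] b_def[symmetric] d_def[symmetric]
      using h d by (simp add: vec_eq_iff field_simps)
    then show False using upar[OF z3(1) zb(1)] z3(3) by blast
  qed
  obtain r1 r2 r3 where mu: "a *s q1 = (r1 * a) *s p1"
     "b *s q1 + d *s q2 = r2 *s (b *s p1 + d *s p2)" "x *s q1 + y *s q2 = r3 *s (x *s p1 + y *s p2)"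
    using ev[OF za] ev[OF zb(1)] ev[OF z3(1)] a unfolding a_def b_def d_def x_def y_def by auto
  have q1: "q1 = r1 *s p1"
  proof -
    have "inverse a *s (a *s q1) = inverse a *s ((r1 * a) *s p1)" using mu(1) by simp
    then show ?thesis using a by simp
  qed
  have dq2: "d *s q2 = (r2 * b - b * r1) *s p1 + (r2 * d) *s p2"
    using mu(2) unfolding q1 by (simp add: vec_eq_iff algebra_simps)
  have yq2: "y *s q2 = (r3 * x - x * r1) *s p1 + (r3 * y) *s p2"
    using mu(3) unfolding q1 by (simp add: vec_eq_iff algebra_simps)
  \<comment> \<open>Eliminating q2 between the relations at zb and at the third parameter makes the
    three eigenvalues agree.\<close>
  have "y *s (d *s q2) - d *s (y *s q2) = 0" by (simp add: mult.commute)
  then have "(y * (r2 * b - b * r1) - d * (r3 * x - x * r1)) *s p1 + (y * (r2 * d) - d * (r3 * y)) *s p2 = 0"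
    unfolding dq2 yq2 by (simp add: vec_eq_iff algebra_simps)
  then have h: "y * (r2 * b - b * r1) - d * (r3 * x - x * r1) = 0" "y * (r2 * d) - d * (r3 * y) = 0"
    using ind by blast+
  have m23: "r2 = r3" using h(2) y d by simp
  have "(r3 - r1) * (y * b - x * d) = 0" using h(1) unfolding m23 by (simp add: algebra_simps)
  then have m: "r3 = r1" using xy by simp
  have "d *s q2 = d *s (r1 *s p2)" using dq2 unfolding m23 m by (simp add: mult.commute)
  then have "q2 = r1 *s p2" using d vec.scale_left_imp_eq by blast
  then show ?thesis using that q1 by blast
qed

text \<open>By uniqueness of the orthogonal element, the span of W has codimension one and is too
  large for the target. So f kills a vector of this span; that vector is orthogonal to W, hence a
  multiple of \<open>pair2 p1 p2\<close>, which therefore lies in the span and is orthogonal to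
  itself.\<close>

lemma orth_null:
  assumes p: "pair2 p1 p2 ~= 0" "\<forall>w\<in>W. herm2 w (pair2 p1 p2) = 0"
  shows "herm p1 p1 + herm p2 p2 = 0"
proof -
  obtain f where f: "clin f"
    "!!i. i \<in> I ==> f (case i of (z, x) => pair2 (t0 z *s x) (t1 z *s x)) = (case i of (z, x) => M z x)"
    using W_map by blast
  define S where "S = vec.span W"
  define P where "P = pair2 p1 p2"
  have dimS: "vec.dim S > CARD(('n + 'n) idx)"
  proof (rule ccontr)
    assume "\<not> ?thesis"
    then have le: "vec.dim S \<le> CARD(('n + 'n) idx)" by simp
    obtain B where B: "B \<subseteq> W" "vec.independent B" "vec.span B = S"
      using vec_span_basis[of W] unfolding S_def by blast
    have fB: "finite B" using B(2) vec.finiteI_independent by blast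
    have "card B = vec.dim S" using vec.dim_span_eq_card_independent[OF B(2)] B(3) by simp
    then have cB: "card B \<le> CARD(('n + 'n) idx)" using le by simp
    obtain i0 where i0: "P $ i0 ~= 0" using p(1) unfolding P_def[symmetric] by (auto simp: vec_eq_iff)
    \<comment> \<open>At most 2n + 2 conditions come from the basis and one from the coordinate i0,
      against 2n + 4 unknowns; the coordinate excludes the multiples of P.\<close>
    define G where "G = insert (%Y. Y $ i0) ((%b Y. herm2 Y b) ` B)"
    have "card G \<le> 1 + CARD(('n + 'n) idx)"
      unfolding G_def using fB cB card_image_le[OF fB, of "%b Y. herm2 Y b"]
      by (simp add: card_insert_if)
    also have "\<dots> < CARD('n idx + 'n idx)" by (simp add: card_idx)
    finally have cG: "card G < CARD('n idx + 'n idx)" .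
    have "clinf g" if "g \<in> G" for g
      using that hermitian_clinf[OF hermitian_herm2] unfolding G_def by (auto simp: clinf_def[of "%Y. Y $ i0"])
    moreover have "finite G" unfolding G_def using fB by simp
    ultimately obtain Y where Y: "Y ~= 0" "!!g. g \<in> G ==> g Y = 0"
      using clinf_common_kernel[of G] cG by blast
    have Yb: "herm2 b Y = 0" if "b \<in> B" for b
      using Y(2)[of "%Y. herm2 Y b"] that hermitian_cnj[OF hermitian_herm2, of Y b] unfolding G_def by auto
    have "herm2 w Y = 0" if "w \<in> S" for w
      using that unfolding B(3)[symmetric]
    proof (induction rule: vec.span_induct_alt)
      case (step c x y)
      then show ?case using Yb[of x] by (simp add: hermitian_simps[OF hermitian_herm2])
    qed (simp add: hermitian_simps[OF hermitian_herm2])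
    then have YW: "\<forall>w\<in>W. herm2 w Y = 0" unfolding S_def using vec.span_base by blast
    obtain q1 q2 where q: "Y = pair2 q1 q2" by (rule pair2_cases)
    obtain c where c: "q1 = c *s p1" "q2 = c *s p2" using orth_unique[OF p] YW unfolding q by blast
    have Yc: "Y = c *s P" unfolding q P_def c pair2_linear by simp
    have "Y $ i0 = 0" using Y(2)[of "%Y. Y $ i0"] unfolding G_def by simp
    then have "c = 0" using i0 unfolding Yc by simp
    then show False using Y(1) Yc by simp
  qed
  obtain a where a: "a \<in> S" "a ~= 0" "f a = 0"
  proof -
    have "\<not> inj_on f S"
    proof
      assume i: "inj_on f S"
      have "vec.span S = S" unfolding S_def by simp
      then have "inj_on f (vec.span S)" by (simp only: i)
      then have "vec.dim (f ` S) = vec.dim S"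
        by (rule vec.dim_image_eq[OF clin_imp_linear[OF f(1)]])
      moreover have "vec.dim (f ` S) \<le> CARD(('n + 'n) idx)"
        using vec.dim_subset[OF subset_UNIV, of "f ` S"] by (simp add: card_cart_basis)
      ultimately show False using dimS by simp
    qed
    then obtain x y where xy: "x \<in> S" "y \<in> S" "x ~= y" "f x = f y" unfolding inj_on_def by blast
    have "x - y \<in> S" using xy unfolding S_def by (simp add: vec.span_diff)
    moreover have "f (x - y) = 0" using clin_diff[OF f(1), of x y] xy by simp
    ultimately show ?thesis using that xy(3) by simp
  qed
  have "herm2 w a = 0" if "w \<in> W" for w
    using span_W_gram[OF f _ that, of a] a hermitian_cnj[OF hermitian_herm2, of a w]
    unfolding S_def by (auto simp: herm_simps)
  then have aW: "\<forall>w\<in>W. herm2 w a = 0" by blast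
  obtain q1 q2 where q: "a = pair2 q1 q2" by (rule pair2_cases)
  obtain c where c: "q1 = c *s p1" "q2 = c *s p2" using orth_unique[OF p] aW unfolding q by blast
  have ac: "a = c *s P" unfolding q P_def c pair2_linear by simp
  then have c0: "c ~= 0" using a(2) by auto
  have "herm2 w P = 0" if "w \<in> S" for w
    using that unfolding S_def
  proof (induction rule: vec.span_induct_alt)
    case (step c x y)
    then show ?case using p(2) unfolding P_def by (simp add: hermitian_simps[OF hermitian_herm2])
  qed (simp add: hermitian_simps[OF hermitian_herm2])
  then have "herm2 a P = 0" using a(1) by blast
  then have "herm2 P P = 0" unfolding ac using c0 by (simp add: hermitian_simps[OF hermitian_herm2])
  then show ?thesis unfolding P_def herm2_pair2 .
qed

end

context hyperplane_family
begin

text \<open>A unitary change of (t0, t1) diagonalises the Gram matrix of p1 and p2. Its trace is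
  zero by \<open>orth_null\<close>, so the eigenvalues are opposite; scaling and, if necessary,
  exchanging the two vectors makes them -1 and 1.\<close>

lemma normal_form:
  obtains p1 p2 a0 a1 where
    "!!a n. [|a \<in> D; n \<in> D|] ==> \<rho> a n = a0 a * cnj (a0 n) + a1 a * cnj (a1 n)"
    "!!a x. [|a \<in> D; herm x (k a) = 0|] ==> a0 a * herm x p1 + a1 a * herm x p2 = 0"
    "herm p1 p1 = -1" "herm p2 p2 = 1" "herm p2 p1 = 0"
proof -
  obtain p1 p2 where p: "pair2 p1 p2 ~= 0" "\<forall>w\<in>W. herm2 w (pair2 p1 p2) = 0" using orth_exists by blast
  note ind = orth_independent'[OF p(2,1)]
  define P :: "complex^2 => 'n V" where "P = (%c. c $ 1 *s p1 + c $ 2 *s p2)"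
  have h: "hermitian (%c d. herm (P c) (P d))"
    unfolding hermitian_def P_def by (simp add: herm_simps herm_cnj algebra_simps)
  obtain f where f: "cip f f = 1" "!!x. cip x f = 0 ==> herm (P x) (P f) = 0"
    using hermitian_max[OF h] by metis
  define f1 where "f1 = f $ 1" define f2 where "f2 = f $ 2"
  have ff: "f1 * cnj f1 + f2 * cnj f2 = 1" using f(1) unfolding cip_def sum_2 f1_def f2_def .
  define q1 where "q1 = f1 *s p1 + f2 *s p2"
  define q2 where "q2 = (- cnj f2) *s p1 + cnj f1 *s p2"
  define b0 where "b0 a = t0 a * f1 + t1 a * f2" for a
  define b1 where "b1 a = - t0 a * cnj f2 + t1 a * cnj f1" for a
  have orth: "herm q2 q1 = 0"
  proof -
    let ?x = "\<chi> i. if i = 1 then - cnj f2 else cnj f1 :: complex^2"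
    have "cip ?x f = 0" unfolding cip_def sum_2 f1_def f2_def by simp
    then show ?thesis using f(2)[of ?x] unfolding P_def q1_def q2_def f1_def f2_def by simp
  qed
  have rho_b: "\<rho> a n = b0 a * cnj (b0 n) + b1 a * cnj (b1 n)" if "a \<in> D" "n \<in> D" for a n
  proof -
    have "b0 a * cnj (b0 n) + b1 a * cnj (b1 n)
        = (f1 * cnj f1 + f2 * cnj f2) * (t0 a * cnj (t0 n) + t1 a * cnj (t1 n))"
      unfolding b0_def b1_def by (simp add: algebra_simps)
    then show ?thesis using rho_factor[OF that] ff by simp
  qed
  have rel_b: "b0 a * herm x q1 + b1 a * herm x q2 = 0" if z: "a \<in> D" "herm x (k a) = 0" for a x
  proof -
    have "b0 a * herm x q1 + b1 a * herm x q2
        = (f1 * cnj f1 + f2 * cnj f2) * (t0 a * herm x p1 + t1 a * herm x p2)"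
      unfolding b0_def b1_def q1_def q2_def by (simp add: herm_simps algebra_simps)
    then show ?thesis using p(2) z unfolding W_orth by simp
  qed
  have tr: "herm q1 q1 + herm q2 q2 = 0"
  proof -
    have "herm q1 q1 + herm q2 q2 = (f1 * cnj f1 + f2 * cnj f2) * (herm p1 p1 + herm p2 p2)"
      unfolding q1_def q2_def by (simp add: herm_simps algebra_simps)
    then show ?thesis using orth_null[OF p] by simp
  qed
  define nu where "nu = Re (herm q2 q2)"
  have n2: "herm q2 q2 = cor nu" unfolding nu_def by (rule hermitian_real[OF hermitian_herm])
  have n1: "herm q1 q1 = cor (- nu)" using tr n2 by (simp add: add_eq_0_iff)
  \<comment> \<open>Two null orthogonal vectors would be proportional by \<open>lorentz\<close>,
    whereas p1 and p2 are independent.\<close>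
  have nz: "nu ~= 0"
  proof
    assume v: "nu = 0"
    have "q1 ~= 0" using ind[of f1 f2] ff unfolding q1_def by auto
    then obtain c where c: "q2 = c *s q1" using lorentz[of q1 q2] n1 n2 v orth by auto
    have "(- cnj f2 - c * f1) *s p1 + (cnj f1 - c * f2) *s p2 = q2 - c *s q1"
      unfolding q1_def q2_def by (simp add: vec_eq_iff algebra_simps)
    then have "(- cnj f2 - c * f1) *s p1 + (cnj f1 - c * f2) *s p2 = 0" using c by simp
    then have "- cnj f2 - c * f1 = 0" "cnj f1 - c * f2 = 0" using ind by blast+
    then have c2: "cnj f2 = - (c * f1)" "cnj f1 = c * f2" by (simp_all add: algebra_simps) (metis minus_minus)
    have "f1 * cnj f1 + f2 * cnj f2 = 0" unfolding c2 by (simp add: algebra_simps)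
    then show False using ff by simp
  qed
  define r where "r = cor (1 / sqrt \<bar>nu\<bar>)"
  have r: "r * r = cor (1 / \<bar>nu\<bar>)" "cnj r = r"
    unfolding r_def using nz by (simp_all add: of_real_mult[symmetric] del: of_real_mult of_real_divide)
  show ?thesis
  proof (cases "nu > 0")
    case True
    show ?thesis
    proof (rule that[of b0 b1 "r *s q1" "r *s q2"])
      show "b0 a * herm x (r *s q1) + b1 a * herm x (r *s q2) = 0" if "a \<in> D" "herm x (k a) = 0" for a x
        using rel_b[OF that] by (simp add: herm_simps) (metis distrib_left mult.left_commute mult_zero_right)
      show "herm (r *s q1) (r *s q1) = -1" "herm (r *s q2) (r *s q2) = 1"
        using r True by (simp_all add: herm_simps mult.assoc[symmetric] n1 n2)
    qed (use rho_b orth in \<open>simp_all add: herm_simps\<close>)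
  next
    case False
    then have neg: "nu < 0" using nz by simp
    show ?thesis
    proof (rule that[of b1 b0 "r *s q2" "r *s q1"])
      show "b1 a * herm x (r *s q2) + b0 a * herm x (r *s q1) = 0" if "a \<in> D" "herm x (k a) = 0" for a x
        using rel_b[OF that] by (simp add: herm_simps) (metis add.commute distrib_left mult.left_commute mult_zero_right)
      show "herm (r *s q2) (r *s q2) = -1" "herm (r *s q1) (r *s q1) = 1"
        using r neg by (simp_all add: herm_simps mult.assoc[symmetric] n1 n2)
      show "herm (r *s q1) (r *s q2) = 0" using orth herm_cnj[of q2 q1] by (simp add: herm_simps)
    qed (use rho_b in \<open>simp_all add: add.commute\<close>)
  qed
qed

text \<open>An isometry A of the source moves p1 and p2 to standard vectors, after which the linear
  relation on each hyperplane reads \<open>a0 v * tco (A x) = a1 v * sco (A x)\<close>. On null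
  vectors this makes (a0, a1) proportional to (sco, tco), which turns expressions bilinear in these
  pairs and \<open>A x\<close> into Whitney quadrics.\<close>

theorem whitney_rigidity:
  obtains T A where "isom T" "isom A"
    "!!v x. [|v \<in> D; herm x (k v) = 0; herm x x = 0; x ~= 0|]
        ==> \<exists>c. T (M v x) = c *s wq (A x)"
proof -
  obtain p1 p2 a0 a1 where rho_a: "!!v w. [|v \<in> D; w \<in> D|] ==> \<rho> v w = a0 v * cnj (a0 w) + a1 v * cnj (a1 w)"
    and rel: "!!v x. [|v \<in> D; herm x (k v) = 0|] ==> a0 v * herm x p1 + a1 v * herm x p2 = 0"
    and p: "herm p1 p1 = -1" "herm p2 p2 = 1" "herm p2 p1 = 0"
    using normal_form by metis
  \<comment> \<open>Vectors of norm -1 and 1 that represent, up to real factors, the functionals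
    \<open>tco\<close> and \<open>sco\<close>.\<close>
  define et :: "'n V" where "et = (\<chi> a. case a of First => sqrt 2 / 2 | Final => - \<i> * sqrt 2 / 2 | Mid i => 0)"
  define es :: "'n V" where "es = (\<chi> a. case a of First => sqrt 2 / 2 | Final => \<i> * sqrt 2 / 2 | Mid i => 0)"
  have two: "cor (sqrt 2) * cor (sqrt 2) = 2"
    by (simp add: of_real_mult[symmetric] del: of_real_mult)
  have et: "tco et = sqrt 2" "sco et = 0" "et $ Mid i = 0" and es: "tco es = 0" "sco es = sqrt 2" "es $ Mid i = 0" for i
    unfolding tco_def sco_def et_def es_def by (simp_all add: field_simps)
  have he: "herm x et = - tco x * sqrt 2 / 2" "herm x es = sco x * sqrt 2 / 2" for x
    unfolding herm_tco_sco by (simp_all add: et es)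
  have "herm p1 p1 = herm et et" "herm et et ~= 0" "herm p2 p2 = herm es es" "herm es es ~= 0" "herm es et = 0"
    unfolding he by (simp_all add: et es p two)
  then obtain A where A: "isom A" "A p1 = et" "A p2 = es" using isom_transitive2[OF _ _ _ _ p(3)] by metis
  have tA: "tco (A x) = - sqrt 2 * herm x p1" and sA: "sco (A x) = sqrt 2 * herm x p2" for x
  proof -
    have "herm x p1 = - tco (A x) * sqrt 2 / 2" "herm x p2 = sco (A x) * sqrt 2 / 2"
      using isomD(2)[OF A(1), of x p1] isomD(2)[OF A(1), of x p2] A(2,3) he by simp_all
    note e = this
    have "cor (sqrt 2) * herm x p1 = - tco (A x) * (cor (sqrt 2) * cor (sqrt 2)) / 2"
      "cor (sqrt 2) * herm x p2 = sco (A x) * (cor (sqrt 2) * cor (sqrt 2)) / 2"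
      unfolding e by (simp_all only: times_divide_eq_right mult.assoc mult.left_commute minus_mult_left mult_minus_right mult.commute)
    then show "tco (A x) = - sqrt 2 * herm x p1" "sco (A x) = sqrt 2 * herm x p2" unfolding two by simp_all
  qed
  have rel': "a0 v * tco (A x) = a1 v * sco (A x)" if "v \<in> D" "herm x (k v) = 0" for v x
  proof -
    have "a1 v * sco (A x) - a0 v * tco (A x) = sqrt 2 * (a0 v * herm x p1 + a1 v * herm x p2)"
      unfolding tA sA by (simp add: algebra_simps)
    then show ?thesis using rel[OF that] by simp
  qed
  \<comment> \<open>The Whitney quadric of \<open>A x\<close> with one factor \<open>tco\<close>
    replaced by a1 and one factor \<open>sco\<close> replaced by a0.\<close>
  define u :: "complex \<times> 'n V => ('n + 'n) V" where
    "u = (%(v, x). \<chi> b. case b of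
        First => (- \<i> * a1 v * tco (A x) + \<i> * a0 v * sco (A x)) / 2
      | Final => (- \<i> * a1 v * tco (A x) - \<i> * a0 v * sco (A x)) / (2 * \<i>)
      | Mid c => (case c of Inl i => \<i> * a0 v * A x $ Mid i | Inr i => - \<i> * a1 v * A x $ Mid i))"
  have u: "tco (u (v, x)) = - \<i> * a1 v * tco (A x)" "sco (u (v, x)) = \<i> * a0 v * sco (A x)"
    "u (v, x) $ Mid (Inl i) = \<i> * a0 v * A x $ Mid i" "u (v, x) $ Mid (Inr i) = - \<i> * a1 v * A x $ Mid i" for v x i
    unfolding u_def tco_def[of "_ :: ('n + 'n) V"] sco_def[of "_ :: ('n + 'n) V"] by (simp_all add: field_simps)
  have gram_u: "herm (case i of (v, x) => M v x) (case j of (v, x) => M v x) = herm (u i) (u j)"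
    if "i \<in> I" "j \<in> I" for i j
  proof -
    obtain v x w y where ij: "i = (v, x)" "j = (w, y)" by fastforce
    then have z: "v \<in> D" "w \<in> D" "herm x (k v) = 0" "herm y (k w) = 0" using that unfolding I_def by auto
    define S where "S = (\<Sum>i\<in>UNIV. A x $ Mid i * cnj (A y $ Mid i))"
    have sum: "(\<Sum>c\<in>UNIV. u (v, x) $ Mid c * cnj (u (w, y) $ Mid c)) = \<rho> v w * S"
      unfolding UNIV_sum S_def
      by (subst sum.union_disjoint)
        (auto simp: sum.reindex u rho_a[OF z(1,2)] sum_distrib_left algebra_simps sum.distrib)
    have xy: "herm x y = S + (sco (A x) * cnj (sco (A y)) - tco (A x) * cnj (tco (A y))) / 2"
      using isomD(2)[OF A(1), of x y] unfolding herm_tco_sco[of "A x"] S_def by simp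
    have cr: "(a0 v * tco (A x)) * cnj (a0 w * tco (A y)) = (a1 v * sco (A x)) * cnj (a1 w * sco (A y))"
      unfolding rel'[OF z(1,3)] rel'[OF z(2,4)] ..
    have "herm (u i) (u j) = \<rho> v w * S + (a0 v * sco (A x) * cnj (a0 w * sco (A y)) - a1 v * tco (A x) * cnj (a1 w * tco (A y))) / 2"
      unfolding ij herm_tco_sco[of "u (v, x)"] sum by (simp add: u algebra_simps)
    also have "\<dots> = \<rho> v w * herm x y"
      using cr unfolding xy rho_a[OF z(1,2)] by (simp add: field_simps)
    finally show ?thesis unfolding ij using gram[OF z] by simp
  qed
  obtain F where F: "clin F" "!!i. i \<in> I ==> F (u i) = (case i of (v, x) => M v x)"
  proof (rule gram_extension[of I "%i. case i of (v, x) => M v x" herm u])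
    fix f :: "('n + 'n) V => ('n + 'n) V"
    assume "clin f" "!!i. i \<in> I ==> f (u i) = (case i of (v, x) => M v x)"
    then show thesis by (rule that)
  qed (rule spanI hermitian_herm gram_u; assumption?)+
  \<comment> \<open>F maps the span of the vectors u onto the target, and they lie in a space of the
    same dimension; so they span, and F preserves the form everywhere.\<close>
  define S where "S = vec.span (u ` I)"
  have FS: "F ` S = UNIV"
  proof (rule spanning_surj[OF F(1), of S I "%i. case i of (v, x) => M v x"])
    show "(case i of (v, x) => M v x) \<in> F ` S" if "i \<in> I" for i
      using F(2)[OF that, symmetric] by (rule image_eqI) (use that in \<open>simp add: S_def vec.span_base\<close>)
  qed (use spanI in \<open>auto simp: S_def\<close>)
  have "vec.dim (F ` S) \<le> vec.dim S" by (rule vec.dim_image_le[OF clin_imp_linear[OF F(1)]])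
  then have "CARD(('n + 'n) idx) \<le> vec.dim S" unfolding FS by (simp add: card_cart_basis)
  then have "vec.dim (UNIV :: ('n + 'n) V set) \<le> vec.dim S" by (simp add: card_cart_basis)
  then have SU: "S = UNIV"
    using vec.subspace_dim_equal[of S UNIV] unfolding S_def by simp
  have FF1: "herm (F a) (F b) = herm a b" if bu: "b \<in> u ` I" for a b
  proof -
    have "a \<in> vec.span (u ` I)" using SU S_def by simp
    then show ?thesis
    proof (induction rule: vec.span_induct_alt)
      case base then show ?case by (simp add: clin_zero[OF F(1)] herm_simps)
    next
      case (step c x y)
      obtain i j where ij: "i \<in> I" "x = u i" "j \<in> I" "b = u j" using step(1) bu by blast
      have "herm (F x) (F b) = herm x b"
        using gram_u[OF ij(1,3)] F(2)[OF ij(1)] F(2)[OF ij(3)] unfolding ij(2,4) by simp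
      then show ?case using step by (simp add: clin_add[OF F(1)] clin_scale[OF F(1)] herm_simps)
    qed
  qed
  have FF: "herm (F a) (F b) = herm a b" for a b
  proof -
    have "b \<in> vec.span (u ` I)" using SU S_def by simp
    then show ?thesis
    proof (induction rule: vec.span_induct_alt)
      case base then show ?case by (simp add: clin_zero[OF F(1)] herm_simps)
    next
      case (step c x y)
      then show ?case using FF1 by (simp add: clin_add[OF F(1)] clin_scale[OF F(1)] herm_simps)
    qed
  qed
  then have iF: "isom F" using F(1) unfolding isom_def by blast
  show ?thesis
  proof (rule that[OF isom_inv[OF iF] A(1)])
    fix v x assume x: "v \<in> D" "herm x (k v) = 0" "herm x x = 0" "x ~= 0"
    have "A x ~= 0" using isom_eq_0[OF A(1)] x(4) by blast
    moreover have "herm (A x) (A x) = 0" using isomD(2)[OF A(1)] x(3) by simp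
    ultimately have t: "tco (A x) ~= 0" using herm_pos(2)[of "A x"] by auto
    define ta where "ta = a1 v / tco (A x)"
    have a1: "a1 v = ta * tco (A x)" unfolding ta_def using t by simp
    have a0: "a0 v = ta * sco (A x)" unfolding ta_def using rel'[OF x(1,2)] t by (simp add: field_simps)
    have "u (v, x) = ta *s wq (A x)"
    proof (rule tco_sco_eqI)
      fix i show "u (v, x) $ Mid i = (ta *s wq (A x)) $ Mid i"
        by (cases i) (simp_all add: u a0 a1 whitney_quadratic_coords)
    qed (simp_all add: u a0 a1 whitney_quadratic_coords clinf_scale[OF tco_clinf] clinf_scale[OF sco_clinf] power2_eq_square)
    moreover have "F (u (v, x)) = M v x" using F(2)[of "(v, x)"] x unfolding I_def by simp
    then have "inv F (M v x) = u (v, x)" using isom_inj[OF iF] by (metis inv_f_f)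
    ultimately show "\<exists>c. inv F (M v x) = c *s wq (A x)" by metis
  qed
qed

end

section \<open>Functions of class \<open>Ck_open\<close>\<close>

lemma FD_works: "f differentiable (at x) ==> (f has_derivative FD f x) (at x)"
  using frechet_derivative_works by blast

lemma FD_unique: "(f has_derivative f') (at x) ==> FD f x = f'"
  using frechet_derivative_at by metis

lemma FD_apply: "(f has_derivative f') (at x) ==> FD f x v = f' v"
  by (simp add: FD_unique)

lemma Ck_open_cong:
  assumes "open S" "!!x. x \<in> S ==> f x = g x" "Ck_open k S f"
  shows "Ck_open k S g"
  using assms(2,3)
proof (induction k arbitrary: f g)
  case 0
  then show ?case using continuous_on_cong[of S S f g] by auto
next
  case (Suc k)
  have d: "(g has_derivative FD f x) (at x)" if x: "x \<in> S" for x
  proof (rule has_derivative_transform_within_open[OF _ assms(1) x])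
    show "(f has_derivative FD f x) (at x)" 
      using Suc.prems(2) x FD_works by auto
  qed (use Suc.prems in auto)
  have "Ck_open k S (%x. FD g x v)" for v
    by (rule Suc.IH[of "%x. FD f x v"])
      (use Suc.prems(2) FD_unique[OF d] in auto)
  moreover have "g differentiable (at x)" if "x \<in> S" for x using d[OF that] by (rule differentiableI)
  ultimately show ?case by simp
qed

lemma Ck_open_subset: "Ck_open k S f ==> T \<subseteq> S ==> Ck_open k T f"
  by (induction k arbitrary: f) (auto intro: continuous_on_subset)

lemma Ck_open_local:
  assumes "!!x. x \<in> S ==> \<exists>U. open U \<and> x \<in> U \<and> Ck_open k U f"
  shows "Ck_open k S f"
  using assms
proof (induction k arbitrary: f)
  case 0
  have "continuous (at x within S) f" if xs: "x \<in> S" for x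
  proof -
    obtain U where "open U" "x \<in> U" "continuous_on U f" using 0[OF xs] by auto
    then have "continuous (at x) f" by (simp add: continuous_on_eq_continuous_at)
    then show ?thesis by (rule continuous_at_imp_continuous_at_within)
  qed
  then show ?case by (simp add: continuous_on_eq_continuous_within)
next
  case (Suc k)
  have "f differentiable (at x)" if "x \<in> S" for x using Suc.prems[OF that] by auto
  moreover have "Ck_open k S (%x. FD f x v)" for v
    by (rule Suc.IH) (use Suc.prems in fastforce)
  ultimately show ?case by simp
qed

lemma Ck_open_Suc_imp: "Ck_open (Suc k) S f ==> Ck_open k S f"
proof (induction k arbitrary: f)
  case 0
  then show ?case by (auto intro!: continuous_at_imp_continuous_on differentiable_imp_continuous_within)
next
  case (Suc k)
  then show ?case by simp
qed

lemma Ck_open_le: "Ck_open m S f ==> k \<le> m ==> Ck_open k S f"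
  by (induction m) (auto simp: le_Suc_eq simp del: Ck_open.simps intro: Ck_open_Suc_imp)

lemma Ck_open_continuous: "Ck_open k S f ==> continuous_on S f"
  using Ck_open_le[of k S f 0] by simp

lemma Ck_open_const: "Ck_open k S (%x. c)"
  by (induction k arbitrary: c) (auto simp: frechet_derivative_const)

lemma Ck_open_linear:
  assumes "bounded_linear f" shows "Ck_open k S f"
proof (cases k)
  case 0 then show ?thesis using assms by (simp add: linear_continuous_on)
next
  case (Suc k)
  have "FD f x = f" for x
    by (rule FD_unique[OF bounded_linear_imp_has_derivative[OF assms]])
  then show ?thesis using Suc assms
    by (auto simp: Ck_open_const intro: bounded_linear_imp_differentiable)
qed

lemma Ck_open_add:
  assumes "open S" "Ck_open k S f" "Ck_open k S g"
  shows "Ck_open k S (%x. f x + g x)"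
  using assms(2,3)
proof (induction k arbitrary: f g)
  case (Suc k)
  have d: "((%x. f x + g x) has_derivative (%v. FD f x v + FD g x v)) (at x)"
    if "x \<in> S" for x
    by (intro has_derivative_add FD_works) (use Suc.prems that in auto)
  have "Ck_open k S (%x. FD (%x. f x + g x) x v)" for v
    by (rule Ck_open_cong[OF assms(1) _ Suc.IH]) (use Suc.prems FD_unique[OF d] in auto)
  moreover have "(%x. f x + g x) differentiable (at x)" if "x \<in> S" for x using d[OF that] by (rule differentiableI)
  ultimately show ?case by simp
qed (auto intro: continuous_on_add)

lemma Ck_open_sum:
  assumes "open S" "!!i. i \<in> I ==> Ck_open k S (f i)"
  shows "Ck_open k S (%x. \<Sum>i\<in>I. f i x)"
  using assms(2)
  by (induction I rule: infinite_finite_induct) (auto simp: Ck_open_const intro: Ck_open_add[OF assms(1)])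

lemma Ck_open_bilinear:
  assumes "open S" "bounded_bilinear B" "Ck_open k S f" "Ck_open k S g"
  shows "Ck_open k S (%x. B (f x) (g x))"
  using assms(3,4)
proof (induction k arbitrary: f g)
  case 0 then show ?case by (simp add: bounded_bilinear.continuous_on[OF assms(2)])
next
  case (Suc k)
  have d: "((%x. B (f x) (g x)) has_derivative
      (%v. B (f x) (FD g x v) + B (FD f x v) (g x))) (at x)"
    if "x \<in> S" for x
    by (intro bounded_bilinear.FDERIV[OF assms(2)] FD_works) (use Suc.prems that in auto)
  have "Ck_open k S (%x. FD (%x. B (f x) (g x)) x v)" for v
  proof (rule Ck_open_cong[OF assms(1)])
    show "Ck_open k S (%x. B (f x) (FD g x v) + B (FD f x v) (g x))"
      by (rule Ck_open_add[OF assms(1) Suc.IH Suc.IH])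
        (use Suc.prems Ck_open_Suc_imp in auto)
  qed (use FD_unique[OF d] in auto)
  moreover have "(%x. B (f x) (g x)) differentiable (at x)" if "x \<in> S" for x using d[OF that] by (rule differentiableI)
  ultimately show ?case by simp
qed

lemma Ck_open_comp_linear:
  assumes "open S" "bounded_linear L" "Ck_open k S f"
  shows "Ck_open k S (%x. L (f x))"
  using assms(3)
proof (induction k arbitrary: f)
  case 0 then show ?case by (simp add: bounded_linear.continuous_on[OF assms(2)])
next
  case (Suc k)
  have d: "((%x. L (f x)) has_derivative (%v. L (FD f x v))) (at x)"
    if "x \<in> S" for x
    by (rule bounded_linear.has_derivative[OF assms(2) FD_works]) (use Suc.prems that in auto)
  have "Ck_open k S (%x. FD (%x. L (f x)) x v)" for v
    by (rule Ck_open_cong[OF assms(1) _ Suc.IH]) (use Suc.prems FD_unique[OF d] in auto)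
  moreover have "(%x. L (f x)) differentiable (at x)" if "x \<in> S" for x using d[OF that] by (rule differentiableI)
  ultimately show ?case by simp
qed

lemma linear_expand:
  fixes L :: "'b::euclidean_space => 'c::real_vector"
  assumes "linear L" shows "L v = (\<Sum>b\<in>Basis. (v \<bullet> b) *\<^sub>R L b)"
proof -
  have "L v = L (\<Sum>b\<in>Basis. (v \<bullet> b) *\<^sub>R b)" by (simp only: euclidean_representation)
  also have "\<dots> = (\<Sum>b\<in>Basis. (v \<bullet> b) *\<^sub>R L b)"
    by (simp only: linear_sum[OF assms] linear_scale[OF assms])
  finally show ?thesis .
qed

text \<open>\<open>Ck_open\<close> controls derivatives in fixed directions, while the chain rule
  evaluates the derivative of g in the moving direction \<open>FD f x v\<close>. Expanding this
  direction in a basis reduces to fixed ones.\<close>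

lemma Ck_open_compose:
  fixes f :: "'a::real_normed_vector => 'b::euclidean_space" and g :: "'b => 'c::real_normed_vector"
  assumes "open S" "f ` S \<subseteq> T" "Ck_open k S f" "Ck_open k T g"
  shows "Ck_open k S (%x. g (f x))"
  using assms(3,4)
proof (induction k arbitrary: g)
  case 0
  then show ?case using assms(2) by (auto intro: continuous_on_compose2[of T g S f])
next
  case (Suc k)
  have fk: "Ck_open k S f" using Suc.prems(1) by (rule Ck_open_Suc_imp)
  have gd: "g differentiable (at (f x))" and fd: "f differentiable (at x)" if "x \<in> S" for x
    using Suc.prems assms(2) that by auto
  have d: "((%x. g (f x)) has_derivative (%v. FD g (f x) (FD f x v))) (at x)"
    if "x \<in> S" for x
    by (rule has_derivative_compose) (use FD_works gd fd that in auto)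
  have "Ck_open k S (%x. FD (%x. g (f x)) x v)" for v
  proof (rule Ck_open_cong[OF assms(1)])
    show "Ck_open k S (%x. \<Sum>b\<in>Basis. (FD f x v \<bullet> b) *\<^sub>R FD g (f x) b)"
      by (intro Ck_open_sum[OF assms(1)] Ck_open_bilinear[OF assms(1) bounded_bilinear_scaleR]
          Ck_open_comp_linear[OF assms(1) bounded_linear_inner_left] Suc.IH fk)
        (use Suc.prems in auto)
    show "(\<Sum>b\<in>Basis. (FD f x v \<bullet> b) *\<^sub>R FD g (f x) b)
        = FD (%x. g (f x)) x v" if "x \<in> S" for x
      unfolding FD_unique[OF d[OF that]]
      by (rule linear_expand[OF has_derivative_linear[OF FD_works[OF gd[OF that]]], symmetric])
  qed
  moreover have "(%x. g (f x)) differentiable (at x)" if "x \<in> S" for x using d[OF that] by (rule differentiableI)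
  ultimately show ?case by simp
qed

lemma Ck_open_inverse:
  fixes f :: "'a::real_normed_vector => complex"
  assumes "open S" "Ck_open k S f" "!!x. x \<in> S ==> f x ~= 0"
  shows "Ck_open k S (%x. inverse (f x))"
  using assms(2)
proof (induction k)
  case 0 then show ?case using assms(3) by (auto intro!: continuous_on_inverse)
next
  case (Suc k)
  have d: "((%x. inverse (f x)) has_derivative
      (%v. - (inverse (f x) * FD f x v * inverse (f x)))) (at x)"
    if "x \<in> S" for x
    using Suc.prems assms(3) that by (intro Deriv.has_derivative_inverse FD_works) auto
  have i: "Ck_open k S (%x. inverse (f x))" using Suc.IH Ck_open_Suc_imp Suc.prems by blast
  have "Ck_open k S (%x. FD (%x. inverse (f x)) x v)" for v
  proof (rule Ck_open_cong[OF assms(1)])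
    show "Ck_open k S (%x. - (inverse (f x) * FD f x v * inverse (f x)))"
      by (intro Ck_open_comp_linear[OF assms(1) bounded_linear_minus[OF bounded_linear_ident]]
           Ck_open_bilinear[OF assms(1) bounded_bilinear_mult] i) (use Suc.prems in auto)
  qed (use FD_unique[OF d] in auto)
  moreover have "(%x. inverse (f x)) differentiable (at x)" if "x \<in> S" for x using d[OF that] by (rule differentiableI)
  ultimately show ?case by simp
qed

lemma bounded_bilinear_vec_scale: "bounded_bilinear (%(c::complex) (x :: complex^'k::finite). c *s x)"
proof
  show "\<exists>K. \<forall>a b. norm (a *s (b :: complex^'k)) \<le> norm a * norm b * K"
    by (rule exI[of _ 1]) (simp add: norm_vec_scale)
qed (simp_all add: vec_eq_iff algebra_simps)

lemma bounded_bilinear_herm: "bounded_bilinear (herm :: 'm::finite V => 'm V => complex)"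
proof (rule bilinear_conv_bounded_bilinear[THEN iffD1])
  show "bilinear (herm :: 'm V => 'm V => complex)"
    unfolding bilinear_def linear_iff
    by (simp add: herm_simps scaleR_eq_vec) (simp add: scaleR_conv_of_real)
qed

lemma bounded_bilinear_cip: "bounded_bilinear (cip :: complex^'k::finite => _)"
proof (rule bilinear_conv_bounded_bilinear[THEN iffD1])
  show "bilinear (cip :: complex^'k => complex^'k => complex)"
    unfolding bilinear_def linear_iff
    by (simp add: cip_simps scaleR_eq_vec) (simp add: scaleR_conv_of_real)
qed

lemma clin_bounded_linear: "clin f ==> bounded_linear (f :: complex^'a::finite => complex^'b::finite)"
  by (rule linear_conv_bounded_linear[THEN iffD1]) (simp add: linear_iff clin_add clin_scaleR)

section \<open>Symmetry of second derivatives\<close>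

lemma vector_mvt_bound:
  fixes g :: "real => 'b::euclidean_space"
  assumes h: "0 < h" and g: "!!s. 0 \<le> s ==> s \<le> h ==> (g has_vector_derivative g' s) (at s)"
    and b: "!!s. 0 \<le> s ==> s \<le> h ==> norm (g' s - c) \<le> e"
  shows "norm (g h - g 0 - h *\<^sub>R c) \<le> e * h"
proof -
  have d: "((%s. g s - s *\<^sub>R c) has_derivative (%r. r *\<^sub>R (g' s - c))) (at s)" if "0 \<le> s" "s \<le> h" for s
    using g[OF that] unfolding has_vector_derivative_def
    by (auto intro!: derivative_eq_intros simp: algebra_simps)
  have "\<exists>s\<in>{0<..<h}. norm ((g h - h *\<^sub>R c) - (g 0 - 0 *\<^sub>R c)) \<le> norm ((h - 0) *\<^sub>R (g' s - c))"
    by (rule mvt_general[OF h]) (auto intro!: continuous_at_imp_continuous_on has_derivative_continuous[OF d] d)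
  moreover have "(g h - h *\<^sub>R c) - (g 0 - 0 *\<^sub>R c) = g h - g 0 - h *\<^sub>R c" by simp
  ultimately have "\<exists>s\<in>{0<..<h}. norm (g h - g 0 - h *\<^sub>R c) \<le> norm ((h - 0) *\<^sub>R (g' s - c))" by (simp only:)
  then obtain s where s: "0 < s" "s < h" "norm (g h - g 0 - h *\<^sub>R c) \<le> h * norm (g' s - c)" using h by auto
  show ?thesis using order_trans[OF s(3) mult_left_mono[OF b[of s]]] s(1,2) h by (simp add: mult.commute)
qed

text \<open>The mean value estimate is used twice: in s for the difference of two values in t, and
  in t for the first derivative in direction v.\<close>

lemma second_difference:
  fixes f :: "'a::real_normed_vector => 'b::euclidean_space" and p v w :: 'a
  defines "P s t \<equiv> p + s *\<^sub>R v + t *\<^sub>R w"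
  assumes h: "0 < h" and d: "!!s t. [|0 \<le> s; s \<le> h; 0 \<le> t; t \<le> h|] ==> (f has_derivative G (P s t)) (at (P s t)) \<and>
      ((%x. G x v) has_derivative H (P s t)) (at (P s t)) \<and> norm (H (P s t) w - a) \<le> e"
  shows "norm (f (P h h) - f (P h 0) - (f (P 0 h) - f (P 0 0)) - h *\<^sub>R h *\<^sub>R a) \<le> e * h * h"
proof (rule vector_mvt_bound[OF h])
  have vd: "((%s. F (P s t)) has_vector_derivative F' v) (at s)" "((%t. F (P s t)) has_vector_derivative F' w) (at t)"
    if F: "(F has_derivative F') (at (P s t))" for F :: "'a => 'b" and F' s t
  proof -
    note l = linear_scale[OF has_derivative_linear[OF F]]
    have "((%s. P s t) has_derivative (%r. r *\<^sub>R v)) (at s)" "((%t. P s t) has_derivative (%r. r *\<^sub>R w)) (at t)"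
      unfolding P_def by (auto intro!: derivative_eq_intros)
    from this[THEN has_derivative_compose, OF F]
    show "((%s. F (P s t)) has_vector_derivative F' v) (at s)" "((%t. F (P s t)) has_vector_derivative F' w) (at t)"
      unfolding has_vector_derivative_def l .
  qed
  fix s assume s: "0 \<le> s" "s \<le> h"
  show "((%s. f (P s h) - f (P s 0)) has_vector_derivative G (P s h) v - G (P s 0) v) (at s)"
    by (intro has_vector_derivative_diff vd(1)) (use d s h in auto)
  show "norm (G (P s h) v - G (P s 0) v - h *\<^sub>R a) \<le> e * h"
    by (rule vector_mvt_bound[OF h, where g' = "%t. H (P s t) w"]) (use vd(2)[where F = "%x. G x v"] d s in auto)
qed

text \<open>The second difference D is the same for both orders of the directions. It approximates
  each mixed derivative within a third of their supposed distance N, which is impossible.\<close>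

lemma second_derivative_symmetric:
  fixes f :: "'a::real_normed_vector => 'b::euclidean_space"
  assumes S: "open S" "p \<in> S" and f: "Ck_open 2 S f"
  shows "FD (%x. FD f x v) p w = FD (%x. FD f x w) p v"
proof (rule ccontr)
  define G2 where "G2 v x = FD (%x. FD f x v) x" for v x
  have f': "Ck_open (Suc (Suc 0)) S f" using f by (simp add: numeral_2_eq_2)
  have df: "(f has_derivative FD f x) (at x)" "((%x. FD f x v) has_derivative G2 v x) (at x)" if "x \<in> S" for x v
    unfolding G2_def by (rule FD_works; use f' that in auto)+
  define N where "N = norm (G2 v p w - G2 w p v)"
  assume "\<not> ?thesis"
  then have N: "N > 0" unfolding N_def G2_def by simp
  have c: "\<forall>\<^sub>F x in nhds p. norm (G2 v x w - G2 v p w) < N / 3" for v w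
  proof -
    have "isCont (%x. G2 v x w) p" using f' S unfolding G2_def by (auto simp: continuous_on_eq_continuous_at)
    then show ?thesis 
      using tendstoD[of "%x. G2 v x w" "G2 v p w" "nhds p" "N / 3"] N
      unfolding isCont_def tendsto_at_iff_tendsto_nhds[of "%x. G2 v x w" p] dist_norm by simp
  qed
  have "\<forall>\<^sub>F x in nhds p. x \<in> S \<and> norm (G2 v x w - G2 v p w) < N / 3 \<and> norm (G2 w x v - G2 w p v) < N / 3"
    by (intro eventually_conj c eventually_nhds_in_open S)
  then obtain d where d: "d > 0" "!!x. dist x p < d ==> x \<in> S \<and> norm (G2 v x w - G2 v p w) < N / 3 \<and> norm (G2 w x v - G2 w p v) < N / 3"
    unfolding eventually_nhds_metric by blast
  define h where "h = d / (2 * (norm v + norm w + 1))"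
  have pos: "norm v + norm w + 1 > 0" by (smt (verit) norm_ge_zero)
  have h: "h > 0" unfolding h_def using d(1) pos by simp
  have near: "dist (p + s *\<^sub>R v + t *\<^sub>R w) p < d" if "0 \<le> s" "s \<le> h" "0 \<le> t" "t \<le> h" for s t
  proof -
    have "dist (p + s *\<^sub>R v + t *\<^sub>R w) p \<le> s * norm v + t * norm w"
      unfolding dist_norm using norm_triangle_ineq[of "s *\<^sub>R v" "t *\<^sub>R w"] that by simp
    also have "\<dots> \<le> h * norm v + h * norm w" using that by (intro add_mono mult_right_mono) auto
    also have "\<dots> \<le> h * (norm v + norm w + 1)" using h by (simp add: algebra_simps)
    also have "\<dots> = d / 2" unfolding h_def using pos by (simp add: field_simps)
    finally show ?thesis using d(1) by simp
  qed
  then have near': "dist (p + s *\<^sub>R w + t *\<^sub>R v) p < d" if "0 \<le> s" "s \<le> h" "0 \<le> t" "t \<le> h" for s t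
    using that by (metis add.commute add.left_commute)
  define D where "D = f (p + h *\<^sub>R v + h *\<^sub>R w) - f (p + h *\<^sub>R v) - (f (p + h *\<^sub>R w) - f p)"
  have "norm (D - h *\<^sub>R h *\<^sub>R G2 v p w) \<le> N / 3 * h * h"
    using second_difference[OF h, where f = f and G = "FD f" and H = "G2 v" and a = "G2 v p w" and e = "N / 3" and p = p and v = v and w = w]
      near d(2) df by (simp add: D_def less_imp_le)
  moreover have "norm (D - h *\<^sub>R h *\<^sub>R G2 w p v) \<le> N / 3 * h * h"
    using second_difference[OF h, where f = f and G = "FD f" and H = "G2 w" and a = "G2 w p v" and e = "N / 3" and p = p and v = w and w = v]
      near' d(2) df by (simp add: D_def less_imp_le algebra_simps)
  ultimately have "norm ((D - h *\<^sub>R h *\<^sub>R G2 w p v) - (D - h *\<^sub>R h *\<^sub>R G2 v p w)) \<le> N / 3 * h * h + N / 3 * h * h"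
    by (intro order_trans[OF norm_triangle_ineq4 add_mono])
  moreover have "(D - h *\<^sub>R h *\<^sub>R G2 w p v) - (D - h *\<^sub>R h *\<^sub>R G2 v p w) = (h * h) *\<^sub>R (G2 v p w - G2 w p v)"
    by (simp add: scaleR_right_diff_distrib)
  ultimately have "norm ((h * h) *\<^sub>R (G2 v p w - G2 w p v)) \<le> N / 3 * h * h + N / 3 * h * h" by (simp only:)
  then have "h * h * N \<le> h * h * (2 * N / 3)" unfolding norm_scaleR N_def[symmetric] using h by simp
  then show False using h N by simp
qed

section \<open>Heisenberg coordinates\<close>

type_synonym 'n heis = "(complex ^ 'n) \<times> real"

definition mk :: "complex => complex ^ 'n => complex => 'n::finite V" where
  "mk a z b = (\<chi> i. case i of First => a | Mid j => z $ j | Final => b)"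

definition midpart :: "'n::finite V => complex ^ 'n" where "midpart x = (\<chi> i. x $ Mid i)"

lemma mk_nth [simp]: "mk a z b $ First = a" "mk a z b $ Mid j = z $ j" "mk a z b $ Final = b"
  and midpart_nth [simp]: "midpart x $ j = x $ Mid j"
  by (simp_all add: mk_def midpart_def)

lemma midpart_mk [simp]: "midpart (mk a z b) = z" by (simp add: vec_eq_iff)

lemma mk_collapse: "mk (x $ First) (midpart x) (x $ Final) = x"
  by (rule idx_eqI) auto

lemma mk_simps: "mk a z b + mk a' z' b' = mk (a + a') (z + z') (b + b')"
  "mk a z b - mk a' z' b' = mk (a - a') (z - z') (b - b')"
  "c *s mk a z b = mk (c * a) (c *s z) (c * b)" "- mk a z b = mk (- a) (- z) (- b)" "mk 0 0 0 = 0"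
  by (rule idx_eqI; simp)+

lemma mk_eq_iff: "mk a z b = mk a' z' b' \<longleftrightarrow> a = a' \<and> z = z' \<and> b = b'"
  by (metis mk_nth(1,3) midpart_mk)

lemma midpart_simps: "midpart (x + y) = midpart x + midpart y" "midpart (c *s x) = c *s midpart x"
  by (simp_all add: vec_eq_iff)

lemma herm_mk: "herm (mk a z b) (mk a' z' b') = cip z z' + \<i> * (a * cnj b' - b * cnj a')"
  by (simp add: herm_def cip_def)

text \<open>\<open>heis\<close> parametrises the null vectors with first coordinate \<open>1\<close>, with differential \<open>dheis\<close>;
  \<open>hor\<close> spans the contact plane. Together with \<open>heis p\<close>, the vectors \<open>EE p z\<close> (orthogonal to
  \<open>heis p\<close>) and \<open>NN\<close> (null, dual to \<open>heis p\<close>) span the space.\<close>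

definition heis :: "'n::finite heis => 'n V" where
  "heis p = mk 1 (fst p) (cor (snd p) - \<i> * cip (fst p) (fst p) / 2)"

definition dheis :: "'n::finite heis => 'n heis => 'n V" where
  "dheis p Y = mk 0 (fst Y) (cor (snd Y) - \<i> * cor (Re (cip (fst Y) (fst p))))"

definition hor :: "'n::finite heis => complex ^ 'n => 'n heis" where
  "hor p z = (z, Im (cip z (fst p)))"

definition EE :: "'n::finite heis => complex ^ 'n => 'n V" where
  "EE p z = mk 0 z (- \<i> * cip z (fst p))"

definition NN :: "'n::finite V" where "NN = mk 0 0 \<i>"

definition cE :: "'n::finite heis => 'n V => complex ^ 'n" where
  "cE p x = midpart x - x $ First *s fst p"

definition cN :: "'n::finite heis => 'n V => complex" where
  "cN p x = herm x (heis p)"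

lemma herm_frame [simp]:
  "herm (heis p) (heis p) = 0" "herm NN (heis p) = 1" "herm (heis p) NN = 1" "herm NN NN = 0"
  "herm (EE p z) (heis p) = 0" "herm (heis p) (EE p z) = 0" "herm (EE p z) NN = 0" "herm NN (EE p z) = 0"
  "herm (EE p z) (EE p w) = cip z w"
  by (simp_all add: heis_def NN_def EE_def herm_mk cip_simps cip_cnj algebra_simps)

lemma cE_frame [simp]: "cE p (heis p) = 0" "cE p (EE p z) = z" "cE p NN = 0"
  by (simp_all add: cE_def heis_def EE_def NN_def vec_eq_iff)

lemma First_frame [simp]: "heis p $ First = 1" "EE p z $ First = 0" "NN $ First = 0"
  by (simp_all add: heis_def EE_def NN_def)

lemma frame_expand: "x = x $ First *s heis p + EE p (cE p x) + cN p x *s NN"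
proof -
  have "x = mk (x $ First) (midpart x) (x $ Final)" by (simp add: mk_collapse)
  also have "\<dots> = x $ First *s heis p + EE p (cE p x) + cN p x *s NN"
  proof -
    have n: "cN p x = cip (midpart x) (fst p) + \<i> * (x $ First * cnj (heis p $ Final) - x $ Final)"
      by (subst mk_collapse[of x, symmetric]) (simp add: cN_def heis_def herm_mk)
    show ?thesis
      unfolding n unfolding heis_def EE_def NN_def cE_def by (simp add: mk_simps mk_eq_iff cip_simps cip_cnj algebra_simps)
  qed
  finally show ?thesis .
qed

lemma EE_simps: "EE p (z + w) = EE p z + EE p w" "EE p (c *s z) = c *s EE p z" "EE p 0 = 0"
  by (simp_all add: EE_def mk_simps cip_simps algebra_simps mk_eq_iff)

lemma EE_clin: "clin (EE p)" by (simp add: clin_def EE_simps)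

lemma cE_clin: "clin (cE p)"
  by (simp add: clin_def cE_def vec_eq_iff algebra_simps)

lemma cN_clinf: "clinf (cN p)" unfolding cN_def by (rule hermitian_clinf[OF hermitian_herm])

lemma hor_simps: "hor p (z + w) = hor p z + hor p w" "hor p (r *\<^sub>R z) = r *\<^sub>R hor p z" "hor p 0 = 0"
  by (simp_all add: hor_def cip_simps scaleR_eq_vec zero_prod_def)

lemma dheis_simps: "dheis p (Y + Z) = dheis p Y + dheis p Z" "dheis p (r *\<^sub>R Y) = of_real r *s dheis p Y" "dheis p 0 = 0"
  by (simp_all add: dheis_def mk_simps mk_eq_iff cip_simps scaleR_eq_vec algebra_simps)

lemma dheis_bounded_linear: "bounded_linear (dheis p)"
  by (rule linear_conv_bounded_linear[THEN iffD1]) (simp add: linear_iff dheis_simps scaleR_eq_vec)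

lemma dheis_hor [simp]: "dheis p (hor p z) = EE p z"
  by (simp add: dheis_def hor_def EE_def mk_eq_iff complex_eq_iff)

lemma dheis_T [simp]: "dheis p (0, 1) = - \<i> *s NN"
  by (simp add: dheis_def NN_def mk_simps mk_eq_iff cip_simps)

lemma cE_dheis [simp]: "cE p (dheis p Y) = fst Y"
  by (simp add: cE_def dheis_def)

lemma First_dheis [simp]: "dheis p Y $ First = 0" by (simp add: dheis_def)

lemma cN_dheis: "cN p (dheis p Y) = - \<i> * cor (snd Y - Im (cip (fst Y) (fst p)))"
  by (simp add: cN_def dheis_def heis_def herm_mk complex_eq_iff)

lemma has_derivative_of_real': "((%p. cor (snd p)) has_derivative (%Y. cor (snd Y))) (at p)"
  by (intro has_derivative_of_real has_derivative_snd) auto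

lemma mk_bounded_linear: "bounded_linear (%(a, z, b). mk a z b)"
  by (rule linear_conv_bounded_linear[THEN iffD1]) (auto simp: linear_iff mk_simps scaleR_eq_vec scaleR_conv_of_real)

lemma has_derivative_mk:
  assumes "(a has_derivative a') (at p)" "(z has_derivative z') (at p)" "(b has_derivative b') (at p)"
  shows "((%p. mk (a p) (z p) (b p)) has_derivative (%Y. mk (a' Y) (z' Y) (b' Y))) (at p)"
  using bounded_linear.has_derivative[OF mk_bounded_linear has_derivative_Pair[OF assms(1) has_derivative_Pair[OF assms(2,3)]]]
  by simp

lemma Ck_open_Pair:
  assumes "open S" "Ck_open k S f" "Ck_open k S g" shows "Ck_open k S (%x. (f x, g x))"
proof -
  have "Ck_open k S (%x. (f x, 0) + (0, g x))"
    by (intro Ck_open_add Ck_open_comp_linear[OF assms(1) _ assms(2)] Ck_open_comp_linear[OF assms(1) _ assms(3)] assms(1)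
        bounded_linear_Pair bounded_linear_ident bounded_linear_zero)
  then show ?thesis by simp
qed

lemma Ck_open_mk:
  assumes "open S" "Ck_open k S a" "Ck_open k S z" "Ck_open k S b"
  shows "Ck_open k S (%p. mk (a p) (z p) (b p))"
  using Ck_open_comp_linear[OF assms(1) mk_bounded_linear Ck_open_Pair[OF assms(1,2) Ck_open_Pair[OF assms(1,3,4)]]]
  by simp

lemma cip_deriv_self:
  fixes p :: "'n::finite heis"
  shows "((%p. cip (fst p) (fst p)) has_derivative (%Y. 2 * cor (Re (cip (fst Y) (fst p))))) (at p)"
proof -
  have "((%p. cip (fst p) (fst p)) has_derivative (%Y. cip (fst p) (fst Y) + cip (fst Y) (fst p))) (at p)"
    by (intro bounded_bilinear.FDERIV[OF bounded_bilinear_cip] has_derivative_fst has_derivative_ident)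
  moreover have "cip (fst p) (fst Y) + cip (fst Y) (fst p) = 2 * cor (Re (cip (fst Y) (fst p)))" for Y :: "'n heis"
    using cip_cnj[of "fst Y" "fst p"] by (simp add: complex_eq_iff)
  ultimately show ?thesis by (simp only:)
qed

lemma heis_deriv: "(heis has_derivative dheis p) (at p)"
proof -
  have "((%p. mk 1 (fst p) (cor (snd p) - \<i> / 2 * cip (fst p) (fst p))) has_derivative
     (%Y. mk 0 (fst Y) (cor (snd Y) - \<i> / 2 * (2 * cor (Re (cip (fst Y) (fst p))))))) (at p)"
    by (intro has_derivative_mk has_derivative_const has_derivative_fst has_derivative_ident has_derivative_diff
        has_derivative_of_real' has_derivative_mult_right cip_deriv_self)
  then show ?thesis by (simp add: heis_def[abs_def] dheis_def[abs_def])
qed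

text \<open>The frame moves only through its last coordinate, hence along \<open>NN\<close>; the
  coefficient is the Levi form of the sphere.\<close>

lemma EE_deriv: "((%p. EE p z) has_derivative (%Y. - cip z (fst Y) *s NN)) (at p)"
proof -
  have "((%p. mk 0 z (- \<i> * cip z (fst p))) has_derivative (%Y. mk 0 0 (- \<i> * cip z (fst Y)))) (at p)"
    by (intro has_derivative_mk has_derivative_const has_derivative_mult_right
        bounded_linear.has_derivative[OF bounded_bilinear.bounded_linear_right[OF bounded_bilinear_cip]]
        has_derivative_fst has_derivative_ident)
  then show ?thesis by (simp add: EE_def NN_def mk_simps mult.commute)
qed

lemma Ck_open_fst: "Ck_open k S (fst :: 'a::real_normed_vector \<times> 'b::real_normed_vector => 'a)"
  and Ck_open_snd: "Ck_open k S (snd :: 'a \<times> 'b => 'b)"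
  by (rule Ck_open_linear, rule bounded_linear_fst, rule Ck_open_linear, rule bounded_linear_snd)

lemma Ck_open_heis: "open S ==> Ck_open k S heis"
proof -
  assume S: "open S"
  have "Ck_open k S (%p::'a heis. mk 1 (fst p) (cor (snd p) + (- \<i> / 2) * cip (fst p) (fst p)))"
    by (intro Ck_open_mk Ck_open_const Ck_open_fst Ck_open_add S
      Ck_open_comp_linear[OF S bounded_linear_of_real Ck_open_snd]
      Ck_open_bilinear[OF S bounded_bilinear_mult] Ck_open_bilinear[OF S bounded_bilinear_cip])
  then show ?thesis by (simp add: heis_def[abs_def])
qed

lemma Ck_open_EE:
  assumes S: "open S" and z: "Ck_open k S z" shows "Ck_open k S (%p. EE p (z p))"
proof -
  have "Ck_open k S (%p. mk 0 (z p) ((- \<i>) * cip (z p) (fst p)))"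
    by (intro Ck_open_mk Ck_open_const Ck_open_fst z S
      Ck_open_bilinear[OF S bounded_bilinear_mult] Ck_open_bilinear[OF S bounded_bilinear_cip])
  then show ?thesis by (simp add: EE_def)
qed

section \<open>CR maps and their jets\<close>

definition CR_on :: "'n::finite heis set => ('n heis => complex^'k::finite) => bool" where
  "CR_on S u \<longleftrightarrow> (\<forall>p\<in>S. \<forall>z. FD u p (hor p (\<i> *s z)) = \<i> *s FD u p (hor p z))"

text \<open>\<open>Dcr\<close>, and \<open>phi2\<close>, \<open>phi3\<close> below, are the successive complex derivatives of the extension of \<open>u\<close>
  to the null cone that is homogeneous of degree \<open>0\<close>; the correction terms are dictated by
  Euler's relation.\<close>

definition Dcr :: "('n::finite heis => complex^'k::finite) => 'n heis => 'n V => complex^'k" where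
  "Dcr u p v = FD u p (hor p (cE p v)) + (\<i> * cN p v) *s FD u p (0, 1)"

lemma CR_on_subset: "CR_on S u ==> T \<subseteq> S ==> CR_on T u" unfolding CR_on_def by blast

context
  fixes S :: "'n::finite heis set" and u :: "'n heis => complex^'k::finite"
  assumes S: "open S" and CR: "CR_on S u"
begin

text \<open>The CR condition gives linearity over \<i> on the horizontal part; the transverse part
  is linear by construction.\<close>

lemma Dcr_clin:
  assumes p: "p \<in> S" and d: "u differentiable (at p)"
  shows "clin (Dcr u p)"
proof -
  define L where "L z = FD u p (hor p z)" for z
  have lin: "linear (FD u p)"
    by (rule has_derivative_linear[OF FD_works[OF d]])
  have add: "L (z + w) = L z + L w" and scR: "L (r *\<^sub>R z) = r *\<^sub>R L z" for z w r
    unfolding L_def by (simp_all add: hor_simps linear_add[OF lin] linear_scale[OF lin])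
  have sci: "L (\<i> *s z) = \<i> *s L z" for z using CR p unfolding L_def CR_on_def by blast
  have sc: "L (c *s z) = c *s L z" for c z
  proof -
    have 1: "c *s z = Re c *\<^sub>R z + Im c *\<^sub>R (\<i> *s z)"
      by (simp add: scaleR_eq_vec vec_eq_iff complex_eq_iff)
    have 2: "c *s L z = Re c *\<^sub>R L z + Im c *\<^sub>R (\<i> *s L z)"
      by (simp add: scaleR_eq_vec vec_eq_iff complex_eq_iff)
    show ?thesis unfolding 2 by (subst 1) (simp add: add scR sci)
  qed
  have D: "Dcr u p v = L (cE p v) + (\<i> * cN p v) *s FD u p (0, 1)" for v
    by (simp add: Dcr_def L_def)
  show ?thesis
  proof (rule clinI)
    show "Dcr u p (x + y) = Dcr u p x + Dcr u p y" for x y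
      unfolding D clin_add[OF cE_clin] clinf_add[OF cN_clinf] add by (simp add: vec_eq_iff algebra_simps)
    show "Dcr u p (c *s x) = c *s Dcr u p x" for c x
      unfolding D clin_scale[OF cE_clin] clinf_scale[OF cN_clinf] sc by (simp only: vec.scale_right_distrib vec.scale_scale mult.left_commute)
  qed
qed

lemma Dcr_dheis:
  assumes d: "u differentiable (at p)"
  shows "Dcr u p (dheis p Y) = FD u p Y"
proof -
  define r where "r = snd Y - Im (cip (fst Y) (fst p))"
  have lin: "linear (FD u p)"
    by (rule has_derivative_linear[OF FD_works[OF d]])
  have Y: "Y = hor p (fst Y) + r *\<^sub>R (0, 1)"
    by (simp add: hor_def r_def prod_eq_iff)
  have "Dcr u p (dheis p Y) = FD u p (hor p (fst Y)) + r *\<^sub>R FD u p (0, 1)"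
    unfolding Dcr_def cN_dheis cE_dheis by (simp add: r_def scaleR_eq_vec)
  also have "\<dots> = FD u p Y"
    by (simp only: linear_add[OF lin, symmetric] linear_scale[OF lin, symmetric] Y[symmetric])
  finally show ?thesis .
qed

lemma Dcr_deriv:
  assumes "u differentiable (at p)"
  shows "(u has_derivative (%Y. Dcr u p (dheis p Y))) (at p)"
  using FD_works[OF assms] by (simp add: Dcr_dheis[OF assms] eta_contract_eq)

lemma Dcr_heis:
  assumes "u differentiable (at p)" shows "Dcr u p (heis p) = 0"
  using linear_0[OF has_derivative_linear[OF FD_works[OF assms]]]
  by (simp add: Dcr_def cN_def hor_simps)

lemma Ck_open_Dcr:
  assumes u: "Ck_open (Suc k) S u" shows "Ck_open k S (%q. Dcr u q v)"
proof -
  have lin: "linear (FD u q)" if "q \<in> S" for q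
    by (rule has_derivative_linear[OF FD_works]) (use u that in auto)
  have "Ck_open k S (%q. (\<Sum>b\<in>Basis. (hor q (cE q v) \<bullet> b) *\<^sub>R FD u q b)
      + (\<i> * cN q v) *s FD u q (0, 1))"
  proof -
    have z: "Ck_open k S (%q. cE q v)"
    proof -
      have "Ck_open k S (%q. midpart v + (- v $ First) *s fst q)"
        by (intro Ck_open_add S Ck_open_const Ck_open_bilinear[OF S bounded_bilinear_vec_scale] Ck_open_fst)
      then show ?thesis by (simp add: cE_def vec.scale_minus_left)
    qed
    have h: "Ck_open k S (%q. hor q (cE q v))"
      unfolding hor_def
      by (intro Ck_open_Pair S z Ck_open_comp_linear[OF S bounded_linear_Im] Ck_open_bilinear[OF S bounded_bilinear_cip] Ck_open_fst)
    have n: "Ck_open k S (%q. cN q v)"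
      unfolding cN_def by (intro Ck_open_bilinear[OF S bounded_bilinear_herm] Ck_open_const Ck_open_heis S)
    show ?thesis
      by (intro Ck_open_add S Ck_open_sum Ck_open_bilinear[OF S bounded_bilinear_scaleR]
        Ck_open_bilinear[OF S bounded_bilinear_vec_scale] Ck_open_bilinear[OF S bounded_bilinear_mult]
        Ck_open_comp_linear[OF S bounded_linear_inner_left] Ck_open_const n h) (use u in auto)
  qed
  then show ?thesis
  proof (rule Ck_open_cong[OF S, rotated])
    fix q assume "q \<in> S"
    show "(\<Sum>b\<in>Basis. (hor q (cE q v) \<bullet> b) *\<^sub>R FD u q b)
      + (\<i> * cN q v) *s FD u q (0, 1) = Dcr u q v"
      unfolding Dcr_def linear_expand[OF lin[OF \<open>q \<in> S\<close>], of "hor q (cE q v)"] ..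
  qed
qed

end

lemma clin_expand:
  assumes "clin L" shows "L x = (\<Sum>i\<in>UNIV. x $ i *s L (axis i 1))"
proof -
  have "L x = L (\<Sum>i\<in>UNIV. x $ i *s axis i 1)" using basis_expansion[of x] by simp
  then show ?thesis by (simp only: clin_sum[OF assms] clin_scale[OF assms])
qed

text \<open>A product rule when differentiability is known for fixed arguments only. The derivative
  L' is not assumed linear in v; uniqueness of derivatives identifies it with its coordinate
  expansion.\<close>

lemma clin_family_deriv:
  fixes L :: "'h::real_normed_vector => complex^'a::finite => complex^'b::finite"
  assumes S: "open S" "p \<in> S" and lin: "!!q. q \<in> S ==> clin (L q)"
    and L: "!!v. ((%q. L q v) has_derivative (%Y. L' Y v)) (at p)" and x: "(x has_derivative x') (at p)"
  shows "((%q. L q (x q)) has_derivative (%Y. L' Y (x p) + L p (x' Y))) (at p)"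
proof -
  have xi: "((%q. x q $ i) has_derivative (%Y. x' Y $ i)) (at p)" for i
    by (rule bounded_linear.has_derivative[OF bounded_linear_vec_nth x])
  have "((%q. \<Sum>i\<in>UNIV. x q $ i *s L q (axis i 1)) has_derivative
     (%Y. \<Sum>i\<in>UNIV. x p $ i *s L' Y (axis i 1) + x' Y $ i *s L p (axis i 1))) (at p)"
    by (intro has_derivative_sum bounded_bilinear.FDERIV[OF bounded_bilinear_vec_scale] xi L)
  then have 1: "((%q. L q (x q)) has_derivative
     (%Y. \<Sum>i\<in>UNIV. x p $ i *s L' Y (axis i 1) + x' Y $ i *s L p (axis i 1))) (at p)"
    by (rule has_derivative_transform_within_open[OF _ S]) (simp add: clin_expand[OF lin, symmetric])
  have "((%q. \<Sum>i\<in>UNIV. x p $ i *s L q (axis i 1)) has_derivative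
     (%Y. \<Sum>i\<in>UNIV. x p $ i *s L' Y (axis i 1))) (at p)"
    by (intro has_derivative_sum bounded_linear.has_derivative[OF bounded_bilinear.bounded_linear_right[OF bounded_bilinear_vec_scale]] L)
  then have "((%q. L q (x p)) has_derivative (%Y. \<Sum>i\<in>UNIV. x p $ i *s L' Y (axis i 1))) (at p)"
    by (rule has_derivative_transform_within_open[OF _ S]) (simp add: clin_expand[OF lin, symmetric])
  then have "(%Y. L' Y (x p)) = (%Y. \<Sum>i\<in>UNIV. x p $ i *s L' Y (axis i 1))"
    by (rule has_derivative_unique[OF L])
  then have "(%Y. L' Y (x p) + L p (x' Y)) = (%Y. \<Sum>i\<in>UNIV. x p $ i *s L' Y (axis i 1) + x' Y $ i *s L p (axis i 1))"
    by (simp add: fun_eq_iff clin_expand[OF lin[OF S(2)], symmetric] sum.distrib)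
  then show ?thesis using 1 by simp
qed

text \<open>Over the complex numbers, \<open>heis p\<close> and the real tangent vectors
  \<open>dheis p Y\<close> span everything, since \<open>NN\<close> is \<i> times
  \<open>dheis p (0, 1)\<close>. Statements about jets thus reduce to Euler's relation and to real
  derivatives.\<close>

lemma frame_induct:
  fixes p :: "'n::finite heis"
  assumes "!!v w. P v ==> P w ==> P (v + w)" "!!c v. P v ==> P (c *s v)"
    and "P (heis p)" "!!Y. P (dheis p Y)"
  shows "P v"
proof -
  have e: "P (EE p z)" for z using assms(4)[of "hor p z"] by simp
  have n: "P NN" using assms(2)[OF assms(4)[of "(0, 1)"], of \<i>] by simp
  have "P (v $ First *s heis p + EE p (cE p v) + cN p v *s NN)"
    by (intro assms(1,2,3) e n)
  then show ?thesis using frame_expand[of v p] by simp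
qed

lemma dheis_deriv: "((%q. dheis q Z) has_derivative (%Y. - cor (Re (cip (fst Z) (fst Y))) *s NN)) (at p)"
proof -
  have "((%q. mk 0 (fst Z) (cor (snd Z) - \<i> * cor (Re (cip (fst Z) (fst q))))) has_derivative
     (%Y. mk 0 0 (0 - \<i> * cor (Re (cip (fst Z) (fst Y)))))) (at p)"
    by (intro has_derivative_mk has_derivative_const has_derivative_diff has_derivative_mult_right has_derivative_of_real
        bounded_linear.has_derivative[OF bounded_linear_Re]
        bounded_linear.has_derivative[OF bounded_bilinear.bounded_linear_right[OF bounded_bilinear_cip]]
        has_derivative_fst has_derivative_ident)
  then show ?thesis by (simp add: dheis_def[abs_def] NN_def mk_simps mult.commute)
qed

section \<open>The second complex derivative\<close>

context
  fixes S :: "'n::finite heis set" and u :: "'n heis => complex^'k::finite"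
  assumes S: "open S" and CR: "CR_on S u" and u2: "Ck_open 2 S u"
begin

lemma u2': "Ck_open (Suc (Suc 0)) S u" using u2 by (simp add: numeral_2_eq_2)

lemma CRu_diff: "p \<in> S ==> u differentiable (at p)" using u2' by auto

lemma CRu_clin: "p \<in> S ==> clin (Dcr u p)" by (rule Dcr_clin[OF S CR _ CRu_diff])

lemma CRu_D1: "Ck_open 1 S (%q. Dcr u q v)"
  using Ck_open_Dcr[OF S CR, of "Suc 0"] u2' by simp

lemma CRu_diff1: "p \<in> S ==> (%q. Dcr u q v) differentiable (at p)"
  using CRu_D1 by simp

abbreviation "DD p Y v \<equiv> FD (%q. Dcr u q v) p Y"

lemma DD_deriv: "p \<in> S ==> ((%q. Dcr u q v) has_derivative (%Y. DD p Y v)) (at p)"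
  using FD_works[OF CRu_diff1] .

lemma DD_add: assumes p: "p \<in> S" shows "DD p Y (v + w) = DD p Y v + DD p Y w"
proof -
  have "((%q. Dcr u q v + Dcr u q w) has_derivative (%Y. DD p Y v + DD p Y w)) (at p)"
    by (intro has_derivative_add DD_deriv p)
  then have "((%q. Dcr u q (v + w)) has_derivative (%Y. DD p Y v + DD p Y w)) (at p)"
    by (rule has_derivative_transform_within_open[OF _ S p]) (simp add: clin_add[OF CRu_clin])
  then show ?thesis by (rule FD_apply)
qed

lemma DD_scale: assumes p: "p \<in> S" shows "DD p Y (c *s v) = c *s DD p Y v"
proof -
  have "((%q. c *s Dcr u q v) has_derivative (%Y. c *s DD p Y v)) (at p)"
    by (intro bounded_linear.has_derivative[OF bounded_bilinear.bounded_linear_right[OF bounded_bilinear_vec_scale]] DD_deriv p)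
  then have "((%q. Dcr u q (c *s v)) has_derivative (%Y. c *s DD p Y v)) (at p)"
    by (rule has_derivative_transform_within_open[OF _ S p]) (simp add: clin_scale[OF CRu_clin])
  then show ?thesis by (rule FD_apply)
qed

lemma DD_heis: assumes p: "p \<in> S" shows "DD p Y (heis p) = - Dcr u p (dheis p Y)"
proof -
  have "((%q. Dcr u q (heis q)) has_derivative (%Y. DD p Y (heis p) + Dcr u p (dheis p Y))) (at p)"
    by (rule clin_family_deriv[OF S p CRu_clin DD_deriv[OF p] heis_deriv])
  moreover have "((%q. Dcr u q (heis q)) has_derivative (%Y. 0)) (at p)"
    by (rule has_derivative_transform_within_open[OF has_derivative_const S p])
      (simp add: Dcr_heis[OF S CR CRu_diff])
  ultimately have "(%Y. DD p Y (heis p) + Dcr u p (dheis p Y)) = (%Y. 0)"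
    by (rule has_derivative_unique)
  then have "DD p Y (heis p) + Dcr u p (dheis p Y) = 0" by (rule fun_cong)
  then show ?thesis by (simp add: eq_neg_iff_add_eq_0)
qed

text \<open>Replacing real derivatives of \<open>FD u q Z\<close> by those of \<open>Dcr\<close>
  costs a term from the motion of \<open>dheis\<close>; it depends on
  \<open>Re (cip (fst Z) (fst Y))\<close> and is itself symmetric.\<close>

lemma DD_sym: assumes p: "p \<in> S" shows "DD p Y (dheis p Z) = DD p Z (dheis p Y)"
proof -
  have 1: "FD (%q. FD u q Z) p Y
     = DD p Y (dheis p Z) + Dcr u p (- cor (Re (cip (fst Z) (fst Y))) *s NN)" for Y Z
  proof -
    have "((%q. Dcr u q (dheis q Z)) has_derivative
       (%Y. DD p Y (dheis p Z) + Dcr u p (- cor (Re (cip (fst Z) (fst Y))) *s NN))) (at p)"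
      by (rule clin_family_deriv[OF S p CRu_clin DD_deriv[OF p] dheis_deriv])
    then have "((%q. FD u q Z) has_derivative
       (%Y. DD p Y (dheis p Z) + Dcr u p (- cor (Re (cip (fst Z) (fst Y))) *s NN))) (at p)"
      by (rule has_derivative_transform_within_open[OF _ S p]) (simp add: Dcr_dheis[OF S CR CRu_diff])
    then show ?thesis by (rule FD_apply)
  qed
  have "Re (cip (fst Z) (fst Y)) = Re (cip (fst Y) (fst Z))"
    using cip_cnj[of "fst Z" "fst Y", symmetric] by simp
  then show ?thesis
    using second_derivative_symmetric[OF S p u2, of Z Y] unfolding 1 by simp
qed

text \<open>Symmetry moves the direction into the slot where \<open>Dcr\<close> is complex linear.
  Hence the complex derivative of a CR map is again a CR map, and the construction can be
  repeated.\<close>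

lemma DD_CR: assumes p: "p \<in> S" shows "DD p (hor p (\<i> *s z)) v = \<i> *s DD p (hor p z) v"
proof (rule frame_induct[of "%v. DD p (hor p (\<i> *s z)) v = \<i> *s DD p (hor p z) v" p])
  show "DD p (hor p (\<i> *s z)) (heis p) = \<i> *s DD p (hor p z) (heis p)"
    by (simp add: DD_heis[OF p] EE_simps clin_scale[OF CRu_clin[OF p]])
  show "DD p (hor p (\<i> *s z)) (dheis p Y) = \<i> *s DD p (hor p z) (dheis p Y)" for Y
    by (subst (1 2) DD_sym[OF p]) (simp add: EE_simps DD_scale[OF p])
qed (simp_all add: DD_add[OF p] DD_scale[OF p] vec.scale_right_distrib mult.commute)

lemma CR_Dcr: "CR_on S (%q. Dcr u q v)"
  unfolding CR_on_def using DD_CR by blast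

definition "Phi2 p v w = Dcr (%q. Dcr u q v) p w - w $ First *s Dcr u p v"

lemma Phi2_clin_right: assumes p: "p \<in> S" shows "clin (Phi2 p v)"
  using Dcr_clin[OF S CR_Dcr p CRu_diff1[OF p], of v]
  by (simp add: clin_def Phi2_def vec_eq_iff algebra_simps)

lemma Phi2_dheis: assumes p: "p \<in> S" shows "Phi2 p v (dheis p Y) = DD p Y v"
  by (simp add: Phi2_def Dcr_dheis[OF S CR_Dcr CRu_diff1[OF p]])

lemma Phi2_heis: assumes p: "p \<in> S" shows "Phi2 p v (heis p) = - Dcr u p v"
  by (simp add: Phi2_def Dcr_heis[OF S CR_Dcr CRu_diff1[OF p]])

lemma Phi2_clin_left: assumes p: "p \<in> S" shows "clin (%v. Phi2 p v w)"
proof (rule frame_induct[of "%w. clin (%v. Phi2 p v w)" p])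
  show "clin (%v. Phi2 p v (heis p))"
    using CRu_clin[OF p] by (simp add: Phi2_heis[OF p] clin_def)
  show "clin (%v. Phi2 p v (dheis p Y))" for Y
    by (simp add: Phi2_dheis[OF p] clin_def DD_add[OF p] DD_scale[OF p])
qed (simp_all add: clin_def clin_add[OF Phi2_clin_right[OF p]] clin_scale[OF Phi2_clin_right[OF p]] vec_eq_iff algebra_simps)

lemma Phi2_sym: assumes p: "p \<in> S" shows "Phi2 p v w = Phi2 p w v"
proof -
  note l = clin_add[OF Phi2_clin_left[OF p]] clin_scale[OF Phi2_clin_left[OF p]]
  note r = clin_add[OF Phi2_clin_right[OF p]] clin_scale[OF Phi2_clin_right[OF p]]
  have h: "Phi2 p (heis p) w = Phi2 p w (heis p)" for w
    by (rule frame_induct[of "%w. Phi2 p (heis p) w = Phi2 p w (heis p)" p])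
      (simp_all add: l r Phi2_dheis[OF p] DD_heis[OF p] Phi2_heis[OF p] clin_add[OF CRu_clin[OF p]] clin_scale[OF CRu_clin[OF p]])
  have d': "Phi2 p (dheis p Y) (dheis p Z) = Phi2 p (dheis p Z) (dheis p Y)" for Y Z
    unfolding Phi2_dheis[OF p] by (rule DD_sym[OF p])
  have d: "Phi2 p (dheis p Y) w = Phi2 p w (dheis p Y)" for w Y
    by (rule frame_induct[of "%w. Phi2 p (dheis p Y) w = Phi2 p w (dheis p Y)" p])
      (simp_all add: l r h d')
  show ?thesis
    by (rule frame_induct[of "%w. Phi2 p v w = Phi2 p w v" p]) (simp_all add: l r h d)
qed

end

lemma Dcr_comb:
  fixes S :: "'n::finite heis set" and v w :: "'n heis => complex^'k::finite"
  assumes "v differentiable (at p)" "w differentiable (at p)"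
  shows "Dcr (%q. v q - c *s w q) p x = Dcr v p x - c *s Dcr w p x"
proof -
  have "((%q. v q - c *s w q) has_derivative (%Y. FD v p Y - c *s FD w p Y)) (at p)"
    by (intro has_derivative_diff bounded_linear.has_derivative[OF bounded_bilinear.bounded_linear_right[OF bounded_bilinear_vec_scale]]
      FD_works assms)
  then show ?thesis
    unfolding Dcr_def by (simp add: FD_unique vec_eq_iff algebra_simps)
qed

lemma CR_on_comb:
  fixes S :: "'n::finite heis set" and v w :: "'n heis => complex^'k::finite"
  assumes "CR_on S v" "CR_on S w" "!!p. p \<in> S ==> v differentiable (at p)" "!!p. p \<in> S ==> w differentiable (at p)"
  shows "CR_on S (%q. v q - c *s w q)"
  unfolding CR_on_def
proof safe
  fix p z assume p: "p \<in> S"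
  have "((%q. v q - c *s w q) has_derivative (%Y. FD v p Y - c *s FD w p Y)) (at p)"
    by (intro has_derivative_diff bounded_linear.has_derivative[OF bounded_bilinear.bounded_linear_right[OF bounded_bilinear_vec_scale]]
      FD_works assms p)
  then show "FD (%q. v q - c *s w q) p (hor p (\<i> *s z)) = \<i> *s FD (%q. v q - c *s w q) p (hor p z)"
    using assms(1,2) p by (simp add: FD_unique CR_on_def vec_eq_iff algebra_simps)
qed

lemma frechet_cong:
  assumes "open S" "p \<in> S" "!!q. q \<in> S ==> f q = g q" "f differentiable (at p)"
  shows "FD g p = FD f p"
  by (rule FD_unique[OF has_derivative_transform_within_open[OF FD_works[OF assms(4)] assms(1,2)]])
    (use assms(3) in auto)

lemma Dcr_component_const:
  fixes u :: "'n::finite heis => complex^'k::finite"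
  assumes S: "open S" "p \<in> S" and "u differentiable (at p)" and "!!q. q \<in> S ==> u q $ j = c"
  shows "Dcr u p v $ j = 0"
proof -
  have "((%q. u q $ j) has_derivative (%Y. FD u p Y $ j)) (at p)"
    by (intro bounded_linear.has_derivative[OF bounded_linear_vec_nth] FD_works assms)
  moreover have "((%q. u q $ j) has_derivative (%Y. 0)) (at p)"
    by (rule has_derivative_transform_within_open[OF has_derivative_const S]) (simp add: assms(4))
  ultimately have "(%Y. FD u p Y $ j) = (%Y. 0)" by (rule has_derivative_unique)
  then have "FD u p Y $ j = 0" for Y by (rule fun_cong)
  then show ?thesis by (simp add: Dcr_def)
qed

section \<open>The jets of a CR map of class C^3\<close>

locale cr_map =
  fixes S :: "'n::finite heis set" and u :: "'n heis => complex^'k::finite"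
  assumes S: "open S" and CR: "CR_on S u" and u3: "Ck_open 3 S u"
begin

lemma u2: "Ck_open 2 S u" using Ck_open_le[OF u3, of 2] by simp

lemma phi1_C2: "Ck_open 2 S (%q. Dcr u q x)"
  by (rule Ck_open_Dcr[OF S CR]) (use u3 in \<open>simp only: eval_nat_numeral\<close>)

lemmas phi1_CR = CR_Dcr[OF S CR u2]

definition "phi1 = Dcr u"
definition "phi2 = Phi2 u"
text \<open>The factor 2 is the degree -2 of the second derivative of a function homogeneous of
  degree 0; compare the factor 1 in \<open>Phi2\<close>.\<close>

definition "phi3 p x y w = Dcr (%q. phi2 q x y) p w - (2 * w $ First) *s phi2 p x y"

lemma phi2_alt: "phi2 q x y = Dcr (%q. Dcr u q x) q y - y $ First *s Dcr u q x"
  unfolding phi2_def by (rule Phi2_def[OF S CR u2])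

lemma phi2_C1: "Ck_open 1 S (%q. phi2 q x y)"
proof -
  have 2: "Ck_open (Suc 1) S (%q. Dcr u q x)" for x using phi1_C2[of x] by (simp only: numeral_2_eq_2 One_nat_def)
  have "Ck_open 1 S (%q. Dcr (%q. Dcr u q x) q y + (- y $ First) *s Dcr u q x)"
    by (intro Ck_open_add S Ck_open_Dcr[OF S phi1_CR] Ck_open_bilinear[OF S bounded_bilinear_vec_scale] Ck_open_const
        Ck_open_le[OF 2] 2) simp
  then show ?thesis by (simp add: phi2_alt vec.scale_minus_left)
qed

context fixes p assumes p: "p \<in> S" begin

lemma u_diff: "u differentiable (at p)" by (rule CRu_diff[OF S CR u2 p])

lemma phi2_diff: "(%q. phi2 q x y) differentiable (at p)"
  using phi2_C1 p by simp

lemma phi1_clin: "clin (phi1 p)" unfolding phi1_def by (rule CRu_clin[OF S CR u2 p])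
lemma phi2_clin_left: "clin (%x. phi2 p x y)" unfolding phi2_def by (rule Phi2_clin_left[OF S CR u2 p])
lemma phi2_clin_right: "clin (phi2 p x)" unfolding phi2_def by (rule Phi2_clin_right[OF S CR u2 p])
lemma phi2_sym: "phi2 p x y = phi2 p y x" unfolding phi2_def by (rule Phi2_sym[OF S CR u2 p])
lemma phi1_heis: "phi1 p (heis p) = 0" unfolding phi1_def by (rule Dcr_heis[OF S CR u_diff])
lemma phi2_heis: "phi2 p x (heis p) = - phi1 p x" "phi2 p (heis p) x = - phi1 p x"
  unfolding phi2_sym[of "heis p" x] unfolding phi2_def phi1_def by (simp_all add: Phi2_heis[OF S CR u2 p])

lemma u_deriv: "(u has_derivative (%Y. phi1 p (dheis p Y))) (at p)"
  unfolding phi1_def by (rule Dcr_deriv[OF S CR u_diff])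
lemma phi1_deriv: "((%q. phi1 q x) has_derivative (%Y. phi2 p x (dheis p Y))) (at p)"
  using DD_deriv[OF S CR u2 p, of x] unfolding phi1_def phi2_def Phi2_dheis[OF S CR u2 p] .

lemma phi2_CR: "CR_on S (%q. phi2 q x y)"
  unfolding phi2_alt
  by (rule CR_on_comb[OF CR_Dcr[OF S phi1_CR phi1_C2] phi1_CR CRu_diff1[OF S phi1_CR phi1_C2] CRu_diff1[OF S CR u2]])

lemma phi2_deriv: "((%q. phi2 q x y) has_derivative (%Y. phi3 p x y (dheis p Y))) (at p)"
  using Dcr_deriv[OF S phi2_CR phi2_diff, of x y] unfolding phi3_def by simp

lemma phi3_heis: "phi3 p x y (heis p) = - 2 *s phi2 p x y"
  using Dcr_heis[OF S phi2_CR phi2_diff, of x y] unfolding phi3_def by (simp add: vec.scale_minus_left)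

lemma phi3_clin: "clin (phi3 p x y)"
  using Dcr_clin[OF S phi2_CR p phi2_diff, of x y]
  by (simp add: phi3_def clin_def vec_eq_iff algebra_simps)

lemma phi3_alt: "phi3 p x y w = Phi2 (%q. Dcr u q x) p y w - w $ First *s Dcr (%q. Dcr u q x) p y
    - y $ First *s Dcr (%q. Dcr u q x) p w + (2 * w $ First * y $ First) *s Dcr u p x"
  unfolding phi3_def phi2_alt Dcr_comb[OF CRu_diff1[OF S phi1_CR phi1_C2 p] CRu_diff1[OF S CR u2 p]]
    Phi2_def[OF S phi1_CR phi1_C2]
  by (simp add: vec_eq_iff algebra_simps)

text \<open>The first exchange is inherited from \<open>phi2\<close>. For the second,
  \<open>phi3_alt\<close> writes \<open>phi3 p x\<close> as the second derivative of the CR map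
  \<open>Dcr u q x\<close> plus terms symmetric in the last two arguments.\<close>

lemma phi3_sym: "phi3 p x y w = phi3 p y x w" "phi3 p x y w = phi3 p x w y"
proof -
  have "(%q. phi2 q y x) differentiable (at p)" by (rule phi2_diff)
  then have "FD (%q. phi2 q x y) p = FD (%q. phi2 q y x) p"
    by (intro frechet_cong[OF S p, of "%q. phi2 q y x"])
      (simp_all add: phi2_def Phi2_sym[OF S CR u2, of _ x y])
  then have "Dcr (%q. phi2 q x y) p w = Dcr (%q. phi2 q y x) p w" by (simp add: Dcr_def)
  then show "phi3 p x y w = phi3 p y x w" unfolding phi3_def by (simp add: phi2_sym[of x y])
  show "phi3 p x y w = phi3 p x w y"
    unfolding phi3_alt Phi2_sym[OF S phi1_CR phi1_C2 p, of x y w]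
    by (simp add: vec_eq_iff algebra_simps)
qed

lemma phi_component:
  assumes "!!q. q \<in> S ==> u q $ j = 1"
  shows "phi1 p x $ j = 0" "phi2 p x y $ j = 0"
proof -
  have 1: "Dcr u q x $ j = 0" if "q \<in> S" for q x
    by (rule Dcr_component_const[OF S that CRu_diff[OF S CR u2 that] assms])
  then show "phi1 p x $ j = 0" unfolding phi1_def using p by blast
  have "Dcr (%q. Dcr u q x) p y $ j = 0"
    by (rule Dcr_component_const[OF S p CRu_diff1[OF S CR u2 p] 1])
  then show "phi2 p x y $ j = 0" unfolding phi2_alt using 1[OF p] by simp
qed

end

end

section \<open>Complexified derivatives\<close>

text \<open>A pair (X, Y) stands for the complexified tangent vector X + \<i> Y.\<close>

type_synonym 'n ctan = "'n heis \<times> 'n heis"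

definition dv :: "('n::finite heis => complex^'k::finite) => 'n heis => 'n ctan => complex^'k" where
  "dv f p d = FD f p (fst d) + \<i> *s FD f p (snd d)"

definition ds :: "('n::finite heis => complex) => 'n heis => 'n ctan => complex" where
  "ds f p d = FD f p (fst d) + \<i> * FD f p (snd d)"

definition cbar :: "'n::finite ctan => 'n ctan" where "cbar d = (fst d, - snd d)"

definition dht :: "'n::finite heis => 'n ctan => 'n V" where
  "dht p d = dheis p (fst d) + \<i> *s dheis p (snd d)"

text \<open>The complex tangent vector of type \<open>(0,1)\<close> with horizontal part \<open>w\<close>, and the one that
  \<open>dheis\<close> maps to \<open>z\<close> modulo \<open>heis\<close>.\<close>

definition anti :: "'n::finite heis => complex^'n => 'n ctan" where
  "anti p w = ((1/2) *\<^sub>R hor p w, (1/2) *\<^sub>R hor p (\<i> *s w))"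

definition holo :: "'n::finite heis => 'n V => 'n ctan" where
  "holo p z = ((1/2) *\<^sub>R hor p (cE p z) - Im (cN p z) *\<^sub>R (0, 1), - (1/2) *\<^sub>R hor p (\<i> *s cE p z) + Re (cN p z) *\<^sub>R (0, 1))"

lemma cbar_cbar [simp]: "cbar (cbar d) = d" by (simp add: cbar_def)

lemma cbar_anti: "cbar (anti p w) = holo p (EE p w)"
  by (simp add: cbar_def anti_def holo_def cN_def zero_prod_def[symmetric])

lemma cbar_holo: "cbar (holo p (EE p w)) = anti p w"
  by (metis cbar_anti cbar_cbar)

lemma dheis_minus: "dheis p (- Y) = - dheis p Y" "dheis p (Y - Z) = dheis p Y - dheis p Z"
  using linear_neg[OF bounded_linear.linear[OF dheis_bounded_linear]]
    linear_diff[OF bounded_linear.linear[OF dheis_bounded_linear]] by blast+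

lemma dht_anti [simp]: "dht p (anti p w) = 0"
  by (simp add: dht_def anti_def dheis_simps EE_simps vec_eq_iff)

lemma dht_holo: "dht p (holo p z) = z - z $ First *s heis p"
proof -
  have "dht p (holo p z) = EE p (cE p z) + cN p z *s NN"
    unfolding dht_def holo_def fst_conv snd_conv dheis_simps dheis_minus
    by (simp add: dheis_simps dheis_minus EE_simps vec_eq_iff) (simp add: complex_eq_iff algebra_simps)
  then show ?thesis using frame_expand[of z p] by (simp add: algebra_simps)
qed

lemma dht_holo_EE [simp]: "dht p (holo p (EE p w)) = EE p w" by (simp add: dht_holo)

context
  fixes p :: "'n::finite heis"
begin

lemma dv_has: "(f has_derivative f') (at p) ==> dv f p d = f' (fst d) + \<i> *s f' (snd d)"
  by (simp add: dv_def FD_unique)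

lemma ds_has: "(f has_derivative f') (at p) ==> ds f p d = f' (fst d) + \<i> * f' (snd d)"
  by (simp add: ds_def FD_unique)

lemma dv_add: "[|f differentiable (at p); g differentiable (at p)|] ==> dv (%q. f q + g q) p d = dv f p d + dv g p d"
  by (subst dv_has[OF has_derivative_add[OF FD_works FD_works]])
    (simp_all add: dv_def vec_eq_iff algebra_simps)

lemma ds_add: "[|f differentiable (at p); g differentiable (at p)|] ==> ds (%q. f q + g q) p d = ds f p d + ds g p d"
  by (subst ds_has[OF has_derivative_add[OF FD_works FD_works]])
    (simp_all add: ds_def algebra_simps)

lemma dv_diff: "[|f differentiable (at p); g differentiable (at p)|] ==> dv (%q. f q - g q) p d = dv f p d - dv g p d"
  by (subst dv_has[OF has_derivative_diff[OF FD_works FD_works]])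
    (simp_all add: dv_def vec_eq_iff algebra_simps)

lemma ds_diff: "[|f differentiable (at p); g differentiable (at p)|] ==> ds (%q. f q - g q) p d = ds f p d - ds g p d"
  by (subst ds_has[OF has_derivative_diff[OF FD_works FD_works]])
    (simp_all add: ds_def algebra_simps)

lemma dv_const [simp]: "dv (%q. c) p d = 0" by (simp add: dv_def frechet_derivative_const)
lemma ds_const [simp]: "ds (%q. c) p d = 0" by (simp add: ds_def frechet_derivative_const)

lemma dv_scale: "[|c differentiable (at p); g differentiable (at p)|] ==> dv (%q. c q *s g q) p d = ds c p d *s g p + c p *s dv g p d"
  by (subst dv_has[OF bounded_bilinear.FDERIV[OF bounded_bilinear_vec_scale FD_works FD_works]])
    (simp_all add: dv_def ds_def vec_eq_iff algebra_simps)

lemma ds_mult: "[|c differentiable (at p); g differentiable (at p)|] ==> ds (%q. c q * g q) p d = ds c p d * g p + c p * ds g p d"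
  by (subst ds_has[OF bounded_bilinear.FDERIV[OF bounded_bilinear_mult FD_works FD_works]])
    (simp_all add: ds_def algebra_simps)

text \<open>The form is conjugate linear in its second argument, so a complex direction acts there
  through its conjugate: a (0,1) derivative of a pairing becomes a (1,0) derivative of the second
  factor.\<close>

lemma ds_herm: "[|f differentiable (at p); g differentiable (at p)|] ==>
    ds (%q. herm (f q) (g q)) p d = herm (dv f p d) (g p) + herm (f p) (dv g p (cbar d))"
  by (subst ds_has[OF bounded_bilinear.FDERIV[OF bounded_bilinear_herm FD_works FD_works]])
    (simp_all add: dv_def cbar_def herm_simps algebra_simps linear_neg[OF has_derivative_linear[OF FD_works]])

lemma ds_cnj: "f differentiable (at p) ==> ds (%q. cnj (f q)) p d = cnj (ds f p (cbar d))"
  by (subst ds_has[OF bounded_linear.has_derivative[OF bounded_linear_cnj FD_works]])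
    (simp_all add: ds_def cbar_def linear_neg[OF has_derivative_linear[OF FD_works]])

lemma dv_heis: "dv heis p d = dht p d"
  by (subst dv_has[OF heis_deriv]) (simp add: dht_def)

lemma dv_EE:
  assumes z: "z differentiable (at p)"
  shows "dv (%q. EE q (z q)) p d = EE p (dv z p d) - (cip (z p) (fst (fst d)) + \<i> * cip (z p) (fst (snd d))) *s NN"
proof -
  have "((%q. EE q (z q)) has_derivative (%Y. - cip (z p) (fst Y) *s NN + EE p (FD z p Y))) (at p)"
    by (rule clin_family_deriv[of UNIV, OF _ _ EE_clin EE_deriv FD_works[OF z]]) auto
  then show ?thesis
    by (simp add: dv_has) (simp add: dv_def EE_simps vec_eq_iff algebra_simps)
qed

text \<open>The \<open>NN\<close> term is the Levi form: along a (0,1) vector a field of contact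
  vectors is turned out of the contact plane. \<open>dv_EE_holo\<close> shows that this does not
  happen along (1,0) vectors.\<close>

lemma dv_EE_anti: "z differentiable (at p) ==> dv (%q. EE q (z q)) p (anti p w) = EE p (dv z p (anti p w)) - cip (z p) w *s NN"
  by (simp add: dv_EE anti_def hor_def cip_simps scaleR_eq_vec algebra_simps)

lemma dv_EE_holo: "z differentiable (at p) ==> dv (%q. EE q (z q)) p (holo p x) = EE p (dv z p (holo p x))"
  by (simp add: dv_EE holo_def hor_def cip_simps scaleR_eq_vec algebra_simps)

lemma ds_zero_on:
  assumes "open S" "p \<in> S" "!!q. q \<in> S ==> f q = 0" shows "ds f p d = 0"
  by (subst ds_has[OF has_derivative_transform_within_open[OF has_derivative_const[of 0] assms(1,2)]]) (use assms(3) in auto)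

lemma ds_cong_on:
  assumes "open S" "p \<in> S" "!!q. q \<in> S ==> f q = g q" "f differentiable (at p)" shows "ds g p d = ds f p d"
  by (simp add: ds_def frechet_cong[OF assms])

lemma dv_cong_on:
  assumes "open S" "p \<in> S" "!!q. q \<in> S ==> f q = g q" "f differentiable (at p)" shows "dv g p d = dv f p d"
  by (simp add: dv_def frechet_cong[OF assms])

lemma dv_zero_on:
  assumes "open S" "p \<in> S" "!!q. q \<in> S ==> f q = 0" shows "dv f p d = 0"
  by (subst dv_has[OF has_derivative_transform_within_open[OF has_derivative_const[of 0] assms(1,2)]]) (use assms(3) in auto)

end

context cr_map begin

context fixes p assumes p: "p \<in> S" begin

lemma dv_u: "dv u p d = phi1 p (dht p d)"
  by (subst dv_has[OF u_deriv[OF p]]) (simp add: dht_def clin_add[OF phi1_clin[OF p]] clin_scale[OF phi1_clin[OF p]])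

lemma phi1_section_deriv:
  assumes x: "(x has_derivative x') (at p)"
  shows "((%q. phi1 q (x q)) has_derivative (%Y. phi2 p (x p) (dheis p Y) + phi1 p (x' Y))) (at p)"
  by (rule clin_family_deriv[OF S p phi1_clin phi1_deriv[OF p] x])

lemma dv_phi1:
  assumes x: "x differentiable (at p)"
  shows "dv (%q. phi1 q (x q)) p d = phi2 p (x p) (dht p d) + phi1 p (dv x p d)"
  by (subst dv_has[OF phi1_section_deriv[OF FD_works[OF x]]])
    (simp add: dht_def dv_def clin_add[OF phi1_clin[OF p]] clin_scale[OF phi1_clin[OF p]]
     clin_add[OF phi2_clin_right[OF p]] clin_scale[OF phi2_clin_right[OF p]] vec.scale_right_distrib)

lemma phi2_section_deriv:
  assumes x: "(x has_derivative x') (at p)" and y: "(y has_derivative y') (at p)"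
  shows "((%q. phi2 q (x q) (y q)) has_derivative
    (%Y. phi3 p (x p) (y p) (dheis p Y) + phi2 p (x' Y) (y p) + phi2 p (x p) (y' Y))) (at p)"
proof -
  have 1: "((%q. phi2 q (x q) v) has_derivative (%Y. phi3 p (x p) v (dheis p Y) + phi2 p (x' Y) v)) (at p)" for v
    by (rule clin_family_deriv[OF S p phi2_clin_left phi2_deriv[OF p] x])
  show ?thesis
    by (rule clin_family_deriv[OF S p phi2_clin_right 1 y])
qed

lemma dv_phi2:
  assumes x: "x differentiable (at p)" and y: "y differentiable (at p)"
  shows "dv (%q. phi2 q (x q) (y q)) p d = phi3 p (x p) (y p) (dht p d) + phi2 p (dv x p d) (y p) + phi2 p (x p) (dv y p d)"
  by (subst dv_has[OF phi2_section_deriv[OF FD_works[OF x] FD_works[OF y]]])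
    (simp add: dht_def dv_def clin_add[OF phi3_clin[OF p]] clin_scale[OF phi3_clin[OF p]]
     clin_add[OF phi2_clin_right[OF p]] clin_scale[OF phi2_clin_right[OF p]]
     clin_add[OF phi2_clin_left[OF p]] clin_scale[OF phi2_clin_left[OF p]] vec.scale_right_distrib)

lemma phi1_section_diff: "x differentiable (at p) ==> (%q. phi1 q (x q)) differentiable (at p)"
  using phi1_section_deriv[OF FD_works] by (rule differentiableI)

lemma phi2_section_diff: "x differentiable (at p) ==> y differentiable (at p) ==> (%q. phi2 q (x q) (y q)) differentiable (at p)"
  using phi2_section_deriv[OF FD_works FD_works] by (rule differentiableI)

lemmas phi_simps = clin_add[OF phi1_clin[OF p]] clin_scale[OF phi1_clin[OF p]] clin_zero[OF phi1_clin[OF p]]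
  clin_minus[OF phi1_clin[OF p]] clin_diff[OF phi1_clin[OF p]] phi1_heis[OF p] phi2_heis[OF p]
  clin_add[OF phi2_clin_left[OF p]] clin_scale[OF phi2_clin_left[OF p]] clin_zero[OF phi2_clin_left[OF p]]
  clin_minus[OF phi2_clin_left[OF p]] clin_diff[OF phi2_clin_left[OF p]]
  clin_add[OF phi2_clin_right[OF p]] clin_scale[OF phi2_clin_right[OF p]] clin_zero[OF phi2_clin_right[OF p]]
  clin_minus[OF phi2_clin_right[OF p]] clin_diff[OF phi2_clin_right[OF p]]
  clin_add[OF phi3_clin[OF p]] clin_scale[OF phi3_clin[OF p]] clin_zero[OF phi3_clin[OF p]]

end

end

section \<open>The second fundamental form\<close>

text \<open>The symmetry in c and d gives an identity for the difference X of the two forms that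
  forces X to be a multiple of \<open>cip\<close>. So g and k can be replaced by one common form,
  which is then made Hermitian.\<close>

lemma gram_normal_form:
  fixes g k :: "complex^'n::finite => complex^'n => complex"
  assumes G: "!!a b c d. G a b c d = cip a d * g b c + cip b d * g a c + cip b c * k a d + cip a c * k b d"
    and sym: "!!a b c d. G a b c d = G a b d c" and herm: "!!a b c d. cnj (G a b c d) = G c d a b"
    and g1: "!!c. clinf (%a. g a c)" and g2: "!!a. clinf (%c. cnj (g a c))" and k1: "!!c. clinf (%a. k a c)"
  obtains h where "hermitian h" "!!a b c d. G a b c d = cip a d * h b c + cip b d * h a c + cip b c * h a d + cip a c * h b d"
proof -
  define X where "X a c = g a c - k a c" for a c
  have X: "cip a d * X b c + cip b d * X a c = cip a c * X b d + cip b c * X a d" for a b c d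
    using sym[of a b c d] unfolding G X_def by (simp add: algebra_simps)
  have X1: "clinf (%a. X a c)" for c
    using g1[of c] k1[of c] unfolding X_def clinf_def by (simp add: algebra_simps)
  have X2: "cip a d * X a c = cip a c * X a d" for a c d using X[of a d a c] by simp
  have X3: "cip c c * X a c = cip a c * X c c" for a c
  proof -
    define b where "b = cip c c *s a - cip a c *s c"
    have "cip b c = 0" unfolding b_def by (simp add: cip_simps)
    then have z: "X b c = 0" using X2[of b b c] by (cases "b = 0") (auto simp: clinf_zero[OF X1] cip_self_eq_0)
    have "X b c = cip c c * X a c - cip a c * X c c"
      unfolding b_def by (simp add: clinf_diff[OF X1] clinf_scale[OF X1])
    then show ?thesis using z by simp
  qed
  have X4: "cip c c * X a a = cip a a * X c c" for a c
  proof (cases "cip a c = 0")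
    case False
    have "cip a c * (cip c c * X a a) = cip c c * (cip a a * X a c)" using X2[of a a c] by simp
    also have "\<dots> = cip a c * (cip a a * X c c)" using X3[of c a] by (metis mult.left_commute)
    finally show ?thesis using False by simp
  next
    case True
    then have "cip c a = 0" using cip_cnj[of a c] by simp
    then show ?thesis using X[of a a c c] X[of a c c a] True by (simp add: mult.commute)
  qed
  define e :: "complex^'n" where "e = axis undefined 1"
  have e: "cip e e = 1" unfolding e_def by (simp add: cip_axis)
  define l where "l = X e e"
  have Xl: "X a c = l * cip a c" for a c
  proof (cases "c = 0")
    case True
    have "X a 0 = 0" using X2[of a a 0] X1 by (cases "a = 0") (auto simp: cip_simps cip_self_eq_0 clinf_zero[OF X1])
    then show ?thesis using True by (simp add: cip_simps)
  next
    case False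
    have "cip c c * X a c = cip a c * (cip c c * l)" using X3[of c a] X4[of e c] e unfolding l_def by simp
    then show ?thesis using False by (simp add: cip_self_eq_0 mult.commute mult.left_commute)
  qed
  \<comment> \<open>The mean of g and k, as k differs from g by l times \<open>cip\<close>.\<close>
  define h0 where "h0 a c = g a c - l / 2 * cip a c" for a c
  define h where "h a c = (h0 a c + cnj (h0 c a)) / 2" for a c
  have k: "k a c = g a c - l * cip a c" for a c using Xl[of a c] unfolding X_def by (simp add: algebra_simps)
  have G0: "G a b c d = cip a d * h0 b c + cip b d * h0 a c + cip b c * h0 a d + cip a c * h0 b d" for a b c d
    unfolding G h0_def k by (simp add: algebra_simps)
  have "G a b c d = (G a b c d + cnj (G c d a b)) / 2" for a b c d using herm[of c d a b] by simp
  also have "\<dots> a b c d = cip a d * h b c + cip b d * h a c + cip b c * h a d + cip a c * h b d" for a b c d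
    unfolding G0 h_def by (simp add: cip_cnj field_simps)
  finally have Gh: "!!a b c d. G a b c d = cip a d * h b c + cip b d * h a c + cip b c * h a d + cip a c * h b d" .
  have "hermitian h"
    unfolding hermitian_def h_def h0_def
    using clinf_add[OF g1] clinf_scale[OF g1] clinf_add[OF g2] clinf_scale[OF g2]
    by (simp add: cip_simps cip_cnj field_simps)
  then show ?thesis using that Gh by blast
qed

locale cr_immersion = cr_map S u for S :: "'n::finite heis set" and u :: "'n heis => ('n + 'n) V" +
  fixes j
  assumes comp: "q \<in> S ==> u q $ j = 1"
    and null: "q \<in> S ==> herm (u q) (u q) = 0"
    and imm: "q \<in> S ==> FD u q Y = 0 ==> Y = 0"
begin

text \<open>By \<open>lorentz\<close> such a vector is a multiple of u, and the normalisation of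
  component j makes the factor zero. This is how the signature of the target is used below.\<close>

lemma null_perp:
  assumes "p \<in> S" "herm v (u p) = 0" "Re (herm v v) \<le> 0" "v $ j = 0"
  shows "v = 0"
proof -
  have "u p ~= 0" using comp[OF assms(1)] by auto
  then obtain c where c: "v = c *s u p"
    using lorentz[of "u p" v] assms null by auto
  then have "c = 0" using assms(4) comp[OF assms(1)] by simp
  then show ?thesis using c by simp
qed

text \<open>\<open>Ehat\<close> corrects \<open>EE\<close> so that the second fundamental form \<open>BB\<close> is orthogonal to the first jet.\<close>

definition "Lam p = herm (phi1 p NN) (u p)"
definition "tau p w = herm (phi1 p (EE p w)) (phi1 p NN)"
definition "Ehat p w = EE p w + (tau p w / Lam p) *s heis p"
definition "BB p v w = phi2 p (Ehat p v) (Ehat p w)"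

lemma EE_diff: "(%q. EE q c) differentiable (at p)"
  using EE_deriv by (rule differentiableI)
lemma heis_diff: "heis differentiable (at p)"
  using heis_deriv by (rule differentiableI)

lemma herm_diff:
  fixes f g :: "'n heis => 'm::finite V"
  shows "f differentiable (at p) ==> g differentiable (at p) ==> (%q. herm (f q) (g q)) differentiable (at p)"
  using bounded_bilinear.FDERIV[OF bounded_bilinear_herm FD_works FD_works] by (rule differentiableI)

lemmas diffs = u_diff phi1_section_diff phi2_section_diff EE_diff heis_diff differentiable_const

lemma ds_herm_zero:
  fixes f g :: "'n heis => 'm::finite V"
  assumes "p \<in> S" "!!q. q \<in> S ==> herm (f q) (g q) = 0" "f differentiable (at p)" "g differentiable (at p)"
  shows "herm (dv f p d) (g p) + herm (f p) (dv g p (cbar d)) = 0"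
proof -
  have "ds (%q. herm (f q) (g q)) p d = 0"
    by (rule ds_zero_on[OF S]) (use assms in auto)
  then show ?thesis by (simp add: ds_herm assms)
qed

lemma phi1_E_u:
  assumes p: "p \<in> S"
  shows "herm (phi1 p (EE p w)) (u p) = 0" "herm (u p) (phi1 p (EE p w)) = 0"
proof -
  have "herm (dv u p (anti p w)) (u p) + herm (u p) (dv u p (cbar (anti p w))) = 0"
    by (rule ds_herm_zero) (simp_all add: null diffs p)
  then show "herm (u p) (phi1 p (EE p w)) = 0"
    by (simp add: dv_u[OF p] cbar_anti phi_simps[OF p] herm_simps)
  then show "herm (phi1 p (EE p w)) (u p) = 0" using herm_cnj[of "u p"] by (metis complex_cnj_zero)
qed

lemma dv_EE_const: "dv (%q. EE q c) p (anti p w) = - cip c w *s NN" "dv (%q. EE q c) p (holo p z) = 0"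
  by (simp_all add: dv_EE_anti dv_EE_holo EE_simps vec.scale_minus_left)

text \<open>The Levi form of the target restricts to \<open>Lam\<close> times that of the source;
  the identity is the (0,1) derivative of \<open>phi1_E_u\<close>.\<close>

lemma phi1_E_E:
  assumes p: "p \<in> S"
  shows "herm (phi1 p (EE p v)) (phi1 p (EE p w)) = cip v w * Lam p"
proof -
  have "herm (dv (%q. phi1 q (EE q v)) p (anti p w)) (u p) + herm (phi1 p (EE p v)) (dv u p (cbar (anti p w))) = 0"
    by (rule ds_herm_zero[OF p]) (simp_all add: phi1_E_u diffs p)
  then show ?thesis
    by (simp add: dv_phi1[OF p] EE_diff dv_EE_const dv_u[OF p] cbar_anti phi_simps[OF p] herm_simps Lam_def algebra_simps)
qed

lemma Lam_cnj:
  assumes p: "p \<in> S"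
  shows "herm (u p) (phi1 p NN) = Lam p" "cnj (Lam p) = Lam p"
proof -
  define d :: "'n ctan" where "d = ((0, 1), 0)"
  have "cbar d = d" by (simp add: d_def cbar_def)
  moreover have "dht p d = - \<i> *s NN" by (simp add: d_def dht_def dheis_simps)
  moreover have "herm (dv u p d) (u p) + herm (u p) (dv u p (cbar d)) = 0"
    by (rule ds_herm_zero[OF p]) (simp_all add: null diffs p)
  ultimately have "herm (u p) (phi1 p NN) = Lam p"
    by (simp add: dv_u[OF p] phi_simps[OF p] herm_simps Lam_def)
  then show "herm (u p) (phi1 p NN) = Lam p" "cnj (Lam p) = Lam p"
    using herm_cnj[of "u p" "phi1 p NN"] unfolding Lam_def by simp_all
qed

lemma Lam_Re: "p \<in> S ==> Lam p = cor (Re (Lam p))" using Lam_cnj(2)[of p] by (simp add: complex_eq_iff)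

text \<open>For a non-positive factor, \<open>phi1 (EE e)\<close> would vanish by
  \<open>null_perp\<close>, against the immersion property.\<close>

lemma Lam_pos: assumes p: "p \<in> S" shows "Re (Lam p) > 0"
proof -
  define e :: "complex^'n" where "e = axis undefined 1"
  define v where "v = phi1 p (EE p e)"
  have e: "cip e e = 1" unfolding e_def by (simp add: cip_axis)
  have "v = FD u p (hor p e)"
    unfolding v_def using FD_apply[OF u_deriv[OF p], of "hor p e"] by simp
  moreover have "hor p e ~= 0" using e by (auto simp: hor_def prod_eq_iff cip_simps)
  ultimately have "v ~= 0" using imm[OF p] by metis
  moreover have "v $ j = 0" unfolding v_def by (rule phi_component(1)[OF p comp])
  ultimately have "\<not> Re (herm v v) \<le> 0"
    using null_perp[OF p, of v] phi1_E_u[OF p, of e] unfolding v_def by blast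
  then show ?thesis unfolding v_def phi1_E_E[OF p] e by simp
qed

lemma Lam_nz: "p \<in> S ==> Lam p ~= 0" using Lam_pos by fastforce

lemma tau_clin: "p \<in> S ==> clinf (tau p)"
  by (simp add: clinf_def tau_def EE_simps phi_simps herm_simps)

lemmas tau_simps = clinf_add[OF tau_clin] clinf_scale[OF tau_clin] clinf_zero[OF tau_clin]

lemma Ehat_clin: "p \<in> S ==> clin (Ehat p)"
  by (simp add: clin_def Ehat_def EE_simps tau_simps vec_eq_iff algebra_simps add_divide_distrib)

lemma Lam_diff: "p \<in> S ==> Lam differentiable (at p)"
  unfolding Lam_def[abs_def] by (intro herm_diff diffs)

lemma tau_diff: "p \<in> S ==> (%q. tau q w) differentiable (at p)"
  unfolding tau_def by (intro herm_diff diffs)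

lemma vec_scale_diff:
  fixes f :: "'n heis => complex" and g :: "'n heis => complex^'m::finite"
  shows "f differentiable (at p) ==> g differentiable (at p) ==> (%q. f q *s g q) differentiable (at p)"
  using bounded_bilinear.FDERIV[OF bounded_bilinear_vec_scale FD_works FD_works] by (rule differentiableI)

lemma tauLam_diff: "p \<in> S ==> (%q. tau q w / Lam q) differentiable (at p)"
  using differentiable_mult[OF tau_diff differentiable_compose[of inverse Lam], of p]
  by (simp add: divide_inverse Lam_diff Lam_nz field_differentiable_imp_differentiable field_differentiable_inverse)

lemma Ehat_diff: "p \<in> S ==> (%q. Ehat q w) differentiable (at p)"
  unfolding Ehat_def by (intro differentiable_add vec_scale_diff tauLam_diff diffs)

text \<open>Reality of \<open>Lam\<close> moves \<open>phi1 NN\<close> to the second argument, where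
  a (1,0) direction acts as a (0,1) one and does not see it.\<close>

lemma ds_Lam: assumes p: "p \<in> S" shows "ds Lam p (holo p (EE p w)) = tau p w"
proof -
  have "ds Lam p (holo p (EE p w)) = ds (%q. herm (u q) (phi1 q NN)) p (holo p (EE p w))"
    by (rule ds_cong_on[OF S p]) (simp_all add: Lam_cnj herm_diff diffs p)
  then show ?thesis
    by (simp add: ds_herm diffs p dv_u[OF p] dv_phi1[OF p] cbar_holo phi_simps[OF p] tau_def herm_simps)
qed

lemma phi2_EE_u: assumes p: "p \<in> S" shows "herm (phi2 p (EE p v) (EE p w)) (u p) = 0"
proof -
  have "herm (dv (%q. phi1 q (EE q v)) p (holo p (EE p w))) (u p) + herm (phi1 p (EE p v)) (dv u p (cbar (holo p (EE p w)))) = 0"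
    by (rule ds_herm_zero[OF p]) (simp_all add: phi1_E_u diffs p)
  then show ?thesis
    by (simp add: dv_phi1[OF p] EE_diff dv_EE_const dv_u[OF p] cbar_holo phi_simps[OF p] herm_simps)
qed

lemma phi2_EE_phi1:
  assumes p: "p \<in> S"
  shows "herm (phi2 p (EE p v) (EE p w)) (phi1 p (EE p c)) = cip w c * tau p v + cip v c * tau p w"
proof -
  have "ds (%q. cip v c * Lam q) p (holo p (EE p w)) = ds (%q. herm (phi1 q (EE q v)) (phi1 q (EE q c))) p (holo p (EE p w))"
    by (rule ds_cong_on[OF S p]) (simp_all add: phi1_E_E herm_diff diffs p)
  then show ?thesis
    by (simp add: ds_herm ds_mult diffs p Lam_diff ds_Lam dv_phi1[OF p] EE_diff dv_EE_const cbar_holo phi_simps[OF p] herm_simps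
        cip_cnj tau_def)
qed

lemma phi1_Ehat: "p \<in> S ==> phi1 p (Ehat p w) = phi1 p (EE p w)"
  by (simp add: Ehat_def phi_simps)

lemma BB_expand: "p \<in> S ==> BB p v w = phi2 p (EE p v) (EE p w) - (tau p v / Lam p) *s phi1 p (EE p w) - (tau p w / Lam p) *s phi1 p (EE p v)"
  by (simp add: BB_def Ehat_def phi_simps vec_eq_iff algebra_simps)

lemma BB_perp:
  assumes p: "p \<in> S"
  shows "herm (BB p v w) (u p) = 0" "herm (BB p v w) (phi1 p (EE p c)) = 0" "herm (phi1 p (EE p c)) (BB p v w) = 0"
proof -
  show 1: "herm (BB p v w) (u p) = 0"
    using p by (simp add: BB_expand phi2_EE_u phi1_E_u herm_simps)
  show "herm (BB p v w) (phi1 p (EE p c)) = 0"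
    using p by (simp add: BB_expand phi2_EE_phi1 phi1_E_E herm_simps Lam_nz)
  then show "herm (phi1 p (EE p c)) (BB p v w) = 0" using herm_cnj[of "BB p v w"] by (metis complex_cnj_zero)
qed

lemma dv_Ehat_anti:
  assumes p: "p \<in> S"
  shows "dv (%q. Ehat q v) p (anti p w) = ds (%q. tau q v / Lam q) p (anti p w) *s heis p - cip v w *s NN"
  unfolding Ehat_def
  by (simp add: dv_add dv_scale tauLam_diff p diffs vec_scale_diff dv_heis dv_EE_const vec.scale_minus_left)

text \<open>A Gauss equation: the orthogonality of \<open>BB a b\<close> and
  \<open>phi1 (EE c)\<close>, differentiated along the (0,1) vector of d. Every term on the right
  carries a factor \<open>cip\<close>, which is the shape required by
  \<open>gram_normal_form\<close>.\<close>

lemma BB_gram: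
  assumes p: "p \<in> S"
  shows "herm (BB p a b) (BB p c d) = cip a d * herm (phi2 p NN (Ehat p b)) (phi1 p (EE p c))
     + cip b d * herm (phi2 p NN (Ehat p a)) (phi1 p (EE p c))
     + cip b c * (Lam p * ds (%q. tau q a / Lam q) p (anti p d)) + cip a c * (Lam p * ds (%q. tau q b / Lam q) p (anti p d))"
proof -
  have "herm (dv (%q. phi2 q (Ehat q a) (Ehat q b)) p (anti p d)) (phi1 p (EE p c))
      + herm (phi2 p (Ehat p a) (Ehat p b)) (dv (%q. phi1 q (EE q c)) p (cbar (anti p d))) = 0"
    by (rule ds_herm_zero[OF p]) (use BB_perp p in \<open>simp_all add: BB_def diffs Ehat_diff\<close>)
  then have "herm (BB p a b) (phi2 p (EE p c) (EE p d)) = cip a d * herm (phi2 p NN (Ehat p b)) (phi1 p (EE p c))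
     + cip b d * herm (phi2 p (Ehat p a) NN) (phi1 p (EE p c))
     + cip b c * (Lam p * ds (%q. tau q a / Lam q) p (anti p d)) + cip a c * (Lam p * ds (%q. tau q b / Lam q) p (anti p d))"
    unfolding BB_def
    by (simp add: dv_phi2[OF p] dv_phi1[OF p] Ehat_diff p EE_diff dv_EE_const dv_Ehat_anti cbar_anti phi_simps[OF p]
        herm_simps phi1_Ehat phi1_E_E algebra_simps add_eq_0_iff)
  moreover have "herm (BB p a b) (BB p c d) = herm (BB p a b) (phi2 p (EE p c) (EE p d))"
    unfolding BB_expand[OF p, of c d] by (simp add: herm_simps BB_perp p)
  ultimately show ?thesis using phi2_sym[OF p, of NN "Ehat p a"] by simp
qed

lemma BB_sym: "p \<in> S ==> BB p v w = BB p w v" unfolding BB_def by (rule phi2_sym)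

lemma BB_simps:
  assumes "p \<in> S"
  shows "BB p (v + v') w = BB p v w + BB p v' w" "BB p (c *s v) w = c *s BB p v w"
    "BB p w (v + v') = BB p w v + BB p w v'" "BB p w (c *s v) = c *s BB p w v" "BB p 0 w = 0" "BB p w 0 = 0"
    "BB p (v - v') w = BB p v w - BB p v' w" "BB p w (v - v') = BB p w v - BB p w v'"
  using assms by (simp_all add: BB_def clin_add[OF Ehat_clin] clin_scale[OF Ehat_clin] clin_zero[OF Ehat_clin] clin_diff[OF Ehat_clin] phi_simps)

lemma BB_h:
  assumes p: "p \<in> S"
  obtains h where "hermitian h" "!!a b c d. herm (BB p a b) (BB p c d) = cip a d * h b c + cip b d * h a c + cip b c * h a d + cip a c * h b d"
proof (rule gram_normal_form[OF BB_gram[OF p]])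
  show "herm (BB p a b) (BB p c d) = herm (BB p a b) (BB p d c)" for a b c d by (simp add: BB_sym p)
  show "clinf (%a. herm (phi2 p NN (Ehat p a)) (phi1 p (EE p c)))" for c
    by (simp add: clinf_def clin_add[OF Ehat_clin[OF p]] clin_scale[OF Ehat_clin[OF p]] phi_simps[OF p] herm_simps)
  show "clinf (%c. cnj (herm (phi2 p NN (Ehat p a)) (phi1 p (EE p c))))" for a
    by (simp add: clinf_def EE_simps phi_simps[OF p] herm_simps)
  show "clinf (%a. Lam p * ds (%q. tau q a / Lam q) p (anti p c))" for c
  proof (rule clinfI)
    fix a b
    have "ds (%q. tau q (a + b) / Lam q) p (anti p c) = ds (%q. tau q a / Lam q + tau q b / Lam q) p (anti p c)"
      by (rule ds_cong_on[OF S p]) (simp_all add: tau_simps add_divide_distrib tauLam_diff p)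
    then show "Lam p * ds (%q. tau q (a + b) / Lam q) p (anti p c) = Lam p * ds (%q. tau q a / Lam q) p (anti p c) + Lam p * ds (%q. tau q b / Lam q) p (anti p c)"
      by (simp add: ds_add tauLam_diff p algebra_simps)
  next
    fix a k
    have d: "(%q. k * (tau q a / Lam q)) differentiable (at p)" by (intro differentiable_mult differentiable_const tauLam_diff p)
    have "ds (%q. tau q (k *s a) / Lam q) p (anti p c) = ds (%q. k * (tau q a / Lam q)) p (anti p c)"
      by (rule ds_cong_on[OF S p]) (use d p in \<open>simp_all add: tau_simps\<close>)
    then show "Lam p * ds (%q. tau q (k *s a) / Lam q) p (anti p c) = k * (Lam p * ds (%q. tau q a / Lam q) p (anti p c))"
      using ds_mult[of "%_. k" p, OF differentiable_const tauLam_diff[OF p], of a "anti p c"] by simp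
  qed
qed (use that in \<open>auto simp: herm_cnj\<close>)

end

section \<open>Regularity of sections, and the structure of the second fundamental form\<close>

lemma Ck_clin_family:
  fixes L :: "'h::real_normed_vector => complex^'a::finite => complex^'b::finite"
  assumes S: "open S" and lin: "!!q. q \<in> S ==> clin (L q)"
    and L: "!!v. Ck_open k S (%q. L q v)" and x: "Ck_open k S x"
  shows "Ck_open k S (%q. L q (x q))"
proof -
  have "Ck_open k S (%q. \<Sum>i\<in>UNIV. x q $ i *s L q (axis i 1))"
    by (intro Ck_open_sum S Ck_open_bilinear[OF S bounded_bilinear_vec_scale]
        Ck_open_comp_linear[OF S bounded_linear_vec_nth] L x)
  then show ?thesis by (rule Ck_open_cong[OF S, rotated]) (simp add: clin_expand[OF lin, symmetric])
qed

lemma Ck_vec_lambda: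
  fixes f :: "'h::real_normed_vector => 'k::finite => complex"
  assumes S: "open S" and f: "!!i. Ck_open k S (%q. f q i)"
  shows "Ck_open k S (%q. \<chi> i. f q i)"
proof -
  have "Ck_open k S (%q. \<Sum>i\<in>UNIV. f q i *s axis i 1)"
    by (intro Ck_open_sum S Ck_open_bilinear[OF S bounded_bilinear_vec_scale] f Ck_open_const)
  moreover have "(\<Sum>i\<in>UNIV. f q i *s axis i 1) = (\<chi> i. f q i)" for q
    using basis_expansion[of "\<chi> i. f q i"] by simp
  ultimately show ?thesis by simp
qed

context cr_immersion begin

lemma Ck_phi1: "Ck_open 1 S x ==> Ck_open 1 S (%q. phi1 q (x q))"
  by (rule Ck_clin_family[OF S phi1_clin], assumption, unfold phi1_def, rule Ck_open_le[OF phi1_C2], simp_all only: one_le_numeral)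

lemma Ck_phi2: "Ck_open 1 S x ==> Ck_open 1 S y ==> Ck_open 1 S (%q. phi2 q (x q) (y q))"
  by (rule Ck_clin_family[OF S phi2_clin_right], assumption, rule Ck_clin_family[OF S phi2_clin_left phi2_C1])

lemma Ck_u: "Ck_open 1 S u" by (rule Ck_open_le[OF u3]) simp

lemma Ck_EE_const: "Ck_open k S (%q. EE q c)" by (rule Ck_open_EE[OF S Ck_open_const])

lemma Ck_herm: "Ck_open k S f ==> Ck_open k S g ==> Ck_open k S (%q. herm (f q) (g q))"
  by (rule Ck_open_bilinear[OF S bounded_bilinear_herm])
lemma Ck_cip: "Ck_open k S f ==> Ck_open k S g ==> Ck_open k S (%q. cip (f q) (g q))"
  by (rule Ck_open_bilinear[OF S bounded_bilinear_cip])
lemma Ck_vscale: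
  fixes g :: "'n heis => complex^'m::finite"
  shows "Ck_open k S f ==> Ck_open k S g ==> Ck_open k S (%q. f q *s g q)"
  by (rule Ck_open_bilinear[OF S bounded_bilinear_vec_scale])
lemma Ck_mult: "Ck_open k S f ==> Ck_open k S g ==> Ck_open k S (%q. f q * g q :: complex)"
  by (rule Ck_open_bilinear[OF S bounded_bilinear_mult])
lemma Ck_divide: "Ck_open k S f ==> Ck_open k S g ==> (!!q. q \<in> S ==> g q ~= 0) ==> Ck_open k S (%q. f q / g q :: complex)"
  unfolding divide_inverse by (intro Ck_mult Ck_open_inverse S)
lemma Ck_cnj: "Ck_open k S f ==> Ck_open k S (%q. cnj (f q))"
  by (rule Ck_open_comp_linear[OF S bounded_linear_cnj])
lemma Ck_minus: "Ck_open k S f ==> Ck_open k S (%q. - f q)"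
  by (rule Ck_open_comp_linear[OF S bounded_linear_minus[OF bounded_linear_ident]])
lemma Ck_add: "Ck_open k S f ==> Ck_open k S g ==> Ck_open k S (%q. f q + g q)"
  by (rule Ck_open_add[OF S])
lemma Ck_diff: "Ck_open k S f ==> Ck_open k S g ==> Ck_open k S (%q. f q - g q)"
  using Ck_add[OF _ Ck_minus, of k f g] by simp

lemmas Ck_intros = Ck_u Ck_phi1 Ck_phi2 Ck_EE_const Ck_herm Ck_cip Ck_vscale Ck_mult Ck_divide Ck_cnj Ck_minus
  Ck_add Ck_diff Ck_open_const Ck_open_heis[OF S] Ck_open_EE[OF S]

lemma Ck_Lam: "Ck_open 1 S Lam" unfolding Lam_def[abs_def] by (intro Ck_intros)
lemma Ck_tau: "Ck_open 1 S x ==> Ck_open 1 S (%q. tau q (x q))" unfolding tau_def by (intro Ck_intros)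
lemma Ck_Ehat: "Ck_open 1 S x ==> Ck_open 1 S (%q. Ehat q (x q))"
  unfolding Ehat_def by (intro Ck_intros Ck_tau Ck_Lam Lam_nz)
lemma Ck_BB: "Ck_open 1 S x ==> Ck_open 1 S y ==> Ck_open 1 S (%q. BB q (x q) (y q))"
  unfolding BB_def by (intro Ck_intros Ck_Ehat)

lemma BB_component: "p \<in> S ==> BB p v w $ j = 0"
  unfolding BB_def by (rule phi_component(2)[OF _ comp])

lemma null_BB: "p \<in> S ==> Re (herm (BB p v w) (BB p v w)) \<le> 0 ==> BB p v w = 0"
  by (rule null_perp[OF _ BB_perp(1)]) (simp_all add: BB_component)

text \<open>The vectors \<open>u\<close>, \<open>phi1 E\<close>, \<open>BB f e\<close> and \<open>phi1 NN\<close> span the target for a maximal direction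
  \<open>f\<close>, so that \<open>BB x x'\<close> is null and vanishes when \<open>x\<close> and \<open>x'\<close> are orthogonal to \<open>f\<close>.\<close>

lemma BB_structure:
  assumes p: "p \<in> S"
  obtains h f where "hermitian h"
    "!!a b c d. herm (BB p a b) (BB p c d) = cip a d * h b c + cip b d * h a c + cip b c * h a d + cip a c * h b d"
    "cip f f = 1" "!!x x'. h x x' = h f f * cip x f * cip f x'" "0 \<le> Re (h f f)"
    "!!x x'. cip x f = 0 ==> cip x' f = 0 ==> BB p x x' = 0" "h f f = 0 ==> BB p = (%x y. 0)"
    "!!v. [|h f f ~= 0; herm v (u p) = 0; !!x. herm v (phi1 p x) = 0; !!x y. herm v (phi2 p x y) = 0|] ==> v = 0"
proof -
  obtain h where h: "hermitian h" and G: "!!a b c d. herm (BB p a b) (BB p c d) = cip a d * h b c + cip b d * h a c + cip b c * h a d + cip a c * h b d"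
    using BB_h[OF p] by blast
  obtain f where f: "cip f f = 1" "!!x. cip x f = 0 ==> h x f = 0" "!!x. Re (h x x) \<le> Re (h f f) * (norm x)\<^sup>2"
    using hermitian_max[OF h] by blast
  have Gd: "herm (BB p x x) (BB p x x) = 4 * cip x x * h x x" for x unfolding G by simp
  \<comment> \<open>A negative value would make \<open>BB p x x\<close> a vector of non-positive
    norm, which vanishes by \<open>null_BB\<close>.\<close>
  have hpos: "0 \<le> Re (h x x)" for x
  proof (rule ccontr)
    assume n: "\<not> 0 \<le> Re (h x x)"
    have "Re (herm (BB p x x) (BB p x x)) = 4 * (norm x)\<^sup>2 * Re (h x x)" unfolding Gd cip_self by simp
    then have "BB p x x = 0" using n by (intro null_BB[OF p]) (simp add: mult_nonneg_nonpos)
    then have "4 * cip x x * h x x = 0" using Gd[of x] by (simp add: herm_simps)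
    then have "x = 0" using n by (auto simp: cip_self_eq_0)
    then show False using n by (simp add: hermitian_simps[OF h])
  qed
  have real: "h x x = cor (Re (h x x))" for x by (rule hermitian_real[OF h])
  have fx: "h f x = 0" if "cip x f = 0" for x using f(2)[OF that] hermitian_cnj[OF h, of x f] by simp
  have polar: "h x x' = 0" if "!!z. z \<in> W ==> h z z = 0" "x \<in> W" "x' \<in> W" "x + x' \<in> W" "x + \<i> *s x' \<in> W" for x x' W
  proof -
    have "h x x' + h x' x = 0" using that(1)[OF that(4)] that(1)[OF that(2)] that(1)[OF that(3)] by (simp add: hermitian_simps[OF h] add.commute)
    moreover have "\<i> * (h x' x - h x x') = 0" using that(1)[OF that(5)] that(1)[OF that(2)] that(1)[OF that(3)]
      by (simp add: hermitian_simps[OF h] algebra_simps)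
    ultimately show ?thesis by simp
  qed
  have fin: "h x x' = h f f * cip x f * cip f x'" if W: "!!z. cip z f = 0 ==> h z z = 0" for x x'
  proof -
    define a where "a = x - cip x f *s f"
    define b where "b = x' - cip x' f *s f"
    have ab: "cip a f = 0" "cip b f = 0" unfolding a_def b_def using f(1) by (simp_all add: cip_simps)
    have "h a b = 0" by (rule polar[of "{z. cip z f = 0}"]) (use W ab in \<open>auto simp: cip_simps\<close>)
    moreover have "x = a + cip x f *s f" "x' = b + cip x' f *s f" unfolding a_def b_def by simp_all
    ultimately show ?thesis using ab f(2)[OF ab(1)] fx[OF ab(2)]
      by (metis (no_types, lifting) hermitian_simps(1-4)[OF h] add_0 add.right_neutral mult_zero_right cip_cnj mult.assoc mult.commute)
  qed
  show ?thesis
  proof (cases "h f f = 0")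
    case True
    have hz: "h z z = 0" for z
    proof -
      have "Re (h z z) = 0" using f(3)[of z] hpos[of z] True by simp
      then show ?thesis using real[of z] by simp
    qed
    then have h0: "h x x' = 0" for x x' using polar[of UNIV x x'] by simp
    have "BB p x x' = 0" for x x' by (rule null_BB[OF p]) (simp add: G h0)
    then show ?thesis using that[OF h G f(1)] h0 True by (simp add: fun_eq_iff)
  next
    case False
    define h1 where "h1 = Re (h f f)"
    have h1: "h f f = cor h1" "h1 > 0"
      using real[of f] hpos[of f] False unfolding h1_def by (auto simp: order_le_less)
    \<comment> \<open>The coefficients number 1 + n + n + 1, the dimension of the target in
      codimension n; so injectivity gives surjectivity.\<close>
    define F :: "('n + 'n) V => ('n + 'n) V" where "F c = c $ First *s u p + phi1 p (EE p (\<chi> i. c $ Mid (Inl i)))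
        + BB p f (\<chi> i. c $ Mid (Inr i)) + c $ Final *s phi1 p NN" for c
    have Fc: "clin F"
    proof (rule clinI)
      fix x y :: "('n + 'n) V" and c
      have s: "(\<chi> i. (x + y) $ Mid (g i)) = (\<chi> i. x $ Mid (g i)) + (\<chi> i. y $ Mid (g i))"
        "(\<chi> i. (c *s x) $ Mid (g i)) = c *s (\<chi> i. x $ Mid (g i))" for g :: "'n => 'n + 'n" by (simp_all add: vec_eq_iff)
      show "F (x + y) = F x + F y" "F (c *s x) = c *s F x"
        unfolding F_def s EE_simps BB_simps[OF p] phi_simps[OF p] by (simp_all add: vec_eq_iff algebra_simps)
    qed
    have inj: "c = 0" if c: "F c = 0" for c
    proof -
      define a where "a = (\<chi> i. c $ Mid (Inl i))"
      define b where "b = (\<chi> i. c $ Mid (Inr i))"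
      have F0: "c $ First *s u p + phi1 p (EE p a) + BB p f b + c $ Final *s phi1 p NN = 0"
        using c unfolding F_def a_def b_def .
      have "herm (c $ First *s u p + phi1 p (EE p a) + BB p f b + c $ Final *s phi1 p NN) (u p) = 0" unfolding F0 by (simp add: herm_simps)
      then have cF: "c $ Final = 0" by (simp add: herm_simps null p phi1_E_u BB_perp Lam_def[symmetric] Lam_nz)
      have "herm (c $ First *s u p + phi1 p (EE p a) + BB p f b + c $ Final *s phi1 p NN) (phi1 p (EE p a)) = 0" unfolding F0 by (simp add: herm_simps)
      then have a: "a = 0" by (simp add: cF herm_simps p phi1_E_u BB_perp phi1_E_E Lam_nz cip_self_eq_0)
      have "(c $ First *s u p + phi1 p (EE p a) + BB p f b + c $ Final *s phi1 p NN) $ j = 0" unfolding F0 by simp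
      then have c0: "c $ First = 0" by (simp add: a cF comp p BB_component EE_simps phi_simps)
      have "BB p f b = 0" using F0 by (simp add: a c0 cF EE_simps phi_simps p)
      then have "herm (BB p f b) (BB p f b) = 0" by (simp add: herm_simps)
      then have "cip f b * h b f + h b b + cip b b * h f f + cip b f * h f b = 0"
        unfolding G using f(1) by (simp add: algebra_simps)
      moreover have "h b f = cip b f * h f f" "h f b = cip f b * h f f"
      proof -
        have e: "b = (b - cip b f *s f) + cip b f *s f" by simp
        have o: "cip (b - cip b f *s f) f = 0" using f(1) by (simp add: cip_simps)
        show "h b f = cip b f * h f f" by (subst e) (simp only: hermitian_simps[OF h] f(2)[OF o, unfolded hermitian_simps[OF h]], simp)
        then show "h f b = cip f b * h f f" using hermitian_cnj[OF h] cip_cnj by (metis complex_cnj_mult)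
      qed
      \<comment> \<open>With the mixed values of h known, the norm of \<open>BB p f b\<close> is, in
        its real part, a sum of non-negative terms, one of them a positive multiple of the squared
        norm of b.\<close>
      ultimately have "2 * (cip b f * cnj (cip b f)) * h f f + h b b + cip b b * h f f = 0"
        by (simp add: cip_cnj algebra_simps)
      then have "Re (cor (2 * (cmod (cip b f))\<^sup>2 * h1) + h b b + cor ((norm b)\<^sup>2 * h1)) = 0"
        unfolding mult_cnj_cmod cip_self h1(1) by (metis of_real_mult of_real_numeral zero_complex.sel(1))
      then have "2 * (cmod (cip b f))\<^sup>2 * h1 + Re (h b b) + (norm b)\<^sup>2 * h1 = 0" by simp
      moreover have "0 \<le> 2 * (cmod (cip b f))\<^sup>2 * h1" using h1 by simp
      moreover have "0 \<le> (norm b)\<^sup>2 * h1" using h1 by simp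
      ultimately have "(norm b)\<^sup>2 * h1 = 0" using hpos[of b] by linarith
      then have b: "b = 0" using h1 by simp
      show "c = 0"
      proof (rule idx_eqI)
        fix i show "c $ Mid i = 0 $ Mid i"
          using a b by (cases i) (simp_all add: a_def b_def vec_eq_iff)
      qed (use c0 cF in simp_all)
    qed
    have surj: "surj F" by (rule clin_inj_surj[OF Fc inj])
    have van: "BB p x x' = 0" if x: "cip x f = 0" "cip x' f = 0" for x x'
    proof -
      \<comment> \<open>w is orthogonal to all spanning vectors except possibly
        \<open>phi1 NN\<close>, whose coefficient in w is zero because w is orthogonal to u. So w is
        orthogonal to itself.\<close>
      define w where "w = BB p x x'"
      obtain c where c: "w = F c" using surj by (metis surjD)
      have o: "cip f x = 0" "cip f x' = 0" using x cip_cnj[of x f] cip_cnj[of x' f] by simp_all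
      have wB: "herm w (BB p f b) = 0" for b
        unfolding w_def G using x f(2) o by simp
      have "herm w (u p) = c $ Final * Lam p"
        unfolding c F_def by (simp add: herm_simps null p phi1_E_u BB_perp Lam_def)
      then have cF: "c $ Final = 0" unfolding w_def using BB_perp(1)[OF p] Lam_nz[OF p] by simp
      have "herm w w = herm w (F c)" unfolding c ..
      also have "\<dots> = 0" unfolding F_def herm_simps wB
        unfolding w_def by (simp add: cF BB_perp[OF p])
      finally show ?thesis unfolding w_def by (intro null_BB[OF p]) simp
    qed
    have hz: "h z z = 0" if "cip z f = 0" for z
    proof (cases "z = 0")
      case False
      then show ?thesis using Gd[of z] van[OF that that] by (simp add: herm_simps cip_self_eq_0)
    qed (simp add: hermitian_simps[OF h])
    have sp: "v = 0" if v: "herm v (u p) = 0" "!!x. herm v (phi1 p x) = 0" "!!x y. herm v (phi2 p x y) = 0" for v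
    proof (rule herm_nondeg)
      fix w
      obtain c where c: "w = F c" using surj by (metis surjD)
      show "herm v w = 0" unfolding c F_def by (simp add: herm_simps v BB_def)
    qed
    show ?thesis by (rule that[OF h G f(1) fin[OF hz] hpos van]) (use False sp in auto)
  qed
qed

text \<open>For a unit vector c this recovers \<open>h x c\<close> of \<open>BB_h\<close> from the
  Gram matrix of \<open>BB\<close>. Unlike the maximal direction f of \<open>BB_structure\<close>,
  it depends differentiably on the point.\<close>

definition hh :: "complex^'n => 'n heis => complex^'n => complex" where
  "hh c q x = herm (BB q x c) (BB q c c) / 2 - cip x c * herm (BB q c c) (BB q c c) / 4"

definition yv :: "complex^'n => 'n heis => complex^'n" where
  "yv c q = (\<chi> i. cnj (hh c q (axis i 1)))"

lemma Ck_yv: "Ck_open 1 S (yv c)"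
  unfolding yv_def[abs_def] hh_def
  by (rule Ck_vec_lambda[OF S]) (intro Ck_intros Ck_BB, simp_all only: zero_neq_numeral numeral_neq_zero not_False_eq_True simp_thms)

lemma cip_yv: "p \<in> S ==> cip x (yv c p) = hh c p x"
proof -
  assume p: "p \<in> S"
  have l: "clinf (hh c p)"
    by (rule clinfI; simp add: hh_def BB_simps[OF p] herm_simps cip_simps) (simp_all add: field_simps)
  have "hh c p x = hh c p (\<Sum>i\<in>UNIV. x $ i *s axis i 1)" using basis_expansion[of x] by simp
  also have "\<dots> = (\<Sum>i\<in>UNIV. x $ i * hh c p (axis i 1))" by (simp only: clinf_sum[OF l] clinf_scale[OF l])
  finally show ?thesis by (simp add: cip_def yv_def)
qed

text \<open>In the notation of \<open>BB_structure\<close>, \<open>yv c p\<close> is a non-zero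
  multiple of f: a c orthogonal to f would have \<open>BB p c c = 0\<close>.\<close>

lemma yv_properties:
  assumes p: "p \<in> S" and c: "cip c c = 1" and nz: "BB p c c ~= 0"
  shows "yv c p ~= 0" "!!a b. cip a (yv c p) = 0 ==> cip b (yv c p) = 0 ==> BB p a b = 0"
    "\<exists>g>0. \<forall>a b. cip a (yv c p) = 0 \<longrightarrow> cip b (yv c p) = 0 \<longrightarrow>
       herm (BB p (yv c p) a) (BB p (yv c p) b) = cor g * cip a b"
proof -
  obtain h f where h: "hermitian h"
    and G: "!!a b c d. herm (BB p a b) (BB p c d) = cip a d * h b c + cip b d * h a c + cip b c * h a d + cip a c * h b d"
    and f: "cip f f = 1" and hf: "!!x x'. h x x' = h f f * cip x f * cip f x'" and pos: "0 \<le> Re (h f f)"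
    and van: "!!x x'. cip x f = 0 ==> cip x' f = 0 ==> BB p x x' = 0" "h f f = 0 ==> BB p = (%x y. 0)"
    by (rule BB_structure[OF p]) blast
  have hff: "h f f ~= 0" using nz van(2) by (auto simp: fun_eq_iff)
  have fc: "cip f c ~= 0" using van(1)[of c c] nz cip_cnj[of f c] by force
  have hh: "hh c p x = h f f * cip f c * cip x f" for x
  proof -
    have "hh c p x = h x c" unfolding hh_def G by (simp add: c algebra_simps)
    then show ?thesis using hf[of x c] by (simp add: algebra_simps)
  qed
  have y: "cip x (yv c p) = h f f * cip f c * cip x f" for x using cip_yv[OF p] hh by simp
  then have y0: "cip x (yv c p) = 0 \<longleftrightarrow> cip x f = 0" for x using hff fc by simp
  show yn: "yv c p ~= 0" using y0[of f] f by (auto simp: cip_simps)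
  show "!!a b. cip a (yv c p) = 0 ==> cip b (yv c p) = 0 ==> BB p a b = 0" using van(1) y0 by blast
  define y where "y = yv c p"
  define g where "g = Re (h y y)"
  have yf: "cip y f ~= 0" using y0[of y] yn unfolding y_def by (simp add: cip_self_eq_0)
  have "h y y = h f f * (cip y f * cnj (cip y f))" using hf[of y y] by (simp add: cip_cnj)
  then have hy: "h y y = cor (Re (h f f) * (cmod (cip y f))\<^sup>2)"
    unfolding mult_cnj_cmod using hermitian_real[OF h, of f] by simp
  have "Re (h f f) ~= 0" using hff hermitian_real[OF h, of f] by auto
  then have r: "g > 0" unfolding g_def hy using yf pos by simp
  have "herm (BB p y a) (BB p y b) = cor g * cip a b" if "cip a y = 0" "cip b y = 0" for a b
  proof -
    have o: "cip a f = 0" "cip b f = 0" using that y0 unfolding y_def by blast+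
    have o': "cip y a = 0" "cip y b = 0" "cip f b = 0" using that o cip_cnj by (metis complex_cnj_zero)+
    have "h y b = 0" "h a y = 0" "h a b = 0" using hf[of y b] hf[of a y] hf[of a b] o o' by simp_all
    then have "herm (BB p y a) (BB p y b) = cip a b * h y y" unfolding G using o' that by simp
    then show ?thesis unfolding hy g_def by simp
  qed
  then show "\<exists>g>0. \<forall>a b. cip a (yv c p) = 0 \<longrightarrow> cip b (yv c p) = 0 \<longrightarrow>
       herm (BB p (yv c p) a) (BB p (yv c p) b) = cor g * cip a b"
    using r unfolding y_def by blast
qed

lemma BB_span:
  assumes p: "p \<in> S" and nz: "BB p a b ~= 0"
    and v: "herm v (u p) = 0" "!!x. herm v (phi1 p x) = 0" "!!x y. herm v (phi2 p x y) = 0"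
  shows "v = 0"
proof (rule BB_structure[OF p])
  fix h f
  assume 0: "h f f = 0 ==> BB p = (%x y. 0)"
    and s: "!!v. [|h f f ~= 0; herm v (u p) = 0; !!x. herm v (phi1 p x) = 0; !!x y. herm v (phi2 p x y) = 0|] ==> v = 0"
  show "v = 0" by (rule s[OF _ v]) (use 0 nz in auto)
qed

lemma BB_polar:
  assumes p: "p \<in> S" and "BB p v w ~= 0"
  obtains c where "cip c c = 1" "BB p c c ~= 0"
proof -
  have "\<exists>x. BB p x x ~= 0"
  proof (rule ccontr)
    assume "\<not> (\<exists>x. BB p x x ~= 0)"
    then have z: "BB p x x = 0" for x by blast
    have "BB p (v + w) (v + w) = BB p v v + BB p w w + 2 *s BB p v w"
      by (simp add: BB_simps[OF p] BB_sym[OF p, of w v] vec_eq_iff)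
    then show False using z assms(2) by (simp add: vec_eq_iff)
  qed
  then obtain x where x: "BB p x x ~= 0" by blast
  then have xn: "x ~= 0" using BB_simps[OF p] by auto
  define c where "c = cor (1 / norm x) *s x"
  have "cip c c = 1" unfolding c_def using xn by (simp add: cip_self norm_vec_scale norm_divide)
  moreover have "BB p c c ~= 0" unfolding c_def using x xn by (simp add: BB_simps[OF p])
  ultimately show ?thesis using that by blast
qed

end

section \<open>The hyperplane along which the second fundamental form degenerates\<close>

text \<open>\<open>BB\<close> vanishes on the hyperplane orthogonal to \<open>y\<close>; the case \<open>y = 0\<close> is that of vanishing \<open>BB\<close>.\<close>

locale cr_split = cr_immersion S u j for S :: "'n::finite heis set" and u :: "'n heis => ('n + 'n) V" and j +
  fixes y :: "'n heis => complex^'n" and e0 :: "complex^'n"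
  assumes yC1: "Ck_open 1 S y"
    and ycase: "(\<forall>q\<in>S. y q = 0) \<or> (\<forall>q\<in>S. y q ~= 0)"
    and van: "[|q \<in> S; cip a (y q) = 0; cip b (y q) = 0|] ==> BB q a b = 0"
    and gram: "[|q \<in> S; y q ~= 0|] ==> \<exists>r>0. \<forall>a b. cip a (y q) = 0 \<longrightarrow> cip b (y q) = 0 \<longrightarrow>
       herm (BB q (y q) a) (BB q (y q) b) = cor r * cip a b"
    and e0: "q \<in> S ==> e0 - (cip e0 (y q) / cip (y q) (y q)) *s y q ~= 0"
begin

text \<open>Where y vanishes, division by zero gives zero and \<open>pr q\<close> is the identity,
  so the linear case is treated together with the other one.\<close>

definition "pr q a = a - (cip a (y q) / cip (y q) (y q)) *s y q"
definition "ee q = pr q e0"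
definition "ka q a = Ehat q (pr q a)"
definition "yh q = Ehat q (y q)"
text \<open>\<open>tt\<close> is the coefficient of \<open>phi2 NN (ka e0)\<close> along
  \<open>phi1 (ka e0)\<close>, and \<open>ss\<close> is minus the one along \<open>BB y ee\<close>;
  the signs differ because \<open>phi2\<close> with \<open>heis\<close> is minus
  \<open>phi1\<close>. With these corrections \<open>N'\<close> is annihilated by
  \<open>phi2\<close> against the horizontal part of K, see \<open>phi2_N'\<close>.\<close>

definition "tt q = herm (phi2 q NN (ka q e0)) (phi1 q (ka q e0)) / herm (phi1 q (ka q e0)) (phi1 q (ka q e0))"
definition "ss q = - herm (phi2 q NN (ka q e0)) (BB q (y q) (ee q)) / herm (BB q (y q) (ee q)) (BB q (y q) (ee q))"
definition "N' q = NN + ss q *s yh q + tt q *s heis q"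

lemma pr_perp: "cip (pr q a) (y q) = 0"
  by (cases "y q = 0") (simp_all add: pr_def cip_simps cip_self_eq_0)

lemma pr_id: "cip a (y q) = 0 ==> pr q a = a" by (simp add: pr_def)

lemma pr_clin: "clin (pr q)"
  by (simp add: clin_def pr_def cip_simps vec_eq_iff algebra_simps add_divide_distrib)

lemma ee_nz: "q \<in> S ==> ee q ~= 0" unfolding ee_def pr_def by (rule e0)
lemma ee_perp: "cip (ee q) (y q) = 0" unfolding ee_def by (rule pr_perp)

text \<open>The two summands are orthogonal, and each has a positive norm unless its argument
  vanishes.\<close>

lemma B_ind:
  assumes p: "p \<in> S" and a: "cip a (y p) = 0" "cip b (y p) = 0"
    and e: "phi1 p (EE p a) + BB p (y p) b = 0"
  shows "a = 0" "y p = 0 \<or> b = 0"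
proof -
  have "herm (phi1 p (EE p a) + BB p (y p) b) (phi1 p (EE p a)) = 0" unfolding e by (simp add: herm_simps)
  then show a0: "a = 0" by (simp add: herm_simps phi1_E_E BB_perp p Lam_nz cip_self_eq_0)
  show "y p = 0 \<or> b = 0"
  proof (rule ccontr)
    assume n: "\<not> (y p = 0 \<or> b = 0)"
    obtain g where r: "g > 0" "!!a b. cip a (y p) = 0 \<longrightarrow> cip b (y p) = 0 \<longrightarrow>
       herm (BB p (y p) a) (BB p (y p) b) = cor g * cip a b" using gram[OF p] n by blast
    have "BB p (y p) b = 0" using e a0 by (simp add: EE_simps phi_simps p)
    then have "cor g * cip b b = 0" using r(2) a(2) by (metis herm_simps(5))
    then show False using r n by (simp add: cip_self_eq_0)
  qed
qed

lemma B_ee_nz: "p \<in> S ==> y p ~= 0 ==> herm (BB p (y p) (ee p)) (BB p (y p) (ee p)) ~= 0"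
  using gram[of p] ee_perp[of p] ee_nz[of p] by (auto simp: cip_self_eq_0)

lemma phi1_ee_nz: "p \<in> S ==> herm (phi1 p (ka p e0)) (phi1 p (ka p e0)) ~= 0"
  unfolding ka_def ee_def[symmetric] by (simp add: phi1_Ehat phi1_E_E Lam_nz ee_nz cip_self_eq_0)

lemma Ck_pr: "Ck_open 1 S (%q. pr q a)"
proof (cases "\<forall>q\<in>S. y q = 0")
  case True
  then show ?thesis by (intro Ck_open_cong[OF S _ Ck_open_const[of 1 S a]]) (simp add: pr_def)
next
  case False
  then show ?thesis using ycase unfolding pr_def by (intro Ck_intros yC1) (auto simp: cip_self_eq_0)
qed

lemma Ck_ka: "Ck_open 1 S (%q. ka q a)" unfolding ka_def by (intro Ck_Ehat Ck_pr)
lemma Ck_yh: "Ck_open 1 S yh" unfolding yh_def[abs_def] by (intro Ck_Ehat yC1)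
lemma Ck_ee: "Ck_open 1 S ee" unfolding ee_def[abs_def] by (rule Ck_pr)
lemma Ck_tt: "Ck_open 1 S tt" unfolding tt_def[abs_def] by (intro Ck_intros Ck_ka phi1_ee_nz)
lemma Ck_ss: "Ck_open 1 S ss"
proof (cases "\<forall>q\<in>S. y q = 0")
  case True
  then show ?thesis by (intro Ck_open_cong[OF S _ Ck_open_const[of 1 S 0]]) (simp add: ss_def BB_simps herm_simps)
next
  case False
  then have "q \<in> S ==> y q ~= 0" for q using ycase by blast
  then show ?thesis unfolding ss_def[abs_def] by (intro Ck_intros Ck_BB Ck_ka Ck_ee yC1) (rule B_ee_nz)
qed
lemma Ck_N': "Ck_open 1 S N'" unfolding N'_def[abs_def] by (intro Ck_intros Ck_ss Ck_tt Ck_yh)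

lemma C1_diff: "Ck_open 1 S f ==> p \<in> S ==> f differentiable (at p)" by simp

lemma dv_Ehat:
  assumes p: "p \<in> S" and z: "z differentiable (at p)" and E: "(%q. Ehat q (z q)) differentiable (at p)"
  shows "dv (%q. Ehat q (z q)) p d = dv (%q. EE q (z q)) p d + (tau p (z p) / Lam p) *s dht p d
     + ds (%q. tau q (z q) / Lam q) p d *s heis p"
proof -
  have dE: "(%q. EE q (z q)) differentiable (at p)"
    by (rule differentiableI[OF clin_family_deriv[of UNIV, OF _ _ EE_clin EE_deriv FD_works[OF z]]]) auto
  then have dt: "(%q. tau q (z q) / Lam q) differentiable (at p)"
    using herm_diff[OF E differentiable_const[of NN]] by (simp add: Ehat_def herm_simps)
  show ?thesis unfolding Ehat_def
    by (simp add: dv_add dv_scale dE dt heis_diff vec_scale_diff dv_heis algebra_simps)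
qed

text \<open>Coordinates dual to \<open>yh\<close> and \<open>heis\<close> in
  \<open>coord_expand\<close>, the remaining part lying in K. The kernel of \<open>ll q\<close> is
  the hyperplane K + \<open>heis\<close>, and \<open>sig q\<close> is the coordinate along
  \<open>heis\<close>.\<close>

definition "ll q x = cip (cE q x) (y q) / cip (y q) (y q) - cN q x * ss q"
definition "sig q x = x $ First - tau q (cE q x) / Lam q - cN q x * tt q"

lemma ss_0: "p \<in> S ==> y p = 0 ==> ss p = 0" by (simp add: ss_def BB_simps herm_simps)
lemma yh_0: "p \<in> S ==> y p = 0 ==> yh p = 0" by (simp add: yh_def clin_zero[OF Ehat_clin])
lemma ll_0: "p \<in> S ==> y p = 0 ==> ll p x = 0" by (simp add: ll_def ss_0 cip_simps)

lemma cE_Ehat [simp]: "cE p (Ehat p a) = a"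
  by (simp add: Ehat_def clin_add[OF cE_clin] clin_scale[OF cE_clin])
lemma cN_Ehat [simp]: "cN p (Ehat p a) = 0" "cN p (heis p) = 0" "cN p NN = 1"
  by (simp_all add: Ehat_def cN_def herm_simps)
lemma First_Ehat [simp]: "Ehat p a $ First = tau p a / Lam p" by (simp add: Ehat_def)

lemma ll_clin: "clinf (ll p)"
  by (simp add: clinf_def ll_def clin_add[OF cE_clin] clin_scale[OF cE_clin] clinf_add[OF cN_clinf]
    clinf_scale[OF cN_clinf] cip_simps add_divide_distrib algebra_simps)

lemma sig_clin: "p \<in> S ==> clinf (sig p)"
  by (simp add: clinf_def sig_def clin_add[OF cE_clin] clin_scale[OF cE_clin] clinf_add[OF cN_clinf]
    clinf_scale[OF cN_clinf] tau_simps add_divide_distrib algebra_simps)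

lemmas ll_simps = clinf_add[OF ll_clin] clinf_scale[OF ll_clin] clinf_zero[OF ll_clin] clinf_diff[OF ll_clin] clinf_minus[OF ll_clin]
lemmas sig_simps = clinf_add[OF sig_clin] clinf_scale[OF sig_clin] clinf_zero[OF sig_clin] clinf_diff[OF sig_clin] clinf_minus[OF sig_clin]

lemma coord_Ehat: "p \<in> S ==> ll p (Ehat p a) = cip a (y p) / cip (y p) (y p)" "p \<in> S ==> sig p (Ehat p a) = 0"
  by (simp_all add: ll_def sig_def)
lemma coord_heis: "p \<in> S ==> ll p (heis p) = 0" "p \<in> S ==> sig p (heis p) = 1"
  by (simp_all add: ll_def sig_def tau_simps cip_simps)
lemma coord_yh: "p \<in> S ==> y p ~= 0 ==> ll p (yh p) = 1" "p \<in> S ==> sig p (yh p) = 0"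
  by (simp_all add: yh_def coord_Ehat cip_self_eq_0)
lemma cN_N': "cN p (N' p) = 1" by (simp add: N'_def yh_def clinf_add[OF cN_clinf] clinf_scale[OF cN_clinf])
lemma coord_N': "p \<in> S ==> ll p (N' p) = 0" "p \<in> S ==> sig p (N' p) = 0"
proof -
  assume p: "p \<in> S"
  have n: "ll p NN = - ss p" "sig p NN = - tt p" using p by (simp_all add: ll_def sig_def tau_simps cip_simps)
  show "ll p (N' p) = 0"
    using n p ss_0[OF p] by (cases "y p = 0") (simp_all add: N'_def ll_simps coord_yh coord_heis ll_0)
  show "sig p (N' p) = 0" using n p by (simp add: N'_def sig_simps coord_yh coord_heis)
qed

definition "KK p x = Ehat p (pr p (cE p x)) + cN p x *s N' p"

lemma coord_expand:
  assumes p: "p \<in> S" shows "x = KK p x + ll p x *s yh p + sig p x *s heis p"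
proof -
  have EE: "EE p c = Ehat p c - (tau p c / Lam p) *s heis p" for c by (simp add: Ehat_def)
  have NN: "NN = N' p - ss p *s yh p - tt p *s heis p" by (simp add: N'_def)
  define c where "c = cE p x"
  have c: "Ehat p c = Ehat p (pr p c) + (cip c (y p) / cip (y p) (y p)) *s yh p"
    unfolding pr_def yh_def by (simp add: clin_diff[OF Ehat_clin[OF p]] clin_scale[OF Ehat_clin[OF p]])
  have "x = x $ First *s heis p + EE p c + cN p x *s NN" unfolding c_def by (rule frame_expand)
  also have "\<dots> = KK p x + ll p x *s yh p + sig p x *s heis p"
    unfolding EE c NN KK_def ll_def sig_def c_def[symmetric]
    by (simp add: vec_eq_iff algebra_simps)
  finally show ?thesis .
qed

definition "inK p x \<longleftrightarrow> ll p x = 0 \<and> sig p x = 0"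

lemma inK_KK: "p \<in> S ==> inK p x ==> KK p x = x"
  using coord_expand[of p x] by (simp add: inK_def)

lemma inK_intros: "p \<in> S ==> inK p x ==> inK p z ==> inK p (x + z)" "p \<in> S ==> inK p x ==> inK p (c *s x)"
  "p \<in> S ==> inK p x ==> inK p z ==> inK p (x - z)"
  "p \<in> S ==> inK p 0" "p \<in> S ==> inK p (N' p)" "p \<in> S ==> cip a (y p) = 0 ==> inK p (Ehat p a)" "p \<in> S ==> inK p (ka p a)"
  "p \<in> S ==> inK p (KK p v)"
  by (simp_all add: inK_def ll_simps sig_simps coord_N' coord_Ehat ka_def pr_perp KK_def)

lemma phi_coord:
  assumes p: "p \<in> S"
  shows "phi2 p v x = phi2 p v (KK p x) + ll p x *s phi2 p v (yh p) - sig p x *s phi1 p v"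
    "phi2 p x v = phi2 p (KK p x) v + ll p x *s phi2 p (yh p) v - sig p x *s phi1 p v"
    "phi1 p x = phi1 p (KK p x) + ll p x *s phi1 p (yh p)"
  by (subst coord_expand[OF p, of x], simp add: phi_simps[OF p])+

subsection \<open>\<open>phi2\<close> vanishes on \<open>K\<close>\<close>

lemma ka_anti:
  assumes p: "p \<in> S"
  obtains b g where "!!a. dv (%q. ka q a) p (anti p w) =
     Ehat p (pr p (dv (%q. pr q a) p (anti p w))) - cip (pr p a) w *s NN + b a *s yh p + g a *s heis p"
proof -
  define z where "z a = dv (%q. pr q a) p (anti p w)" for a
  have 1: "dv (%q. ka q a) p (anti p w) = EE p (z a) - cip (pr p a) w *s NN + ds (%q. tau q (pr q a) / Lam q) p (anti p w) *s heis p" for a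
    unfolding ka_def z_def
    by (subst dv_Ehat[OF p]) (use C1_diff[OF Ck_ka[of a] p] C1_diff[OF Ck_pr[of a] p] in \<open>simp_all add: dv_EE_anti ka_def\<close>)
  have 2: "EE p (z a) = Ehat p (pr p (z a)) + (cip (z a) (y p) / cip (y p) (y p)) *s yh p - (tau p (z a) / Lam p) *s heis p" for a
  proof -
    have "EE p (z a) = Ehat p (z a) - (tau p (z a) / Lam p) *s heis p" by (simp add: Ehat_def)
    then show ?thesis
      unfolding pr_def yh_def by (simp add: clin_diff[OF Ehat_clin[OF p]] clin_scale[OF Ehat_clin[OF p]])
  qed
  show ?thesis
    by (rule that[of "%a. cip (z a) (y p) / cip (y p) (y p)" "%a. ds (%q. tau q (pr q a) / Lam q) p (anti p w) - tau p (z a) / Lam p"])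
      (simp add: 1 2 z_def[symmetric] vec_eq_iff algebra_simps)
qed

lemma phi2_ka_zero: "q \<in> S ==> phi2 q (ka q a) (ka q b) = 0"
  unfolding ka_def using van[of q "pr q a" "pr q b"] by (simp add: pr_perp BB_def)

lemma phi2_ka_anti:
  assumes p: "p \<in> S"
  shows "phi2 p (dv (%q. ka q a) p (anti p w)) (ka p b) + phi2 p (ka p a) (dv (%q. ka q b) p (anti p w)) = 0"
proof -
  have "dv (%q. phi2 q (ka q a) (ka q b)) p (anti p w) = 0"
    by (rule dv_zero_on[OF S p]) (rule phi2_ka_zero)
  then show ?thesis by (simp add: dv_phi2[OF p] C1_diff[OF Ck_ka p] phi_simps[OF p])
qed

text \<open>The relation \<open>phi2 (ka a) (ka b) = 0\<close> is differentiated along the (0,1)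
  vector of a unit vector e in the hyperplane; the Levi form brings in \<open>NN\<close>. The pair
  (e, e) gives the formula for e, and its coefficients then serve for every a.\<close>

lemma phi2_NN_aux:
  assumes p: "p \<in> S"
  obtains r t where "!!a. cip a (y p) = 0 ==> phi2 p NN (Ehat p a) = r *s BB p (y p) a - t *s phi1 p (EE p a)"
proof -
  define e where "e = cor (1 / norm (ee p)) *s ee p"
  have ee: "cip e e = 1" unfolding e_def using ee_nz[OF p] by (simp add: cip_self norm_vec_scale norm_divide)
  have ey: "cip e (y p) = 0" unfolding e_def using ee_perp by (simp add: cip_simps)
  obtain r t where D: "!!a. dv (%q. ka q a) p (anti p e) =
     Ehat p (pr p (dv (%q. pr q a) p (anti p e))) - cip (pr p a) e *s NN + r a *s yh p + t a *s heis p"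
    using ka_anti[OF p] by blast
  define P where "P a = phi2 p NN (Ehat p a)" for a
  have P: "P (a + b) = P a + P b" "P (c *s a) = c *s P a" for a b c
    unfolding P_def by (simp_all add: clin_add[OF Ehat_clin[OF p]] clin_scale[OF Ehat_clin[OF p]] phi_simps[OF p])
  have Q: "phi2 p (dv (%q. ka q a) p (anti p e)) (ka p b) = - cip a e *s P b + r a *s BB p (y p) b - t a *s phi1 p (EE p b)"
    if ab: "cip a (y p) = 0" "cip b (y p) = 0" for a b
  proof -
    have v: "phi2 p (Ehat p (pr p (dv (%q. pr q a) p (anti p e)))) (Ehat p b) = 0"
      using van[OF p pr_perp ab(2)] unfolding BB_def .
    show ?thesis unfolding D unfolding ka_def pr_id[OF ab(1)] pr_id[OF ab(2)]
      by (simp add: phi_simps[OF p] v P_def BB_def yh_def phi1_Ehat[OF p] vec.scale_minus_left)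
  qed
  have main: "- cip a e *s P b + r a *s BB p (y p) b - t a *s phi1 p (EE p b)
      + (- cip b e *s P a + r b *s BB p (y p) a - t b *s phi1 p (EE p a)) = 0"
    if ab: "cip a (y p) = 0" "cip b (y p) = 0" for a b
    using phi2_ka_anti[OF p, of a e b] unfolding phi2_sym[OF p, of "ka p a"] Q[OF ab] Q[OF ab(2,1)] .
  have e1: "P e = r e *s BB p (y p) e - t e *s phi1 p (EE p e)"
  proof -
    have "2 *s P e = 2 *s (r e *s BB p (y p) e - t e *s phi1 p (EE p e))"
      using main[OF ey ey] unfolding ee by (simp add: vec_eq_iff algebra_simps)
    then show ?thesis by (simp only: vec.scale_cancel_left) simp
  qed
  have e2: "P a = r e *s BB p (y p) a - t e *s phi1 p (EE p a)" if ay: "cip a (y p) = 0" and ae: "cip a e = 0" for a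
  proof (cases "a = 0")
    case True
    then show ?thesis by (simp add: P_def clin_zero[OF Ehat_clin[OF p]] phi_simps[OF p] BB_simps[OF p] EE_simps)
  next
    case False
    \<comment> \<open>For a orthogonal to e the pair (a, a) contains no \<open>P\<close> term, so
      \<open>B_ind\<close> removes the coefficients belonging to a; the pair (a, e) then yields
      \<open>P a\<close>.\<close>
    have "phi1 p (EE p (- t a *s a)) + BB p (y p) (r a *s a) = 0"
      using main[OF ay ay] unfolding ae by (simp add: EE_simps clin_minus[OF EE_clin] phi_simps[OF p] BB_simps[OF p] vec_eq_iff algebra_simps)
    from B_ind[OF p _ _ this] have "- t a *s a = 0" "y p = 0 \<or> r a *s a = 0" using ay by (simp_all add: cip_simps)
    then have g: "t a = 0" "r a *s BB p (y p) e = 0" using False by (auto simp: BB_simps[OF p])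
    show ?thesis using main[OF ay ey] unfolding ae ee g by (simp add: vec_eq_iff algebra_simps)
  qed
  show ?thesis
  proof (rule that[of "r e" "t e"])
    fix a assume ay: "cip a (y p) = 0"
    define b where "b = a - cip a e *s e"
    have b: "cip b (y p) = 0" "cip b e = 0" unfolding b_def using ay ey ee by (simp_all add: cip_simps)
    have a: "a = b + cip a e *s e" unfolding b_def by simp
    have "P a = P b + cip a e *s P e" by (subst a) (simp only: P)
    also have "\<dots> = r e *s BB p (y p) (b + cip a e *s e) - t e *s phi1 p (EE p (b + cip a e *s e))"
      unfolding e2[OF b] e1 by (simp add: EE_simps phi_simps[OF p] BB_simps[OF p] vec_eq_iff algebra_simps)
    finally show "phi2 p NN (Ehat p a) = r e *s BB p (y p) a - t e *s phi1 p (EE p a)"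
      unfolding P_def a[symmetric] .
  qed
qed

lemma phi2_N':
  assumes p: "p \<in> S" and a: "cip a (y p) = 0"
  shows "phi2 p (N' p) (Ehat p a) = 0" "phi2 p (Ehat p a) (N' p) = 0"
proof -
  obtain b g where bg: "!!a. cip a (y p) = 0 ==> phi2 p NN (Ehat p a) = b *s BB p (y p) a - g *s phi1 p (EE p a)"
    using phi2_NN_aux[OF p] by blast
  have k: "ka p e0 = Ehat p (ee p)" by (simp add: ka_def ee_def)
  have pn: "cip (ee p) (ee p) * Lam p ~= 0" using ee_nz[OF p] Lam_nz[OF p] by (simp add: cip_self_eq_0)
  have "tt p = - g" unfolding tt_def k bg[OF ee_perp] using pn
    by (simp add: phi1_Ehat phi1_E_E BB_perp herm_simps p)
  moreover have "ss p *s BB p (y p) a = - b *s BB p (y p) a"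
  proof (cases "y p = 0")
    case False
    then show ?thesis unfolding ss_def k bg[OF ee_perp] using B_ee_nz[OF p False]
      by (simp add: phi1_E_E BB_perp herm_simps p)
  qed (simp add: BB_simps[OF p])
  ultimately show 1: "phi2 p (N' p) (Ehat p a) = 0"
    unfolding N'_def using bg[OF a] by (simp add: phi_simps[OF p] phi1_Ehat[OF p] yh_def BB_def[symmetric] vec.scale_minus_left)
  then show "phi2 p (Ehat p a) (N' p) = 0" by (simp add: phi2_sym[OF p, of _ "N' p"])
qed

lemma cN_ka_anti:
  assumes p: "p \<in> S" shows "cN p (dv (%q. ka q a) p (anti p w)) = - cip (pr p a) w"
proof -
  obtain b g where D: "!!a. dv (%q. ka q a) p (anti p w) =
     Ehat p (pr p (dv (%q. pr q a) p (anti p w))) - cip (pr p a) w *s NN + b a *s yh p + g a *s heis p"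
    using ka_anti[OF p] by blast
  show ?thesis unfolding D yh_def
    by (simp add: clinf_add[OF cN_clinf] clinf_diff[OF cN_clinf] clinf_scale[OF cN_clinf])
qed

lemma phi2_KK_ka: "p \<in> S ==> cip b (y p) = 0 ==> phi2 p (KK p x) (Ehat p b) = 0"
  unfolding KK_def using van[of p "pr p (cE p x)" b] by (simp add: phi_simps phi2_N' pr_perp BB_def)

text \<open>Differentiating \<open>phi2 (ka a) (ka a) = 0\<close> leaves only the \<open>yh\<close>
  and \<open>heis\<close> components of the derivative, as factors of vectors that are independent
  by \<open>B_ind\<close>.\<close>

lemma inK_ka_anti:
  assumes p: "p \<in> S" shows "inK p (dv (%q. ka q a) p (anti p w))"
proof -
  have *: "inK p (dv (%q. ka q a) p (anti p w))" if nz: "pr p a ~= 0" for a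
  proof -
    define x where "x = dv (%q. ka q a) p (anti p w)"
    have "phi2 p x (ka p a) = 0"
      using phi2_ka_anti[OF p, of a w a] unfolding phi2_sym[OF p, of "ka p a"] x_def by (simp add: vec_eq_iff)
    then have "ll p x *s phi2 p (yh p) (ka p a) - sig p x *s phi1 p (ka p a) = 0"
      using phi_coord(2)[OF p, of x "ka p a"] phi2_KK_ka[OF p pr_perp] unfolding ka_def by simp
    then have "phi1 p (EE p (- sig p x *s pr p a)) + BB p (y p) (ll p x *s pr p a) = 0"
      unfolding ka_def yh_def by (simp add: phi1_Ehat p BB_def clin_scale[OF Ehat_clin[OF p]] EE_simps clin_minus[OF EE_clin] phi_simps vec_eq_iff)
    from B_ind[OF p _ _ this] have "- sig p x *s pr p a = 0" "y p = 0 \<or> ll p x *s pr p a = 0"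
      by (simp_all add: cip_simps pr_perp)
    then show ?thesis using nz ll_0[OF p] unfolding inK_def x_def by auto
  qed
  show ?thesis
  proof (cases "pr p a = 0")
    case True
    \<comment> \<open>The argument needs a section with non-zero value at p; it is applied to the
      sections of a + c and of c.\<close>
    define c where "c = ee p"
    have c: "pr p c = c" "c ~= 0" unfolding c_def using ee_perp ee_nz[OF p] by (simp_all add: pr_id)
    have "dv (%q. ka q a) p (anti p w) = dv (%q. ka q (a + c) - ka q c) p (anti p w)"
    proof (rule dv_cong_on[OF S p])
      show "ka q (a + c) - ka q c = ka q a" if "q \<in> S" for q
        unfolding ka_def by (simp add: clin_add[OF pr_clin] clin_add[OF Ehat_clin[OF that]])
    qed (intro differentiable_diff C1_diff[OF Ck_ka p])
    also have "\<dots> = dv (%q. ka q (a + c)) p (anti p w) - dv (%q. ka q c) p (anti p w)"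
      by (intro dv_diff C1_diff[OF Ck_ka p])
    finally show ?thesis using *[of "a + c"] *[of c] c True
      by (simp add: inK_intros p clin_add[OF pr_clin])
  qed (rule *)
qed

end

section \<open>The transverse section of K\<close>

context cr_split begin

lemma phi1_yh: "p \<in> S ==> phi1 p (yh p) = phi1 p (EE p (y p))" by (simp add: yh_def phi1_Ehat)
lemma phi1_N': "p \<in> S ==> phi1 p (N' p) = phi1 p NN + ss p *s phi1 p (EE p (y p))"
  by (simp add: N'_def phi_simps phi1_yh)

lemma herm_phi1_N'_u: "p \<in> S ==> herm (phi1 p (N' p)) (u p) = Lam p"
  by (simp add: phi1_N' herm_simps phi1_E_u Lam_def)

lemma phi2_NN_EE_u: assumes p: "p \<in> S" shows "herm (phi2 p NN (EE p w)) (u p) = tau p w"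
proof -
  have "ds Lam p (holo p (EE p w)) = herm (phi2 p NN (EE p w)) (u p)"
    unfolding Lam_def[abs_def]
    by (simp add: ds_herm diffs p dv_u[OF p] dv_phi1[OF p] cbar_holo phi_simps[OF p] herm_simps)
  then show ?thesis using ds_Lam[OF p] by simp
qed

lemma phi2_N'_yh_u: assumes p: "p \<in> S" shows "herm (phi2 p (N' p) (yh p)) (u p) = 0"
proof -
  have "phi2 p (N' p) (yh p) = phi2 p NN (EE p (y p)) - (tau p (y p) / Lam p) *s phi1 p NN + ss p *s BB p (y p) (y p) - tt p *s phi1 p (EE p (y p))"
    unfolding N'_def BB_def yh_def by (simp add: phi_simps[OF p] phi1_Ehat[OF p]) (simp add: Ehat_def phi_simps[OF p])
  then show ?thesis
    by (simp add: herm_simps phi2_NN_EE_u BB_perp phi1_E_u p Lam_def[symmetric] Lam_nz)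
qed

lemma cip_ee_nz: "p \<in> S ==> cip (ee p) (ee p) ~= 0" by (simp add: ee_nz cip_self_eq_0)

lemma ka_e0: "ka q e0 = Ehat q (ee q)" by (simp add: ka_def ee_def)

lemma phi2_ka_yh: "p \<in> S ==> phi2 p (ka p a) (yh p) = BB p (y p) (pr p a)" "p \<in> S ==> phi2 p (yh p) (ka p a) = BB p (y p) (pr p a)"
  by (simp_all add: ka_def yh_def BB_def phi2_sym)

lemma phi2_KK_right: "p \<in> S ==> cip b (y p) = 0 ==> phi2 p (Ehat p b) (KK p x) = 0"
  using phi2_KK_ka[of p b x] by (simp add: phi2_sym)

lemma phi2_ka_any:
  assumes p: "p \<in> S"
  shows "phi2 p (ka p a) x = ll p x *s BB p (y p) (pr p a) - sig p x *s phi1 p (EE p (pr p a))"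
proof -
  have "phi2 p (ka p a) (KK p x) = 0" unfolding ka_def by (rule phi2_KK_right[OF p pr_perp])
  moreover have "phi1 p (ka p a) = phi1 p (EE p (pr p a))" unfolding ka_def by (rule phi1_Ehat[OF p])
  ultimately show ?thesis by (subst phi_coord(1)[OF p]) (simp add: phi2_ka_yh[OF p])
qed

text \<open>The orthogonality of \<open>BB y ee\<close> and \<open>phi1 (EE y)\<close> is
  differentiated along the (0,1) vector of ee. The Levi term gives this pairing times the squared
  norm of ee, and the other side is the norm of \<open>BB y ee\<close>.\<close>

lemma mu_nz:
  assumes p: "p \<in> S" and y: "y p ~= 0"
  shows "herm (phi2 p (N' p) (yh p)) (phi1 p (EE p (y p))) ~= 0"
proof -
  define e where "e = ee p"
  define K where "K = dv (%q. ka q e0) p (anti p e)"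
  have ey: "cip e (y p) = 0" unfolding e_def by (rule ee_perp)
  have dEE: "(%q. EE q (y q)) differentiable (at p)"
    by (rule C1_diff[OF Ck_open_EE[OF S yC1] p])
  have "herm (dv (%q. phi2 q (ka q e0) (yh q)) p (anti p e)) (phi1 p (EE p (y p)))
      + herm (phi2 p (ka p e0) (yh p)) (dv (%q. phi1 q (EE q (y q))) p (cbar (anti p e))) = 0"
    by (rule ds_herm_zero[OF p])
      (simp_all add: phi2_ka_yh BB_perp diffs C1_diff[OF Ck_ka p] C1_diff[OF Ck_yh p] p dEE)
  then have 1: "herm (phi2 p K (yh p) + phi2 p (ka p e0) (dv yh p (anti p e))) (phi1 p (EE p (y p)))
      + herm (BB p (y p) e) (phi2 p (EE p (y p)) (EE p e) + phi1 p (EE p (dv y p (holo p (EE p e))))) = 0"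
    by (simp add: dv_phi2[OF p] dv_phi1[OF p] C1_diff[OF Ck_ka p] C1_diff[OF Ck_yh p] dEE C1_diff[OF yC1 p] cbar_anti
        dv_EE_holo phi_simps[OF p] K_def phi2_ka_yh p ee_def[symmetric] e_def)
  have cN: "cN p K = - cip e e" unfolding K_def cN_ka_anti[OF p] e_def ee_def ..
  have Kk: "K = KK p K" unfolding K_def by (rule inK_KK[OF p inK_ka_anti[OF p], symmetric])
  have 2: "phi2 p K (yh p) = BB p (y p) (pr p (cE p K)) - cip e e *s phi2 p (N' p) (yh p)"
    by (subst Kk) (simp add: KK_def cN phi_simps[OF p] vec.scale_minus_left yh_def BB_def phi2_sym[OF p, of _ "Ehat p (y p)"])
  have ye: "cip (y p) e = 0" using ey cip_cnj[of e "y p"] by simp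
  have 3: "herm (BB p (y p) e) (phi2 p (EE p (y p)) (EE p e)) = herm (BB p (y p) e) (BB p (y p) e)"
    using arg_cong[OF BB_expand[OF p, of "y p" e], of "herm (BB p (y p) e)"] by (simp add: herm_simps BB_perp p)
  have "cip e e * herm (phi2 p (N' p) (yh p)) (phi1 p (EE p (y p))) = herm (BB p (y p) e) (BB p (y p) e)"
    using 1 unfolding 2 phi2_ka_any[OF p] ee_def[symmetric] e_def[symmetric]
    by (simp add: herm_simps BB_perp p phi1_E_E ey 3)
  then show ?thesis using B_ee_nz[OF p y] unfolding e_def by auto
qed

lemma N'_anti:
  assumes p: "p \<in> S"
  shows "cip (pr p a) w *s phi2 p (N' p) (N' p) = ll p (dv N' p (anti p w)) *s BB p (y p) (pr p a)
     - sig p (dv N' p (anti p w)) *s phi1 p (EE p (pr p a))"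
proof -
  define K where "K = dv (%q. ka q a) p (anti p w)"
  have "dv (%q. phi2 q (ka q a) (N' q)) p (anti p w) = 0"
    by (rule dv_zero_on[OF S p]) (simp add: ka_def phi2_N'(2) pr_perp)
  then have 1: "phi2 p K (N' p) + phi2 p (ka p a) (dv N' p (anti p w)) = 0"
    by (simp add: dv_phi2[OF p] C1_diff[OF Ck_ka p] C1_diff[OF Ck_N' p] phi_simps[OF p] K_def)
  have Kk: "K = KK p K" unfolding K_def by (rule inK_KK[OF p inK_ka_anti[OF p], symmetric])
  have "phi2 p K (N' p) = - cip (pr p a) w *s phi2 p (N' p) (N' p)"
    by (subst Kk) (simp add: KK_def phi_simps[OF p] phi2_N'(2)[OF p pr_perp] cN_ka_anti[OF p] K_def)
  then show ?thesis using 1 unfolding phi2_ka_any[OF p] by (simp add: vec_eq_iff algebra_simps)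
qed

definition "beta q = herm (phi2 q (N' q) (N' q)) (phi2 q (yh q) (ka q e0)) / herm (BB q (y q) (ee q)) (BB q (y q) (ee q))"
definition "gamma q = herm (phi2 q (N' q) (N' q)) (phi1 q (ka q e0)) / herm (phi1 q (ka q e0)) (phi1 q (ka q e0))"

lemma Ck_gamma: "Ck_open 1 S gamma" unfolding gamma_def[abs_def] by (intro Ck_intros Ck_ka Ck_N' phi1_ee_nz)
lemma Ck_beta: "Ck_open 1 S beta"
proof (cases "\<forall>q\<in>S. y q = 0")
  case True
  then show ?thesis by (intro Ck_open_cong[OF S _ Ck_open_const[of 1 S 0]]) (simp add: beta_def BB_simps herm_simps)
next
  case False
  then have "q \<in> S ==> y q ~= 0" for q using ycase by blast
  then show ?thesis unfolding beta_def[abs_def] by (intro Ck_intros Ck_BB Ck_ka Ck_N' Ck_yh Ck_ee yC1) (rule B_ee_nz)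
qed

text \<open>\<open>N'_anti\<close> for e0 and ee puts \<open>phi2 N' N'\<close> into the span of two
  vectors and identifies its coefficients with those by which the derivative of \<open>N'\<close>
  leaves K.\<close>

lemma R_expand:
  assumes p: "p \<in> S"
  shows "phi2 p (N' p) (N' p) = beta p *s phi2 p (yh p) (ka p e0) + gamma p *s phi1 p (ka p e0)"
    "sig p (dv N' p (anti p (ee p))) = - cip (ee p) (ee p) * gamma p"
    "ll p (dv N' p (anti p (ee p))) *s yh p = (cip (ee p) (ee p) * beta p) *s yh p"
proof -
  define e where "e = ee p"
  define x where "x = dv N' p (anti p e)"
  have ey: "cip e (y p) = 0" unfolding e_def by (rule ee_perp)
  have ee: "cip e e ~= 0" unfolding e_def by (rule cip_ee_nz[OF p])
  have pe: "pr p e0 = e" unfolding e_def ee_def ..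
  have R: "cip e e *s phi2 p (N' p) (N' p) = ll p x *s BB p (y p) e - sig p x *s phi1 p (EE p e)"
    using N'_anti[OF p, of e0 e] unfolding pe x_def .
  have r: "phi2 p (N' p) (N' p) = (ll p x / cip e e) *s BB p (y p) e - (sig p x / cip e e) *s phi1 p (EE p e)"
  proof -
    have "phi2 p (N' p) (N' p) = (1 / cip e e) *s (cip e e *s phi2 p (N' p) (N' p))" using ee by simp
    also have "\<dots> = (ll p x / cip e e) *s BB p (y p) e - (sig p x / cip e e) *s phi1 p (EE p e)"
      unfolding R by (simp add: vec.scale_right_diff_distrib)
    finally show ?thesis .
  qed
  have k: "phi1 p (ka p e0) = phi1 p (EE p e)" "phi2 p (yh p) (ka p e0) = BB p (y p) e"
    unfolding ka_e0 e_def by (simp_all add: phi1_Ehat p yh_def BB_def)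
  have g: "gamma p = - (sig p x / cip e e)"
    unfolding gamma_def k r using ee by (simp add: herm_simps phi1_E_E BB_perp p Lam_nz)
  then show "sig p (dv N' p (anti p (ee p))) = - cip (ee p) (ee p) * gamma p"
    unfolding x_def[symmetric] e_def[symmetric] using ee by simp
  have b: "y p = 0 \<or> beta p = ll p x / cip e e"
    unfolding beta_def k r e_def[symmetric] using B_ee_nz[OF p] unfolding e_def[symmetric]
    by (auto simp: herm_simps BB_perp p)
  then show "ll p (dv N' p (anti p (ee p))) *s yh p = (cip (ee p) (ee p) * beta p) *s yh p"
    unfolding x_def[symmetric] e_def[symmetric] using ee by (auto simp: yh_0 p)
  show "phi2 p (N' p) (N' p) = beta p *s phi2 p (yh p) (ka p e0) + gamma p *s phi1 p (ka p e0)"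
    unfolding k r using b g by (auto simp: BB_simps p vec.scale_minus_left)
qed

text \<open>Differentiating the expansion of \<open>phi2 N' N'\<close> once more in the direction \<open>ee\<close>, and pairing
  with \<open>u\<close> and with \<open>phi1 yh\<close>, kills both coefficients.\<close>

lemma phi2_N'_N':
  assumes p: "p \<in> S" shows "phi2 p (N' p) (N' p) = 0"
proof -
  define e where "e = ee p"
  define x where "x = dv N' p (anti p e)"
  define K where "K = dv (%q. ka q e0) p (anti p e)"
  define c where "c = cip e e"
  define R where "R = phi2 p (N' p) (N' p)"
  define a' where "a' = pr p (cE p K)"
  define b where "b = beta p"
  define g where "g = gamma p"
  have ey: "cip e (y p) = 0" unfolding e_def by (rule ee_perp)
  have cnz: "c ~= 0" unfolding c_def e_def by (rule cip_ee_nz[OF p])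
  have k: "phi1 p (ka p e0) = phi1 p (EE p e)" "phi2 p (yh p) (ka p e0) = BB p (y p) e"
    unfolding ka_e0 e_def by (simp_all add: phi1_Ehat p yh_def BB_def)
  have R: "R = b *s BB p (y p) e + g *s phi1 p (EE p e)" unfolding R_def R_expand(1)[OF p] k b_def g_def ..
  have sx: "sig p x = - c * g" "ll p x *s yh p = (c * b) *s yh p"
    unfolding x_def c_def e_def b_def g_def by (rule R_expand[OF p])+
  have K: "K = Ehat p a' - c *s N' p"
    using inK_KK[OF p inK_ka_anti[OF p, of e0 e], symmetric] cN_ka_anti[OF p, of e0 e]
    unfolding K_def[symmetric] KK_def a'_def[symmetric] ee_def[symmetric] e_def[symmetric] c_def[symmetric]
    by (simp add: vec.scale_minus_left)
  have d: "(%q. phi2 q (yh q) (ka q e0)) differentiable (at p)" "(%q. phi1 q (ka q e0)) differentiable (at p)"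
    by (intro diffs p C1_diff[OF Ck_yh p] C1_diff[OF Ck_ka p])+
  have "dv (%q. phi2 q (N' q) (N' q)) p (anti p e) = dv (%q. beta q *s phi2 q (yh q) (ka q e0) + gamma q *s phi1 q (ka q e0)) p (anti p e)"
    by (rule dv_cong_on[OF S p])
      (simp_all add: R_expand(1) vec_scale_diff d C1_diff[OF Ck_beta p] C1_diff[OF Ck_gamma p])
  then have "phi2 p x (N' p) + phi2 p (N' p) x = ds beta p (anti p e) *s BB p (y p) e
      + b *s (phi2 p (dv yh p (anti p e)) (ka p e0) + phi2 p (yh p) K)
      + (ds gamma p (anti p e) *s phi1 p (EE p e) + g *s phi1 p K)"
    by (simp add: dv_add dv_scale vec_scale_diff d C1_diff[OF Ck_beta p] C1_diff[OF Ck_gamma p] k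
      dv_phi2[OF p] dv_phi1[OF p] C1_diff[OF Ck_ka p] C1_diff[OF Ck_yh p] C1_diff[OF Ck_N' p] phi_simps[OF p]
      x_def K_def b_def g_def)
  moreover have "phi2 p x (N' p) = phi2 p (N' p) x" by (rule phi2_sym[OF p])
  moreover have "phi2 p (N' p) x = cN p x *s R + (c * b) *s phi2 p (N' p) (yh p) + (c * g) *s phi1 p (N' p)"
  proof -
    have "phi2 p (N' p) (KK p x) = cN p x *s R"
      unfolding KK_def R_def by (simp add: phi_simps[OF p] phi2_N'[OF p pr_perp])
    moreover have "ll p x *s phi2 p (N' p) (yh p) = (c * b) *s phi2 p (N' p) (yh p)"
      using arg_cong[OF sx(2), of "phi2 p (N' p)"] by (simp add: phi_simps[OF p])
    ultimately show ?thesis by (subst phi_coord(1)[OF p]) (simp add: sx(1) vec.scale_minus_left)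
  qed
  moreover have "phi2 p (dv yh p (anti p e)) (ka p e0) = ll p (dv yh p (anti p e)) *s BB p (y p) e - sig p (dv yh p (anti p e)) *s phi1 p (EE p e)"
    unfolding phi2_sym[OF p, of _ "ka p e0"] phi2_ka_any[OF p] ee_def[symmetric] e_def ..
  moreover have "phi2 p (yh p) K = BB p (y p) a' - c *s phi2 p (N' p) (yh p)"
    unfolding K by (simp add: phi_simps[OF p] yh_def BB_def phi2_sym[OF p, of "Ehat p (y p)" "N' p"])
  moreover have "phi1 p K = phi1 p (EE p a') - c *s phi1 p (N' p)"
    unfolding K by (simp add: phi_simps[OF p] phi1_Ehat[OF p])
  ultimately have eq: "2 *s (cN p x *s R + (c * b) *s phi2 p (N' p) (yh p) + (c * g) *s phi1 p (N' p))
    = ds beta p (anti p e) *s BB p (y p) e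
      + b *s (ll p (dv yh p (anti p e)) *s BB p (y p) e - sig p (dv yh p (anti p e)) *s phi1 p (EE p e)
        + (BB p (y p) a' - c *s phi2 p (N' p) (yh p)))
      + (ds gamma p (anti p e) *s phi1 p (EE p e) + g *s (phi1 p (EE p a') - c *s phi1 p (N' p)))" (is "?l = ?r")
    by (simp add: vec_eq_iff algebra_simps)
  \<comment> \<open>In this pairing and in the one below, the unknown appears with factor 2 on the
    left and -1 on the right, hence with factor 3 after collecting.\<close>
  have "herm ?l (u p) = herm ?r (u p)" unfolding eq ..
  then have "2 * (c * g * Lam p) = - g * (c * Lam p)"
    unfolding R by (simp add: herm_simps BB_perp phi1_E_u p phi2_N'_yh_u herm_phi1_N'_u)
  then have "3 * (c * g * Lam p) = 0" by (simp add: algebra_simps)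
  then have g: "g = 0" using cnz Lam_nz[OF p] by simp
  have "y p = 0 \<or> b = 0"
  proof (rule disjCI)
    assume y: "\<not> b = 0"
    show "y p = 0"
    proof (rule ccontr)
      assume yn: "y p ~= 0"
      have "herm ?l (phi1 p (EE p (y p))) = herm ?r (phi1 p (EE p (y p)))" unfolding eq ..
      then have "2 * (c * b * herm (phi2 p (N' p) (yh p)) (phi1 p (EE p (y p)))) = - b * (c * herm (phi2 p (N' p) (yh p)) (phi1 p (EE p (y p))))"
        unfolding R g by (simp add: herm_simps BB_perp p phi1_E_E ey)
      then have "3 * (c * b * herm (phi2 p (N' p) (yh p)) (phi1 p (EE p (y p)))) = 0" by (simp add: algebra_simps)
      then show False using cnz y mu_nz[OF p yn] by simp
    qed
  qed
  then show ?thesis using R g unfolding R_def by (auto simp: BB_simps[OF p])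
qed

lemma phi2_inK: assumes p: "p \<in> S" and x: "inK p x" "inK p z" shows "phi2 p x z = 0"
proof -
  have "phi2 p (KK p x) (KK p z) = 0"
    unfolding KK_def using van[OF p pr_perp pr_perp]
    by (simp add: phi_simps[OF p] phi2_N'[OF p pr_perp] phi2_N'_N'[OF p] BB_def[symmetric])
  then show ?thesis by (simp add: inK_KK p x)
qed

lemma inK_N'_anti: assumes p: "p \<in> S" shows "inK p (dv N' p (anti p w))"
proof -
  define x where "x = dv N' p (anti p w)"
  have "ll p x *s BB p (y p) (ee p) - sig p x *s phi1 p (EE p (ee p)) = 0"
    using N'_anti[OF p, of e0 w] unfolding phi2_N'_N'[OF p] x_def ee_def[symmetric] by simp
  then have "phi1 p (EE p (- sig p x *s ee p)) + BB p (y p) (ll p x *s ee p) = 0"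
    by (simp add: EE_simps clin_minus[OF EE_clin] phi_simps[OF p] BB_simps[OF p] vec_eq_iff)
  from B_ind[OF p _ _ this] have "- sig p x *s ee p = 0" "y p = 0 \<or> ll p x *s ee p = 0"
    by (simp_all add: cip_simps ee_perp)
  then show ?thesis using ee_nz[OF p] ll_0[OF p] unfolding inK_def x_def by auto
qed

subsection \<open>Derivatives of sections of \<open>K\<close>\<close>

text \<open>Pairing with u detects the \<open>N'\<close> component of a, and pairing with
  \<open>phi1 (EE y)\<close> that of b, thanks to \<open>mu_nz\<close>; what remains is
  \<open>B_ind\<close>.\<close>

lemma inK_ind:
  assumes p: "p \<in> S" and a: "inK p a" and b: "inK p b" and e: "phi1 p a + phi2 p (yh p) b = 0"
  shows "a = 0" "y p = 0 \<or> b = 0"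
proof -
  define a' where "a' = pr p (cE p a)"
  define b' where "b' = pr p (cE p b)"
  have A: "a = Ehat p a' + cN p a *s N' p" "b = Ehat p b' + cN p b *s N' p"
    using inK_KK[OF p a] inK_KK[OF p b] unfolding KK_def a'_def b'_def by simp_all
  have perp: "cip a' (y p) = 0" "cip b' (y p) = 0" unfolding a'_def b'_def by (rule pr_perp)+
  have e': "phi1 p (EE p a') + cN p a *s phi1 p (N' p) + (BB p (y p) b' + cN p b *s phi2 p (N' p) (yh p)) = 0"
    using e by (subst (asm) A(1), subst (asm) A(2))
      (simp add: phi_simps[OF p] phi1_Ehat[OF p] yh_def BB_def phi2_sym[OF p, of "Ehat p (y p)" "N' p"])
  have "herm (phi1 p (EE p a') + cN p a *s phi1 p (N' p) + (BB p (y p) b' + cN p b *s phi2 p (N' p) (yh p))) (u p) = 0"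
    unfolding e' by (simp add: herm_simps)
  then have a0: "cN p a = 0"
    by (simp add: herm_simps phi1_E_u herm_phi1_N'_u BB_perp phi2_N'_yh_u p Lam_nz)
  have "herm (phi1 p (EE p a') + cN p a *s phi1 p (N' p) + (BB p (y p) b' + cN p b *s phi2 p (N' p) (yh p))) (phi1 p (EE p (y p))) = 0"
    unfolding e' by (simp add: herm_simps)
  then have b0: "y p = 0 \<or> cN p b = 0"
    using mu_nz[OF p] by (auto simp: a0 herm_simps phi1_E_E perp BB_perp p)
  then have z: "cN p b *s phi2 p (N' p) (yh p) = 0" by (auto simp: yh_0[OF p] phi_simps[OF p])
  have "phi1 p (EE p a') + BB p (y p) b' = 0" using e' z a0 by simp
  from B_ind[OF p perp this] have "a' = 0" "y p = 0 \<or> b' = 0" .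
  then show "a = 0" "y p = 0 \<or> b = 0"
    using A a0 b0 by (auto simp: clin_zero[OF Ehat_clin[OF p]])
qed

definition "sec p x q = ka q (pr p (cE p x)) + cN p x *s N' q"

lemma sec_at: assumes "p \<in> S" "inK p x" shows "sec p x p = x"
  using inK_KK[OF assms] by (simp add: sec_def KK_def ka_def pr_id[OF pr_perp])
lemma sec_inK: "q \<in> S ==> inK q (sec p x q)" unfolding sec_def by (intro inK_intros)
lemma Ck_sec: "Ck_open 1 S (sec p x)" unfolding sec_def[abs_def] by (intro Ck_intros Ck_ka Ck_N')
lemmas sec_diff = C1_diff[OF Ck_sec]

definition "Tm p z x b = ll p (dv (sec p x) p (holo p z)) *s phi2 p (yh p) b - sig p (dv (sec p x) p (holo p z)) *s phi1 p b"

text \<open>Differentiating \<open>phi2 = 0\<close> along two sections of K expresses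
  \<open>phi3\<close> on K by \<open>Tm\<close>, the first order failure of these sections to stay
  in K.\<close>

lemma phi3_Tm:
  assumes p: "p \<in> S" and x: "inK p x" and b: "inK p b"
  shows "phi3 p x b z = - (Tm p z x b + Tm p z b x)"
proof -
  have "dv (%q. phi2 q (sec p x q) (sec p b q)) p (holo p z) = 0"
    by (rule dv_zero_on[OF S p]) (intro phi2_inK sec_inK)
  then have 1: "phi3 p x b (z - z $ First *s heis p) + phi2 p (dv (sec p x) p (holo p z)) b + phi2 p x (dv (sec p b) p (holo p z)) = 0"
    by (simp add: dv_phi2[OF p] sec_diff[OF p] sec_at p x b dht_holo)
  have 2: "phi3 p x b (z - z $ First *s heis p) = phi3 p x b z"
    by (simp add: clin_diff[OF phi3_clin[OF p]] phi_simps[OF p] phi3_heis[OF p] phi2_inK[OF p x b])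
  have 3: "phi2 p v b = ll p v *s phi2 p (yh p) b - sig p v *s phi1 p b" if "inK p b" for v b
    by (subst phi_coord(2)[OF p]) (simp add: phi2_inK[OF p inK_intros(8)[OF p] that])
  have 4: "phi2 p x (dv (sec p b) p (holo p z)) = phi2 p (dv (sec p b) p (holo p z)) x"
    by (rule phi2_sym[OF p])
  show ?thesis
    using 1 unfolding 2 4 3[OF x, of "dv (sec p b) p (holo p z)"] 3[OF b, of "dv (sec p x) p (holo p z)"] Tm_def by (simp only: eq_neg_iff_add_eq_0 add.assoc)
qed

definition "indep x z \<longleftrightarrow> (\<forall>r s. r *s x + s *s z = 0 \<longrightarrow> r = 0 \<and> s = (0::complex))" for x z :: "'n V"

lemma indep_sym: "indep x z ==> indep z x" unfolding indep_def by (metis add.commute)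

abbreviation "al p z x \<equiv> ll p (dv (sec p x) p (holo p z))"
abbreviation "cc p z x \<equiv> sig p (dv (sec p x) p (holo p z))"

lemma inK_coeff:
  assumes p: "p \<in> S" and a: "inK p a" and b: "inK p b" and i: "indep a b"
    and e: "phi1 p (c1 *s a + c2 *s b) + phi2 p (yh p) (d1 *s a + d2 *s b) = 0"
  shows "c1 = 0" "c2 = 0" "y p = 0 \<or> d1 = 0" "y p = 0 \<or> d2 = 0"
  using inK_ind[OF p inK_intros(1)[OF p inK_intros(2)[OF p a] inK_intros(2)[OF p b]]
     inK_intros(1)[OF p inK_intros(2)[OF p a] inK_intros(2)[OF p b]] e] i unfolding indep_def by blast+

text \<open>The symmetry of \<open>phi3\<close> is read off on the triples x x z and x z x.
  Exchanging x and z gives the factor 2 once more, so each coefficient is four times itself; this is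
  used in \<open>indep_zero\<close>.\<close>

lemma indep_coeffs:
  assumes p: "p \<in> S" and x: "inK p x" and z: "inK p z" and i: "indep x z"
  shows "al p x z = 2 * al p z x" "cc p x z = 2 * cc p z x"
proof -
  have "phi3 p x x z = phi3 p x z x" by (rule phi3_sym(2)[OF p])
  then have e: "Tm p z x x + Tm p z x x = Tm p x x z + Tm p x z x"
    by (simp only: phi3_Tm[OF p x x] phi3_Tm[OF p x z] neg_equal_iff_equal)
  have "phi1 p ((cc p x z - 2 * cc p z x) *s x + cc p x x *s z) + phi2 p (yh p) ((2 * al p z x - al p x z) *s x + (- al p x x) *s z) = 0"
    using e unfolding Tm_def by (simp add: phi_simps[OF p] vec_eq_iff algebra_simps)
  from inK_coeff[OF p x z i this] show "al p x z = 2 * al p z x" "cc p x z = 2 * cc p z x"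
    using ll_0[OF p] by auto
qed

lemma indep_zero:
  assumes p: "p \<in> S" and x: "inK p x" and z: "inK p z" and i: "indep x z"
  shows "al p z x = 0" "cc p z x = 0"
  using indep_coeffs[OF assms] indep_coeffs[OF p z x indep_sym[OF i]] by auto

lemma indep_exists:
  assumes p: "p \<in> S" and x: "x ~= 0"
  obtains b where "inK p b" "indep x b" "b ~= 0"
proof (cases "cN p x = 0")
  case True
  have i: "indep x (N' p)"
    unfolding indep_def
  proof safe
    fix r s assume h: "r *s x + s *s N' p = 0"
    have "cN p (r *s x + s *s N' p) = 0" unfolding h by (rule clinf_zero[OF cN_clinf])
    then show s: "s = 0" using True by (simp add: clinf_add[OF cN_clinf] clinf_scale[OF cN_clinf] cN_N')
    then show "r = 0" using h x by simp
  qed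
  moreover have "N' p ~= 0" using cN_N'[of p] clinf_zero[OF cN_clinf, of p] by auto
  ultimately show ?thesis using that inK_intros(5)[OF p] by blast
next
  case False
  have i: "indep x (Ehat p (ee p))"
    unfolding indep_def
  proof safe
    fix r s assume h: "r *s x + s *s Ehat p (ee p) = 0"
    have "cN p (r *s x + s *s Ehat p (ee p)) = 0" unfolding h by (rule clinf_zero[OF cN_clinf])
    then show r: "r = 0" using False by (simp add: clinf_add[OF cN_clinf] clinf_scale[OF cN_clinf])
    have "s *s Ehat p (ee p) = 0" using h unfolding r by (simp only: vec.scale_zero_left add_0)
    then have "cE p (s *s Ehat p (ee p)) = cE p 0" by (rule arg_cong)
    then have "s *s ee p = 0" by (simp only: clin_scale[OF cE_clin] clin_zero[OF cE_clin] cE_Ehat)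
    then show "s = 0" using ee_nz[OF p] by simp
  qed
  moreover have "Ehat p (ee p) ~= 0"
  proof
    assume "Ehat p (ee p) = 0"
    then have "cE p (Ehat p (ee p)) = cE p 0" by (rule arg_cong)
    then show False using ee_nz[OF p] by (simp only: clin_zero[OF cE_clin] cE_Ehat)
  qed
  ultimately show ?thesis using that inK_intros(6)[OF p ee_perp] by blast
qed

text \<open>Independent x and z are covered by \<open>indep_zero\<close>. For proportional ones, a
  vector b of K independent of both isolates \<open>Tm p z x b\<close> in the symmetry relation, and
  \<open>inK_ind\<close> applies.\<close>

lemma inK_sec_holo:
  assumes p: "p \<in> S" and x: "inK p x" and z: "inK p z"
  shows "inK p (dv (sec p x) p (holo p z))"
proof (cases "x = 0 \<or> z = 0")
  case True
  have "dv (sec p x) p (holo p z) = 0"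
  proof (cases "x = 0")
    case xz: True
    then show ?thesis
      by (intro dv_zero_on[OF S p])
        (simp add: sec_def clin_zero[OF cE_clin] clinf_zero[OF cN_clinf] ka_def clin_zero[OF pr_clin] clin_zero[OF Ehat_clin])
  next
    case False
    then have "z = 0" using True by simp
    then have "holo p z = (0, 0)"
      by (simp add: holo_def clin_zero[OF cE_clin] clinf_zero[OF cN_clinf] hor_simps zero_prod_def)
    then show ?thesis
      using linear_0[OF has_derivative_linear[OF FD_works[OF sec_diff[OF p]]]] by (simp add: dv_def zero_prod_def)
  qed
  then show ?thesis using inK_intros(4)[OF p] by simp
next
  case False
  show ?thesis
  proof (cases "indep x z")
    case True
    then show ?thesis using indep_zero[OF p x z] by (simp add: inK_def)
  next
    case dep: False
    obtain b where b: "inK p b" "indep x b" "b ~= 0" using indep_exists[OF p] False by blast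
    obtain r s where rs: "r *s x + s *s z = 0" "r ~= 0 \<or> s ~= 0" using dep unfolding indep_def by blast
    have s: "s ~= 0" using rs False by auto
    have zx: "z = (- r / s) *s x"
    proof -
      have "s *s z = s *s ((- r / s) *s x)" using rs(1) s by (simp add: vec.scale_minus_left eq_neg_iff_add_eq_0 add.commute)
      then show ?thesis using s by (simp only: vec.scale_cancel_left) simp
    qed
    have r: "- r / s ~= 0" using zx False by auto
    have bz: "indep z b"
      unfolding indep_def
    proof (intro allI impI)
      fix c d assume "c *s z + d *s b = 0"
      then have "(c * (- r / s)) *s x + d *s b = 0" unfolding zx by simp
      then have "c * (- r / s) = 0 \<and> d = 0" using b(2) unfolding indep_def by blast
      then show "c = 0 \<and> d = 0" using r by auto
    qed
    have "phi3 p x b z = phi3 p x z b" by (rule phi3_sym(2)[OF p])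
    then have "Tm p z x b + Tm p z b x = Tm p b x z + Tm p b z x"
      by (simp only: phi3_Tm[OF p x b(1)] phi3_Tm[OF p x z] neg_equal_iff_equal)
    moreover have "Tm p z b x = 0" "Tm p b x z = 0" "Tm p b z x = 0"
      unfolding Tm_def using indep_zero[OF p b(1) z indep_sym[OF bz]] indep_zero[OF p x b(1,2)] indep_zero[OF p z b(1) bz] by simp_all
    ultimately have "Tm p z x b = 0" by simp
    then have "phi1 p (- cc p z x *s b) + phi2 p (yh p) (al p z x *s b) = 0"
      unfolding Tm_def by (simp add: phi_simps[OF p])
    from inK_ind[OF p inK_intros(2)[OF p b(1)] inK_intros(2)[OF p b(1)] this] b(3)
    show ?thesis unfolding inK_def using ll_0[OF p] by auto
  qed
qed

end

section \<open>Derivatives of types (1,0) and (0,1)\<close>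

lemma clinf_expand:
  assumes "clinf L" shows "L x = (\<Sum>i\<in>UNIV. x $ i * L (axis i 1))"
proof -
  have "L x = L (\<Sum>i\<in>UNIV. x $ i *s axis i 1)" using basis_expansion[of x] by simp
  then show ?thesis by (simp only: clinf_sum[OF assms] clinf_scale[OF assms])
qed

lemma clinf_family_deriv:
  fixes L :: "'h::real_normed_vector => complex^'a::finite => complex"
  assumes S: "open S" "p \<in> S" and lin: "!!q. q \<in> S ==> clinf (L q)"
    and L: "!!v. ((%q. L q v) has_derivative (%Y. L' Y v)) (at p)" and x: "(x has_derivative x') (at p)"
  shows "((%q. L q (x q)) has_derivative (%Y. L' Y (x p) + L p (x' Y))) (at p)"
proof -
  define M where "M q v = L q v *s (1 :: complex^1)" for q v
  have "((%q. M q (x q)) has_derivative (%Y. L' Y (x p) *s 1 + M p (x' Y))) (at p)"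
  proof (rule clin_family_deriv[OF S _ _ x])
    show "clin (M q)" if "q \<in> S" for q
      using lin[OF that] by (simp add: clin_def clinf_def M_def vec_eq_iff)
    show "((%q. M q v) has_derivative (%Y. L' Y v *s 1)) (at p)" for v
      unfolding M_def by (rule bounded_linear.has_derivative[OF bounded_bilinear.bounded_linear_left[OF bounded_bilinear_vec_scale] L])
  qed
  from bounded_linear.has_derivative[OF bounded_linear_vec_nth this, of 1]
  show ?thesis by (simp add: M_def)
qed

lemma ds_clinf_family:
  fixes L :: "'n::finite heis => complex^'a::finite => complex"
  assumes S: "open S" "p \<in> S" and lin: "!!q. q \<in> S ==> clinf (L q)"
    and L: "!!v. (%q. L q v) differentiable (at p)" and x: "x differentiable (at p)"
  shows "ds (%q. L q (x q)) p d = ds (%q. L q (x p)) p d + L p (dv x p d)"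
  by (subst ds_has[OF clinf_family_deriv[OF S lin FD_works[OF L] FD_works[OF x]]])
    (use lin[OF S(2)] in \<open>simp_all add: ds_def dv_def clinf_add clinf_scale algebra_simps\<close>)

lemma dv_clin_family:
  fixes L :: "'n::finite heis => complex^'a::finite => complex^'b::finite"
  assumes S: "open S" "p \<in> S" and lin: "!!q. q \<in> S ==> clin (L q)"
    and L: "!!v. (%q. L q v) differentiable (at p)" and x: "x differentiable (at p)"
  shows "dv (%q. L q (x q)) p d = dv (%q. L q (x p)) p d + L p (dv x p d)"
  by (subst dv_has[OF clin_family_deriv[OF S lin FD_works[OF L] FD_works[OF x]]])
    (use lin[OF S(2)] in \<open>simp_all add: dv_def clin_add clin_scale vec.scale_right_distrib\<close>)

lemma holo_add: "holo p (z + z') = (fst (holo p z) + fst (holo p z'), snd (holo p z) + snd (holo p z'))"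
  by (simp add: holo_def clin_add[OF cE_clin] clinf_add[OF cN_clinf] vec.scale_right_distrib hor_simps algebra_simps)

lemma dv_holo_add: "f differentiable (at p) ==> dv f p (holo p (z + z')) = dv f p (holo p z) + dv f p (holo p z')"
  by (simp add: dv_def holo_add linear_add[OF has_derivative_linear[OF FD_works]] vec.scale_right_distrib)

lemma ds_holo_add: "f differentiable (at p) ==> ds f p (holo p (z + z')) = ds f p (holo p z) + ds f p (holo p z')"
  by (simp add: ds_def holo_add linear_add[OF has_derivative_linear[OF FD_works]] algebra_simps)

lemma holo_i: "holo p (\<i> *s z) = (- snd (holo p z), fst (holo p z))"
proof -
  have 1: "hor p (\<i> *s (\<i> *s w)) = - hor p w" for w
    by (simp add: hor_def cip_simps)
  show ?thesis
    unfolding holo_def clin_scale[OF cE_clin] clinf_scale[OF cN_clinf] 1 by simp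
qed

lemma holo_scaleR: "holo p (cor r *s z) = (r *\<^sub>R fst (holo p z), r *\<^sub>R snd (holo p z))"
proof -
  have h: "hor p (cor r *s w) = r *\<^sub>R hor p w" for w using hor_simps(2)[of p r w] by (simp add: scaleR_eq_vec)
  have 2: "\<i> *s (cor r *s w) = cor r *s (\<i> *s w)" for w :: "complex^'n"
    by simp
  show ?thesis unfolding holo_def clin_scale[OF cE_clin] clinf_scale[OF cN_clinf] 2 h
    by (simp add: algebra_simps)
qed

lemma dv_holo_scale:
  assumes f: "f differentiable (at p)" shows "dv f p (holo p (c *s z)) = c *s dv f p (holo p z)"
proof -
  note l = has_derivative_linear[OF FD_works[OF f]]
  have r: "dv f p (holo p (cor r *s z)) = cor r *s dv f p (holo p z)" for r z
    by (simp add: dv_def holo_scaleR linear_scale[OF l] scaleR_eq_vec vec.scale_right_distrib mult.commute)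
  have i: "dv f p (holo p (\<i> *s z)) = \<i> *s dv f p (holo p z)" for z
    by (simp add: dv_def holo_i linear_neg[OF l] vec.scale_right_distrib vec_eq_iff)
  have c: "c *s w = cor (Re c) *s w + cor (Im c) *s (\<i> *s w)" for w :: "complex^'k::finite"
    by (simp add: vec_eq_iff complex_eq_iff)
  show ?thesis by (subst (1 2) c) (simp only: dv_holo_add[OF f] r i)
qed

lemma ds_holo_scale:
  assumes f: "f differentiable (at p)" shows "ds f p (holo p (c *s z)) = c * ds f p (holo p z)"
proof -
  note l = has_derivative_linear[OF FD_works[OF f]]
  have r: "ds f p (holo p (cor r *s z)) = cor r * ds f p (holo p z)" for r z
    by (simp add: ds_def holo_scaleR linear_scale[OF l] scaleR_conv_of_real algebra_simps)
  have i: "ds f p (holo p (\<i> *s z)) = \<i> * ds f p (holo p z)" for z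
    by (simp add: ds_def holo_i linear_neg[OF l] algebra_simps)
  have c: "c *s w = cor (Re c) *s w + cor (Im c) *s (\<i> *s w)" for w :: "complex^'k::finite"
    by (simp add: vec_eq_iff complex_eq_iff)
  have c': "c * d = cor (Re c) * d + cor (Im c) * (\<i> * d)" for d
    by (simp add: complex_eq_iff)
  show ?thesis by (subst c, subst c') (simp only: ds_holo_add[OF f] r i)
qed

lemma real_tangent: "holo p (dheis p Y) = (hor p ((1/2) *\<^sub>R fst Y) + (snd Y - Im (cip (fst Y) (fst p))) *\<^sub>R (0, 1), - (1/2) *\<^sub>R hor p (\<i> *s fst Y))"
  unfolding holo_def cE_dheis cN_dheis by (simp add: hor_simps zero_prod_def)

text \<open>A real tangent vector Y is the sum of the (1,0) vector over \<open>dheis p Y\<close> and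
  the (0,1) vector with horizontal part \<open>fst Y\<close>.\<close>

lemma frechet_holo_anti:
  assumes f: "f differentiable (at p)"
  shows "FD f p Y = dv f p (holo p (dheis p Y)) + dv f p (anti p (fst Y))"
proof -
  note l = has_derivative_linear[OF FD_works[OF f]]
  have Y: "Y = (1/2) *\<^sub>R hor p (fst Y) + (1/2) *\<^sub>R hor p (fst Y) + (snd Y - Im (cip (fst Y) (fst p))) *\<^sub>R (0, 1)"
    by (simp add: hor_def prod_eq_iff scaleR_left_distrib[symmetric])
  have "FD f p Y = (1/2) *\<^sub>R FD f p (hor p (fst Y))
     + (1/2) *\<^sub>R FD f p (hor p (fst Y))
     + (snd Y - Im (cip (fst Y) (fst p))) *\<^sub>R FD f p (0, 1)"
    by (simp only: linear_add[OF l, symmetric] linear_scale[OF l, symmetric] Y[symmetric])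
  then show ?thesis
    unfolding dv_def real_tangent anti_def fst_conv snd_conv hor_simps linear_add[OF l] linear_scale[OF l] linear_neg[OF l]
    by (simp add: vec_eq_iff)
qed

lemma frechet_holo_anti_s:
  assumes f: "f differentiable (at p)"
  shows "FD f p Y = ds f p (holo p (dheis p Y)) + ds f p (anti p (fst Y))"
proof -
  note l = has_derivative_linear[OF FD_works[OF f]]
  have Y: "Y = (1/2) *\<^sub>R hor p (fst Y) + (1/2) *\<^sub>R hor p (fst Y) + (snd Y - Im (cip (fst Y) (fst p))) *\<^sub>R (0, 1)"
    by (simp add: hor_def prod_eq_iff scaleR_left_distrib[symmetric])
  have "FD f p Y = (1/2) *\<^sub>R FD f p (hor p (fst Y))
     + (1/2) *\<^sub>R FD f p (hor p (fst Y))
     + (snd Y - Im (cip (fst Y) (fst p))) *\<^sub>R FD f p (0, 1)"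
    by (simp only: linear_add[OF l, symmetric] linear_scale[OF l, symmetric] Y[symmetric])
  then show ?thesis
    unfolding ds_def real_tangent anti_def fst_conv snd_conv hor_simps linear_add[OF l] linear_scale[OF l] linear_neg[OF l]
    by simp
qed

section \<open>The hyperplane field and the linear maps on it\<close>

context cr_split begin

text \<open>The directions in which the hyperplane and the map on it stay constant up to scale.
  Modulo these only one complex direction remains, which is the source of the single complex
  parameter.\<close>

definition "allowed p d \<longleftrightarrow> (\<exists>w. d = anti p w) \<or> (\<exists>z. ll p z = 0 \<and> d = holo p z)"

lemma holo_KK:
  assumes p: "p \<in> S" and z: "ll p z = 0" shows "holo p z = holo p (KK p z)"
proof -
  have e: "z = KK p z + sig p z *s heis p" using coord_expand[OF p, of z] z by simp
  have "cE p z = cE p (KK p z)" "cN p z = cN p (KK p z)"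
    by (subst e, simp add: clin_add[OF cE_clin] clin_scale[OF cE_clin] clinf_add[OF cN_clinf] clinf_scale[OF cN_clinf])+
  then show ?thesis unfolding holo_def by simp
qed

lemma inK_sec:
  assumes p: "p \<in> S" and x: "inK p x" and d: "allowed p r"
  shows "inK p (dv (sec p x) p r)"
  using d unfolding allowed_def
proof (elim disjE exE conjE)
  fix w assume "r = anti p w"
  then show ?thesis
    unfolding sec_def[abs_def]
    by (simp add: dv_add dv_scale vec_scale_diff C1_diff[OF Ck_ka p] C1_diff[OF Ck_N' p] inK_intros[OF p]
        inK_ka_anti[OF p] inK_N'_anti[OF p])
next
  fix z assume "ll p z = 0" "r = holo p z"
  then show ?thesis using inK_sec_holo[OF p x inK_intros(8)[OF p, of z]] holo_KK[OF p] by simp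
qed

lemma Ck_cE: "Ck_open k S (%q. cE q v)"
proof -
  have "Ck_open k S (%q. midpart v + (- v $ First) *s fst q)"
    by (intro Ck_intros Ck_open_fst)
  then show ?thesis by (simp add: cE_def vec.scale_minus_left)
qed

lemma Ck_ll: "Ck_open 1 S (%q. ll q v)"
proof (cases "\<forall>q\<in>S. y q = 0")
  case True
  then show ?thesis by (intro Ck_open_cong[OF S _ Ck_open_const[of 1 S 0]]) (simp add: ll_0)
next
  case False
  then have "q \<in> S ==> cip (y q) (y q) ~= 0" for q using ycase by (auto simp: cip_self_eq_0)
  then show ?thesis unfolding ll_def cN_def by (intro Ck_intros Ck_cE Ck_ss yC1)
qed

lemma Ck_sig: "Ck_open 1 S (%q. sig q v)"
  unfolding sig_def cN_def by (intro Ck_intros Ck_tau Ck_cE Ck_tt Ck_Lam Lam_nz)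

text \<open>\<open>phi1\<close> annihilates \<open>heis\<close>; the additional term sends
  \<open>heis\<close> to u, so that on the hyperplane the map is conformal with factor
  \<open>Lam\<close>, see \<open>MM_gram\<close>.\<close>

definition "MM q x = phi1 q x + sig q x *s u q"

lemma MM_clin: "q \<in> S ==> clin (MM q)"
  by (simp add: clin_def MM_def phi_simps sig_simps vec_eq_iff algebra_simps)

lemma Ck_MM: "Ck_open 1 S (%q. MM q v)"
  unfolding MM_def by (intro Ck_intros Ck_sig)

lemma MM_heis: "q \<in> S ==> MM q (heis q) = u q"
  by (simp add: MM_def phi_simps coord_heis)

lemma MM_component: "q \<in> S ==> MM q x $ j = sig q x"
  by (simp add: MM_def comp phi_component(1)[OF _ comp])

definition "secL p x q = sec p (KK p x) q + sig p x *s heis q"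

lemma secL_diff: "p \<in> S ==> secL p x differentiable (at p)"
  unfolding secL_def[abs_def] by (intro differentiable_add vec_scale_diff differentiable_const sec_diff heis_diff)

lemma secL_at: "p \<in> S ==> ll p x = 0 ==> secL p x p = x"
  using coord_expand[of p x] by (simp add: secL_def sec_at inK_intros)

lemma dv_secL: "p \<in> S ==> dv (secL p x) p d = dv (sec p (KK p x)) p d + sig p x *s dht p d"
  unfolding secL_def[abs_def] by (simp add: dv_add dv_scale vec_scale_diff sec_diff heis_diff dv_heis)

lemma allowed_dht: "p \<in> S ==> allowed p d ==> ll p (dht p d) = 0"
  unfolding allowed_def by (auto simp: ll_simps dht_holo coord_heis)

text \<open>\<open>ll\<close> vanishes on the sections \<open>secL\<close>, whose derivatives in
  allowed directions remain in its kernel. So the derivative of \<open>ll\<close> annihilates this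
  kernel, that is, it is proportional to \<open>ll\<close>.\<close>

lemma ll_deriv:
  assumes p: "p \<in> S" and x: "ll p x = 0" and d: "allowed p r"
  shows "ds (%q. ll q x) p r = 0"
proof -
  have "ds (%q. ll q (secL p x q)) p r = 0"
    by (rule ds_zero_on[OF S p]) (use sec_inK in \<open>simp add: secL_def ll_simps coord_heis inK_def\<close>)
  moreover have "ds (%q. ll q (secL p x q)) p r = ds (%q. ll q (secL p x p)) p r + ll p (dv (secL p x) p r)"
    by (rule ds_clinf_family[OF S p ll_clin C1_diff[OF Ck_ll p] secL_diff[OF p]])
  moreover have "ll p (dv (secL p x) p r) = 0"
    using inK_sec[OF p inK_intros(8)[OF p] d, of x] allowed_dht[OF p d]
    by (simp add: dv_secL[OF p] ll_simps inK_def)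
  ultimately show ?thesis by (simp add: secL_at[OF p x])
qed

text \<open>As \<open>phi2\<close> vanishes on K, only the \<open>heis\<close> component of the
  direction contributes, and its contribution is a multiple of \<open>MM\<close> itself.\<close>

lemma MM_deriv:
  assumes p: "p \<in> S" and x: "ll p x = 0" and d: "allowed p r"
  shows "dv (%q. MM q x) p r = - sig p (dht p r) *s MM p x"
proof -
  define a where "a = sec p (KK p x)"
  define s where "s = sig p x"
  have ad: "a differentiable (at p)" unfolding a_def by (rule sec_diff[OF p])
  have ak: "inK p (a p)" unfolding a_def by (rule sec_inK[OF p])
  have "dv (%q. MM q (secL p x q)) p r = dv (%q. MM q (secL p x p)) p r + MM p (dv (secL p x) p r)"
    by (rule dv_clin_family[OF S p MM_clin C1_diff[OF Ck_MM p] secL_diff[OF p]])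
  moreover have "dv (%q. MM q (secL p x q)) p r = dv (%q. phi1 q (a q) + s *s u q) p r"
  proof (rule dv_cong_on[OF S p])
    show "phi1 q (a q) + s *s u q = MM q (secL p x q)" if q: "q \<in> S" for q
      using sec_inK[OF q, of p "KK p x"]
      by (simp add: MM_def secL_def a_def s_def phi_simps[OF q] sig_simps[OF q] coord_heis[OF q] inK_def)
  qed (intro differentiable_add vec_scale_diff differentiable_const diffs p ad)
  moreover have "dv (%q. phi1 q (a q) + s *s u q) p r = phi2 p (a p) (dht p r) + phi1 p (dv a p r) + s *s phi1 p (dht p r)"
    by (simp add: dv_add dv_scale vec_scale_diff diffs p ad dv_phi1[OF p] dv_u[OF p])
  moreover have "MM p (dv (secL p x) p r) = phi1 p (dv a p r) + s *s (phi1 p (dht p r) + sig p (dht p r) *s u p)"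
    using inK_sec[OF p inK_intros(8)[OF p] d, of x]
    unfolding dv_secL[OF p] a_def s_def clin_add[OF MM_clin[OF p]] clin_scale[OF MM_clin[OF p]] by (simp add: MM_def inK_def)
  moreover have "phi2 p (a p) (dht p r) = - sig p (dht p r) *s phi1 p (a p)"
    by (subst phi_coord(1)[OF p])
      (simp add: allowed_dht[OF p d] phi2_inK[OF p ak inK_intros(8)[OF p]] vec.scale_minus_left)
  moreover have "MM p x = phi1 p (a p) + s *s u p"
    by (subst secL_at[OF p x, symmetric])
      (use ak in \<open>simp add: MM_def secL_def a_def[symmetric] s_def[symmetric] phi_simps[OF p] sig_simps[OF p] coord_heis[OF p] inK_def\<close>)
  ultimately show ?thesis unfolding secL_at[OF p x] by (simp add: vec_eq_iff eq_neg_iff_add_eq_0 algebra_simps)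
qed

lemma herm_phi1_Ehat_N':
  assumes p: "p \<in> S" and a: "cip a (y p) = 0"
  shows "herm (phi1 p (Ehat p a)) (phi1 p (N' p)) = Lam p * herm (Ehat p a) (N' p)"
proof -
  have "herm (Ehat p a) (N' p) = tau p a / Lam p"
    unfolding N'_def by (simp add: herm_simps Ehat_def yh_def a algebra_simps)
  then show ?thesis
    by (simp add: phi1_N' phi1_Ehat p herm_simps phi1_E_E a tau_def[symmetric] Lam_nz)
qed

lemma herm_phi1_Ehat:
  assumes p: "p \<in> S"
  shows "herm (phi1 p (Ehat p a)) (phi1 p (Ehat p b)) = Lam p * herm (Ehat p a) (Ehat p b)"
proof -
  have "herm (Ehat p a) (Ehat p b) = cip a b" by (simp add: Ehat_def herm_simps)
  then show ?thesis by (simp add: phi1_Ehat p phi1_E_E)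
qed

text \<open>The remaining entry of the Gram matrix of \<open>phi1\<close> on K. It enters through
  the Levi term of \<open>ka e0\<close> when the known entry for \<open>ka e0\<close> and
  \<open>N'\<close> is differentiated along the (0,1) vector of ee.\<close>

lemma herm_phi1_N':
  assumes p: "p \<in> S"
  shows "herm (phi1 p (N' p)) (phi1 p (N' p)) = Lam p * herm (N' p) (N' p)"
proof -
  define e where "e = ee p"
  define K where "K = dv (%q. ka q e0) p (anti p e)"
  define v where "v = dv N' p (holo p (EE p e))"
  define a where "a = pr p (cE p K)"
  define b where "b = pr p (cE p v)"
  define n where "n = cN p v"
  define k where "k = Ehat p e"
  define t where "t = tau p e"
  have ey: "cip e (y p) = 0" unfolding e_def by (rule ee_perp)
  have ab: "cip a (y p) = 0" "cip b (y p) = 0" unfolding a_def b_def by (rule pr_perp)+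
  have ke: "ka p e0 = k" unfolding ka_e0 e_def k_def ..
  have cnz: "cip e e ~= 0" unfolding e_def by (rule cip_ee_nz[OF p])
  have K: "K = Ehat p a - cip e e *s N' p"
    using inK_KK[OF p inK_ka_anti[OF p, of e0 e], symmetric] cN_ka_anti[OF p, of e0 e]
    unfolding K_def[symmetric] KK_def a_def[symmetric] ee_def[symmetric] e_def[symmetric]
    by (simp add: vec.scale_minus_left)
  have hE: "holo p (EE p e) = holo p k"
    unfolding k_def holo_def cE_Ehat cN_Ehat by (simp add: cN_def)
  have kK: "inK p k" unfolding k_def using ey by (rule inK_intros(6)[OF p])
  \<comment> \<open>\<open>N'\<close> is the difference of two of the sections \<open>sec\<close>,
    whose derivatives along vectors of K stay in K.\<close>
  have vK: "inK p v"
  proof -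
    have "sec p (N' p) = (%q. ka q (pr p (cE p (N' p))) + N' q)"
      unfolding sec_def[abs_def] by (simp add: cN_N')
    then have 1: "dv (sec p (N' p)) p (holo p k) = dv (%q. ka q (pr p (cE p (N' p)))) p (holo p k) + dv N' p (holo p k)"
      by (simp add: dv_add C1_diff[OF Ck_ka p] C1_diff[OF Ck_N' p])
    define c where "c = pr p (cE p (N' p))"
    have "sec p (Ehat p c) = (%q. ka q c)"
      unfolding sec_def[abs_def] by (simp add: c_def pr_id pr_perp)
    then have 2: "inK p (dv (%q. ka q c) p (holo p k))"
      using inK_sec_holo[OF p inK_intros(6)[OF p] kK, of c] unfolding c_def by (simp add: pr_perp)
    have "v = dv (sec p (N' p)) p (holo p k) - dv (%q. ka q c) p (holo p k)"
      unfolding v_def hE 1 c_def by simp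
    then show ?thesis using inK_intros(3)[OF p inK_sec_holo[OF p inK_intros(5)[OF p] kK] 2] by simp
  qed
  have v: "v = Ehat p b + n *s N' p"
    using inK_KK[OF p vK] unfolding KK_def b_def n_def by simp
  have dLam: "ds Lam p (anti p e) = cnj t"
  proof -
    have "ds Lam p (anti p e) = ds (%q. cnj (Lam q)) p (anti p e)"
      by (rule ds_cong_on[OF S p]) (simp_all add: Lam_cnj bounded_linear_imp_differentiable
        differentiable_compose[OF bounded_linear_imp_differentiable[OF bounded_linear_cnj] Lam_diff] p)
    then show ?thesis by (simp add: ds_cnj Lam_diff p cbar_anti ds_Lam t_def)
  qed
  have zero: "herm (phi1 q (ka q e0)) (phi1 q (N' q)) - Lam q * herm (ka q e0) (N' q) = 0" if q: "q \<in> S" for q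
    unfolding ka_def using herm_phi1_Ehat_N'[OF q pr_perp] by simp
  have "ds (%q. herm (phi1 q (ka q e0)) (phi1 q (N' q)) - Lam q * herm (ka q e0) (N' q)) p (anti p e) = 0"
    by (rule ds_zero_on[OF S p]) (rule zero)
  moreover have "phi2 p (N' p) (EE p e) = (t / Lam p) *s phi1 p (N' p)"
    using phi2_N'(1)[OF p ey] unfolding Ehat_def by (simp add: phi_simps[OF p] t_def)
  ultimately have "herm (phi1 p K) (phi1 p (N' p)) + herm (phi1 p k) ((t / Lam p) *s phi1 p (N' p) + phi1 p v)
     - (cnj t * herm k (N' p) + Lam p * (herm K (N' p) + herm k v)) = 0"
    by (simp add: ds_diff ds_mult ds_herm herm_diff differentiable_mult diffs p C1_diff[OF Ck_ka p] C1_diff[OF Ck_N' p] Lam_diff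
        dv_phi1[OF p] cbar_anti phi_simps[OF p] dLam ke K_def[symmetric] v_def[symmetric])
  moreover have "herm (phi1 p k) (phi1 p v) = Lam p * herm k v"
    unfolding v k_def by (simp add: phi_simps[OF p] herm_simps herm_phi1_Ehat[OF p] herm_phi1_Ehat_N'[OF p ey] algebra_simps)
  moreover have "herm (phi1 p k) (phi1 p (N' p)) = Lam p * herm k (N' p)" unfolding k_def by (rule herm_phi1_Ehat_N'[OF p ey])
  moreover have "herm (phi1 p K) (phi1 p (N' p)) = Lam p * herm (Ehat p a) (N' p) - cip e e * herm (phi1 p (N' p)) (phi1 p (N' p))"
    unfolding K by (simp add: phi_simps[OF p] herm_simps herm_phi1_Ehat_N'[OF p ab(1)])
  moreover have "herm K (N' p) = herm (Ehat p a) (N' p) - cip e e * herm (N' p) (N' p)"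
    unfolding K by (simp add: herm_simps)
  ultimately have "cip e e * (Lam p * herm (N' p) (N' p) - herm (phi1 p (N' p)) (phi1 p (N' p))) = 0"
    using Lam_nz[OF p] Lam_cnj(2)[OF p] by (simp add: herm_simps algebra_simps)
  then show ?thesis using cnz by simp
qed

lemma MM_gram:
  assumes p: "p \<in> S" and x: "ll p x = 0" "ll p x' = 0"
  shows "herm (MM p x) (MM p x') = Lam p * herm x x'"
proof -
  have c: "z = KK p z + sig p z *s heis p" "MM p z = phi1 p (KK p z) + sig p z *s u p" if "ll p z = 0" for z
  proof -
    show z: "z = KK p z + sig p z *s heis p" using coord_expand[OF p, of z] that by simp
    then have "phi1 p z = phi1 p (KK p z + sig p z *s heis p)" by (rule arg_cong)
    also have "\<dots> = phi1 p (KK p z)" by (simp add: phi_simps[OF p])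
    finally show "MM p z = phi1 p (KK p z) + sig p z *s u p" by (simp add: MM_def)
  qed
  have g: "herm (phi1 p (KK p z)) (phi1 p (KK p z')) = Lam p * herm (KK p z) (KK p z')" for z z'
  proof -
    have o: "herm (phi1 p (N' p)) (phi1 p (Ehat p a)) = Lam p * herm (N' p) (Ehat p a)" if "cip a (y p) = 0" for a
      using arg_cong[OF herm_phi1_Ehat_N'[OF p that], of cnj] Lam_cnj(2)[OF p] by (simp add: herm_cnj)
    show ?thesis unfolding KK_def
      by (simp add: phi_simps[OF p] herm_simps herm_phi1_Ehat[OF p] herm_phi1_Ehat_N'[OF p pr_perp] o[OF pr_perp] herm_phi1_N'[OF p] algebra_simps)
  qed
  have n: "herm (phi1 p (KK p z)) (u p) = Lam p * herm (KK p z) (heis p)" for z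
    unfolding KK_def using cN_N'[of p] cN_Ehat(1)[of p]
    by (simp add: phi_simps[OF p] herm_simps phi1_Ehat[OF p] phi1_E_u[OF p] herm_phi1_N'_u[OF p] cN_def)
  have n': "herm (u p) (phi1 p (KK p z)) = Lam p * herm (heis p) (KK p z)" for z
    using arg_cong[OF n, of cnj z] Lam_cnj(2)[OF p] by (simp add: herm_cnj)
  have "herm (MM p x) (MM p x') = Lam p * herm (KK p x + sig p x *s heis p) (KK p x' + sig p x' *s heis p)"
    unfolding c(2)[OF x(1)] c(2)[OF x(2)] by (simp add: herm_simps g n n' null[OF p] algebra_simps)
  then show ?thesis using c(1)[OF x(1)] c(1)[OF x(2)] by simp
qed

end

section \<open>Functions of one holomorphic parameter\<close>

text \<open>By the inverse function theorem \<open>g\<close> is a complex coordinate; \<open>F\<close> is constant on its level sets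
  and complex differentiable across them.\<close>

lemma straighten:
  fixes g :: "'a::euclidean_space => complex"
  assumes S: "open S" "p0 \<in> S" and g: "Ck_open 1 S g" and surj: "surj (FD g p0)"
  obtains W d si where "open W" "p0 \<in> W" "W \<subseteq> S" "d > 0" "!!q. q \<in> W ==> g q \<in> ball (g p0) d"
    "!!w. w \<in> ball (g p0) d ==> si w \<in> W \<and> g (si w) = w"
    "!!F a q. (!!q. q \<in> S ==> (F has_derivative (%Y. a q * FD g q Y)) (at q)) ==> q \<in> W ==> F q = F (si (g q))"
    "!!F a. (!!q. q \<in> S ==> (F has_derivative (%Y. a q * FD g q Y)) (at q)) ==>
        (%w. F (si w)) holomorphic_on ball (g p0) d"
proof -
  define g' where "g' q = FD g q" for q
  have dg: "(g has_derivative g' q) (at q)" if "q \<in> S" for q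
    unfolding g'_def by (rule FD_works) (use g that in auto)
  have cg: "continuous_on S (%q. g' q v)" for v using g unfolding g'_def by simp
  define A where "A = g' p0"
  have bA: "bounded_linear A" unfolding A_def using dg[OF S(2)] by (rule has_derivative_bounded_linear)
  have surjA: "surj A" using surj unfolding A_def g'_def .
  obtain r1 ri where r: "A r1 = 1" "A ri = \<i>" using surjA by (metis surjD)
  define R where "R w = Re w *\<^sub>R r1 + Im w *\<^sub>R ri" for w
  have bR: "bounded_linear R" unfolding R_def[abs_def]
    by (intro bounded_linear_add bounded_linear_scaleR_const bounded_linear_Re bounded_linear_Im)
  have AR: "A (R w) = w" for w
    unfolding R_def using r by (simp add: linear_add[OF bounded_linear.linear[OF bA]] linear_scale[OF bounded_linear.linear[OF bA]]
      complex_eq_iff)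
  \<comment> \<open>R is a right inverse of A, so A composed with T is g and the derivative of T at
    p0 is the identity: T is a change of variables in which g becomes the linear map A.\<close>
  define T where "T q = q + R (g q - A q)" for q
  have A\<Theta>: "A (T q) = g q" for q
    unfolding T_def by (simp add: linear_add[OF bounded_linear.linear[OF bA]] AR)
  define f' where "f' q = Blinfun (%Y. Y + R (g' q Y - A Y))" for q
  have bl: "bounded_linear (%Y. Y + R (g' q Y - A Y))" if "q \<in> S" for q
    by (intro bounded_linear_add bounded_linear_ident bounded_linear_compose[OF bR] bounded_linear_sub bA
      has_derivative_bounded_linear[OF dg[OF that]])
  have f': "blinfun_apply (f' q) = (%Y. Y + R (g' q Y - A Y))" if "q \<in> S" for q
    unfolding f'_def by (rule bounded_linear_Blinfun_apply[OF bl[OF that]])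
  have d\<Theta>: "(T has_derivative blinfun_apply (f' q)) (at q)" if "q \<in> S" for q
    unfolding f'[OF that] T_def[abs_def]
    by (intro has_derivative_add has_derivative_ident bounded_linear.has_derivative[OF bR] has_derivative_diff dg[OF that]
      bounded_linear_imp_has_derivative[OF bA])
  have cf: "continuous_on S f'"
  proof (rule continuous_on_blinfun_componentwise)
    fix i :: 'a
    have "continuous_on S (%q. i + R (g' q i - A i))"
      by (intro continuous_intros linear_continuous_on_compose[OF _ bounded_linear.linear[OF bR]] cg)
    then show "continuous_on S (%q. blinfun_apply (f' q) i)"
      by (rule continuous_on_eq) (simp add: f')
  qed
  have "blinfun_apply (f' p0) = id"
    unfolding f'[OF S(2)] A_def by (simp add: fun_eq_iff linear_0[OF bounded_linear.linear[OF bR]])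
  then have id: "id_blinfun o\<^sub>L f' p0 = id_blinfun"
    by (simp add: blinfun_eqI)
  obtain U V P P' where U: "open U" "U \<subseteq> S" "p0 \<in> U" and V: "open V" "T p0 \<in> V" and hom: "homeomorphism U V T P"
    and d\<Psi>: "!!y. y \<in> V ==> (P has_derivative (P' y)) (at y)"
    using inverse_function_theorem[OF S(1) d\<Theta> cf S(2) id] by metis
  have \<Theta>\<Psi>: "P v \<in> U" "T (P v) = v" if "v \<in> V" for v
    using hom that by (auto simp: homeomorphism_def)
  have \<Psi>\<Theta>: "P (T q) = q" if "q \<in> U" for q using hom that by (auto simp: homeomorphism_def)
  define x0 where "x0 = T p0"
  obtain r where r: "r > 0" "ball x0 r \<subseteq> V" using V openE unfolding x0_def by blast
  obtain K where K: "K > 0" "!!w. norm (R w) \<le> norm w * K" using bounded_linear.pos_bounded[OF bR] by blast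
  define d where "d = r / K"
  have d: "d > 0" unfolding d_def using r K by simp
  define l where "l w = x0 + R (w - g p0)" for w
  have lball: "l w \<in> ball x0 r" if "w \<in> ball (g p0) d" for w
  proof -
    have "norm (R (w - g p0)) \<le> norm (w - g p0) * K" by (rule K)
    also have "\<dots> < d * K" using that K by (simp add: dist_norm norm_minus_commute)
    finally show ?thesis unfolding l_def d_def using K by (simp add: dist_norm)
  qed
  have Al: "A (l w) = w" for w
    unfolding l_def x0_def by (simp add: linear_add[OF bounded_linear.linear[OF bA]] A\<Theta> AR)
  define si where "si w = P (l w)" for w
  define W where "W = (U \<inter> T -` ball x0 r) \<inter> (U \<inter> g -` ball (g p0) d)"
  have cU: "continuous_on U T" "continuous_on U g"
    using hom Ck_open_continuous[OF g] U(2) continuous_on_subset by (auto simp: homeomorphism_def)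
  have W: "open W" unfolding W_def
    by (intro open_Int[OF continuous_open_preimage[OF cU(1) U(1) open_ball] continuous_open_preimage[OF cU(2) U(1) open_ball]])
  have gl: "g (si w) = w" "si w \<in> W" if w: "w \<in> ball (g p0) d" for w
  proof -
    have v: "l w \<in> V" using lball[OF w] r by blast
    have t: "T (si w) = l w" unfolding si_def by (rule \<Theta>\<Psi>(2)[OF v])
    show g: "g (si w) = w" unfolding A\<Theta>[symmetric] t Al ..
    show "si w \<in> W" unfolding W_def using \<Theta>\<Psi>(1)[OF v] t lball[OF w] w g by (simp add: si_def[symmetric])
  qed
  have hF: "((%v. F (P v)) has_derivative (%Y. a (P v) * A Y)) (at v)"
    if F: "!!q. q \<in> S ==> (F has_derivative (%Y. a q * FD g q Y)) (at q)" and v: "v \<in> V" for F a v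
  proof -
    have s: "P v \<in> S" using \<Theta>\<Psi>(1)[OF v] U by blast
    have "((%v. g (P v)) has_derivative (%Y. g' (P v) (P' v Y))) (at v)"
      by (rule has_derivative_compose[OF d\<Psi>[OF v] dg[OF s]])
    then have "(A has_derivative (%Y. g' (P v) (P' v Y))) (at v)"
      by (rule has_derivative_transform_within_open[OF _ V(1) v]) (metis A\<Theta> \<Theta>\<Psi>(2))
    then have "A = (%Y. g' (P v) (P' v Y))"
      by (rule has_derivative_unique[OF bounded_linear_imp_has_derivative[OF bA]])
    then have e: "g' (P v) (P' v Y) = A Y" for Y by metis
    have "((%v. F (P v)) has_derivative (%Y. a (P v) * FD g (P v) (P' v Y))) (at v)"
      by (rule has_derivative_compose[OF d\<Psi>[OF v] F[OF s]])
    then show ?thesis unfolding g'_def[symmetric] e .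
  qed
  show ?thesis
  proof (rule that[of W d si])
    show "p0 \<in> W" unfolding W_def using U r d by (simp add: x0_def)
    show "W \<subseteq> S" unfolding W_def using U by blast
    show "g q \<in> ball (g p0) d" if "q \<in> W" for q using that unfolding W_def by blast
    show "si w \<in> W \<and> g (si w) = w" if "w \<in> ball (g p0) d" for w using gl[OF that] by blast
  next
    fix F a q
    assume F: "!!q. q \<in> S ==> (F has_derivative (%Y. a q * FD g q Y)) (at q)" and q: "q \<in> W"
    define h where "h v = F (P v)" for v
    define v where "v = T q"
    define v' where "v' = l (g q)"
    have vb: "v \<in> ball x0 r" "v' \<in> ball x0 r" using q lball[of "g q"] unfolding v_def v'_def W_def by auto
    \<comment> \<open>In the new variables the two points differ by an element of the kernel of A,
      and F has zero derivative along the segment joining them.\<close>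
    have Av: "A (v - v') = 0"
      unfolding v_def v'_def by (simp add: linear_diff[OF bounded_linear.linear[OF bA]] A\<Theta> Al)
    have "((%t. h (v' + t *\<^sub>R (v - v'))) has_derivative (%t. 0)) (at t within {0..1})" if "t \<in> {0..1}" for t :: real
    proof -
      have "v' + t *\<^sub>R (v - v') = (1 - t) *\<^sub>R v' + t *\<^sub>R v" by (simp add: algebra_simps)
      also have "\<dots> \<in> ball x0 r" using convexD[OF convex_ball vb(2,1), of "1 - t" t] that by simp
      finally have V: "v' + t *\<^sub>R (v - v') \<in> V" using r by blast
      have h: "((%v. F (P v)) has_derivative (%Y. a (P (v' + t *\<^sub>R (v - v'))) * A Y)) (at (v' + t *\<^sub>R (v - v')))"
        by (rule hF[OF _ V]) (rule F)
      have "((%t. h (v' + t *\<^sub>R (v - v'))) has_derivative (%k. a (P (v' + t *\<^sub>R (v - v'))) * A (k *\<^sub>R (v - v')))) (at t within {0..1})"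
        unfolding h_def by (rule has_derivative_compose[where f = "%t. v' + t *\<^sub>R (v - v')" and x = t, OF _ h]) (auto intro!: derivative_eq_intros)
      then show ?thesis by (simp add: linear_scale[OF bounded_linear.linear[OF bA]] Av)
    qed
    from has_derivative_zero_constant[OF _ this] obtain c where "!!t. t \<in> {0..1} ==> h (v' + t *\<^sub>R (v - v')) = c" by auto
    from this[of 0] this[of 1] have "h v = h v'" by simp
    then show "F q = F (si (g q))" unfolding h_def v_def v'_def si_def using \<Psi>\<Theta> q by (simp add: W_def)
  next
    fix F a
    assume F: "!!q. q \<in> S ==> (F has_derivative (%Y. a q * FD g q Y)) (at q)"
    have "((%w. F (si w)) has_field_derivative a (P (l w))) (at w)" if w: "w \<in> ball (g p0) d" for w
    proof -
      have v: "l w \<in> V" using lball[OF w] r by blast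
      have "(l has_derivative R) (at w)"
      proof -
        have "((%w. w - g p0) has_derivative (%k. k)) (at w)" by (auto intro!: derivative_eq_intros)
        from has_derivative_add[OF has_derivative_const[of x0] bounded_linear.has_derivative[OF bR this]] show ?thesis
          unfolding l_def[abs_def] by simp
      qed
      then have "((%w. F (P (l w))) has_derivative (%k. a (P (l w)) * A (R k))) (at w)"
      proof (rule has_derivative_compose)
        show "((%v. F (P v)) has_derivative (%Y. a (P (l w)) * A Y)) (at (l w))"
          by (rule hF[OF _ v]) (rule F)
      qed
      then show ?thesis unfolding si_def AR has_field_derivative_def .
    qed
    then show "(%w. F (si w)) holomorphic_on ball (g p0) d"
      unfolding holomorphic_on_def field_differentiable_def using has_field_derivative_at_within by blast
  qed (use W d in auto)
qed

subsection \<open>Polarisation\<close>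

text \<open>Holomorphy in z and in the conjugate of w, encoded by one-variable substitutions. This
  is the form in which polarisation uses it, and closure under sums and products is
  immediate.\<close>

definition sesquiholo :: "complex set => (complex => complex => complex) => bool" where
  "sesquiholo D F \<longleftrightarrow> (\<forall>E a b. open E \<longrightarrow> a holomorphic_on E \<longrightarrow> b holomorphic_on E \<longrightarrow>
     (\<forall>z\<in>E. a z \<in> D \<and> cnj (b z) \<in> D) \<longrightarrow> (%z. F (a z) (cnj (b z))) holomorphic_on E)"

lemma sesquiholoD:
  assumes "sesquiholo D F" "open E" "a holomorphic_on E" "b holomorphic_on E"
    "!!z. z \<in> E ==> a z \<in> D" "!!z. z \<in> E ==> cnj (b z) \<in> D"
  shows "(%z. F (a z) (cnj (b z))) holomorphic_on E"
  using assms unfolding sesquiholo_def by blast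

lemma sesquiholo_left: "f holomorphic_on D ==> sesquiholo D (%z w. f z)"
  unfolding sesquiholo_def using holomorphic_on_compose_gen[of _ _ f D] by (auto simp: o_def image_subset_iff)

lemma sesquiholo_right:
  assumes D: "open D" and f: "f holomorphic_on D" shows "sesquiholo D (%x w. cnj (f w))"
proof -
  have "(%z. cnj (f (cnj z))) holomorphic_on (cnj ` D)"
  proof -
    have "cnj ` D = cnj -` D" by (auto simp: image_iff) (metis complex_cnj_cnj)
    then have "open (cnj ` D)" using open_vimage[OF D, of cnj] by (simp add: continuous_on_cnj)
    then have "(cnj \<circ> f \<circ> cnj) holomorphic_on (cnj ` D)"
      using f D by (intro holomorphic_on_compose_cnj_cnj) (simp_all add: image_image)
    then show ?thesis by (simp add: o_def)
  qed
  then show ?thesis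
    unfolding sesquiholo_def
    using holomorphic_on_compose_gen[of _ _ "%z. cnj (f (cnj z))" "cnj ` D"]
    by (auto simp: o_def image_subset_iff image_iff) (metis (no_types, lifting) complex_cnj_cnj)
qed

lemma sesquiholo_intros:
  "sesquiholo D F ==> sesquiholo D P ==> sesquiholo D (%z w. F z w + P z w)"
  "sesquiholo D F ==> sesquiholo D P ==> sesquiholo D (%z w. F z w - P z w)"
  "sesquiholo D F ==> sesquiholo D P ==> sesquiholo D (%z w. F z w * P z w)"
  "sesquiholo D (%z w. c)"
  unfolding sesquiholo_def by (auto intro!: holomorphic_intros)

lemma sesquiholo_sum: "(!!i. i \<in> I ==> sesquiholo D (F i)) ==> sesquiholo D (%z w. \<Sum>i\<in>I. F i z w)"
  by (induction I rule: infinite_finite_induct) (auto intro: sesquiholo_intros)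

lemma sesquiholo_herm:
  fixes F G :: "complex => 'm::finite V"
  assumes "open D" "!!i. (%z. F z $ i) holomorphic_on D" "!!i. (%z. G z $ i) holomorphic_on D"
  shows "sesquiholo D (%z w. herm (F z) (G w))"
  unfolding herm_def
  by (intro sesquiholo_intros sesquiholo_sum sesquiholo_left[OF assms(2)] sesquiholo_right[OF assms(1,3)])

text \<open>The function \<open>F (a + \<i> b) (cnj (a - \<i> b))\<close> is holomorphic in \<open>a\<close> and in \<open>b\<close> and vanishes for real \<open>a\<close>, \<open>b\<close>.\<close>

lemma polarisation:
  assumes P: "sesquiholo (ball 0 g) F" and diag: "!!x. x \<in> ball 0 g ==> F x x = 0"
    and z: "x \<in> ball 0 g" "w \<in> ball 0 g"
  shows "F x w = 0"
proof -
  have g: "g > 0" using z(1) norm_ge_zero[of x] by (simp del: norm_ge_zero)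
  have real_zero: "h z = 0"
    if h: "h holomorphic_on E" and E: "open E" "connected E" "0 \<in> E" and z: "z \<in> E"
      and r: "!!t. cor t \<in> E ==> h (cor t) = 0 \<or> t = 0" for h :: "complex => complex" and E z
  proof (rule analytic_continuation[OF h E(1,2) _ E(3) _ _ z])
    define U where "U = {cor t | t. t ~= 0 \<and> cor t \<in> E}"
    show "U \<subseteq> E" unfolding U_def by blast
    obtain e where e: "e > 0" "ball 0 e \<subseteq> E" using E openE by blast
    show "0 islimpt U"
      unfolding islimpt_approachable
    proof safe
      fix d :: real assume "d > 0"
      define t where "t = min d e / 2"
      have t: "t > 0" "t < d" "t < e" unfolding t_def using \<open>d > 0\<close> e by auto
      have "cor t \<in> ball 0 e" using t by simp
      then have "cor t \<in> U" unfolding U_def using t e(2) by (intro CollectI exI[of _ t]) auto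
      then show "\<exists>x'\<in>U. x' ~= 0 \<and> dist x' 0 < d" using t by (intro bexI[of _ "cor t"]) auto
    qed
    show "h z = 0" if "z \<in> U" for z using that r unfolding U_def by blast
  qed
  define Q where "Q a b = F (a + \<i> * b) (cnj (a - \<i> * b))" for a b
  have 1: "Q a (cor t) = 0" if a: "a \<in> ball (- \<i> * t) g \<inter> ball (\<i> * t) g" for a t
  proof -
    \<comment> \<open>The set of a for which both arguments of F stay in the disc; it is convex and
      contains 0, so the identity theorem applies on it.\<close>
    define E where "E = ball (- \<i> * cor t) g \<inter> ball (\<i> * cor t) g"
    have mem: "a \<in> E \<longleftrightarrow> cmod (a + \<i> * t) < g \<and> cmod (a - \<i> * t) < g" for a
      unfolding E_def by (simp add: dist_norm norm_minus_commute[of "- (\<i> * cor t)"] norm_minus_commute[of "\<i> * cor t"])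
    have OE: "open E" unfolding E_def by auto
    have sh: "(%a. Q a t) holomorphic_on E"
      unfolding Q_def
      by (rule sesquiholoD[OF P]) (auto simp: mem E_def[symmetric] simp del: complex_cnj_diff intro!: holomorphic_intros OE)
    have z: "Q (cor s) (cor t) = 0" if "cor s \<in> E" for s
    proof -
      have "cnj (cor s - \<i> * cor t) = cor s + \<i> * cor t" by simp
      then show ?thesis unfolding Q_def using diag that by (simp add: mem)
    qed
    have "0 \<in> E"
    proof -
      have "cmod (a + \<i> * t) < g" "cmod (a - \<i> * t) < g" using a mem[of a] unfolding E_def by auto
      then have "cmod ((a + \<i> * t) - (a - \<i> * t)) < g + g" using norm_triangle_ineq4[of "a + \<i> * t" "a - \<i> * t"] by linarith
      moreover have "(a + \<i> * t) - (a - \<i> * t) = 2 * (\<i> * t)" by simp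
      ultimately have "cmod (\<i> * t) < g" by (simp add: norm_mult)
      then show ?thesis unfolding mem by simp
    qed
    moreover have "connected E" unfolding E_def by (intro convex_connected convex_Int convex_ball)
    ultimately show ?thesis
      using real_zero[OF sh _ _ _ a[folded E_def]] z unfolding E_def by auto
  qed
  have 2: "Q a b = 0" if ab: "cmod (a + \<i> * b) < g" "cmod (a - \<i> * b) < g" for a b
  proof -
    define E where "E = ball (\<i> * a) g \<inter> ball (- \<i> * a) g"
    have mem: "b \<in> E \<longleftrightarrow> cmod (a + \<i> * b) < g \<and> cmod (a - \<i> * b) < g" for b
    proof -
      have "dist (\<i> * a) b = cmod (a + \<i> * b)" "dist (- \<i> * a) b = cmod (a - \<i> * b)"
      proof -
        have "\<i> * a - b = \<i> * (a + \<i> * b)" "- \<i> * a - b = - \<i> * (a - \<i> * b)" by (simp_all add: algebra_simps)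
        then show "dist (\<i> * a) b = cmod (a + \<i> * b)" "dist (- \<i> * a) b = cmod (a - \<i> * b)"
          unfolding dist_norm by (simp_all only: norm_mult norm_minus_cancel norm_ii mult_1)
      qed
      then show ?thesis unfolding E_def by auto
    qed
    have OE: "open E" unfolding E_def by auto
    have sh: "(%b. Q a b) holomorphic_on E"
      unfolding Q_def
      by (rule sesquiholoD[OF P]) (auto simp: mem E_def[symmetric] simp del: complex_cnj_diff intro!: holomorphic_intros OE)
    have z: "Q a (cor t) = 0" if "cor t \<in> E" for t
    proof (rule 1)
      show "a \<in> ball (- \<i> * t) g \<inter> ball (\<i> * t) g"
        using that unfolding mem
        by (simp add: dist_norm norm_minus_commute[of "- (\<i> * cor t)"] norm_minus_commute[of "\<i> * cor t"])
    qed
    have "0 \<in> E"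
    proof -
      have "cmod ((a + \<i> * b) + (a - \<i> * b)) < g + g" using norm_triangle_ineq[of "a + \<i> * b" "a - \<i> * b"] ab by linarith
      moreover have "(a + \<i> * b) + (a - \<i> * b) = 2 * a" by simp
      ultimately have "cmod a < g" by (simp add: norm_mult)
      then show ?thesis unfolding mem by simp
    qed
    moreover have "connected E" unfolding E_def by (intro convex_connected convex_Int convex_ball)
    moreover have "b \<in> E" unfolding mem using ab by blast
    ultimately show ?thesis
      using real_zero[OF sh, of b] z unfolding E_def by auto
  qed
  define a where "a = (x + cnj w) / 2"
  define b where "b = (x - cnj w) / (2 * \<i>)"
  have "a + \<i> * b = x" "a - \<i> * b = cnj w" unfolding a_def b_def by (simp_all add: field_simps)
  then show ?thesis using 2[of a b] z unfolding Q_def by simp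
qed

lemma herm_riesz:
  fixes L :: "'m::finite V => complex"
  assumes L: "clinf L"
  shows "herm x (mk (- \<i> * cnj (L (axis Final 1))) (\<chi> i. cnj (L (axis (Mid i) 1))) (\<i> * cnj (L (axis First 1)))) = L x"
proof -
  have U: "(UNIV :: 'm idx set) = insert First (insert Final (range Mid))" using idx.exhaust by auto
  have "L x = (\<Sum>i\<in>UNIV. x $ i * L (axis i 1))" by (rule clinf_expand[OF L])
  also have "\<dots> = x $ First * L (axis First 1) + (x $ Final * L (axis Final 1) + (\<Sum>i\<in>range Mid. x $ i * L (axis i 1)))"
    unfolding U by (subst sum.insert | simp add: image_iff)+
  also have "(\<Sum>i\<in>range Mid. x $ i * L (axis i 1)) = (\<Sum>i\<in>UNIV. x $ Mid i * L (axis (Mid i) 1))"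
    by (subst sum.reindex) (auto simp: inj_def)
  finally show ?thesis unfolding herm_def by (simp add: algebra_simps)
qed

section \<open>Local classification\<close>

lemma cip_orth_exists:
  fixes v :: "complex^'n::finite"
  assumes "CARD('n) \<ge> 2" obtains e where "e ~= 0" "cip e v = 0"
proof -
  obtain a b :: 'n where ab: "a ~= b"
    using assms card_le_Suc0_iff_eq[of "UNIV :: 'n set"] by fastforce
  show ?thesis
  proof (cases "v $ a = 0")
    case True
    then show ?thesis by (intro that[of "axis a 1"]) (simp_all add: cip_axis)
  next
    case False
    define e where "e = cnj (v $ b) *s axis a 1 - cnj (v $ a) *s axis b 1"
    have "e $ b = - cnj (v $ a)" unfolding e_def using ab by (simp add: axis_def)
    then have "e ~= 0" using False by auto
    moreover have "cip e v = 0" unfolding e_def by (simp add: cip_simps cip_axis)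
    ultimately show ?thesis using that by blast
  qed
qed

lemma open_nonzero:
  fixes f :: "'a::topological_space => 'b::{t1_space, zero}"
  assumes "open S" "continuous_on S f" shows "open {q \<in> S. f q ~= 0}"
proof -
  have "open (S \<inter> f -` (- {0}))" by (rule continuous_open_preimage[OF assms(2,1)]) auto
  moreover have "S \<inter> f -` (- {0}) = {q \<in> S. f q ~= 0}" by auto
  ultimately show ?thesis by simp
qed

lemma (in cr_immersion) cr_immersion_subset:
  assumes "open S'" "S' \<subseteq> S" shows "cr_immersion S' u j"
proof unfold_locales
  show "CR_on S' u" using CR_on_subset[OF CR assms(2)] .
  show "Ck_open 3 S' u" using Ck_open_subset[OF u3 assms(2)] .
qed (use assms comp null imm in auto)

lemma (in cr_split) cr_split_subset:
  assumes "open S'" "S' \<subseteq> S" shows "cr_split S' u j y e0"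
proof -
  interpret I: cr_immersion S' u j by (rule cr_immersion_subset[OF assms])
  show ?thesis
  proof unfold_locales
    show "Ck_open 1 S' y" using Ck_open_subset[OF yC1 assms(2)] .
    show "(\<forall>q\<in>S'. y q = 0) \<or> (\<forall>q\<in>S'. y q ~= 0)" using ycase assms(2) by blast
    show "BB q a b = 0" if "q \<in> S'" "cip a (y q) = 0" "cip b (y q) = 0" for q a b using van that assms(2) by blast
    show "\<exists>r>0. \<forall>a b. cip a (y q) = 0 \<longrightarrow> cip b (y q) = 0 \<longrightarrow>
       herm (BB q (y q) a) (BB q (y q) b) = cor r * cip a b" if "q \<in> S'" "y q ~= 0" for q
      using gram that assms(2) by blast
    show "e0 - (cip e0 (y q) / cip (y q) (y q)) *s y q ~= 0" if "q \<in> S'" for q using e0 that assms(2) by blast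
  qed
qed

text \<open>Constant reference vectors: v0 is transverse to the kernel of \<open>ll\<close>, and x0
  fixes the scale of \<open>MM\<close>. If y vanishes then so does \<open>ll\<close>, and division
  by zero makes \<open>lh\<close> zero.\<close>

locale cr_normal = cr_split S u j y e0
  for S :: "'n::finite heis set" and u :: "'n heis => ('n + 'n) V" and j and y :: "'n heis => complex^'n" and e0 +
  fixes v0 x0 :: "'n V"
  assumes v0: "(\<forall>q\<in>S. y q = 0) \<or> (\<forall>q\<in>S. ll q v0 ~= 0)"
    and x0: "q \<in> S ==> sig q (x0 - (ll q x0 / ll q v0) *s v0) ~= 0"
begin

text \<open>Dividing by values at fixed vectors turns the property of being constant up to scale
  into plain constancy: \<open>ds_lh\<close> and \<open>dv_mh\<close>. The projection
  \<open>xx\<close> along v0 extends the map from the hyperplane to the whole space.\<close>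

definition "lh q x = ll q x / ll q v0"
definition "xx q x = x - lh q x *s v0"
definition "sg q = sig q (xx q x0)"
definition "mh q x = inverse (sg q) *s MM q (xx q x)"

lemma sg_nz: "q \<in> S ==> sg q ~= 0" unfolding sg_def xx_def lh_def by (rule x0)

lemma lh_ll: "q \<in> S ==> lh q x * ll q v0 = ll q x"
proof (cases "ll q v0 = 0")
  assume q: "q \<in> S"
  case True
  then have "y q = 0" using v0 q by blast
  then show ?thesis using ll_0[OF q] by simp
qed (simp add: lh_def)

lemma ll_xx: "q \<in> S ==> ll q (xx q x) = 0" by (simp add: xx_def ll_simps lh_ll)

lemma lh_clin: "clinf (lh q)" by (simp add: clinf_def lh_def ll_simps add_divide_distrib)
lemmas lh_simps = clinf_add[OF lh_clin] clinf_scale[OF lh_clin] clinf_diff[OF lh_clin] clinf_zero[OF lh_clin]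

lemma xx_clin: "clin (xx q)" by (simp add: clin_def xx_def lh_simps vec_eq_iff algebra_simps)

lemma mh_clin: "q \<in> S ==> clin (mh q)"
  by (simp add: clin_def mh_def clin_add[OF xx_clin] clin_scale[OF xx_clin] clin_add[OF MM_clin] clin_scale[OF MM_clin]
    vec.scale_right_distrib mult.commute)

lemma Ck_lh: "Ck_open 1 S (%q. lh q x)"
proof (cases "\<forall>q\<in>S. y q = 0")
  case True
  then show ?thesis by (intro Ck_open_cong[OF S _ Ck_open_const[of 1 S 0]]) (simp add: lh_def ll_0)
next
  case False
  then show ?thesis unfolding lh_def by (intro Ck_intros Ck_ll) (use v0 in blast)
qed

lemma Ck_xx: "Ck_open 1 S (%q. xx q x)" unfolding xx_def by (intro Ck_intros Ck_lh)

lemma Ck_MM_xx: "Ck_open 1 S (%q. MM q (xx q x))"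
  by (rule Ck_clin_family[OF S MM_clin Ck_MM Ck_xx])

lemma sg_MM: "q \<in> S ==> sg q = MM q (xx q x0) $ j" by (simp add: MM_component sg_def)

lemma Ck_sg: "Ck_open 1 S sg"
  by (rule Ck_open_cong[OF S _ Ck_open_comp_linear[OF S bounded_linear_vec_nth[of j] Ck_MM_xx[of x0]]]) (simp add: sg_MM)

lemma Ck_mh: "Ck_open 1 S (%q. mh q x)"
  unfolding mh_def by (intro Ck_intros Ck_open_inverse[OF S Ck_sg sg_nz] Ck_MM_xx)

lemma ds_lh:
  assumes p: "p \<in> S" and d: "allowed p r" shows "ds (%q. lh q x) p r = 0"
proof (cases "\<forall>q\<in>S. y q = 0")
  case True
  then show ?thesis by (intro ds_zero_on[OF S p]) (simp add: lh_def ll_0)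
next
  case False
  then have nz: "ll p v0 ~= 0" using v0 p by blast
  define c where "c = lh p x"
  have "ds (%q. ll q x) p r = ds (%q. ll q (xx p x) + c * ll q v0) p r"
    by (rule ds_cong_on[OF S p]) (simp_all add: xx_def c_def ll_simps C1_diff[OF Ck_ll p])
  also have "\<dots> = c * ds (%q. ll q v0) p r"
    by (simp add: ds_add ds_mult C1_diff[OF Ck_ll p] ll_deriv[OF p ll_xx[OF p] d])
  finally have 1: "ds (%q. ll q x) p r = c * ds (%q. ll q v0) p r" .
  have "ds (%q. ll q x) p r = ds (%q. lh q x * ll q v0) p r"
    by (rule ds_cong_on[OF S p]) (use C1_diff[OF Ck_ll p] C1_diff[OF Ck_lh p] in \<open>simp_all add: lh_ll differentiable_mult\<close>)
  also have "\<dots> = ds (%q. lh q x) p r * ll p v0 + c * ds (%q. ll q v0) p r"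
    by (simp add: ds_mult C1_diff[OF Ck_ll p] C1_diff[OF Ck_lh p] c_def)
  finally show ?thesis using 1 nz by simp
qed

lemma dv_MM_xx:
  assumes p: "p \<in> S" and d: "allowed p r"
  shows "dv (%q. MM q (xx q x)) p r = - sig p (dht p r) *s MM p (xx p x)"
proof -
  have "dv (%q. xx q x) p r = 0"
    unfolding xx_def by (simp add: dv_diff dv_scale vec_scale_diff C1_diff[OF Ck_lh p] ds_lh[OF p d])
  then show ?thesis
    by (subst dv_clin_family[OF S p MM_clin C1_diff[OF Ck_MM p] C1_diff[OF Ck_xx p]])
      (simp_all add: MM_deriv[OF p ll_xx[OF p] d] clin_zero[OF MM_clin[OF p]])
qed

lemma dv_mh:
  assumes p: "p \<in> S" and d: "allowed p r" shows "dv (%q. mh q x) p r = 0"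
proof -
  define c where "c = - sig p (dht p r)"
  have "dv (%q. MM q (xx q x)) p r = dv (%q. sg q *s mh q x) p r"
    by (rule dv_cong_on[OF S p, symmetric])
      (simp_all add: mh_def sg_nz vec_scale_diff C1_diff[OF Ck_MM_xx p])
  also have "\<dots> = ds sg p r *s mh p x + sg p *s dv (%q. mh q x) p r"
    by (rule dv_scale[OF C1_diff[OF Ck_sg p] C1_diff[OF Ck_mh p]])
  finally have 1: "c *s MM p (xx p x) = ds sg p r *s mh p x + sg p *s dv (%q. mh q x) p r"
    unfolding dv_MM_xx[OF p d] c_def .
  have "ds sg p r = ds (%q. MM q (xx q x0) $ j) p r"
  proof (rule ds_cong_on[OF S p])
    show "(%q. MM q (xx q x0) $ j) differentiable (at p)"
      by (rule C1_diff[OF Ck_open_comp_linear[OF S bounded_linear_vec_nth Ck_MM_xx] p])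
  qed (simp add: sg_MM)
  also have "\<dots> = dv (%q. MM q (xx q x0)) p r $ j"
    by (subst ds_has[OF bounded_linear.has_derivative[OF bounded_linear_vec_nth FD_works[OF C1_diff[OF Ck_MM_xx p]]]])
      (simp add: dv_def)
  also have "\<dots> = c * sg p" by (simp add: dv_MM_xx[OF p d] c_def sg_MM[OF p])
  finally have 2: "ds sg p r = c * sg p" .
  have "sg p *s mh p x = MM p (xx p x)" using sg_nz[OF p] by (simp add: mh_def)
  then have "c *s MM p (xx p x) = c *s MM p (xx p x) + sg p *s dv (%q. mh q x) p r"
    using 1 unfolding 2 by (simp only: vec.scale_scale[symmetric])
  then show ?thesis using sg_nz[OF p] by simp
qed

lemma allowed_xx: "p \<in> S ==> allowed p (holo p (xx p z))" "allowed p (anti p w)"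
  unfolding allowed_def using ll_xx by blast+

text \<open>Derivatives along (0,1) vectors vanish, and a (1,0) vector acts only through its v0
  component. So the differential is a multiple of one complex-valued form, the same for every x and
  for \<open>mh\<close>.\<close>

lemma lh_has_derivative:
  assumes p: "p \<in> S"
  shows "((%q. lh q x) has_derivative (%Y. ds (%q. lh q x) p (holo p v0) * lh p (dheis p Y))) (at p)"
proof -
  have d: "(%q. lh q x) differentiable (at p)" by (rule C1_diff[OF Ck_lh p])
  have "FD (%q. lh q x) p Y = ds (%q. lh q x) p (holo p v0) * lh p (dheis p Y)" for Y
  proof -
    have e: "dheis p Y = xx p (dheis p Y) + lh p (dheis p Y) *s v0" by (simp add: xx_def)
    have "FD (%q. lh q x) p Y = ds (%q. lh q x) p (holo p (dheis p Y))"
      by (simp add: frechet_holo_anti_s[OF d] ds_lh[OF p allowed_xx(2)])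
    also have "\<dots> = ds (%q. lh q x) p (holo p (xx p (dheis p Y) + lh p (dheis p Y) *s v0))" using e by simp
    also have "\<dots> = lh p (dheis p Y) * ds (%q. lh q x) p (holo p v0)"
      by (simp only: ds_holo_add[OF d] ds_holo_scale[OF d] ds_lh[OF p allowed_xx(1)[OF p]]) simp
    finally show ?thesis by simp
  qed
  then have "FD (%q. lh q x) p = (%Y. ds (%q. lh q x) p (holo p v0) * lh p (dheis p Y))" by (rule ext)
  then show ?thesis using FD_works[OF d] by simp
qed

lemma mh_has_derivative:
  assumes p: "p \<in> S"
  shows "((%q. mh q x) has_derivative (%Y. lh p (dheis p Y) *s dv (%q. mh q x) p (holo p v0))) (at p)"
proof -
  have d: "(%q. mh q x) differentiable (at p)" by (rule C1_diff[OF Ck_mh p])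
  have "FD (%q. mh q x) p Y = lh p (dheis p Y) *s dv (%q. mh q x) p (holo p v0)" for Y
  proof -
    have e: "dheis p Y = xx p (dheis p Y) + lh p (dheis p Y) *s v0" by (simp add: xx_def)
    have "FD (%q. mh q x) p Y = dv (%q. mh q x) p (holo p (dheis p Y))"
      by (simp add: frechet_holo_anti[OF d] dv_mh[OF p allowed_xx(2)])
    also have "\<dots> = dv (%q. mh q x) p (holo p (xx p (dheis p Y) + lh p (dheis p Y) *s v0))" using e by simp
    also have "\<dots> = lh p (dheis p Y) *s dv (%q. mh q x) p (holo p v0)"
      by (simp only: dv_holo_add[OF d] dv_holo_scale[OF d] dv_mh[OF p allowed_xx(1)[OF p]]) simp
    finally show ?thesis .
  qed
  then have "FD (%q. mh q x) p = (%Y. lh p (dheis p Y) *s dv (%q. mh q x) p (holo p v0))" by (rule ext)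
  then show ?thesis using FD_works[OF d] by simp
qed

lemma lh_heis: "q \<in> S ==> lh q (heis q) = 0" by (simp add: lh_def coord_heis)

lemma u_mh: "q \<in> S ==> u q = sg q *s mh q (heis q)"
  by (simp add: mh_def sg_nz xx_def lh_heis MM_heis)

lemma mh_gram:
  assumes q: "q \<in> S"
  shows "herm (mh q x) (mh q x') = cor (Re (Lam q) / (cmod (sg q))\<^sup>2) * herm (xx q x) (xx q x')"
proof -
  have "herm (mh q x) (mh q x') = (inverse (sg q) * cnj (inverse (sg q))) * (Lam q * herm (xx q x) (xx q x'))"
    unfolding mh_def by (simp add: herm_simps MM_gram[OF q ll_xx[OF q] ll_xx[OF q]])
  also have "Lam q = cor (Re (Lam q))" by (rule Lam_Re[OF q])
  finally show ?thesis unfolding mult_cnj_cmod by (simp add: norm_inverse power_inverse divide_inverse)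
qed

end

context cr_immersion begin

text \<open>With y = 0 the form \<open>lh\<close> vanishes and \<open>mh\<close> is locally
  constant; its value is the linear map.\<close>

lemma local_linear:
  assumes p0: "p0 \<in> S" and B: "!!q a b. q \<in> S ==> BB q a b = 0"
  obtains W m where "open W" "p0 \<in> W" "W \<subseteq> S" "clin m" "inj m" "!!q. q \<in> W ==> \<exists>c. u q = c *s m (heis q)"
proof -
  define e0 :: "complex^'n" where "e0 = axis undefined 1"
  have e0: "e0 ~= 0" unfolding e0_def by simp
  interpret A: cr_split S u j "%_. 0" e0
    by unfold_locales (use e0 in \<open>simp_all add: B Ck_open_const\<close>)
  define S' where "S' = {q \<in> S. A.sig q (heis p0) ~= 0}"
  have "continuous_on S (%q. A.sig q (heis p0))" by (rule Ck_open_continuous[OF A.Ck_sig])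
  then have oS: "open S'" unfolding S'_def by (rule open_nonzero[OF S])
  have sub: "S' \<subseteq> S" unfolding S'_def by blast
  have p0': "p0 \<in> S'" unfolding S'_def using p0 by (simp add: A.coord_heis)
  interpret A': cr_split S' u j "%_. 0" e0 by (rule A.cr_split_subset[OF oS sub])
  interpret N: cr_normal S' u j "%_. 0" e0 0 "heis p0"
    by unfold_locales (simp_all add: A'.ll_0, simp add: S'_def)
  obtain r where r: "r > 0" "ball p0 r \<subseteq> S'" using oS p0' openE by blast
  have lh0: "N.lh q x = 0" if "q \<in> S'" for q x using that by (simp add: N.lh_def A'.ll_0)
  have const: "N.mh q x = N.mh p0 x" if q: "q \<in> ball p0 r" for q x
  proof -
    have "((%q. N.mh q x) has_derivative (%Y. 0)) (at q within ball p0 r)" if "q \<in> ball p0 r" for q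
    proof -
      have "q \<in> S'" using that r by blast
      then show ?thesis
        using N.mh_has_derivative[of q x] lh0[of q] by (simp add: has_derivative_at_withinI)
    qed
    from has_derivative_zero_constant[OF convex_ball this]
    obtain c where c: "!!q. q \<in> ball p0 r ==> N.mh q x = c" by auto
    show ?thesis using c[OF q] c[of p0] r by simp
  qed
  show ?thesis
  proof (rule that[of "ball p0 r" "N.mh p0"])
    show "ball p0 r \<subseteq> S" using r sub by blast
    show "\<exists>c. u q = c *s N.mh p0 (heis q)" if "q \<in> ball p0 r" for q
      using N.u_mh[of q] const[OF that] that r by (metis subsetD)
    show "clin (N.mh p0)" by (rule N.mh_clin[OF p0'])
    then show "inj (N.mh p0)"
    proof (rule clin_injI)
      fix x assume x: "N.mh p0 x = 0"
      show "x = 0"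
      proof (rule herm_nondeg)
        fix z
        have "cor (Re (Lam p0) / (cmod (N.sg p0))\<^sup>2) * herm (N.xx p0 x) (N.xx p0 z) = 0"
          using N.mh_gram[OF p0', of x z] x by (simp add: herm_simps)
        then show "herm x z = 0" using Lam_pos[OF p0] N.sg_nz[OF p0'] by (simp add: N.xx_def lh0[OF p0'])
      qed
    qed
  qed (use r in auto)
qed

end

section \<open>The Whitney form near a point with non-zero second fundamental form\<close>

lemma heis_nz [simp]: "heis p ~= 0"
proof
  assume "heis p = 0"
  then have "heis p $ First = 0" by simp
  then show False by (simp only: First_frame) simp
qed

lemma C1_frechet_continuous: "Ck_open 1 S f ==> continuous_on S (%x. FD f x v)"
  by simp

context cr_immersion begin

text \<open>Together with \<open>BB_span\<close> this shows that, near a point where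
  \<open>BB\<close> is non-zero, no non-zero vector is orthogonal to all values of u.\<close>

lemma herm_zero_jets:
  assumes W: "open W" "W \<subseteq> S" and v: "!!q. q \<in> W ==> herm v (u q) = 0" and q: "q \<in> W"
  shows "herm v (phi1 q x) = 0" "herm v (phi2 q x y) = 0"
proof -
  have bl: "bounded_linear (herm v)" by (rule bounded_bilinear.bounded_linear_right[OF bounded_bilinear_herm])
  have der: "herm v (f' Y) = 0" if f: "(f has_derivative f') (at q)" and z: "!!q. q \<in> W ==> herm v (f q) = 0" and q: "q \<in> W"
    for f :: "'n heis => ('n + 'n) V" and f' q Y
  proof -
    have "((%q. herm v (f q)) has_derivative (%Y. 0)) (at q)"
      by (rule has_derivative_transform_within_open[OF has_derivative_const W(1) q]) (simp add: z)
    from has_derivative_unique[OF bounded_linear.has_derivative[OF bl f] this] show ?thesis by (rule fun_cong)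
  qed
  have 1: "herm v (phi1 q x) = 0" if q: "q \<in> W" for q x
  proof (rule frame_induct[of "%x. herm v (phi1 q x) = 0" q])
    have qS: "q \<in> S" using q W by blast
    show "herm v (phi1 q (dheis q Y)) = 0" for Y by (rule der[OF u_deriv[OF qS] v q])
  qed (use q W in \<open>auto simp: phi_simps herm_simps\<close>)
  show "herm v (phi1 q x) = 0" by (rule 1[OF q])
  show "herm v (phi2 q x y) = 0"
  proof (rule frame_induct[of "%y. herm v (phi2 q x y) = 0" q])
    have qS: "q \<in> S" using q W by blast
    show "herm v (phi2 q x (dheis q Y)) = 0" for Y by (rule der[OF phi1_deriv[OF qS] 1 q])
  qed (use q W 1[OF q] in \<open>auto simp: phi_simps herm_simps\<close>)
qed

end

lemma (in cr_normal) ll_EE: "p \<in> S ==> ll p (EE p z) = cip z (y p) / cip (y p) (y p)"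
  using coord_Ehat(1)[of p z] by (simp add: Ehat_def ll_simps coord_heis)

text \<open>Differentiating the identity \<open>lh q (heis q) = 0\<close> towards v0, the motion of
  \<open>heis\<close> contributes \<open>lh p v0 = 1\<close>.\<close>

lemma (in cr_normal) lh_heis_deriv:
  assumes p: "p \<in> S" and nz: "ll p v0 ~= 0"
  shows "ds (%q. lh q (heis p)) p (holo p v0) = - 1"
proof -
  have "ds (%q. lh q (heis q)) p (holo p v0) = 0" by (rule ds_zero_on[OF S p]) (rule lh_heis)
  moreover have "ds (%q. lh q (heis q)) p (holo p v0) = ds (%q. lh q (heis p)) p (holo p v0) + lh p (dv heis p (holo p v0))"
    by (rule ds_clinf_family[OF S p lh_clin C1_diff[OF Ck_lh p] heis_diff])
  moreover have "lh p v0 = 1" using nz by (simp add: lh_def)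
  ultimately show ?thesis by (simp add: dv_heis dht_holo lh_simps lh_heis[OF p] eq_neg_iff_add_eq_0)
qed

lemma nonzero_near:
  fixes F :: "complex => complex => complex"
  assumes "d > 0" "continuous_on (ball 0 d \<times> ball 0 d) (%(z, w). F z w)" "F 0 0 ~= 0"
  obtains d' where "0 < d'" "d' \<le> d" "!!z w. z \<in> ball 0 d' ==> w \<in> ball 0 d' ==> F z w ~= 0"
proof -
  define U where "U = {x \<in> ball 0 d \<times> ball 0 d. (%(z, w). F z w) x ~= 0}"
  have "open U" unfolding U_def by (rule open_nonzero[OF open_Times[OF open_ball open_ball] assms(2)])
  moreover have "(0, 0) \<in> U" unfolding U_def using assms by simp
  ultimately obtain A B where AB: "open A" "open B" "0 \<in> A" "0 \<in> B" "A \<times> B \<subseteq> U" using open_prod_elim by (metis mem_Sigma_iff)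
  have "open (A \<inter> B \<inter> ball 0 d)" "0 \<in> A \<inter> B \<inter> ball 0 d" using AB assms(1) by auto
  then obtain e where e: "e > 0" "ball 0 e \<subseteq> A \<inter> B \<inter> ball 0 d" using openE by blast
  show ?thesis
  proof (rule that[of "min e d"])
    fix z w :: complex assume "z \<in> ball 0 (min e d)" "w \<in> ball (0::complex) (min e d)"
    then have "z \<in> ball 0 e" "w \<in> ball 0 e" by auto
    then have "(z, w) \<in> U" using e AB(5) by blast
    then show "F z w ~= 0" unfolding U_def by simp
  qed (use e assms in auto)
qed

lemma continuous_on_herm_pair:
  assumes "continuous_on A F" "continuous_on B G"
  shows "continuous_on (A \<times> B) (%(z, w). herm (F z) (G w))"
proof -
  have "continuous_on (A \<times> B) (%x. herm (F (fst x)) (G (snd x)))"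
    by (intro bounded_bilinear.continuous_on[OF bounded_bilinear_herm] continuous_on_compose2[OF assms(1)]
      continuous_on_compose2[OF assms(2)] continuous_intros) auto
  then show ?thesis by (simp add: case_prod_beta')
qed

lemma continuous_on_vec:
  fixes F :: "'a::topological_space => complex^'k::finite"
  assumes "!!i. continuous_on A (%z. F z $ i)" shows "continuous_on A F"
  using continuous_on_vec_lambda[of A "%i z. F z $ i"] assms by simp

context cr_immersion begin

theorem local_whitney:
  assumes n2: "CARD('n) \<ge> 2" and p0: "p0 \<in> S" and nz: "BB p0 a b ~= 0"
  obtains W T A where "open W" "p0 \<in> W" "W \<subseteq> S" "isom T" "isom A"
    "!!q. q \<in> W ==> \<exists>c. T (u q) = c *s wq (A (heis q))"
proof -
  obtain c where c: "cip c c = 1" "BB p0 c c ~= 0" using BB_polar[OF p0 nz] by blast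
  define y where "y = yv c"
  obtain e0 where e0: "e0 ~= 0" "cip e0 (y p0) = 0" using cip_orth_exists[OF n2] by blast
  \<comment> \<open>Near p0 the value \<open>BB q c c\<close> stays non-zero, and y becomes a
    nowhere vanishing C^1 field.\<close>
  define S1 where "S1 = {q \<in> S. BB q c c ~= 0}"
  have S1: "open S1" "S1 \<subseteq> S" "p0 \<in> S1" unfolding S1_def
    using open_nonzero[OF S Ck_open_continuous[OF Ck_BB[OF Ck_open_const Ck_open_const]]] p0 c by auto
  interpret I1: cr_immersion S1 u j by (rule cr_immersion_subset[OF S1(1,2)])
  have y1: "Ck_open 1 S1 y" unfolding y_def by (rule I1.Ck_yv)
  have yn: "y q ~= 0" if "q \<in> S1" for q unfolding y_def using yv_properties(1)[of q c] c(1) that by (auto simp: S1_def)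
  define S2 where "S2 = {q \<in> S1. e0 - (cip e0 (y q) / cip (y q) (y q)) *s y q ~= 0}"
  have C1: "Ck_open 1 S1 (%q. e0 - (cip e0 (y q) / cip (y q) (y q)) *s y q)"
    by (intro I1.Ck_intros y1) (simp add: cip_self_eq_0 yn)
  have S2: "open S2" "S2 \<subseteq> S1" "p0 \<in> S2"
    using open_nonzero[OF S1(1) Ck_open_continuous[OF C1]] S1(3) e0 unfolding S2_def by auto
  interpret I2: cr_immersion S2 u j by (rule I1.cr_immersion_subset[OF S2(1,2)])
  have S2S: "q \<in> S2 ==> q \<in> S \<and> BB q c c ~= 0" for q using S2(2) unfolding S1_def by blast
  interpret A2: cr_split S2 u j y e0
  proof unfold_locales
    show "Ck_open 1 S2 y" by (rule Ck_open_subset[OF y1 S2(2)])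
    show "(\<forall>q\<in>S2. y q = 0) \<or> (\<forall>q\<in>S2. y q ~= 0)" using yn S2 by blast
    show "BB q a b = 0" if "q \<in> S2" "cip a (y q) = 0" "cip b (y q) = 0" for q a b
      using yv_properties(2)[of q c a b] S2S[OF that(1)] c(1) that unfolding y_def by blast
    show "\<exists>rh>0. \<forall>a b. cip a (y q) = 0 \<longrightarrow> cip b (y q) = 0 \<longrightarrow>
       herm (BB q (y q) a) (BB q (y q) b) = cor rh * cip a b" if "q \<in> S2" for q
      using yv_properties(3)[of q c] S2S[OF that] c(1) unfolding y_def by blast
    show "e0 - (cip e0 (y q) / cip (y q) (y q)) *s y q ~= 0" if "q \<in> S2" for q using that unfolding S2_def by blast
  qed
  define v0 where "v0 = A2.yh p0"
  \<comment> \<open>With this x0 the function \<open>g = lh x0\<close> vanishes at p0 and has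
    surjective differential there, so it serves as the complex parameter.\<close>
  define x0 :: "'n V" where "x0 = heis p0"
  have v0: "A2.ll p0 v0 = 1" unfolding v0_def using A2.coord_yh(1)[OF S2(3)] yn S2 by blast
  define S3 where "S3 = {q \<in> S2. A2.ll q v0 ~= 0}"
  have S3: "open S3" "S3 \<subseteq> S2" "p0 \<in> S3" unfolding S3_def
    using open_nonzero[OF S2(1) Ck_open_continuous[OF A2.Ck_ll]] S2(3) v0 by auto
  interpret A3: cr_split S3 u j y e0 by (rule A2.cr_split_subset[OF S3(1,2)])
  define S4 where "S4 = {q \<in> S3. A2.sig q x0 - (A2.ll q x0 / A2.ll q v0) * A2.sig q v0 ~= 0}"
  have C3: "Ck_open 1 S3 (%q. A2.sig q x0 - (A2.ll q x0 / A2.ll q v0) * A2.sig q v0)"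
    by (intro A3.Ck_intros A3.Ck_sig A3.Ck_ll) (simp add: S3_def)
  have S4: "open S4" "S4 \<subseteq> S3" "p0 \<in> S4"
    using open_nonzero[OF S3(1) Ck_open_continuous[OF C3]] S3(3) A2.coord_heis[OF S2(3)] unfolding S4_def by (auto simp: x0_def)
  interpret A4: cr_split S4 u j y e0 by (rule A3.cr_split_subset[OF S4(1,2)])
  interpret N: cr_normal S4 u j y e0 v0 x0
  proof unfold_locales
    show "(\<forall>q\<in>S4. y q = 0) \<or> (\<forall>q\<in>S4. A4.ll q v0 ~= 0)" using S4(2) unfolding S3_def by blast
    show "A4.sig q (x0 - (A4.ll q x0 / A4.ll q v0) *s v0) ~= 0" if "q \<in> S4" for q
      using that unfolding A4.sig_simps(2,4)[OF that] S4_def by blast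
  qed
  have lv0: "A4.ll q v0 ~= 0" if "q \<in> S4" for q using that S4(2) unfolding S3_def by blast
  define g where "g q = N.lh q x0" for q
  define r where "r q = ds g q (holo q v0)" for q
  have dg: "FD g q Y = r q * N.lh q (dheis q Y)" if "q \<in> S4" for q Y
    unfolding r_def g_def[abs_def] by (rule FD_apply[OF N.lh_has_derivative[OF that]])
  have r0: "r p0 = - 1"
    unfolding r_def g_def[abs_def] x0_def by (rule N.lh_heis_deriv[OF S4(3) lv0[OF S4(3)]])
  have lhE: "N.lh p0 (EE p0 ze) = cip ze (y p0) / cip (y p0) (y p0)" for ze
    by (simp add: N.lh_def N.ll_EE[OF S4(3)] v0)
  have y0: "cip (y p0) (y p0) ~= 0" using yn[OF S1(3)] by (simp add: cip_self_eq_0)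
  have dg0: "FD g p0 (hor p0 (w *s y p0)) = - w" for w
    unfolding dg[OF S4(3)] r0 dheis_hor lhE using y0 by (simp add: cip_simps)
  define S5 where "S5 = {q \<in> S4. FD g q (hor p0 (1 *s y p0)) ~= 0}"
  have gC: "Ck_open 1 S4 g" unfolding g_def[abs_def] by (rule N.Ck_lh)
  then have "continuous_on S4 (%q. FD g q (hor p0 (1 *s y p0)))" by (rule C1_frechet_continuous)
  then have S5: "open S5" "S5 \<subseteq> S4" "p0 \<in> S5"
    unfolding S5_def using open_nonzero[OF S4(1)] S4(3) dg0[of 1] by auto
  have r: "r q ~= 0" if "q \<in> S5" for q using that dg[of q] unfolding S5_def by auto
  have sg: "surj (FD g p0)"
    by (rule surjI[of _ "%w. hor p0 (- w *s y p0)"]) (simp only: dg0, simp)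
  have g0: "g p0 = 0" unfolding g_def x0_def by (rule N.lh_heis[OF S4(3)])
  obtain W d t where W: "open W" "p0 \<in> W" "W \<subseteq> S5" and d: "d > 0" and gW: "!!q. q \<in> W ==> g q \<in> ball 0 d"
    and t: "!!w. w \<in> ball 0 d ==> t w \<in> W \<and> g (t w) = w"
    and F1: "!!F a q. (!!q. q \<in> S5 ==> (F has_derivative (%Y. a q * FD g q Y)) (at q)) ==> q \<in> W ==> F q = F (t (g q))"
    and F2: "!!F a. (!!q. q \<in> S5 ==> (F has_derivative (%Y. a q * FD g q Y)) (at q)) ==>
        (%w. F (t w)) holomorphic_on ball 0 d"
  proof (rule straighten[OF S5(1,3) Ck_open_subset[OF gC S5(2)] sg, unfolded g0])
    fix W d t assume *: "open W" "p0 \<in> W" "W \<subseteq> S5" "d > 0" "!!q. q \<in> W ==> g q \<in> ball 0 d"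
      "!!w. w \<in> ball 0 d ==> t w \<in> W \<and> g (t w) = w"
      "!!F a q. (!!q. q \<in> S5 ==> (F has_derivative (%Y. a q * FD g q Y)) (at q)) ==> q \<in> W ==> F q = F (t (g q))"
      "!!F a. (!!q. q \<in> S5 ==> (F has_derivative (%Y. a q * FD g q Y)) (at q)) ==>
        (%w. F (t w)) holomorphic_on ball 0 d"
    show thesis by (rule that[OF *])
  qed
  have t4: "t w \<in> S4" if "w \<in> ball 0 d" for w using t[OF that] W S5 by blast
  have W4: "q \<in> S4" if "q \<in> W" for q using that W S5 by blast
  define L where "L w x = N.lh (t w) x" for w x
  define M where "M w x = N.mh (t w) x" for w x
  define xw where "xw w x = N.xx (t w) x" for w x
  have dl: "((%q. N.lh q x) has_derivative (%Y. ds (%q. N.lh q x) q (holo q v0) / r q * FD g q Y)) (at q)"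
    if q: "q \<in> S5" for q x
    using N.lh_has_derivative[of q x] r[OF q] q S5(2) by (simp add: dg subsetD)
  have dm: "((%q. N.mh q x $ i) has_derivative (%Y. dv (%q. N.mh q x) q (holo q v0) $ i / r q * FD g q Y)) (at q)"
    if q: "q \<in> S5" for q x i
    using bounded_linear.has_derivative[OF bounded_linear_vec_nth N.mh_has_derivative[of q x], of i] r[OF q] q S5(2)
    by (simp add: dg subsetD mult.commute)
  have L1: "N.lh q x = L (g q) x" if "q \<in> W" for q x unfolding L_def by (rule F1[OF dl that])
  have M1: "N.mh q x = M (g q) x" if "q \<in> W" for q x
    unfolding M_def vec_eq_iff by (intro allI F1[OF dm that])
  have L2: "(%w. L w x) holomorphic_on ball 0 d" for x unfolding L_def by (rule F2[OF dl])
  have M2: "(%w. M w x $ i) holomorphic_on ball 0 d" for x i unfolding M_def by (rule F2[OF dm])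
  have xw: "xw w x = x - L w x *s v0" for w x unfolding xw_def L_def N.xx_def ..
  have X2: "(%w. xw w x $ i) holomorphic_on ball 0 d" for x i
    unfolding xw using L2[of x] by (auto intro!: holomorphic_intros)
  have Lc: "clinf (L w)" for w unfolding L_def by (rule N.lh_clin)
  have Mc: "clin (M w)" if "w \<in> ball 0 d" for w unfolding M_def by (rule N.mh_clin[OF t4[OF that]])
  have Lv: "L w v0 = 1" "L w x0 = w" if "w \<in> ball 0 d" for w
  proof -
    show "L w v0 = 1" unfolding L_def N.lh_def using lv0[OF t4[OF that]] by simp
    show "L w x0 = w" unfolding L_def using t[OF that] unfolding g_def by simp
  qed
  define k where "k w = mk (- \<i> * cnj (L w (axis Final 1))) (\<chi> i. cnj (L w (axis (Mid i) 1))) (\<i> * cnj (L w (axis First 1)))" for w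
  have k: "herm x (k w) = L w x" for x w unfolding k_def by (rule herm_riesz[OF Lc])
  have diag: "herm (M w x) (M w x') = cor (Re (Lam (t w)) / (cmod (N.sg (t w)))\<^sup>2) * herm (xw w x) (xw w x')"
    if "w \<in> ball 0 d" for w x x'
    unfolding M_def xw_def by (rule N.mh_gram[OF t4[OF that]])
  have rpos: "Re (Lam (t w)) / (cmod (N.sg (t w)))\<^sup>2 > 0" if "w \<in> ball 0 d" for w
    using A4.Lam_pos[OF t4[OF that]] N.sg_nz[OF t4[OF that]] by simp
  \<comment> \<open>A vector of the hyperplane at p0 with non-zero norm; comparing its images gives
    the factor \<open>rh\<close> for pairs of different parameters.\<close>
  define f where "f = Ehat p0 (A4.ee p0)"
  define H where "H w w' = herm (xw w f) (xw w' f)" for w w'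
  have z0: "(0::complex) \<in> ball 0 d" using d by simp
  have p0W: "L 0 x = N.lh p0 x" for x using L1[OF W(2)] g0 by simp
  have H0: "H 0 0 ~= 0"
  proof -
    have "A4.ll p0 f = 0" unfolding f_def by (simp add: A4.coord_Ehat S4(3) A4.ee_perp)
    then have "xw 0 f = f" unfolding xw p0W by (simp add: N.lh_def)
    then show ?thesis unfolding H_def f_def using A4.cip_ee_nz[OF S4(3)] by (simp add: Ehat_def herm_simps)
  qed
  \<comment> \<open>Otherwise \<open>k w\<close>, being orthogonal to the null vector
    \<open>heis q\<close>, would be a multiple of it, and \<open>L w\<close> would vanish at
    \<open>yh\<close>.\<close>
  have kpos: "Re (herm (k w) (k w)) > 0" if w: "w \<in> ball 0 d" for w
  proof (rule ccontr)
    assume n: "\<not> ?thesis"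
    define q where "q = t w"
    have q: "q \<in> S4" unfolding q_def by (rule t4[OF w])
    have "herm (heis q) (k w) = 0" unfolding k L_def q_def[symmetric] by (rule N.lh_heis[OF q])
    then have "herm (k w) (heis q) = 0" using herm_cnj[of "heis q" "k w"] by simp
    moreover have "heis q ~= 0" by simp
    ultimately obtain c where c: "k w = c *s heis q" using lorentz[of "heis q" "k w"] n by auto
    have "L w (A4.yh q) = cnj c * cN q (A4.yh q)" unfolding k[symmetric] c cN_def by (simp add: herm_simps)
    also have "\<dots> = 0" by (simp add: A4.yh_def)
    finally have "A4.ll q (A4.yh q) = 0" unfolding L_def q_def[symmetric] N.lh_def using lv0[OF q] by simp
    moreover have "y q ~= 0" using yn q S4(2) S3(2) S2(2) by blast
    ultimately show False using A4.coord_yh(1)[OF q] by simp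
  qed
  have kcont: "continuous_on (ball 0 d) k"
  proof -
    have "continuous_on (ball 0 d) (%w. L w x)" for x by (rule holomorphic_on_imp_continuous_on[OF L2])
    then have "continuous_on (ball 0 d) (%w. (- \<i> * cnj (L w (axis Final 1)), (\<chi> i. cnj (L w (axis (Mid i) 1))), \<i> * cnj (L w (axis First 1))))"
      by (intro continuous_intros continuous_on_vec_lambda)
    from bounded_linear.continuous_on[OF mk_bounded_linear this] show ?thesis unfolding k_def[abs_def] by simp
  qed
  have xcont: "continuous_on (ball 0 d) (%w. xw w x)" for x
    by (rule continuous_on_vec) (rule holomorphic_on_imp_continuous_on[OF X2])
  have Mcont: "continuous_on (ball 0 d) (%w. M w x)" for x
    by (rule continuous_on_vec) (rule holomorphic_on_imp_continuous_on[OF M2])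
  have "continuous_on (ball 0 d \<times> ball 0 d) (%(z, w). herm (k z) (k w) * H z w)"
    using continuous_on_mult[OF continuous_on_herm_pair[OF kcont kcont] continuous_on_herm_pair[OF xcont[of f] xcont[of f]]]
    unfolding H_def by (simp add: case_prod_beta')
  moreover have "herm (k 0) (k 0) * H 0 0 ~= 0" using kpos[OF z0] H0 by auto
  ultimately obtain d' where d': "0 < d'" "d' \<le> d"
    and nz': "!!z w. z \<in> ball 0 d' ==> w \<in> ball 0 d' ==> herm (k z) (k w) * H z w ~= 0"
    using nonzero_near[of d "%z w. herm (k z) (k w) * H z w"] d by blast
  define D where "D = ball (0::complex) d'"
  have D: "w \<in> ball 0 d" if "w \<in> D" for w using that d' unfolding D_def by auto
  have nzD: "herm (k z) (k w) ~= 0" "H z w ~= 0" if "z \<in> D" "w \<in> D" for z w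
    using nz'[of z w] that unfolding D_def by auto
  define rh where "rh z w = herm (M z f) (M w f) / H z w" for z w
  define W' where "W' = W \<inter> g -` D"
  have W': "open W'" "p0 \<in> W'" "W' \<subseteq> S"
  proof -
    have "continuous_on W g" using Ck_open_continuous[OF gC] continuous_on_subset W S5 by blast
    then show "open W'" unfolding W'_def D_def using W(1) by (intro continuous_open_preimage) auto
    show "p0 \<in> W'" unfolding W'_def D_def using W g0 d' by simp
    show "W' \<subseteq> S" unfolding W'_def using W(3) S5(2) S4(2) S3(2) S2(2) S1(2) by blast
  qed
  have uM: "u q = N.sg q *s M (g q) (heis q)" "g q \<in> D" "L (g q) (heis q) = 0" if "q \<in> W'" for q
  proof -
    have q: "q \<in> W" "q \<in> S4" using that W4 unfolding W'_def by auto
    show "g q \<in> D" using that unfolding W'_def by simp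
    show "u q = N.sg q *s M (g q) (heis q)" unfolding M1[OF q(1), symmetric] by (rule N.u_mh[OF q(2)])
    show "L (g q) (heis q) = 0" unfolding L1[OF q(1), symmetric] by (rule N.lh_heis[OF q(2)])
  qed
  interpret F: hyperplane_family D k M rh
  proof unfold_locales
    show "CARD('n) \<ge> 2" by (rule n2)
    show "open D" "D ~= {}" unfolding D_def using d' by auto
    show "clin (M ze)" if "ze \<in> D" for ze using Mc D that by blast
    show "herm (M ze x) (M h x') = rh ze h * herm x x'"
      if z: "ze \<in> D" "h \<in> D" and x: "herm x (k ze) = 0" "herm x' (k h) = 0" for ze h x x'
    proof -
      \<comment> \<open>Without denominators the identity is sesquiholomorphic; on the diagonal it
        says that both pairings are multiplied by the same factor.\<close>
      have "herm (M ze x) (M h x') * H ze h - herm (M ze f) (M h f) * herm (xw ze x) (xw h x') = 0"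
      proof (rule polarisation[of d "%ze h. herm (M ze x) (M h x') * H ze h - herm (M ze f) (M h f) * herm (xw ze x) (xw h x')"])
        show "sesquiholo (ball 0 d) (%ze h. herm (M ze x) (M h x') * H ze h - herm (M ze f) (M h f) * herm (xw ze x) (xw h x'))"
          unfolding H_def by (intro sesquiholo_intros sesquiholo_herm open_ball M2 X2)
        show "herm (M ze x) (M ze x') * H ze ze - herm (M ze f) (M ze f) * herm (xw ze x) (xw ze x') = 0" if "ze \<in> ball 0 d" for ze
          unfolding diag[OF that] H_def by simp
      qed (use z D in auto)
      moreover have "xw ze x = x" "xw h x' = x'" using x unfolding xw k by simp_all
      ultimately show ?thesis unfolding rh_def using nzD(2)[OF z] by (simp add: field_simps)
    qed
    show "cnj (rh ze h) = rh h ze" for ze h unfolding rh_def H_def by (simp add: herm_cnj)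
    show "Re (rh ze ze) > 0" if "ze \<in> D" for ze
      using rpos[OF D[OF that]] nzD(2)[OF that that] unfolding rh_def diag[OF D[OF that]] H_def[symmetric] by simp
    show "continuous_on D (%ze. rh ze h)" if "h \<in> D" for h
    proof -
      have "D \<subseteq> ball 0 d" using D by blast
      then show ?thesis unfolding rh_def H_def
        by (intro continuous_on_divide bounded_bilinear.continuous_on[OF bounded_bilinear_herm] continuous_on_const
          continuous_on_subset[OF Mcont] continuous_on_subset[OF xcont]) (use nzD(2)[OF _ that] in \<open>auto simp: H_def\<close>)
    qed
    show "herm (k ze) (k h) ~= 0" if "ze \<in> D" "h \<in> D" for ze h by (rule nzD(1)[OF that])
    show "Re (herm (k ze) (k ze)) > 0" if "ze \<in> D" for ze by (rule kpos[OF D[OF that]])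
    show "ze = h" if z: "ze \<in> D" "h \<in> D" and e: "k ze = c *s k h" for ze h c
    proof -
      have "L ze x = cnj c * L h x" for x unfolding k[symmetric] e by (simp add: herm_simps)
      from this[of v0] this[of x0] show ?thesis using Lv[OF D[OF z(1)]] Lv[OF D[OF z(2)]] by simp
    qed
    show "\<exists>x. x ~= 0 \<and> herm x x = 0 \<and> herm x (k ze) = 0" if "ze \<in> D" for ze
    proof (intro exI[of _ "heis (t ze)"] conjI)
      show "heis (t ze) ~= 0" by simp
      show "herm (heis (t ze)) (k ze) = 0" unfolding k L_def by (rule N.lh_heis[OF t4[OF D[OF that]]])
    qed simp
    \<comment> \<open>Orthogonality to the family implies orthogonality to u on an open set, hence
      to its 2-jet at p0.\<close>
    show "v = 0" if v: "!!ze x. ze \<in> D ==> herm x (k ze) = 0 ==> herm v (M ze x) = 0" for v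
    proof -
      have "herm v (u q) = 0" if "q \<in> W'" for q
        using v[OF uM(2)[OF that], of "heis q"] uM(3)[OF that] by (subst uM(1)[OF that]) (simp add: herm_simps k)
      from BB_span[OF p0 nz _ herm_zero_jets(1)[OF W'(1,3) this W'(2)] herm_zero_jets(2)[OF W'(1,3) this W'(2)]] this[OF W'(2)]
      show ?thesis by blast
    qed
  qed
  obtain T A where T: "isom T" "isom A" and TA: "!!ze x. [|ze \<in> D; herm x (k ze) = 0; herm x x = 0; x ~= 0|]
        ==> \<exists>c. T (M ze x) = c *s wq (A x)"
    using F.whitney_rigidity by blast
  show ?thesis
  proof (rule that[OF W' T])
    fix q assume q: "q \<in> W'"
    have "heis q ~= 0" by simp
    then obtain c where "T (M (g q) (heis q)) = c *s wq (A (heis q))"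
      using TA[OF uM(2)[OF q], of "heis q"] uM(3)[OF q] unfolding k by auto
    then have "T (u q) = (N.sg q * c) *s wq (A (heis q))"
      by (subst uM(1)[OF q]) (simp add: isom_sc[OF T(1)])
    then show "\<exists>c. T (u q) = c *s wq (A (heis q))" by blast
  qed
qed

end

section \<open>Polynomial identities on the quadric\<close>

text \<open>The parameter is real, so conjugation acts on the coefficients only; this gives closure
  under \<open>cnj\<close>.\<close>

definition rpoly :: "(real => complex) => bool" where
  "rpoly f \<longleftrightarrow> (\<exists>P. \<forall>s. f s = poly P (cor s))"

lemma rpoly_const: "rpoly (%s. c)" unfolding rpoly_def by (rule exI[of _ "[:c:]"]) simp
lemma rpoly_id: "rpoly cor" unfolding rpoly_def by (rule exI[of _ "[:0, 1:]"]) simp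
lemma rpoly_add: "rpoly f ==> rpoly g ==> rpoly (%s. f s + g s)" unfolding rpoly_def by (metis poly_add)
lemma rpoly_diff: "rpoly f ==> rpoly g ==> rpoly (%s. f s - g s)" unfolding rpoly_def by (metis poly_diff)
lemma rpoly_mult: "rpoly f ==> rpoly g ==> rpoly (%s. f s * g s)" unfolding rpoly_def by (metis poly_mult)
lemma rpoly_cnj: "rpoly f ==> rpoly (%s. cnj (f s))"
proof -
  assume "rpoly f"
  then obtain P where P: "!!s. f s = poly P (cor s)" unfolding rpoly_def by blast
  show ?thesis unfolding rpoly_def
  proof (intro exI allI)
    fix s
    show "cnj (f s) = poly (map_poly cnj P) (cor s)"
      unfolding P using poly_cnj[of P "cor s"] by simp
  qed
qed
lemma rpoly_sum: "(!!i. i \<in> I ==> rpoly (f i)) ==> rpoly (%s. \<Sum>i\<in>I. f i s)"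
  by (induction I rule: infinite_finite_induct) (auto intro: rpoly_const rpoly_add)

lemmas rpoly_intros = rpoly_const rpoly_id rpoly_add rpoly_diff rpoly_mult rpoly_cnj rpoly_sum

lemma rpoly_zero:
  assumes f: "rpoly f" and e: "e > 0" "!!s. \<bar>s\<bar> < e ==> f s = 0"
  shows "f s = 0"
proof -
  obtain P where P: "!!s. f s = poly P (cor s)" using f unfolding rpoly_def by blast
  have "P = 0"
  proof (rule ccontr)
    assume "P ~= 0"
    then have "finite {x. poly P x = 0}" by (rule poly_roots_finite)
    moreover have "cor ` {- e<..<e} \<subseteq> {x. poly P x = 0}" using e(2) P by (auto simp: abs_less_iff)
    ultimately have "finite (cor ` {- e<..<e})" using finite_subset by blast
    then have "finite {- e<..<e}" by (rule finite_imageD) (simp add: inj_on_def)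
    then show False using e(1) infinite_Ioo[of "- e" e] by simp
  qed
  then show ?thesis by (simp add: P)
qed

text \<open>Being polynomial along every polynomial curve captures polynomials in the coordinates
  and their conjugates, and is closed under composition without any bookkeeping of
  monomials.\<close>

definition pf :: "('m::finite V => complex) => bool" where
  "pf F \<longleftrightarrow> (\<forall>x. (\<forall>i. rpoly (%s. x s $ i)) \<longrightarrow> rpoly (%s. F (x s)))"

lemma pf_nth: "pf (%x. x $ i)" and pf_const: "pf (%x. c)"
  and pf_add: "pf F ==> pf G ==> pf (%x. F x + G x)" and pf_diff: "pf F ==> pf G ==> pf (%x. F x - G x)"
  and pf_mult: "pf F ==> pf G ==> pf (%x. F x * G x)" and pf_cnj: "pf F ==> pf (%x. cnj (F x))"
  unfolding pf_def by (auto intro: rpoly_intros)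

lemma pf_sum: "(!!i. i \<in> I ==> pf (F i)) ==> pf (%x. \<Sum>i\<in>I. F i x)"
  unfolding pf_def by (auto intro: rpoly_sum)

lemmas pf_intros = pf_nth pf_const pf_add pf_diff pf_mult pf_cnj pf_sum

definition pfv :: "('m::finite V => complex^'k::finite) => bool" where
  "pfv F \<longleftrightarrow> (\<forall>i. pf (%x. F x $ i))"

lemma pf_compose:
  fixes F :: "'m::finite V => 'k::finite V"
  assumes G: "pf G" and F: "pfv F" shows "pf (%x. G (F x))"
  unfolding pf_def
proof (intro allI impI)
  fix x :: "real => 'm V" assume x: "\<forall>i. rpoly (%s. x s $ i)"
  have "rpoly (%s. F (x s) $ i)" for i using F x unfolding pfv_def pf_def by simp
  then show "rpoly (%s. G (F (x s)))" using G unfolding pf_def by simp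
qed

lemma pfv_compose: "pfv G ==> pfv F ==> pfv (%x. G (F x))"
  unfolding pfv_def[of G] pfv_def[of "%x. G (F x)"] using pf_compose[of "%y. G y $ i" F for i] by simp

lemma clinf_pf: "clinf L ==> pf L"
proof -
  assume L: "clinf L"
  have 1: "L = (%x. \<Sum>i\<in>UNIV. x $ i * L (axis i 1))" by (rule ext) (rule clinf_expand[OF L])
  show ?thesis by (subst 1) (intro pf_intros)
qed

lemma clin_pfv: "clin L ==> pfv L"
  unfolding pfv_def by (intro allI clinf_pf) (simp add: clinf_def clin_add clin_scale)

lemma pf_herm: "pfv F ==> pfv G ==> pf (%x. herm (F x) (G x))"
  unfolding pfv_def herm_def by (intro pf_intros) blast+

lemma rpoly_heis_line: "rpoly (%s. heis (q + s *\<^sub>R Y) $ i)"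
proof (cases i)
  case First
  then show ?thesis by (simp add: heis_def rpoly_const)
next
  case (Mid k)
  have "rpoly (%s. fst q $ k + cor s * fst Y $ k)" by (intro rpoly_intros)
  then show ?thesis using Mid by (simp add: heis_def scaleR_conv_of_real[where 'a=complex])
next
  case Final
  have z: "rpoly (%s. (fst q + s *\<^sub>R fst Y) $ k)" for k
  proof -
    have "rpoly (%s. fst q $ k + cor s * fst Y $ k)" by (intro rpoly_intros)
    then show ?thesis by (simp add: scaleR_conv_of_real[where 'a=complex])
  qed
  have "rpoly (%s. (cor (snd q) + cor s * cor (snd Y)) -
    (\<i> / 2) * (\<Sum>k\<in>UNIV. (fst q + s *\<^sub>R fst Y) $ k * cnj ((fst q + s *\<^sub>R fst Y) $ k)))"
    by (intro rpoly_intros z)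
  then show ?thesis using Final by (simp add: heis_def cip_def)
qed

text \<open>Along the line from q0 to q in Heisenberg coordinates the function is a polynomial in
  one real variable with an interval of zeros.\<close>

lemma pf_heis_zero:
  assumes F: "pf F" and U: "open U" "q0 \<in> U" "!!q. q \<in> U ==> F (heis q) = 0"
  shows "F (heis q) = 0"
proof -
  have r: "rpoly (%s. F (heis (q0 + s *\<^sub>R (q - q0))))"
    using F[unfolded pf_def, THEN spec, of "%s. heis (q0 + s *\<^sub>R (q - q0))"] rpoly_heis_line by blast
  have "open ((%s. q0 + s *\<^sub>R (q - q0)) -` U)"
    by (intro open_vimage[OF U(1)] continuous_intros)
  moreover have "0 \<in> (%s. q0 + s *\<^sub>R (q - q0)) -` U" using U(2) by simp
  ultimately obtain e where e: "e > 0" "ball 0 e \<subseteq> (%s. q0 + s *\<^sub>R (q - q0)) -` U" using openE by blast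
  have "F (heis (q0 + 1 *\<^sub>R (q - q0))) = 0"
  proof (rule rpoly_zero[OF r e(1)])
    fix s :: real assume "\<bar>s\<bar> < e"
    then have "s \<in> ball 0 e" by simp
    then show "F (heis (q0 + s *\<^sub>R (q - q0))) = 0" using e(2) U(3) by blast
  qed
  then show ?thesis by simp
qed

section \<open>The Whitney quadratic form\<close>

definition wqb :: "'n::finite V => 'n V => ('n + 'n) V" where
  "wqb x y = (1/2) *s (wq (x + y) - wq x - wq y)"

lemma wqb_coords:
  "tco (wqb x y) = - \<i> * tco x * tco y" "sco (wqb x y) = \<i> * sco x * sco y"
  "wqb x y $ Mid (Inl i) = \<i> / 2 * (sco x * y $ Mid i + sco y * x $ Mid i)"
  "wqb x y $ Mid (Inr i) = - \<i> / 2 * (tco x * y $ Mid i + tco y * x $ Mid i)"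
  unfolding wqb_def
  by (simp_all add: clinf_scale[OF tco_clinf] clinf_scale[OF sco_clinf] clinf_diff[OF tco_clinf] clinf_diff[OF sco_clinf]
    whitney_quadratic_coords clinf_add[OF tco_clinf] clinf_add[OF sco_clinf] power2_eq_square field_simps)

lemma wqb_simps: "wqb (x + x') y = wqb x y + wqb x' y" "wqb (c *s x) y = c *s wqb x y"
  "wqb x y = wqb y x" "wqb x x = wq x"
proof -
  have e: "v = w" if "tco v = tco w" "sco v = sco w" "!!i. v $ Mid (Inl i) = w $ Mid (Inl i)" "!!i. v $ Mid (Inr i) = w $ Mid (Inr i)"
    for v w :: "('n::finite + 'n) V"
    by (rule tco_sco_eqI) (use that in \<open>auto, metis sumE\<close>)
  note c = wqb_coords clinf_scale[OF tco_clinf] clinf_scale[OF sco_clinf] clinf_add[OF tco_clinf] clinf_add[OF sco_clinf] whitney_quadratic_coords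
  show "wqb (x + x') y = wqb x y + wqb x' y" by (rule e) (simp_all add: c algebra_simps)
  show "wqb (c *s x) y = c *s wqb x y" by (rule e) (simp_all add: c algebra_simps)
  show "wqb x y = wqb y x" by (rule e) (simp_all add: c algebra_simps)
  show "wqb x x = wq x" by (rule e) (simp_all add: c power2_eq_square)
qed

lemma whitney_quadratic_nz:
  assumes "herm x x = 0" "x ~= 0" shows "wq x ~= 0"
proof
  assume z: "wq x = 0"
  have "tco x = 0" "sco x = 0"
    using whitney_quadratic_coords(1,2)[of x] unfolding z by (simp_all add: clinf_zero[OF tco_clinf] clinf_zero[OF sco_clinf])
  then show False using herm_pos(2)[of x] assms by simp
qed

text \<open>The hypothesis U says that second derivatives of the Whitney map along the complement of
  w stay in the image of its differential at w, as happens where the second fundamental form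
  vanishes. Testing it on a vector e orthogonal to the middle part of w would make e a multiple of
  that middle part.\<close>

lemma whitney_umbilic:
  fixes w :: "'n::finite V"
  assumes n2: "CARD('n) \<ge> 2" and w: "herm w w = 0"
    and U: "!!x x'. herm x w = 0 ==> herm x' w = 0 ==> \<exists>z. wqb x x' = wqb w z"
  shows "midpart w = 0"
proof (rule ccontr)
  assume m: "midpart w ~= 0"
  obtain e where e: "e ~= 0" "cip e (midpart w) = 0" using cip_orth_exists[OF n2] by blast
  have null: "(\<Sum>i\<in>UNIV. (cmod (w $ Mid i))\<^sup>2) + ((cmod (sco w))\<^sup>2 - (cmod (tco w))\<^sup>2) / 2 = 0"
    using w unfolding herm_self by (metis of_real_eq_0_iff)
  have "(norm (midpart w))\<^sup>2 = (\<Sum>i\<in>UNIV. (cmod (w $ Mid i))\<^sup>2)"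
    by (simp add: norm_vec_def L2_set_def sum_nonneg)
  moreover have "(norm (midpart w))\<^sup>2 > 0" "(cmod (sco w))\<^sup>2 \<ge> 0" using m by simp_all
  moreover have "(cmod (tco w))\<^sup>2 = 2 * (\<Sum>i\<in>UNIV. (cmod (w $ Mid i))\<^sup>2) + (cmod (sco w))\<^sup>2"
    using null by (simp add: field_simps)
  ultimately have "(cmod (tco w))\<^sup>2 > 0" by linarith
  then have t: "tco w ~= 0" by auto
  define x :: "'n V" where "x = mk 0 e 0"
  \<comment> \<open>The value for which x' is orthogonal to w while \<open>tco x' = 0\<close> and
    \<open>sco x' = 1\<close>.\<close>
  define a where "a = - cnj (sco w) / (2 * cip (midpart w) (midpart w))"
  define x' :: "'n V" where "x' = mk (1/2) (a *s midpart w) (\<i> / 2)"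
  have mm: "cip (midpart w) (midpart w) ~= 0" using m by (simp add: cip_self_eq_0)
  have "herm x w = 0" unfolding x_def by (subst mk_collapse[of w, symmetric]) (simp only: herm_mk e, simp)
  moreover have "herm x' w = 0"
  proof -
    have "herm x' w = a * cip (midpart w) (midpart w) + \<i> * (1/2 * cnj (w $ Final) - \<i> / 2 * cnj (w $ First))"
      unfolding x'_def by (subst mk_collapse[of w, symmetric]) (simp only: herm_mk cip_simps)
    also have "\<dots> = 0" unfolding a_def sco_def using mm by (simp add: field_simps)
    finally show ?thesis .
  qed
  ultimately obtain z where z: "wqb x x' = wqb w z" using U by blast
  have c: "tco x = 0" "sco x = 0" "tco x' = 0" "sco x' = 1" "!!i. x $ Mid i = e $ i"
    unfolding x_def x'_def tco_def sco_def by (simp_all add: field_simps)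
  have "tco (wqb x x') = tco (wqb w z)" using z by simp
  then have tz: "tco z = 0" unfolding wqb_coords c using t by simp
  have zm: "z $ Mid i = 0" for i
  proof -
    have "wqb x x' $ Mid (Inr i) = wqb w z $ Mid (Inr i)" using z by simp
    then show ?thesis unfolding wqb_coords c tz using t by simp
  qed
  have "e $ i = sco z * w $ Mid i" for i
  proof -
    have "wqb x x' $ Mid (Inl i) = wqb w z $ Mid (Inl i)" using z by simp
    then show ?thesis unfolding wqb_coords c zm by simp
  qed
  then have "e = sco z *s midpart w" by (simp add: vec_eq_iff)
  then have "cip e e = sco z * cip (midpart w) e" by (metis cip_simps(3))
  also have "cip (midpart w) e = 0" using e(2) cip_cnj[of e "midpart w"] by simp
  finally show False using e(1) by (simp add: cip_self_eq_0)
qed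

lemma whitney_quadratic_pfv: "pfv (wq :: 'n::finite V => _)"
  unfolding pfv_def
proof
  fix i :: "('n + 'n) idx"
  show "pf (%x :: 'n V. wq x $ i)"
  proof (cases i)
    case (Mid b)
    then show ?thesis
      by (cases b) (auto simp: whitney_quadratic_def intro!: pf_intros)
  qed (auto simp: whitney_quadratic_def power2_eq_square intro!: pf_intros)
qed

section \<open>Propagation of the Whitney form\<close>

lemma zero_on_closure:
  fixes f :: "'a::topological_space => 'b::{t1_space, zero}"
  assumes "open S" "continuous_on S f" "!!q. q \<in> G ==> f q = 0" "q \<in> S" "q \<in> closure G"
  shows "f q = 0"
proof (rule ccontr)
  assume "f q ~= 0"
  then have "q \<in> {q \<in> S. f q ~= 0}" using assms(4) by simp
  then have "{q \<in> S. f q ~= 0} \<inter> G ~= {}"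
    using open_nonzero[OF assms(1,2)] assms(5) open_Int_closure_eq_empty by blast
  then show False using assms(3) by auto
qed

lemma segment_spread:
  fixes G :: "'a::real_normed_vector set"
  assumes G: "open G" "a \<in> G" and cl: "!!x. x \<in> closed_segment a b ==> x \<in> closure G ==> x \<in> G"
  shows "b \<in> G"
proof -
  define K where "K = closed_segment a b"
  have "openin (top_of_set K) (K \<inter> G)" using G(1) by (rule openin_open_Int)
  moreover have "K \<inter> G = K \<inter> closure G" unfolding K_def using cl closure_subset[of G] by blast
  then have "closedin (top_of_set K) (K \<inter> G)" by (simp add: closedin_closed_Int)
  moreover have "connected K" unfolding K_def by (rule connected_segment)
  ultimately have "K \<inter> G = {} \<or> K \<inter> G = K" unfolding connected_clopen by blast
  then show ?thesis using G(2) unfolding K_def by auto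
qed

lemma open_shift:
  fixes x :: "'a::real_normed_vector"
  assumes U: "open U" "x \<in> U" obtains e where "e > 0" "x + e *\<^sub>R y \<in> U"
proof -
  have "open ((%s. x + s *\<^sub>R y) -` U)" by (intro open_vimage[OF U(1)] continuous_intros)
  moreover have "0 \<in> (%s. x + s *\<^sub>R y) -` U" using U(2) by simp
  ultimately obtain e where e: "e > 0" "ball 0 e \<subseteq> (%s. x + s *\<^sub>R y) -` U" using openE by blast
  then have "e / 2 \<in> ball 0 e" by simp
  then have "x + (e / 2) *\<^sub>R y \<in> U" using e(2) by blast
  then show ?thesis using that[of "e / 2"] e(1) by simp
qed

text \<open>p is complex affine, so its zero set has real codimension two and can be bypassed: a
  segment that meets it is replaced by two segments through a displaced midpoint.\<close>

lemma hyperplane_spread: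
  fixes G S :: "'n::finite heis set" and p :: "'n heis => complex"
  assumes S: "open S" "convex S" and G: "open G" "G \<subseteq> S" "G ~= {}"
    and p: "!!q Y s. p (q + s *\<^sub>R Y) = p q + cor s * g (fst Y)" and g: "!!c z. g (c *s z) = c * g z"
    and nontriv: "\<exists>q. p q ~= 0"
    and cl: "!!q. q \<in> S ==> q \<in> closure G ==> p q ~= 0 ==> q \<in> G"
  shows "S \<subseteq> closure G"
proof -
  have diff: "p b = p a + g (fst (b - a))" for a b using p[of a 1 "b - a"] by simp
  have line: "p (a + s *\<^sub>R (b - a)) = p a + cor s * (p b - p a)" for a b s unfolding p diff[of b a] by simp
  have seg: "b \<in> G" if a: "a \<in> G" and b: "b \<in> S"
    and nz: "!!s. 0 \<le> s ==> s \<le> 1 ==> p a + cor s * (p b - p a) ~= 0" for a b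
  proof (rule segment_spread[OF G(1) a])
    fix x assume x: "x \<in> closed_segment a b" and xc: "x \<in> closure G"
    obtain s where s: "0 \<le> s" "s \<le> 1" "x = a + s *\<^sub>R (b - a)"
      using x unfolding in_segment by (auto simp: algebra_simps)
    have "x \<in> S" using x a b G(2) closed_segment_subset[OF _ _ S(2)] by blast
    moreover have "p x ~= 0" unfolding s(3) line by (rule nz[OF s(1,2)])
    ultimately show "x \<in> G" using cl xc by blast
  qed
  have dense: "\<exists>q'\<in>U. p q' ~= 0" if U: "open U" "q \<in> U" for q U
  proof (cases "p q = 0")
    case True
    obtain q1 where q1: "p q1 ~= 0" using nontriv by blast
    obtain e where "e > 0" "q + e *\<^sub>R (q1 - q) \<in> U" using open_shift[OF U] .
    then show ?thesis using q1 True line[of q e q1] by (intro bexI) auto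
  qed (use U in blast)
  obtain a where a: "a \<in> G" "p a ~= 0" using G(1,3) dense by blast
  have main: "b \<in> G" if b: "b \<in> S" "p b ~= 0" for b
  proof (cases "\<exists>s. 0 \<le> s \<and> s \<le> 1 \<and> p a + cor s * (p b - p a) = 0")
    case False
    then show ?thesis using seg[OF a(1) b(1)] by blast
  next
    case True
    then obtain s where s: "p a + cor s * (p b - p a) = 0" by blast
    define d where "d = p b - p a"
    have pa: "p a = - cor s * d" and pb: "p b = (1 - cor s) * d"
      using s by (simp_all add: d_def algebra_simps add_eq_0_iff2)
    have d: "d ~= 0" "s ~= 0" "s ~= 1" using pa pb a(2) b(2) by auto
    have mid: "a + (1/2) *\<^sub>R (b - a) \<in> S"
    proof -
      have "a + (1/2) *\<^sub>R (b - a) = (1 - 1/2) *\<^sub>R a + (1/2) *\<^sub>R b"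
        by (simp only: scaleR_left_diff_distrib scaleR_right_diff_distrib scaleR_one) simp
      then show ?thesis using convexD[OF S(2), of a b "1 - 1/2" "1/2"] a(1) G(2) b(1) by auto
    qed
    \<comment> \<open>Displacement by \<i> times the horizontal part of the segment gives p a
      component transverse to its values on the segment, so neither half meets zero.\<close>
    obtain e where e: "e > 0" "a + (1/2) *\<^sub>R (b - a) + e *\<^sub>R (\<i> *s fst (b - a), 0) \<in> S" using open_shift[OF S(1) mid] .
    define c where "c = a + (1/2) *\<^sub>R (b - a) + e *\<^sub>R (\<i> *s fst (b - a), 0)"
    have gd: "g (fst (b - a)) = d" unfolding d_def diff[of b a] by simp
    have pc: "p c = Complex (1/2 - s) e * d"
      unfolding c_def p[of _ e] line fst_conv g gd d_def[symmetric] unfolding pa by (simp add: Complex_eq algebra_simps)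
    have "c \<in> G"
    proof (rule seg[OF a(1)])
      fix t :: real
      have "p a + cor t * (p c - p a) = Complex (t / 2 - s) (t * e) * d"
        unfolding pc pa by (simp add: Complex_eq algebra_simps)
      moreover have "Complex (t / 2 - s) (t * e) ~= 0" using d(2) e(1) by (auto simp: complex_eq_iff)
      ultimately show "p a + cor t * (p c - p a) ~= 0" using d(1) by simp
    qed (use e c_def in simp)
    then show "b \<in> G"
    proof (rule seg[OF _ b(1)])
      fix t :: real
      have "p c + cor t * (p b - p c) = Complex (1/2 + t / 2 - s) ((1 - t) * e) * d"
        unfolding pc pb by (simp add: Complex_eq algebra_simps)
      moreover have "Complex (1/2 + t / 2 - s) ((1 - t) * e) ~= 0" using d(3) e(1) by (auto simp: complex_eq_iff)
      ultimately show "p c + cor t * (p b - p c) ~= 0" using d(1) by simp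
    qed
  qed
  show ?thesis
  proof
    fix q assume q: "q \<in> S"
    show "q \<in> closure G"
    proof (rule ccontr)
      assume "q \<notin> closure G"
      then have "open (S - closure G)" "q \<in> S - closure G" using S(1) q by auto
      then obtain q' where "q' \<in> S - closure G" "p q' ~= 0" using dense by blast
      then show False using main closure_subset[of G] by blast
    qed
  qed
qed

context cr_immersion begin

lemma u_nz: "q \<in> S ==> u q ~= 0" using comp[of q] by auto

lemma null_proportional:
  assumes q: "q \<in> S" and v: "herm v v = 0" "herm (u q) v = 0"
  shows "v = v $ j *s u q"
proof -
  have "herm v (u q) = 0" using v(2) herm_cnj[of "u q" v] by simp
  then obtain c where "v = c *s u q" using lorentz[of "u q" v] u_nz[OF q] null[OF q] v(1) by auto
  then show ?thesis using comp[OF q] by simp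
qed

text \<open>The comparison map R is the Whitney quadric in the coordinates given by T and A. The set
  where u is proportional to it is open and, away from a locus of complex codimension at least one,
  relatively closed; \<open>hyperplane_spread\<close> bypasses that locus.\<close>

lemma whitney_spread:
  assumes n2: "CARD('n) \<ge> 2" and conv: "convex S" and T: "isom T" and A: "isom A"
    and G0: "open G0" "G0 \<subseteq> S" "G0 ~= {}" "!!q. q \<in> G0 ==> \<exists>c. T (u q) = c *s wq (A (heis q))"
    and q: "q \<in> S"
  shows "\<exists>c. T (u q) = c *s wq (A (heis q))"
proof -
  define Ti where "Ti = inv T"
  have Ti: "isom Ti" "T (Ti x) = x" "Ti (T x) = x" for x
    unfolding Ti_def using isom_inv[OF T] isom_surj[OF T] isom_inj[OF T] by (auto simp: surj_f_inv_f)
  define Rb where "Rb x y = Ti (wqb (A x) (A y))" for x y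
  define R where "R x = Ti (wq (A x))" for x
  have RR: "Rb x x = R x" for x unfolding Rb_def R_def wqb_simps(4) ..
  have Rbl: "Rb (x + x') y = Rb x y + Rb x' y" "Rb (c *s x) y = c *s Rb x y" "Rb x y = Rb y x" for x x' y c
    unfolding Rb_def by (simp_all add: isom_add[OF A] isom_sc[OF A] wqb_simps(1,2)
      isom_add[OF Ti(1)] isom_sc[OF Ti(1)] wqb_simps(3)[of "A x"])
  have Rbr: "Rb x (y + y') = Rb x y + Rb x y'" "Rb x (c *s y) = c *s Rb x y" for x y y' c
    using Rbl(1)[of y y' x] Rbl(2)[of c y x] unfolding Rbl(3)[of _ x] by simp_all
  have Rb0: "Rb x 0 = 0" for x using Rbr(2)[of x 0 0] by simp
  have bb: "bounded_bilinear Rb"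
    by (rule bilinear_conv_bounded_bilinear[THEN iffD1])
      (simp add: bilinear_def linear_iff Rbl(1,2) Rbr scaleR_eq_vec)
  have Rnull: "herm (R (heis q)) (R (heis q)) = 0" and Rnz: "R (heis q) ~= 0" for q
  proof -
    have "herm (A (heis q)) (A (heis q)) = 0" using isomD(2)[OF A] by simp
    then show "herm (R (heis q)) (R (heis q)) = 0" unfolding R_def by (simp add: isomD(2)[OF Ti(1)] whitney_quadratic_null)
    have "A (heis q) ~= 0" using isom_eq_0[OF A, of "heis q"] by auto
    then show "R (heis q) ~= 0"
      using whitney_quadratic_nz[OF \<open>herm (A (heis q)) (A (heis q)) = 0\<close>] isom_eq_0[OF Ti(1)] unfolding R_def by blast
  qed
  define lam where "lam q = R (heis q) $ j" for q
  have prp: "R (heis q) = lam q *s u q" if "q \<in> S" "herm (u q) (R (heis q)) = 0" for q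
    unfolding lam_def by (rule null_proportional[OF that(1) Rnull that(2)])
  have CR1: "Ck_open 1 S (%q. Rb (x q) (y q))" if "Ck_open 1 S x" "Ck_open 1 S y" for x y
    by (rule Ck_open_bilinear[OF S bb that])
  have CRR: "Ck_open 1 S (%q. R (heis q))" unfolding RR[symmetric] by (intro CR1 Ck_intros)
  \<comment> \<open>Both vectors are null, so by \<open>null_proportional\<close> their
    orthogonality already means proportionality; it is a closed condition.\<close>
  define G where "G = interior {q \<in> S. herm (u q) (R (heis q)) = 0}"
  have G: "open G" "G \<subseteq> S" "!!q. q \<in> G ==> herm (u q) (R (heis q)) = 0"
    unfolding G_def using interior_subset by auto
  have GI: "q \<in> G" if "open U" "q \<in> U" "U \<subseteq> S" "!!q. q \<in> U ==> herm (u q) (R (heis q)) = 0" for q U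
    unfolding G_def using that by (intro interiorI[of U]) auto
  have uR: "herm (u q) (R (heis q)) = 0" if "T (u q) = c *s wq (A (heis q))" for q c
  proof -
    have "u q = c *s R (heis q)"
      using arg_cong[OF that, of Ti] unfolding Ti R_def by (simp add: isom_sc[OF Ti(1)])
    then show ?thesis using Rnull[of q] by (simp add: herm_simps)
  qed
  have "G0 \<subseteq> G" using GI[OF G0(1) _ G0(2)] uR G0(4) by blast
  then have Gne: "G ~= {}" using G0(3) by blast
  have dR: "((%q. Rb (x q) (y q)) has_derivative (%Y. Rb (x p) (y' Y) + Rb (x' Y) (y p))) (at p)"
    if "(x has_derivative x') (at p)" "(y has_derivative y') (at p)" for x y x' y' p
    by (rule bounded_bilinear.FDERIV[OF bb that])
  have dvR: "dv (%q. Rb (x q) (y q)) p r = Rb (dv x p r) (y p) + Rb (x p) (dv y p r)"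
    if "x differentiable (at p)" "y differentiable (at p)" for x y p r
    by (subst dv_has[OF dR[OF FD_works[OF that(1)] FD_works[OF that(2)]]])
      (simp add: dv_def Rbl(1,2) Rbr vec.scale_right_distrib algebra_simps)
  have dsj: "ds (%q. F q $ j) p r = dv F p r $ j" if "F differentiable (at p)" for F :: "'n heis => ('n + 'n) V" and p r
    by (subst ds_has[OF bounded_linear.has_derivative[OF bounded_linear_vec_nth FD_works[OF that]]])
      (simp add: dv_def)
  have dj: "(%q. F q $ j) differentiable (at p)" if "F differentiable (at p)" for F :: "'n heis => ('n + 'n) V" and p
    using bounded_linear.has_derivative[OF bounded_linear_vec_nth FD_works[OF that]] by (rule differentiableI)
  have dRd: "(%q. Rb (x q) (y q)) differentiable (at p)" if "x differentiable (at p)" "y differentiable (at p)" for x y p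
    using dR[OF FD_works[OF that(1)] FD_works[OF that(2)]] by (rule differentiableI)
  have hd: "heis differentiable (at p)" for p :: "'n heis" by (rule heis_diff)
  have dRh: "(%q. R (heis q)) differentiable (at p)" for p unfolding RR[symmetric] by (rule dRd[OF hd hd])
  have Rh: "R (heis q) = lam q *s u q" if "q \<in> G" for q using prp G that by blast
  \<comment> \<open>The first and second (1,0) derivatives of
    \<open>R (heis q) = lam q *s u q\<close>, with the derivatives of the factors read off from
    component j.\<close>
  have eq1: "2 *s Rb (heis p) (EE p w) = (2 *s Rb (heis p) (EE p w)) $ j *s u p + lam p *s phi1 p (EE p w)" if p: "p \<in> G" for p w
  proof -
    have pS: "p \<in> S" using p G(2) by blast
    have dl: "lam differentiable (at p)" unfolding lam_def[abs_def] by (rule dj[OF dRh])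
    have 1: "dv (%q. R (heis q)) p (holo p (EE p w)) = 2 *s Rb (heis p) (EE p w)"
      unfolding RR[symmetric] by (simp add: dvR[OF hd hd] dv_heis Rbl(3)[of "EE p w"] vec_eq_iff)
    have "dv (%q. R (heis q)) p (holo p (EE p w)) = dv (%q. lam q *s u q) p (holo p (EE p w))"
      by (rule dv_cong_on[OF G(1) p]) (simp_all add: Rh vec_scale_diff dl diffs pS)
    also have "\<dots> = ds lam p (holo p (EE p w)) *s u p + lam p *s phi1 p (EE p w)"
      by (simp add: dv_scale dl diffs pS dv_u[OF pS])
    also have "ds lam p (holo p (EE p w)) = (2 *s Rb (heis p) (EE p w)) $ j"
      unfolding lam_def[abs_def] dsj[OF dRh] 1 ..
    finally show ?thesis unfolding 1 .
  qed
  have eq2: "2 *s Rb (EE p w) (EE p v) = (2 *s Rb (EE p w) (EE p v)) $ j *s u p + (2 *s Rb (heis p) (EE p v)) $ j *s phi1 p (EE p w)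
      + (2 *s Rb (heis p) (EE p w)) $ j *s phi1 p (EE p v) + lam p *s phi2 p (EE p v) (EE p w)" if p: "p \<in> G" for p v w
  proof -
    have pS: "p \<in> S" using p G(2) by blast
    define F where "F q = 2 *s Rb (heis q) (EE q v)" for q
    have dF: "F differentiable (at p)" unfolding F_def[abs_def] by (intro vec_scale_diff differentiable_const dRd hd EE_diff)
    have dl: "lam differentiable (at p)" unfolding lam_def[abs_def] by (rule dj[OF dRh])
    define r where "r = holo p (EE p w)"
    have F1: "F q = F q $ j *s u q + lam q *s phi1 q (EE q v)" if "q \<in> G" for q
      unfolding F_def by (rule eq1[OF that])
    have 1: "dv F p r = 2 *s Rb (EE p w) (EE p v)"
      unfolding F_def[abs_def] r_def
      by (simp add: dv_scale dRd hd EE_diff dvR dv_heis dv_EE_const Rb0)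
    have 2: "ds lam p r = (2 *s Rb (heis p) (EE p w)) $ j"
      unfolding lam_def[abs_def] dsj[OF dRh] unfolding RR[symmetric] r_def
      by (simp add: dvR[OF hd hd] dv_heis Rbl(3)[of "EE p w"])
    have "dv F p r = dv (%q. F q $ j *s u q + lam q *s phi1 q (EE q v)) p r"
      by (rule dv_cong_on[OF G(1) p, symmetric])
        (simp_all add: F1[symmetric] vec_scale_diff dj dF dl diffs pS)
    also have "\<dots> = dv F p r $ j *s u p + F p $ j *s phi1 p (EE p w) + (ds lam p r *s phi1 p (EE p v) + lam p *s phi2 p (EE p v) (EE p w))"
      by (simp add: dv_add dv_scale vec_scale_diff dj dF dl diffs pS dsj dv_u[OF pS] dv_phi1[OF pS] EE_diff dv_EE_const phi_simps[OF pS] r_def)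
    finally show ?thesis unfolding 1 2 F_def by (simp only: add.assoc)
  qed
  \<comment> \<open>A limit point with non-zero \<open>BB\<close> has a Whitney form of its own,
    which is compared with R by polynomial continuation. At one with \<open>BB = 0\<close> the
    relations between 2-jets pass to the limit and contradict
    \<open>whitney_umbilic\<close>.\<close>
  have closed: "q \<in> G" if qS: "q \<in> S" and qc: "q \<in> closure G" and m: "midpart (A (heis q)) ~= 0" for q
  proof (cases "\<forall>a b. BB q a b = 0")
    case False
    then obtain a b where nz: "BB q a b ~= 0" by blast
    obtain W T2 A2 where W: "open W" "q \<in> W" "W \<subseteq> S" and T2: "isom T2" and A2: "isom A2"
      and w: "!!q. q \<in> W ==> \<exists>c. T2 (u q) = c *s wq (A2 (heis q))"
      by (rule local_whitney[OF n2 qS nz], rule that)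
    \<comment> \<open>Its vanishing at \<open>heis x\<close> makes the two Whitney values at x
      proportional, and it is a real polynomial in the Heisenberg coordinates.\<close>
    define F where "F x = herm (inv T2 (wq (A2 x))) (R x)" for x
    have T2i: "isom (inv T2)" "inv T2 (T2 x) = x" for x using isom_inv[OF T2] isom_inj[OF T2] by auto
    have ux: "\<exists>c. u q = c *s inv T2 (wq (A2 (heis q)))" if "q \<in> W" for q
    proof -
      obtain c where "T2 (u q) = c *s wq (A2 (heis q))" using w \<open>q \<in> W\<close> by blast
      from arg_cong[OF this, of "inv T2"] show ?thesis unfolding T2i by (auto simp: isom_sc[OF T2i(1)])
    qed
    have pfF: "pf F"
      unfolding F_def[abs_def] R_def
      by (rule pf_herm[OF pfv_compose[OF clin_pfv[OF isomD(1)[OF T2i(1)]] pfv_compose[OF whitney_quadratic_pfv clin_pfv[OF isomD(1)[OF A2]]]]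
        pfv_compose[OF clin_pfv[OF isomD(1)[OF Ti(1)]] pfv_compose[OF whitney_quadratic_pfv clin_pfv[OF isomD(1)[OF A]]]]])
    have "W \<inter> G ~= {}" using W qc open_Int_closure_eq_empty[OF W(1), of G] by blast
    then obtain q1 where q1: "q1 \<in> W \<inter> G" by blast
    have z: "F (heis q) = 0" for q
    proof (rule pf_heis_zero[OF pfF, of "W \<inter> G" q1])
      show "open (W \<inter> G)" using W G by blast
      show "F (heis x) = 0" if x: "x \<in> W \<inter> G" for x
      proof -
        obtain c where c: "u x = c *s inv T2 (wq (A2 (heis x)))" using ux x by blast
        then have "c ~= 0" using u_nz[of x] x G(2) by auto
        moreover have "herm (u x) (R (heis x)) = 0" using G(3) x by blast
        ultimately show ?thesis unfolding F_def c by (simp add: herm_simps)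
      qed
    qed (rule q1)
    show ?thesis
    proof (rule GI[OF W])
      fix x assume "x \<in> W"
      then obtain c where c: "u x = c *s inv T2 (wq (A2 (heis x)))" using ux by blast
      then show "herm (u x) (R (heis x)) = 0" using z[of x] unfolding F_def by (simp add: herm_simps)
    qed
  next
    case True
    have lim: "F q = H q" if "!!p. p \<in> G ==> F p = H p" "Ck_open 1 S F" "Ck_open 1 S H" for F H :: "'n heis => ('n + 'n) V"
      using zero_on_closure[OF S Ck_open_continuous[OF Ck_diff[OF that(2,3)]] _ qS qc] that(1) by simp
    have e1: "2 *s Rb (heis q) (EE q w) = (2 *s Rb (heis q) (EE q w)) $ j *s u q + lam q *s phi1 q (EE q w)" for w
      by (rule lim[OF eq1], assumption, unfold lam_def) (intro Ck_intros CR1 CRR Ck_open_comp_linear[OF S bounded_linear_vec_nth])+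
    have e2: "2 *s Rb (EE q w) (EE q v) = (2 *s Rb (EE q w) (EE q v)) $ j *s u q + (2 *s Rb (heis q) (EE q v)) $ j *s phi1 q (EE q w)
      + (2 *s Rb (heis q) (EE q w)) $ j *s phi1 q (EE q v) + lam q *s phi2 q (EE q v) (EE q w)" for v w
      by (rule lim[OF eq2], assumption, unfold lam_def) (intro Ck_intros CR1 CRR Ck_open_comp_linear[OF S bounded_linear_vec_nth])+
    have "herm (u q) (R (heis q)) = 0"
      by (rule zero_on_closure[OF S _ G(3) qS qc]) (rule Ck_open_continuous[OF Ck_herm[OF Ck_u CRR]])
    then have Ru: "R (heis q) = lam q *s u q" by (rule prp[OF qS])
    then have lnz: "lam q ~= 0" using Rnz[of q] by auto
    \<comment> \<open>The image of the differential of R at \<open>heis q\<close>. It contains u and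
      its first jet, and because \<open>BB\<close> vanishes at q also the second derivatives in
      contact directions.\<close>
    define Q where "Q = range (Rb (heis q))"
    have Qadd: "x + y \<in> Q" if "x \<in> Q" "y \<in> Q" for x y
      using that unfolding Q_def by (auto simp: Rbr[symmetric])
    have Qsc: "c *s x \<in> Q" if "x \<in> Q" for x c
      using that unfolding Q_def by (auto simp: Rbr[symmetric])
    have uQ: "u q \<in> Q"
    proof -
      have "u q = (1 / lam q) *s Rb (heis q) (heis q)" unfolding RR Ru using lnz by simp
      then show ?thesis using Qsc[of "Rb (heis q) (heis q)"] unfolding Q_def by auto
    qed
    have fQ: "phi1 q (EE q w) \<in> Q" for w
    proof -
      have "lam q *s phi1 q (EE q w) = 2 *s Rb (heis q) (EE q w) + (- (2 *s Rb (heis q) (EE q w)) $ j) *s u q"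
        using e1[of w, symmetric] by (simp only: vec.scale_minus_left add_uminus_conv_diff eq_diff_eq add.commute)
      also have "\<dots> \<in> Q" by (intro Qadd Qsc uQ) (simp add: Q_def)
      finally have "(1 / lam q) *s (lam q *s phi1 q (EE q w)) \<in> Q" by (rule Qsc)
      then show ?thesis using lnz by simp
    qed
    have EQ: "Rb (EE q w) (EE q v) \<in> Q" for v w
    proof -
      have B: "phi2 q (EE q v) (EE q w) = (tau q v / Lam q) *s phi1 q (EE q w) + (tau q w / Lam q) *s phi1 q (EE q v)"
        using True BB_expand[OF qS, of v w] by (simp add: vec_eq_iff algebra_simps)
      have "2 *s Rb (EE q w) (EE q v) \<in> Q"
        by (subst e2, subst B) (intro Qadd Qsc uQ fQ)
      then have "(1/2) *s (2 *s Rb (EE q w) (EE q v)) \<in> Q" by (rule Qsc)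
      then show ?thesis by simp
    qed
    have "midpart (A (heis q)) = 0"
    proof (rule whitney_umbilic[OF n2])
      show "herm (A (heis q)) (A (heis q)) = 0" by (simp add: isomD(2)[OF A])
      fix x x' assume x: "herm x (A (heis q)) = 0" "herm x' (A (heis q)) = 0"
      obtain a b where ab: "x = A a" "x' = A b" using isom_surj[OF A] by (metis surjD)
      have cn: "cN q a = 0" "cN q b = 0" using x unfolding ab by (simp_all add: isomD(2)[OF A] cN_def)
      have e: "a = a $ First *s heis q + EE q (cE q a)" "b = b $ First *s heis q + EE q (cE q b)"
        using frame_expand[of a q] frame_expand[of b q] cn by simp_all
      have "Rb a b \<in> Q"
        by (subst e(1), subst e(2)) (simp only: Rbl(1,2) Rbr, intro Qadd Qsc EQ, auto simp: Q_def Rbl(3)[of "EE q _" "heis q"])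
      then obtain z where "Rb a b = Rb (heis q) z" unfolding Q_def by blast
      then have "T (Rb a b) = T (Rb (heis q) z)" by simp
      then show "\<exists>z. wqb x x' = wqb (A (heis q)) z" unfolding Rb_def Ti ab by blast
    qed
    then show ?thesis using m by contradiction
  qed
  \<comment> \<open>This choice removes the last coordinate of \<open>heis q\<close> from f, the
    only one that is not complex affine in \<open>fst q\<close>.\<close>
  obtain d where d: "d ~= 0" "cip d (midpart (A (axis Final 1))) = 0" using cip_orth_exists[OF n2] by blast
  have d': "cip (midpart (A (axis Final 1))) d = 0" using d(2) cip_cnj[of d "midpart (A (axis Final 1))"] by simp
  define f where "f q = cip (midpart (A (heis q))) d" for q
  define g where "g z = cip (midpart (A (mk 0 z 0))) d" for z
  have fin: "mk 0 0 b = b *s axis Final 1" for b :: complex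
    by (rule idx_eqI) (simp_all add: axis_def)
  have \<phi>F: "f q = cip (midpart (A (mk 1 (fst q) 0))) d" for q
  proof -
    have "heis q = mk 1 (fst q) 0 + heis q $ Final *s axis Final 1"
      unfolding fin[symmetric] by (simp add: heis_def mk_simps mk_eq_iff)
    then have "A (heis q) = A (mk 1 (fst q) 0) + heis q $ Final *s A (axis Final 1)"
      by (metis isom_add[OF A] isom_sc[OF A])
    then show ?thesis unfolding f_def by (simp add: midpart_simps cip_simps d')
  qed
  have \<beta>c: "clinf g"
  proof (rule clinfI)
    fix x y :: "complex^'n" and c
    have "mk 0 (x + y) 0 = mk 0 x 0 + mk 0 y 0" "mk 0 (c *s x) 0 = c *s mk 0 x 0" by (simp_all add: mk_simps)
    then show "g (x + y) = g x + g y" "g (c *s x) = c * g x"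
      unfolding g_def by (simp_all add: isom_add[OF A] isom_sc[OF A] midpart_simps cip_simps)
  qed
  have "S \<subseteq> closure G"
  proof (rule hyperplane_spread[OF S conv G(1,2) Gne])
    show "f (q + s *\<^sub>R Y) = f q + cor s * g (fst Y)" for q s Y
    proof -
      have "mk 1 (fst (q + s *\<^sub>R Y)) 0 = mk 1 (fst q) 0 + cor s *s mk 0 (fst Y) 0"
        by (simp add: mk_simps scaleR_eq_vec)
      then show ?thesis unfolding \<phi>F g_def by (simp add: isom_add[OF A] isom_sc[OF A] midpart_simps cip_simps)
    qed
    show "g (c *s z) = c * g z" for c z by (rule clinf_scale[OF \<beta>c])
    show "\<exists>q. f q ~= 0"
    proof (rule ccontr)
      assume "\<not> (\<exists>q. f q ~= 0)"
      then have z: "f q = 0" for q by blast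
      obtain x where x: "A x = mk 0 d 0" using isom_surj[OF A] by (metis surjD)
      have m1: "mk 1 0 0 = heis (0, 0)" by (simp add: heis_def cip_simps)
      have "cip (midpart (A (mk 1 0 0))) d = 0" using z[of "(0, 0)"] unfolding f_def m1 .
      moreover have "g v = 0" for v
      proof -
        have "mk 1 v 0 = mk 0 v 0 + mk 1 0 0" by (simp add: mk_simps)
        then have "A (mk 1 v 0) = A (mk 0 v 0) + A (mk 1 0 0)" by (simp only: isom_add[OF A])
        then show ?thesis using z[of "(v, 0)"] z[of "(0, 0)"] unfolding \<phi>F g_def
          by (simp add: midpart_simps cip_simps)
      qed
      moreover have "x = x $ First *s mk 1 0 0 + mk 0 (midpart x) 0 + x $ Final *s axis Final 1"
        unfolding fin[symmetric] by (subst mk_collapse[of x, symmetric]) (simp add: mk_simps)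
      then have "A x = x $ First *s A (mk 1 0 0) + A (mk 0 (midpart x) 0) + x $ Final *s A (axis Final 1)"
        by (metis isom_add[OF A] isom_sc[OF A])
      ultimately have "cip (midpart (A x)) d = 0" unfolding g_def by (simp add: midpart_simps cip_simps d')
      then show False unfolding x using d(1) by (simp add: cip_self_eq_0)
    qed
    show "q \<in> G" if "q \<in> S" "q \<in> closure G" "f q ~= 0" for q
    proof (rule closed[OF that(1,2)])
      show "midpart (A (heis q)) ~= 0" using that(3) unfolding f_def by (auto simp: cip_simps)
    qed
  qed
  then have "herm (u q) (R (heis q)) = 0"
    by (intro zero_on_closure[OF S _ G(3) q]) (use q Ck_open_continuous[OF Ck_herm[OF Ck_u CRR]] in auto)
  from prp[OF q this] have Rq: "R (heis q) = lam q *s u q" .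
  then have l: "lam q ~= 0" using Rnz[of q] by auto
  have "T (R (heis q)) = lam q *s T (u q)" unfolding Rq by (rule isom_sc[OF T])
  then have "T (u q) = (1 / lam q) *s wq (A (heis q))" unfolding R_def Ti using l by simp
  then show ?thesis by blast
qed

text \<open>On a ball, either \<open>BB\<close> vanishes identically, or it is non-zero somewhere
  and the Whitney form found there spreads over the whole ball by convexity.\<close>

theorem local_form:
  assumes n2: "CARD('n) \<ge> 2" and p0: "p0 \<in> S"
  obtains W where "open W" "p0 \<in> W" "W \<subseteq> S"
    "(\<exists>m. clin m \<and> inj m \<and> (\<forall>q\<in>W. \<exists>c. u q = c *s m (heis q))) \<or>
     (\<exists>T A. isom T \<and> isom A \<and> (\<forall>q\<in>W. \<exists>c. T (u q) = c *s wq (A (heis q))))"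
proof -
  obtain r where r: "r > 0" "ball p0 r \<subseteq> S" using S p0 openE by blast
  interpret B: cr_immersion "ball p0 r" u j by (rule cr_immersion_subset[OF open_ball r(2)])
  have p0': "p0 \<in> ball p0 r" using r by simp
  show ?thesis
  proof (cases "\<forall>q\<in>ball p0 r. \<forall>a b. BB q a b = 0")
    case True
    then have B0: "BB q a b = 0" if "q \<in> ball p0 r" for q a b using that by blast
    show ?thesis
    proof (rule B.local_linear[OF p0' B0])
      fix W m assume W: "open W" "p0 \<in> W" "W \<subseteq> ball p0 r" "clin m" "inj m" "!!q. q \<in> W ==> \<exists>c. u q = c *s m (heis q)"
      show ?thesis using W r(2) by (intro that[of W] disjI1 exI[of _ m] conjI) auto
    qed
  next
    case False
    then obtain q a b where q: "q \<in> ball p0 r" "BB q a b ~= 0" by blast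
    show ?thesis
    proof (rule B.local_whitney[OF n2 q])
      fix G0 T A assume G: "open G0" "q \<in> G0" "G0 \<subseteq> ball p0 r" and TA: "isom T" "isom A"
        and w: "!!q. q \<in> G0 ==> \<exists>c. T (u q) = c *s wq (A (heis q))"
      have ne: "G0 ~= {}" using G(2) by blast
      have "\<exists>c. T (u q) = c *s wq (A (heis q))" if "q \<in> ball p0 r" for q
        by (rule B.whitney_spread[OF n2 convex_ball TA G(1,3) ne w that])
      then show ?thesis using r TA by (intro that[of "ball p0 r"] disjI2 exI[of _ T] exI[of _ A] conjI) auto
    qed
  qed
qed

end

section \<open>Lines, affine charts and atlases\<close>

lemma span_line: "vec.span {v :: complex^'k} = {c *s v | c. True}"
  unfolding vec.span_singleton by auto

lemma CP_line:
  fixes L :: "'m::finite V set"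
  assumes "L \<in> CP" obtains v where "v ~= 0" "L = vec.span {v}"
proof -
  have L: "vec.subspace L" "vec.dim L = 1" using assms unfolding CP_def by auto
  obtain B where B: "B \<subseteq> L" "vec.independent B" "L \<subseteq> vec.span B" "card B = vec.dim L"
    using vec.basis_exists[of L] by metis
  obtain v where v: "B = {v}" using B(4) L(2) card_1_singletonE by metis
  have "v ~= 0" using B(2) v vec.dependent_zero[of B] by auto
  moreover have "L = vec.span {v}" using B v L(1) vec.span_minimal by blast
  ultimately show ?thesis using that by blast
qed

lemma span_in_CP: "v ~= 0 ==> vec.span {v} \<in> (CP :: 'm::finite V set set)"
proof -
  assume "v ~= 0"
  then have "vec.independent {v}" by simp
  from vec.dim_eq_card_independent[OF this] have "vec.dim (vec.span {v}) = 1" by (simp add: vec.dim_span)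
  then show ?thesis unfolding CP_def by (simp add: vec.subspace_span)
qed

lemma affine_chart_domain: "L \<in> fst (affine_chart j) \<longleftrightarrow> L \<in> CP \<and> (\<exists>v\<in>L. v $ j ~= 0)"
  by (simp add: affine_chart_def)

lemma affine_chart_eqI:
  assumes "w $ j = 1" shows "snd (affine_chart j) (vec.span {w}) = w"
  unfolding affine_chart_def snd_conv
proof (rule the_equality)
  show "w \<in> vec.span {w} \<and> w $ j = 1" using assms vec.span_base[of w "{w}"] by simp
  show "v = w" if "v \<in> vec.span {w} \<and> v $ j = 1" for v
    using that assms unfolding span_line by auto
qed

lemma affine_chart_line:
  assumes "L \<in> fst (affine_chart j)"
  shows "snd (affine_chart j) L $ j = 1" "L = vec.span {snd (affine_chart j) L}" "snd (affine_chart j) L \<in> L"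
proof -
  have L: "L \<in> CP" and ex: "\<exists>v\<in>L. v $ j ~= 0" using assms unfolding affine_chart_domain by auto
  obtain v where v: "v ~= 0" "L = vec.span {v}" using CP_line[OF L] by blast
  have vj: "v $ j ~= 0" using ex v unfolding span_line by auto
  define w where "w = (1 / v $ j) *s v"
  have w: "w $ j = 1" unfolding w_def using vj by simp
  have "vec.span {w} = L"
  proof -
    have "v = v $ j *s w" unfolding w_def using vj by simp
    then have "v \<in> vec.span {w}" unfolding span_line by blast
    moreover have "w \<in> vec.span {v}" unfolding w_def span_line by blast
    ultimately show ?thesis unfolding v(2)
      by (intro equalityI vec.span_minimal vec.subspace_span) auto
  qed
  then have s: "snd (affine_chart j) L = w" using affine_chart_eqI[OF w] by simp
  show "snd (affine_chart j) L $ j = 1" "L = vec.span {snd (affine_chart j) L}"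
    unfolding s using w \<open>vec.span {w} = L\<close> by auto
  then show "snd (affine_chart j) L \<in> L" using vec.span_base by blast
qed

lemma span_affine_domain: "w $ j = 1 ==> vec.span {w} \<in> fst (affine_chart j)"
  unfolding affine_chart_domain using span_in_CP[of w] vec.span_base[of w "{w}"] by force

lemma affine_chart_inj: "inj_on (snd (affine_chart j)) (fst (affine_chart j))"
proof (rule inj_onI)
  fix L L' assume L: "L \<in> fst (affine_chart j)" "L' \<in> fst (affine_chart j)" "snd (affine_chart j) L = snd (affine_chart j) L'"
  have "L = vec.span {snd (affine_chart j) L}" by (rule affine_chart_line(2)[OF L(1)])
  also have "\<dots> = L'" unfolding L(3) by (rule affine_chart_line(2)[OF L(2), symmetric])
  finally show "L = L'" .
qed

lemma CP_chart_exists: "(L :: 'm::finite V set) \<in> CP ==> \<exists>j. L \<in> fst (affine_chart j)"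
proof -
  assume L: "L \<in> CP"
  obtain v where v: "v ~= 0" "L = vec.span {v}" using CP_line[OF L] by blast
  obtain j where "v $ j ~= 0" using v(1) by (auto simp: vec_eq_iff)
  then show ?thesis unfolding affine_chart_domain using L v vec.span_base by blast
qed

lemma Sigma_null_span:
  assumes "v ~= 0" shows "vec.span {v} \<in> Sigma_null \<longleftrightarrow> herm v v = 0"
  unfolding Sigma_null_def using span_in_CP[OF assms] vec.span_base[of v "{v}"]
  by (auto simp: span_line herm_simps)

lemma carrier_restrict: "carrier_of (restrict_atlas A W) = carrier_of A \<inter> W"
  unfolding carrier_of_def restrict_atlas_def by auto

lemma atlas_open_istopology:
  assumes "!!U g. (U, g) \<in> A ==> inj_on g U"
  shows "istopology (atlas_open A)"
  unfolding istopology_def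
proof (intro conjI allI impI)
  fix V W assume V: "atlas_open A V" and W: "atlas_open A W"
  show "atlas_open A (V \<inter> W)"
    unfolding atlas_open_def
  proof (intro conjI ballI)
    show "V \<inter> W \<subseteq> carrier_of A" using V unfolding atlas_open_def by blast
    fix c assume c: "c \<in> A"
    obtain U g where c': "c = (U, g)" by (cases c)
    have "g ` (U \<inter> (V \<inter> W)) = g ` (U \<inter> V) \<inter> g ` (U \<inter> W)"
      using assms[of U g] c c' by (auto simp: inj_on_def)
    moreover have "openin (top_of_set (g ` U)) (g ` (U \<inter> V))" "openin (top_of_set (g ` U)) (g ` (U \<inter> W))"
      using V W c c' unfolding atlas_open_def by auto
    ultimately show "case c of (U, g) => openin (top_of_set (g ` U)) (g ` (U \<inter> (V \<inter> W)))"
      unfolding c' by (simp add: openin_Int)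
  qed
next
  fix K assume K: "\<forall>V\<in>K. atlas_open A V"
  show "atlas_open A (\<Union>K)"
    unfolding atlas_open_def
  proof (intro conjI ballI)
    show "\<Union>K \<subseteq> carrier_of A" using K unfolding atlas_open_def by blast
    fix c assume c: "c \<in> A"
    obtain U g where c': "c = (U, g)" by (cases c)
    have "g ` (U \<inter> \<Union>K) = \<Union>((%V. g ` (U \<inter> V)) ` K)" by auto
    moreover have "openin (top_of_set (g ` U)) (g ` (U \<inter> V))" if "V \<in> K" for V
      using K c c' that unfolding atlas_open_def by auto
    ultimately show "case c of (U, g) => openin (top_of_set (g ` U)) (g ` (U \<inter> \<Union>K))"
      unfolding c' by (auto intro!: openin_Union)
  qed
qed

lemma openin_atlas_topology:
  assumes "!!U g. (U, g) \<in> A ==> inj_on g U"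
  shows "openin (atlas_topology A) W \<longleftrightarrow> atlas_open A W"
  unfolding atlas_topology_def using topology_inverse'[OF atlas_open_istopology[OF assms]] by simp

lemma topspace_atlas_topology:
  assumes "!!U g. (U, g) \<in> A ==> inj_on g U"
  shows "topspace (atlas_topology A) = carrier_of A"
proof
  show "topspace (atlas_topology A) \<subseteq> carrier_of A"
  proof -
    have "atlas_open A (topspace (atlas_topology A))"
      using openin_atlas_topology[of A "topspace (atlas_topology A)"] assms openin_topspace by blast
    then show ?thesis unfolding atlas_open_def by blast
  qed
  have "atlas_open A (carrier_of A)"
    unfolding atlas_open_def
  proof (intro conjI ballI)
    fix c assume c: "c \<in> A"
    obtain U g where c': "c = (U, g)" by (cases c)
    have "U \<inter> carrier_of A = U" using c c' unfolding carrier_of_def by auto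
    then show "case c of (U, g) => openin (top_of_set (g ` U)) (g ` (U \<inter> carrier_of A))" unfolding c' by simp
  qed simp
  then show "carrier_of A \<subseteq> topspace (atlas_topology A)"
    using openin_atlas_topology[OF assms] openin_subset by blast
qed

lemma Ck_on_open:
  assumes S: "open S" and f: "Ck_on k S f" shows "Ck_open k S f"
proof (rule Ck_open_local)
  fix x assume x: "x \<in> S"
  obtain U g where U: "open U" "x \<in> U" "Ck_open k U g" "\<forall>y\<in>S \<inter> U. g y = f y"
    using f[unfolded Ck_on_def, rule_format, OF x] by (elim exE conjE) (rule that)
  show "\<exists>U. open U \<and> x \<in> U \<and> Ck_open k U f"
    by (intro exI[of _ "S \<inter> U"] conjI open_Int S U(1) Ck_open_cong[OF open_Int[OF S U(1)] bspec[OF U(4)] Ck_open_subset[OF U(3)]])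
      (use x U in auto)
qed

text \<open>\<open>atlas_open\<close> must be tested in all charts at once; continuity of the
  transition maps reduces this to the given chart.\<close>

lemma chart_open:
  assumes M: "Ck_manifold k A" and c: "(U, g) \<in> A" and W: "W \<subseteq> U" "open (g ` W)"
  shows "atlas_open A W"
  unfolding atlas_open_def
proof (intro conjI ballI)
  show "W \<subseteq> carrier_of A" using W c unfolding carrier_of_def by force
  fix d assume d: "d \<in> A"
  obtain V q where d': "d = (V, q)" by (cases d)
  have inj: "inj_on g U" "inj_on q V" and "open (q ` V)" and o: "open (q ` (V \<inter> U))"
    and tr: "Ck_on k (q ` (V \<inter> U)) (g \<circ> inv_into V q)"
    using M c d d' unfolding Ck_manifold_def by blast+
  have "continuous_on (q ` (V \<inter> U)) (g \<circ> inv_into V q)"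
    by (rule Ck_open_continuous[OF Ck_on_open[OF o tr]])
  from continuous_open_preimage[OF this o W(2)]
  have "open (q ` (V \<inter> U) \<inter> (g \<circ> inv_into V q) -` (g ` W))" .
  moreover have "q ` (V \<inter> U) \<inter> (g \<circ> inv_into V q) -` (g ` W) = q ` (V \<inter> W)"
  proof (intro equalityI subsetI)
    fix x assume "x \<in> q ` (V \<inter> U) \<inter> (g \<circ> inv_into V q) -` (g ` W)"
    then obtain p w where p: "p \<in> V \<inter> U" "x = q p" "w \<in> W" "g (inv_into V q x) = g w" by auto
    have "inv_into V q x = p" using p inj(2) by simp
    then have "p = w" using p inj(1) W(1) by (metis IntD2 inj_onD subsetD)
    then show "x \<in> q ` (V \<inter> W)" using p by blast
  next
    fix x assume "x \<in> q ` (V \<inter> W)"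
    then show "x \<in> q ` (V \<inter> U) \<inter> (g \<circ> inv_into V q) -` (g ` W)" using W(1) inj(2) by auto
  qed
  ultimately show "case d of (V, q) => openin (top_of_set (q ` V)) (q ` (V \<inter> W))"
    unfolding d' by (auto intro: open_openin_trans[OF \<open>open (q ` V)\<close>] open_subset)
qed

lemma atlas_open_chart:
  assumes M: "Ck_manifold k A" and c: "(U, g) \<in> A" and W: "atlas_open A W"
  shows "open (g ` (U \<inter> W))"
proof -
  have "open (g ` U)" using M c unfolding Ck_manifold_def by blast
  moreover have "openin (top_of_set (g ` U)) (g ` (U \<inter> W))" using W c unfolding atlas_open_def by blast
  ultimately show ?thesis using openin_open_trans by blast
qed

subsection \<open>The contact planes\<close>

lemma frechet_herm: "FD (%x :: 'm::finite V. herm x x) x w = cor (2 * Re (herm w x))"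
proof -
  have "FD (%x :: 'm V. herm x x) x w = herm x w + herm w x"
    by (rule FD_apply[OF bounded_bilinear.FDERIV[OF bounded_bilinear_herm has_derivative_ident has_derivative_ident]])
  then show ?thesis using herm_cnj[of w x] by (simp add: complex_eq_iff)
qed

text \<open>Tangency is the vanishing of the real part of the pairing with the point; imposed on w
  and on \<i> w together, it is complex orthogonality.\<close>

lemma contact_plane_eq:
  "contact_plane j L = {w. w $ j = 0 \<and> herm w (snd (affine_chart j) L) = 0}"
  unfolding contact_plane_def Sigma_tangent_def frechet_herm
  by (auto simp: herm_simps complex_eq_iff)

section \<open>Heisenberg parametrisations of CR-flat submanifolds\<close>

lemma linear_inj_surj_dim:
  fixes f :: "'a::euclidean_space => 'b::euclidean_space"
  assumes "linear f" "inj f" "DIM('a) = DIM('b)" shows "surj f"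
proof -
  have "dim (range f) = DIM('b)" using dim_image_eq[OF assms(1), of UNIV] assms(2,3) by simp
  moreover have "subspace (range f)" using assms(1) by (simp add: linear_subspace_image)
  ultimately show ?thesis using dim_eq_full[of "range f"] by (metis span_eq_iff)
qed

text \<open>The isometry \<open>swp\<close> exchanges the affine charts \<open>First\<close> and \<open>Final\<close>; these two cover the null lines.\<close>

definition swp :: "'n::finite V => 'n V" where "swp x = mk (- x $ Final) (midpart x) (x $ First)"

lemma swp_clin: "clin swp"
  by (simp add: clin_def swp_def mk_simps mk_eq_iff midpart_simps)

lemma herm_swp: "herm (swp x) (swp y) = herm x y"
proof -
  have "herm x y = herm (mk (x $ First) (midpart x) (x $ Final)) (mk (y $ First) (midpart y) (y $ Final))"
    by (simp only: mk_collapse)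
  then show ?thesis unfolding swp_def herm_mk by (simp add: algebra_simps)
qed

definition ii :: "bool => 'n idx" where "ii b = (if b then First else Final)"
definition Psi :: "bool => 'n::finite heis => 'n V" where "Psi b q = (if b then heis q else swp (heis q))"
definition dPsi :: "bool => 'n::finite heis => 'n heis => 'n V" where
  "dPsi b q Y = (if b then dheis q Y else swp (dheis q Y))"
definition chi :: "bool => 'n::finite V => 'n heis" where
  "chi b w = (midpart w, Re (if b then w $ Final else - w $ First))"

lemma Psi_ii: "Psi b q $ ii b = 1" by (simp add: Psi_def ii_def swp_def)
lemma Psi_null: "herm (Psi b q) (Psi b q) = 0" by (simp add: Psi_def herm_swp)

lemma heis_Final: "Re (heis q $ Final) = snd q"
  by (simp add: heis_def cip_self)

lemma heis_midpart: "midpart (heis q) = fst q" by (simp add: heis_def)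

lemma chi_Psi: "chi b (Psi b q) = q"
  by (simp add: chi_def Psi_def swp_def heis_Final heis_midpart)

lemma heis_chi:
  assumes "w $ First = 1" "herm w w = 0" shows "heis (chi True w) = w"
proof -
  have "herm (mk 1 (midpart w) (w $ Final)) (mk 1 (midpart w) (w $ Final)) = 0"
    using assms mk_collapse[of w] by simp
  then have "cip (midpart w) (midpart w) + \<i> * (cnj (w $ Final) - w $ Final) = 0" unfolding herm_mk by simp
  then have "cor ((norm (midpart w))\<^sup>2 + 2 * Im (w $ Final)) = 0"
    unfolding cip_self by (simp add: complex_eq_iff)
  then have "2 * Im (w $ Final) = - (norm (midpart w))\<^sup>2" by (simp only: of_real_eq_0_iff)
  then have "mk 1 (midpart w) (cor (Re (w $ Final)) - \<i> * cip (midpart w) (midpart w) / 2) = mk 1 (midpart w) (w $ Final)"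
    unfolding mk_eq_iff cip_self by (simp add: complex_eq_iff)
  then show ?thesis using assms(1) mk_collapse[of w] by (simp add: heis_def chi_def)
qed

lemma Psi_chi:
  assumes "w $ ii b = 1" "herm w w = 0" shows "Psi b (chi b w) = w"
proof (cases b)
  case True
  then show ?thesis using heis_chi[of w] assms by (simp add: Psi_def ii_def)
next
  case False
  define x where "x = mk (w $ Final) (midpart w) (- w $ First)"
  have sx: "swp x = w" unfolding swp_def x_def by (simp add: mk_collapse)
  have "herm x x = 0" using herm_swp[of x x] assms(2) unfolding sx by simp
  moreover have "x $ First = 1" unfolding x_def using assms(1) False by (simp add: ii_def)
  ultimately have "heis (chi True x) = x" by (rule heis_chi[rotated])
  moreover have "chi True x = chi b w" unfolding chi_def x_def using False by simp
  ultimately show ?thesis using sx False by (simp add: Psi_def)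
qed

lemma Psi_deriv: "(Psi b has_derivative dPsi b q) (at q)"
  using heis_deriv[of q] bounded_linear.has_derivative[OF clin_bounded_linear[OF swp_clin] heis_deriv[of q]]
  by (cases b) (simp_all add: Psi_def[abs_def] dPsi_def[abs_def])

lemma Ck_open_Psi: "open S ==> Ck_open k S (Psi b)"
  using Ck_open_comp_linear[OF _ clin_bounded_linear[OF swp_clin] Ck_open_heis, of S k] Ck_open_heis[of S k]
  by (cases b) (simp_all add: Psi_def[abs_def] eta_contract_eq)

lemma Psi_continuous: "continuous_on UNIV (Psi b)" by (rule Ck_open_continuous[OF Ck_open_Psi[OF open_UNIV, of 0]])

lemma chi_bounded_linear: "bounded_linear (chi b)"
  by (rule linear_conv_bounded_linear[THEN iffD1])
    (cases b; simp add: linear_iff chi_def scaleR_eq_vec midpart_simps scaleR_conv_of_real[where 'a=complex])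

lemma dPsi_hor: "dPsi b q (hor q z) $ ii b = 0" "herm (dPsi b q (hor q z)) (Psi b q) = 0"
  "dPsi b q (hor q (\<i> *s z)) = \<i> *s dPsi b q (hor q z)"
proof -
  show "herm (dPsi b q (hor q z)) (Psi b q) = 0" by (simp add: dPsi_def Psi_def herm_swp)
qed (simp_all add: dPsi_def ii_def swp_def EE_simps clin_scale[OF swp_clin, unfolded swp_def] mk_simps midpart_simps)

lemma dPsi_0: "dPsi b q Y = 0 ==> Y = 0"
proof -
  assume z: "dPsi b q Y = 0"
  have "dheis q Y = 0"
  proof (cases b)
    case False
    then have "swp (dheis q Y) = swp 0" using z by (simp add: dPsi_def clin_zero[OF swp_clin])
    then have "mk (- dheis q Y $ Final) (midpart (dheis q Y)) (dheis q Y $ First) = mk 0 (midpart 0) 0"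
      unfolding swp_def zero_index minus_zero .
    then have "dheis q Y $ Final = 0" "midpart (dheis q Y) = 0" "dheis q Y $ First = 0"
      unfolding mk_eq_iff by (auto simp: midpart_def vec_eq_iff)
    then show ?thesis using mk_collapse[of "dheis q Y"] by (simp add: mk_simps(5))
  qed (use z in \<open>simp add: dPsi_def\<close>)
  then have e: "mk 0 (fst Y) (cor (snd Y) - \<i> * cor (Re (cip (fst Y) (fst q)))) = mk 0 0 0"
    unfolding dheis_def mk_simps(5) .
  then have "fst Y = 0" "snd Y = 0" unfolding mk_eq_iff by (auto simp: complex_eq_iff)
  then show "Y = 0" by (simp add: prod_eq_iff)
qed

lemma null_chart:
  fixes L :: "'n::finite V set"
  assumes "L \<in> Sigma_null" obtains b where "L \<in> fst (affine_chart (ii b))"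
proof -
  have L: "L \<in> CP" "!!x. x \<in> L ==> herm x x = 0" using assms unfolding Sigma_null_def by auto
  obtain v where v: "v ~= 0" "L = vec.span {v}" using CP_line[OF L(1)] by blast
  have vL: "v \<in> L" using v vec.span_base by blast
  have "v $ First ~= 0 \<or> v $ Final ~= 0"
  proof (rule ccontr)
    assume "\<not> ?thesis"
    then have "v = mk 0 (midpart v) 0" using mk_collapse[of v] by simp
    then have "cip (midpart v) (midpart v) = 0" using L(2)[OF vL] herm_mk[of 0 "midpart v" 0 0 "midpart v" 0] by simp
    then have "midpart v = 0" by (simp add: cip_self_eq_0)
    then show False using v(1) \<open>v = mk 0 (midpart v) 0\<close> by (simp add: mk_simps(5))
  qed
  then show ?thesis using that[of True] that[of False] vL L(1) unfolding affine_chart_domain ii_def by auto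
qed

section \<open>One chart of a flat submanifold in Heisenberg coordinates\<close>

locale flat_chart =
  fixes A :: "('p, 'e::euclidean_space) chart set" and f :: "'p => ('n::finite + 'n) V set"
    and W :: "'p set" and h :: "'p => 'n V set" and U \<phi> and b :: bool and j :: "('n + 'n) idx"
  assumes sub: "CR_submanifold 3 CARD('n) A f" and flat: "CR_equivalence 3 A f W h" and c: "(U, \<phi>) \<in> A"
begin

lemma M: "Ck_manifold 3 A" and dim: "DIM('e) = 2 * CARD('n) + 1" and fC: "Ck_map 3 A CP_atlas f"
  and fnull: "f ` carrier_of A \<subseteq> Sigma_null"
  using sub unfolding CR_submanifold_def by auto

lemma A_inj: "(V, p) \<in> A ==> inj_on p V" using M unfolding Ck_manifold_def by blast

lemma W_open: "atlas_open A W"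
  using flat openin_atlas_topology[of A W] A_inj unfolding CR_equivalence_def by blast

lemma W_carrier: "carrier_of A \<inter> W = W" using W_open unfolding atlas_open_def by blast

abbreviation i :: "'n idx" where "i \<equiv> ii b"
definition "F1 = local_rep (U, \<phi>) (affine_chart j) f"
definition "H1 = local_rep (U, \<phi>) (affine_chart i) h"
definition "O1 = {x \<in> U. f x \<in> fst (affine_chart j)}"
definition "O2 = {x \<in> U \<inter> W. h x \<in> fst (affine_chart i)}"
definition "Om = O1 \<inter> O2"

lemma inj\<phi>: "inj_on \<phi> U" by (rule A_inj[OF c])

lemma F1: "open (\<phi> ` O1)" "Ck_open 3 (\<phi> ` O1) F1"
proof -
  have m: "openin (top_of_set (\<phi> ` U)) (\<phi> ` O1)" "Ck_on 3 (\<phi> ` O1) F1"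
    using fC c unfolding Ck_map_def O1_def F1_def CP_atlas_def by fastforce+
  have "open (\<phi> ` U)" using M c unfolding Ck_manifold_def by blast
  then show "open (\<phi> ` O1)" using m(1) openin_open_trans by blast
  then show "Ck_open 3 (\<phi> ` O1) F1" using m(2) by (rule Ck_on_open)
qed

lemma hC: "Ck_diffeo 3 (restrict_atlas A W) (restrict_atlas CP_atlas (h ` W)) h"
  using flat unfolding CR_equivalence_def by blast

lemma hinj: "inj_on h W"
  using hC unfolding Ck_diffeo_def carrier_restrict W_carrier bij_betw_def by blast

lemma restr: "(U \<inter> W, \<phi>) \<in> restrict_atlas A W" "(fst (affine_chart k) \<inter> Z, snd (affine_chart k)) \<in> restrict_atlas CP_atlas Z"
  unfolding restrict_atlas_def CP_atlas_def using c by (force simp: case_prod_beta)+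

lemma H1: "open (\<phi> ` O2)" "Ck_open 3 (\<phi> ` O2) H1"
proof -
  have O2: "O2 = {p \<in> U \<inter> W. h p \<in> fst (affine_chart i) \<inter> h ` W}" unfolding O2_def by auto
  have Ckm: "Ck_map 3 (restrict_atlas A W) (restrict_atlas CP_atlas (h ` W)) h" using hC unfolding Ck_diffeo_def by blast
  have m: "openin (top_of_set (\<phi> ` (U \<inter> W))) (\<phi> ` O2)"
    "Ck_on 3 (\<phi> ` O2) (local_rep (U \<inter> W, \<phi>) (fst (affine_chart i) \<inter> h ` W, snd (affine_chart i)) h)"
    using Ckm[unfolded Ck_map_def, THEN conjunct2, THEN bspec, OF restr(1), THEN bspec, OF restr(2)[of i "h ` W"]]
    unfolding O2 by simp_all
  have "open (\<phi> ` (U \<inter> W))" by (rule atlas_open_chart[OF M c W_open])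
  then show o: "open (\<phi> ` O2)" using m(1) openin_open_trans by blast
  show "Ck_open 3 (\<phi> ` O2) H1"
  proof (rule Ck_open_cong[OF o _ Ck_on_open[OF o m(2)]])
    fix y assume "y \<in> \<phi> ` O2"
    then obtain x where x: "x \<in> O2" "y = \<phi> x" by blast
    have "inv_into (U \<inter> W) \<phi> y = x" "inv_into U \<phi> y = x"
      using x inj\<phi> inj_on_subset[OF inj\<phi>, of "U \<inter> W"] unfolding O2_def by (auto intro!: inv_into_f_eq)
    then show "local_rep (U \<inter> W, \<phi>) (fst (affine_chart i) \<inter> h ` W, snd (affine_chart i)) h y = H1 y"
      unfolding H1_def local_rep_def by simp
  qed
qed

lemma Om: "open (\<phi> ` Om)" "Om \<subseteq> U" "Om \<subseteq> O1" "Om \<subseteq> O2"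
proof -
  have "\<phi> ` Om = \<phi> ` O1 \<inter> \<phi> ` O2"
    unfolding Om_def by (rule inj_on_image_Int[OF inj\<phi>]) (auto simp: O1_def O2_def)
  then show "open (\<phi> ` Om)" using F1(1) H1(1) by auto
qed (auto simp: Om_def O1_def)

lemma F1_at: "x \<in> U ==> F1 (\<phi> x) = snd (affine_chart j) (f x)"
  and H1_at: "x \<in> U ==> H1 (\<phi> x) = snd (affine_chart i) (h x)"
  unfolding F1_def H1_def local_rep_def using inj\<phi> by simp_all

lemma hW_Sigma: "atlas_open (restrict_atlas CP_atlas Sigma_null) (h ` W)"
proof -
  have "inj_on p V" if "(V, p) \<in> restrict_atlas CP_atlas (Sigma_null :: 'n V set set)" for V p
    using that unfolding restrict_atlas_def CP_atlas_def
    by (auto simp: case_prod_beta intro: inj_on_subset[OF affine_chart_inj])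
  then show ?thesis
    using flat openin_atlas_topology[of "restrict_atlas CP_atlas Sigma_null" "h ` W"] unfolding CR_equivalence_def by blast
qed

lemma h_null: "x \<in> W ==> h x \<in> Sigma_null"
  using hW_Sigma unfolding atlas_open_def carrier_restrict by blast

text \<open>\<open>kap\<close> reads the model point \<open>h x\<close> in Heisenberg coordinates,
  \<open>vv\<close> leads from there to the coordinates of the manifold, and \<open>uu\<close> is
  the lift of f normalised by the affine chart j.\<close>

definition "kap x = chi b (snd (affine_chart i) (h x))"
definition "SS = kap ` Om"
definition "vv q = \<phi> (inv_into W h (vec.span {Psi b q}))"
definition "uu q = F1 (vv q)"

lemma Psi_kap:
  assumes "x \<in> O2" shows "Psi b (kap x) = snd (affine_chart i) (h x)"
proof -
  have d: "h x \<in> fst (affine_chart i)" "h x \<in> Sigma_null" using assms h_null unfolding O2_def by auto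
  show ?thesis
    unfolding kap_def
    by (rule Psi_chi) (use d affine_chart_line[OF d(1)] in \<open>auto simp: Sigma_null_def\<close>)
qed

lemma span_kap:
  assumes "x \<in> O2" shows "vec.span {Psi b (kap x)} = h x" "inv_into W h (vec.span {Psi b (kap x)}) = x" "vv (kap x) = \<phi> x"
proof -
  have d: "h x \<in> fst (affine_chart i)" "x \<in> W" using assms unfolding O2_def by auto
  show 1: "vec.span {Psi b (kap x)} = h x" unfolding Psi_kap[OF assms] by (rule affine_chart_line(2)[OF d(1), symmetric])
  show "inv_into W h (vec.span {Psi b (kap x)}) = x" unfolding 1 using hinj d(2) by simp
  then show "vv (kap x) = \<phi> x" unfolding vv_def by simp
qed

definition "EE2 = snd (affine_chart i) ` {L \<in> fst (affine_chart i) \<inter> h ` W. inv_into W h L \<in> U \<inter> W}"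
definition "S2 = {q. Psi b q \<in> EE2}"

lemma S2_mem: "q \<in> S2 \<longleftrightarrow> vec.span {Psi b q} \<in> h ` W \<and> inv_into W h (vec.span {Psi b q}) \<in> U"
proof -
  have d: "vec.span {Psi b q} \<in> fst (affine_chart i)" by (rule span_affine_domain[OF Psi_ii])
  have a: "snd (affine_chart i) (vec.span {Psi b q}) = Psi b q" by (rule affine_chart_eqI[OF Psi_ii])
  show ?thesis
  proof
    assume "q \<in> S2"
    then obtain L where L: "L \<in> fst (affine_chart i)" "L \<in> h ` W" "inv_into W h L \<in> U" "Psi b q = snd (affine_chart i) L"
      unfolding S2_def EE2_def by blast
    have "vec.span {Psi b q} = L" unfolding L(4) by (rule affine_chart_line(2)[OF L(1), symmetric])
    then show "vec.span {Psi b q} \<in> h ` W \<and> inv_into W h (vec.span {Psi b q}) \<in> U" using L by simp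
  next
    assume *: "vec.span {Psi b q} \<in> h ` W \<and> inv_into W h (vec.span {Psi b q}) \<in> U"
    then have "inv_into W h (vec.span {Psi b q}) \<in> W" by (simp add: inv_into_into)
    then have "snd (affine_chart i) (vec.span {Psi b q}) \<in> EE2" unfolding EE2_def using * d by blast
    then show "q \<in> S2" unfolding S2_def a by simp
  qed
qed

lemma EE2_open: "openin (top_of_set {w. w $ i = 1 \<and> herm w w = 0}) EE2"
  and theta: "Ck_on 3 EE2 (\<phi> \<circ> inv_into W h \<circ> inv_into (fst (affine_chart i) \<inter> h ` W) (snd (affine_chart i)))"
proof -
  have Ckm: "Ck_map 3 (restrict_atlas CP_atlas (h ` W)) (restrict_atlas A W) (inv_into W h)"
    using hC unfolding Ck_diffeo_def carrier_restrict W_carrier by blast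
  have m: "openin (top_of_set (snd (affine_chart i) ` (fst (affine_chart i) \<inter> h ` W))) EE2"
    "Ck_on 3 EE2 (local_rep (fst (affine_chart i) \<inter> h ` W, snd (affine_chart i)) (U \<inter> W, \<phi>) (inv_into W h))"
    using Ckm[unfolded Ck_map_def, THEN conjunct2, THEN bspec, OF restr(2)[of i "h ` W"], THEN bspec, OF restr(1)]
    unfolding EE2_def by simp_all
  then show "Ck_on 3 EE2 (\<phi> \<circ> inv_into W h \<circ> inv_into (fst (affine_chart i) \<inter> h ` W) (snd (affine_chart i)))"
    unfolding local_rep_def by simp
  have img: "snd (affine_chart i) ` (fst (affine_chart i) \<inter> Sigma_null) = {w :: 'n V. w $ i = 1 \<and> herm w w = 0}"
  proof (intro equalityI subsetI)
    fix w assume "w \<in> snd (affine_chart i) ` (fst (affine_chart i) \<inter> (Sigma_null :: 'n V set set))"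
    then obtain L where L: "L \<in> fst (affine_chart i)" "L \<in> Sigma_null" "w = snd (affine_chart i) L" by blast
    then show "w \<in> {w. w $ i = 1 \<and> herm w w = 0}"
      using affine_chart_line[OF L(1)] unfolding Sigma_null_def by auto
  next
    fix w :: "'n V" assume w: "w \<in> {w. w $ i = 1 \<and> herm w w = 0}"
    have "w ~= 0" using w by auto
    then have "vec.span {w} \<in> fst (affine_chart i) \<inter> Sigma_null" using w span_affine_domain Sigma_null_span by auto
    then show "w \<in> snd (affine_chart i) ` (fst (affine_chart i) \<inter> Sigma_null)"
      using affine_chart_eqI[of w i] w by force
  qed
  have "openin (top_of_set (snd (affine_chart i) ` (fst (affine_chart i) \<inter> Sigma_null)))
      (snd (affine_chart i) ` (fst (affine_chart i) \<inter> Sigma_null \<inter> h ` W))"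
    using hW_Sigma restr(2)[of i Sigma_null] unfolding atlas_open_def by blast
  moreover have "fst (affine_chart i) \<inter> Sigma_null \<inter> h ` W = fst (affine_chart i) \<inter> h ` W" using h_null by blast
  ultimately have "openin (top_of_set {w. w $ i = 1 \<and> herm w w = 0}) (snd (affine_chart i) ` (fst (affine_chart i) \<inter> h ` W))"
    unfolding img by simp
  then show "openin (top_of_set {w. w $ i = 1 \<and> herm w w = 0}) EE2"
    by (rule openin_trans[OF m(1)])
qed

text \<open>Openness in the affine chart is relative to the null quadric; since \<open>Psi b\<close>
  takes its values there, the preimage is open in Heisenberg space.\<close>

lemma S2_open: "open S2"
proof -
  obtain T where T: "open T" "EE2 = {w. w $ i = 1 \<and> herm w w = 0} \<inter> T" using EE2_open unfolding openin_open by blast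
  have "S2 = Psi b -` T" unfolding S2_def T(2) by (auto simp: Psi_ii Psi_null)
  then show ?thesis using open_vimage[OF T(1) Psi_continuous] by simp
qed

text \<open>The regularity of the inverse of h is given on a subset of the quadric, that is by local
  extensions to the ambient space; composing an extension with \<open>Psi b\<close> gives regularity
  on an open set.\<close>

lemma vv_Ck: "Ck_open 3 S2 vv"
proof (rule Ck_open_local)
  fix q assume q: "q \<in> S2"
  define t where "t = \<phi> \<circ> inv_into W h \<circ> inv_into (fst (affine_chart i) \<inter> h ` W) (snd (affine_chart i))"
  have qE: "Psi b q \<in> EE2" using q unfolding S2_def by simp
  obtain T g where T: "open T" "Psi b q \<in> T" "Ck_open 3 T g" "\<forall>y\<in>EE2 \<inter> T. g y = t y"
    using theta[folded t_def, unfolded Ck_on_def, rule_format, OF qE] by (elim exE conjE) (rule that)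
  define Q where "Q = S2 \<inter> Psi b -` T"
  have Q: "open Q" unfolding Q_def using S2_open open_vimage[OF T(1) Psi_continuous] by blast
  have C: "Ck_open 3 Q (%q. g (Psi b q))"
    by (rule Ck_open_compose[OF Q _ Ck_open_Psi[OF Q] T(3)]) (auto simp: Q_def)
  have e: "g (Psi b q) = vv q" if "q \<in> Q" for q
  proof -
    have "Psi b q \<in> EE2 \<inter> T" using that unfolding Q_def S2_def by auto
    then have "g (Psi b q) = t (Psi b q)" using T(4) by blast
    moreover have "inv_into (fst (affine_chart i) \<inter> h ` W) (snd (affine_chart i)) (Psi b q) = vec.span {Psi b q}"
    proof (rule inv_into_f_eq)
      show "inj_on (snd (affine_chart i)) (fst (affine_chart i) \<inter> h ` W)"
        by (rule inj_on_subset[OF affine_chart_inj]) blast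
      show "vec.span {Psi b q} \<in> fst (affine_chart i) \<inter> h ` W"
        using span_affine_domain[OF Psi_ii] that S2_mem unfolding Q_def by blast
    qed (rule affine_chart_eqI[OF Psi_ii])
    ultimately show ?thesis unfolding t_def vv_def by simp
  qed
  have "Ck_open 3 Q vv" by (rule Ck_open_cong[OF Q e C])
  then show "\<exists>U. open U \<and> q \<in> U \<and> Ck_open 3 U vv" using Q q T(2) unfolding Q_def by blast
qed

lemma kap_image:
  assumes "X \<subseteq> Om" shows "kap ` X = {q \<in> S2. vv q \<in> \<phi> ` X}"
proof (intro equalityI subsetI)
  fix q assume "q \<in> kap ` X"
  then obtain x where x: "x \<in> X" "q = kap x" by blast
  have xO: "x \<in> O2" using x assms Om(4) by blast
  then show "q \<in> {q \<in> S2. vv q \<in> \<phi> ` X}"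
    using x span_kap[OF xO] unfolding mem_Collect_eq S2_mem by (auto simp: O2_def)
next
  fix q assume "q \<in> {q \<in> S2. vv q \<in> \<phi> ` X}"
  then obtain x where q: "q \<in> S2" and x: "x \<in> X" "vv q = \<phi> x" by blast
  define x' where "x' = inv_into W h (vec.span {Psi b q})"
  have m: "vec.span {Psi b q} \<in> h ` W" "x' \<in> U" using q unfolding S2_mem x'_def by auto
  have "x' = x" using x(2) m(2) inj\<phi> x(1) assms Om(2) unfolding vv_def x'_def[symmetric] by (meson inj_onD subsetD)
  then have "h x = vec.span {Psi b q}" using f_inv_into_f[OF m(1)] unfolding x'_def by simp
  then have "kap x = q" unfolding kap_def by (simp only: affine_chart_eqI[OF Psi_ii] chi_Psi)
  then show "q \<in> kap ` X" using x(1) by blast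
qed

lemma kap_open:
  assumes "X \<subseteq> Om" "open (\<phi> ` X)" shows "open (kap ` X)"
proof -
  have "open (S2 \<inter> vv -` (\<phi> ` X))"
    by (rule continuous_open_preimage[OF Ck_open_continuous[OF vv_Ck] S2_open assms(2)])
  moreover have "S2 \<inter> vv -` (\<phi> ` X) = {q \<in> S2. vv q \<in> \<phi> ` X}" by blast
  ultimately show ?thesis unfolding kap_image[OF assms(1)] by simp
qed

lemma SS: "open SS" "SS \<subseteq> S2"
  unfolding SS_def using kap_open[OF order_refl Om(1)] kap_image[OF order_refl] by auto

lemma SS_x:
  assumes "q \<in> SS" obtains x where "x \<in> Om" "q = kap x" "vv q = \<phi> x" "uu q = snd (affine_chart j) (f x)"
    "Psi b q = snd (affine_chart i) (h x)"
proof -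
  obtain x where x: "x \<in> Om" "q = kap x" using assms unfolding SS_def by blast
  have xO: "x \<in> O2" using x Om by blast
  have v: "vv q = \<phi> x" unfolding x(2) by (rule span_kap(3)[OF xO])
  have "uu q = snd (affine_chart j) (f x)" unfolding uu_def v using F1_at x Om by blast
  moreover have "Psi b q = snd (affine_chart i) (h x)" unfolding x(2) by (rule Psi_kap[OF xO])
  ultimately show ?thesis using that[OF x v] by simp
qed

lemma vv_C3: "Ck_open 3 SS vv" by (rule Ck_open_subset[OF vv_Ck SS(2)])

lemma vv_SS: "vv ` SS \<subseteq> \<phi> ` Om"
proof safe
  fix q assume "q \<in> SS"
  then show "vv q \<in> \<phi> ` Om" by (rule SS_x) simp
qed

lemma uu_C3: "Ck_open 3 SS uu"
  unfolding uu_def[abs_def]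
  by (rule Ck_open_compose[OF SS(1) _ vv_C3 F1(2)]) (use vv_SS Om(3) in blast)

definition "Dv q = FD vv q"
definition "DF q = FD F1 (vv q)"
definition "DH q = FD H1 (vv q)"

lemma Ck3_diff: "Ck_open 3 S g ==> q \<in> S ==> g differentiable (at q)"
  by (simp add: numeral_3_eq_3)

lemma derivs:
  assumes q: "q \<in> SS"
  shows "(vv has_derivative Dv q) (at q)" "(F1 has_derivative DF q) (at (vv q))" "(H1 has_derivative DH q) (at (vv q))"
proof -
  have m: "vv q \<in> \<phi> ` O1" "vv q \<in> \<phi> ` O2" using vv_SS q Om(3,4) by blast+
  show "(vv has_derivative Dv q) (at q)" unfolding Dv_def by (rule FD_works[OF Ck3_diff[OF vv_C3 q]])
  show "(F1 has_derivative DF q) (at (vv q))" unfolding DF_def by (rule FD_works[OF Ck3_diff[OF F1(2) m(1)]])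
  show "(H1 has_derivative DH q) (at (vv q))" unfolding DH_def by (rule FD_works[OF Ck3_diff[OF H1(2) m(2)]])
qed

lemma Du: "q \<in> SS ==> FD uu q Y = DF q (Dv q Y)"
  unfolding uu_def[abs_def] by (rule FD_apply[OF has_derivative_compose[OF derivs(1,2)]])

lemma DH_Dv: assumes q: "q \<in> SS" shows "DH q (Dv q Y) = dPsi b q Y"
proof -
  have "((%q. H1 (vv q)) has_derivative (%Y. DH q (Dv q Y))) (at q)"
    by (rule has_derivative_compose[OF derivs(1,3)[OF q]])
  then have "(Psi b has_derivative (%Y. DH q (Dv q Y))) (at q)"
  proof (rule has_derivative_transform_within_open[OF _ SS(1) q])
    fix q assume "q \<in> SS"
    then show "H1 (vv q) = Psi b q" by (rule SS_x) (use H1_at Om(2) in auto)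
  qed
  from has_derivative_unique[OF this Psi_deriv] show ?thesis by (rule fun_cong)
qed

lemma DIM_heis: "DIM('n heis) = 2 * CARD('n) + 1" by simp

lemma Dv_inj: "q \<in> SS ==> Dv q Y = 0 ==> Y = 0"
  using DH_Dv[of q Y] linear_0[OF has_derivative_linear[OF derivs(3)]] dPsi_0 by metis

lemma Dv_surj: assumes q: "q \<in> SS" shows "surj (Dv q)"
proof (rule linear_inj_surj_dim)
  show l: "linear (Dv q)" by (rule has_derivative_linear[OF derivs(1)[OF q]])
  show "inj (Dv q)" using linear_injective_0[OF l] Dv_inj[OF q] by blast
  show "DIM('n heis) = DIM('e)" unfolding dim DIM_heis ..
qed

lemma DH_inj: assumes q: "q \<in> SS" "DH q X = DH q X'" shows "X = X'"
proof -
  obtain Y Y' where Y: "X = Dv q Y" "X' = Dv q Y'" using Dv_surj[OF q(1)] by (metis surjD)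
  have "dPsi b q (Y - Y') = 0"
    using q(2) linear_diff[OF has_derivative_linear[OF Psi_deriv], of b q Y Y'] unfolding Y DH_Dv[OF q(1)] by simp
  then have "Y = Y'" using dPsi_0 by fastforce
  then show ?thesis using Y by simp
qed

lemma at_point:
  assumes x: "x \<in> Om"
  shows "inj (DF (kap x))" "vec.subspace (range (DF (kap x)) \<inter> contact_plane j (f x))"
    "!!X. DH (kap x) X \<in> contact_plane i (h x) ==> DF (kap x) X \<in> contact_plane j (f x) \<and>
       (THE Y. DF (kap x) Y = \<i> *s DF (kap x) X) = (THE Y. DH (kap x) Y = \<i> *s DH (kap x) X)"
proof -
  have m: "x \<in> U" "x \<in> W" "f x \<in> fst (affine_chart j)" "h x \<in> fst (affine_chart i)" using x unfolding Om_def O1_def O2_def by auto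
  have v: "vv (kap x) = \<phi> x" using span_kap(3) x Om(4) by blast
  have cF: "chart_deriv (U, \<phi>) (affine_chart j) f x = DF (kap x)" "chart_deriv (U, \<phi>) (affine_chart i) h x = DH (kap x)"
    unfolding chart_deriv_def DF_def DH_def v F1_def H1_def by simp_all
  have s: "let df = chart_deriv (U, \<phi>) (affine_chart j) f x; D = range df \<inter> contact_plane j (f x)
         in inj df \<and> vec.subspace D \<and> vec.dim D = CARD('n)"
    using sub c m unfolding CR_submanifold_def by fastforce
  show "inj (DF (kap x))" "vec.subspace (range (DF (kap x)) \<inter> contact_plane j (f x))"
    using s unfolding cF Let_def by auto
  have e: "CR_plane (U, \<phi>) j f x = CR_plane (U, \<phi>) i h x"
    "\<forall>X\<in>CR_plane (U, \<phi>) j f x. CR_J (U, \<phi>) j f x X = CR_J (U, \<phi>) i h x X"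
    using flat c m unfolding CR_equivalence_def by fastforce+
  fix X assume "DH (kap x) X \<in> contact_plane i (h x)"
  then have X: "X \<in> CR_plane (U, \<phi>) j f x" unfolding e(1) unfolding CR_plane_def cF by simp
  then show "DF (kap x) X \<in> contact_plane j (f x) \<and>
       (THE Y. DF (kap x) Y = \<i> *s DF (kap x) X) = (THE Y. DH (kap x) Y = \<i> *s DH (kap x) X)"
    using e(2) unfolding CR_plane_def CR_J_def cF by simp
qed

text \<open>The complex structures induced by f and h are definite descriptions that agree by
  \<open>at_point\<close>. The one for h is computed from \<open>Psi b\<close>; the one for f exists
  because the contact part of its tangent space is a complex subspace.\<close>

lemma uu_CR: "CR_on SS uu"
  unfolding CR_on_def
proof (intro ballI allI)
  fix q z assume q: "q \<in> SS"
  obtain x where x: "x \<in> Om" "q = kap x" "Psi b q = snd (affine_chart i) (h x)" by (rule SS_x[OF q])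
  define X where "X = Dv q (hor q z)"
  have HX: "DH q X = dPsi b q (hor q z)" unfolding X_def by (rule DH_Dv[OF q])
  have "DH q X \<in> contact_plane i (h x)" unfolding HX contact_plane_eq x(3)[symmetric] by (simp add: dPsi_hor)
  note * = at_point(3)[OF x(1), of X, folded x(2), OF this]
  \<comment> \<open>Injectivity of \<open>DH q\<close>, which follows from the equal dimensions,
    makes the description unique.\<close>
  have "(THE Y. DH q Y = \<i> *s DH q X) = Dv q (hor q (\<i> *s z))"
  proof (rule the_equality)
    show "DH q (Dv q (hor q (\<i> *s z))) = \<i> *s DH q X" unfolding HX DH_Dv[OF q] by (rule dPsi_hor(3))
    then show "Y = Dv q (hor q (\<i> *s z))" if "DH q Y = \<i> *s DH q X" for Y using DH_inj[OF q] that by metis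
  qed
  moreover have "DF q (THE Y. DF q Y = \<i> *s DF q X) = \<i> *s DF q X"
  proof -
    have "DF q X \<in> range (DF q) \<inter> contact_plane j (f x)" using * by blast
    from vec.subspace_scale[OF at_point(2)[OF x(1), folded x(2)] this, of \<i>]
    obtain Y where Y: "DF q Y = \<i> *s DF q X" by (metis IntD1 rangeE)
    then have "(THE Y. DF q Y = \<i> *s DF q X) = Y"
      by (rule the_equality) (metis Y at_point(1)[OF x(1), folded x(2)] injD)
    then show ?thesis using Y by simp
  qed
  ultimately have "DF q (Dv q (hor q (\<i> *s z))) = \<i> *s DF q X" using * by simp
  then show "FD uu q (hor q (\<i> *s z)) = \<i> *s FD uu q (hor q z)"
    unfolding Du[OF q] X_def .
qed

lemma uu_immersion: "cr_immersion SS uu j"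
proof unfold_locales
  show "open SS" by (rule SS(1))
  show "CR_on SS uu" by (rule uu_CR)
  show "Ck_open 3 SS uu" by (rule uu_C3)
  fix q assume q: "q \<in> SS"
  obtain x where x: "x \<in> Om" "q = kap x" "uu q = snd (affine_chart j) (f x)" by (rule SS_x[OF q])
  have d: "f x \<in> fst (affine_chart j)" using x(1) unfolding Om_def O1_def by blast
  show "uu q $ j = 1" unfolding x(3) by (rule affine_chart_line(1)[OF d])
  have "x \<in> carrier_of A" using x(1) Om(2) c unfolding carrier_of_def by force
  then have "f x \<in> Sigma_null" using fnull by blast
  then show "herm (uu q) (uu q) = 0" unfolding x(3) Sigma_null_def using affine_chart_line(3)[OF d] by blast
  fix Y assume "FD uu q Y = 0"
  then have "DF q (Dv q Y) = DF q 0" unfolding Du[OF q] using linear_0[OF has_derivative_linear[OF derivs(2)[OF q]]] by simp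
  then have "Dv q Y = 0" using injD[OF at_point(1)[OF x(1), folded x(2)]] by blast
  then show "Y = 0" by (rule Dv_inj[OF q])
qed

lemma f_uu: "x \<in> Om ==> kap x \<in> SS \<and> f x = vec.span {uu (kap x)}"
proof -
  assume x: "x \<in> Om"
  have q: "kap x \<in> SS" unfolding SS_def using x by blast
  have "vv (kap x) = \<phi> x" using span_kap(3) x Om(4) by blast
  then have "uu (kap x) = snd (affine_chart j) (f x)" unfolding uu_def using F1_at x Om(2) by auto
  then show ?thesis using q affine_chart_line(2)[of "f x" j] x unfolding Om_def O1_def by auto
qed

lemma kap_atlas_open: "X \<subseteq> Om ==> atlas_open A X ==> open (kap ` X)"
proof -
  assume X: "X \<subseteq> Om" "atlas_open A X"
  have "U \<inter> X = X" using X(1) Om(2) by blast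
  then show ?thesis using kap_open[OF X(1)] atlas_open_chart[OF M c X(2)] by simp
qed

lemma kap_preimage: "open Z ==> atlas_open A {x \<in> Om. kap x \<in> Z}"
proof (rule chart_open[OF M c])
  assume Z: "open Z"
  show "{x \<in> Om. kap x \<in> Z} \<subseteq> U" using Om(2) by blast
  have "continuous_on (\<phi> ` Om) (%y. chi b (H1 y))"
    by (rule bounded_linear.continuous_on[OF chi_bounded_linear]) (rule continuous_on_subset[OF Ck_open_continuous[OF H1(2)]], use Om(4) in blast)
  from continuous_open_preimage[OF this Om(1) Z]
  have "open (\<phi> ` Om \<inter> (%y. chi b (H1 y)) -` Z)" .
  moreover have "\<phi> ` Om \<inter> (%y. chi b (H1 y)) -` Z = \<phi> ` {x \<in> Om. kap x \<in> Z}"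
    using H1_at Om(2) unfolding kap_def by force
  ultimately show "open (\<phi> ` {x \<in> Om. kap x \<in> Z})" by simp
qed

end

section \<open>Globalisation\<close>

lemma span_line_eq: "v = c *s w ==> v ~= 0 ==> vec.span {v :: complex^'k} = vec.span {w}"
proof -
  assume v: "v = c *s w" "v ~= 0"
  then have "w = (1 / c) *s v" by auto
  then have "w \<in> vec.span {v}" "v \<in> vec.span {w}" unfolding span_line using v(1) by blast+
  then show ?thesis by (intro equalityI vec.span_minimal vec.subspace_span) auto
qed

text \<open>Only what analytic continuation needs is retained: a polynomial lift F of f on the
  quadric and a coordinate map \<open>kap\<close> that sends open sets to open sets.\<close>

lemma local_polynomial_form:
  fixes A :: "('p, 'e::euclidean_space) chart set" and f :: "'p => ('n::finite + 'n) V set"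
  assumes n2: "CARD('n) \<ge> 2" and sub: "CR_submanifold 3 CARD('n) A f"
    and flat: "CR_flat TYPE('n) 3 A f" and p: "p \<in> carrier_of A"
  obtains G and kap :: "'p => 'n heis" and F where "atlas_open A G" "p \<in> G" "pfv F"
    "!!X. X \<subseteq> G ==> atlas_open A X ==> open (kap ` X)"
    "!!x. x \<in> G ==> f x = vec.span {F (heis (kap x))}"
    "clin F \<and> inj F \<or> (\<exists>T B. isom T \<and> isom B \<and> (\<forall>x. T (F x) = wq (B x)))"
proof -
  obtain U g where c: "(U, g) \<in> A" "p \<in> U" using p unfolding carrier_of_def by force
  obtain W and h :: "'p => 'n V set" where h: "p \<in> W" "CR_equivalence 3 A f W h"
    using flat p unfolding CR_flat_def by metis
  \<comment> \<open>The chart indices b and j depend on knowing that \<open>h p\<close> and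
    \<open>f p\<close> are null lines; this preliminary instance provides it.\<close>
  interpret C0: flat_chart A f W h U g True undefined by unfold_locales (use sub h c in auto)
  obtain b where b: "h p \<in> fst (affine_chart (ii b))" using null_chart[OF C0.h_null[OF h(1)]] .
  have "f p \<in> CP" using C0.fnull p unfolding Sigma_null_def by auto
  then obtain j where j: "f p \<in> fst (affine_chart j)" using CP_chart_exists by blast
  interpret C: flat_chart A f W h U g b j by unfold_locales (use sub h c in auto)
  interpret I: cr_immersion C.SS C.uu j by (rule C.uu_immersion)
  have pO: "p \<in> C.Om" using c h b j unfolding C.Om_def C.O1_def C.O2_def by auto
  then have "C.kap p \<in> C.SS" using C.f_uu by blast
  then obtain Z where Z: "open Z" "C.kap p \<in> Z" "Z \<subseteq> C.SS"
    and Zf: "(\<exists>m. clin m \<and> inj m \<and> (\<forall>q\<in>Z. \<exists>c. C.uu q = c *s m (heis q))) \<or>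
     (\<exists>T B. isom T \<and> isom B \<and> (\<forall>q\<in>Z. \<exists>c. T (C.uu q) = c *s wq (B (heis q))))"
    by (rule I.local_form[OF n2])
  define G where "G = {x \<in> C.Om. C.kap x \<in> Z}"
  have G: "atlas_open A G" "p \<in> G" unfolding G_def using C.kap_preimage[OF Z(1)] pO Z(2) by auto
  have o: "open (C.kap ` X)" if "X \<subseteq> G" "atlas_open A X" for X
    using C.kap_atlas_open[of X] that unfolding G_def by blast
  have fx: "f x = vec.span {F (heis (C.kap x))}" if "x \<in> G" "\<forall>q\<in>Z. \<exists>c. C.uu q = c *s F (heis q)" for x F
    using that C.f_uu[of x] span_line_eq[of "C.uu (C.kap x)"] I.u_nz[of "C.kap x"] unfolding G_def by fastforce
  from Zf show ?thesis
  proof (elim disjE exE conjE)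
    fix m assume m: "clin m" "inj m" "\<forall>q\<in>Z. \<exists>c. C.uu q = c *s m (heis q)"
    show ?thesis by (rule that[OF G clin_pfv[OF m(1)] o fx[OF _ m(3)]]) (use m in auto)
  next
    fix T :: "('n + 'n) V => ('n + 'n) V" and B assume T: "isom T" "isom B" "\<forall>q\<in>Z. \<exists>c. T (C.uu q) = c *s wq (B (heis q))"
    define F where "F x = inv T (wq (B x))" for x
    have Ti: "isom (inv T)" "T (inv T y) = y" "inv T (T y) = y" for y
      using isom_inv[OF T(1)] isom_surj[OF T(1)] isom_inj[OF T(1)] by (auto simp: surj_f_inv_f)
    have pF: "pfv F" unfolding F_def[abs_def]
      by (rule pfv_compose[OF clin_pfv[OF isomD(1)[OF Ti(1)]] pfv_compose[OF whitney_quadratic_pfv clin_pfv[OF isomD(1)[OF T(2)]]]])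
    have "\<forall>q\<in>Z. \<exists>c. C.uu q = c *s F (heis q)"
      unfolding F_def using T(3) isom_sc[OF Ti(1)] Ti(3) by metis
    note * = fx[OF _ this]
    have "T (F x) = wq (B x)" for x unfolding F_def by (rule Ti(2))
    then show ?thesis by (intro that[OF G pF o *]) (use T in auto)
  qed
qed

text \<open>X collects the points near which f maps into Z, and Y those having a neighbourhood
  disjoint from X. If the domain of a local form meets X, the polynomials vanish on an open set of
  Heisenberg coordinates and hence on all of that domain, so X and Y cover the manifold and
  connectedness makes Y empty.\<close>

lemma global_spread:
  fixes A :: "('p, 'e::euclidean_space) chart set" and f :: "'p => ('n::finite + 'n) V set"
  assumes n2: "CARD('n) \<ge> 2" and sub: "CR_submanifold 3 CARD('n) A f"
    and conn: "connected_space (atlas_topology A)" and flat: "CR_flat TYPE('n) 3 A f"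
    and Z: "!!v. v \<in> Z \<longleftrightarrow> (\<forall>P\<in>\<P>. P v = 0)" "!!P. P \<in> \<P> ==> pf P" "!!c v. v \<in> Z ==> c *s v \<in> Z"
    and G0: "atlas_open A G0" "x0 \<in> G0" "!!x. x \<in> G0 ==> f x \<subseteq> Z"
    and x: "x \<in> carrier_of A"
  shows "f x \<subseteq> Z"
proof -
  have inj: "inj_on g U" if "(U, g) \<in> A" for U g
  proof -
    have "Ck_manifold 3 A" using sub unfolding CR_submanifold_def by blast
    then show ?thesis using that unfolding Ck_manifold_def by blast
  qed
  have op: "openin (atlas_topology A) X \<longleftrightarrow> atlas_open A X" for X by (rule openin_atlas_topology[OF inj])
  have top: "topspace (atlas_topology A) = carrier_of A" by (rule topspace_atlas_topology[OF inj])
  define X where "X = \<Union>{G. atlas_open A G \<and> (\<forall>x\<in>G. f x \<subseteq> Z)}"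
  define Y where "Y = \<Union>{G. atlas_open A G \<and> G \<inter> X = {}}"
  have oX: "openin (atlas_topology A) X" unfolding X_def by (rule openin_Union) (use op in auto)
  have oY: "openin (atlas_topology A) Y" unfolding Y_def by (rule openin_Union) (use op in auto)
  have "carrier_of A \<subseteq> X \<union> Y"
  proof
    fix p assume p: "p \<in> carrier_of A"
    obtain G and kap :: "'p => 'n heis" and F where G: "atlas_open A G" "p \<in> G" "pfv F"
      "!!X. X \<subseteq> G ==> atlas_open A X ==> open (kap ` X)"
      "!!x. x \<in> G ==> f x = vec.span {F (heis (kap x))}"
      by (rule local_polynomial_form[OF n2 sub flat p], rule that)
    show "p \<in> X \<union> Y"
    proof (cases "G \<inter> X = {}")
      case True
      then show ?thesis using G(1,2) unfolding Y_def by blast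
    next
      case False
      have "atlas_open A (G \<inter> X)" using op openin_Int oX G(1) by blast
      then have o: "open (kap ` (G \<inter> X))" using G(4) by blast
      obtain y where y: "y \<in> G \<inter> X" using False by blast
      have "F (heis q) \<in> Z" for q
        unfolding Z(1)
      proof
        fix P assume P: "P \<in> \<P>"
        show "P (F (heis q)) = 0"
        proof (rule pf_heis_zero[where F = "%x. P (F x)", OF pf_compose[OF Z(2)[OF P] G(3)] o])
          show "kap y \<in> kap ` (G \<inter> X)" using y by blast
          fix q assume "q \<in> kap ` (G \<inter> X)"
          then obtain z where z: "z \<in> G" "z \<in> X" "q = kap z" by blast
          have "F (heis q) \<in> f z" unfolding G(5)[OF z(1)] z(3) by (simp add: vec.span_base)
          then have "F (heis q) \<in> Z" using z(2) unfolding X_def by blast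
          then show "P (F (heis q)) = 0" using Z(1) P by blast
        qed
      qed
      then have "f z \<subseteq> Z" if "z \<in> G" for z unfolding G(5)[OF that] span_line using Z(3) by blast
      then show ?thesis using G(1,2) unfolding X_def by blast
    qed
  qed
  moreover have "X \<inter> Y = {}" unfolding Y_def by blast
  moreover have "x0 \<in> X" using G0 unfolding X_def by blast
  ultimately have "Y = {}" using connected_spaceD[OF conn oX oY, unfolded top] by (metis empty_iff)
  then show ?thesis using x \<open>carrier_of A \<subseteq> X \<union> Y\<close> unfolding X_def by blast
qed

theorem theorem5p1:
  fixes A :: "('p, 'e::euclidean_space) chart set"
    and f :: "'p \<Rightarrow> ('n::finite + 'n) V set"
  assumes "CARD('n) \<ge> 2"
    and "CR_submanifold 3 CARD('n) A f"
    and "connected_space (atlas_topology A)"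
    and "CR_flat TYPE('n) 3 A f"
    and "\<not> CR_linear CARD('n) A f"
  shows "\<exists>\<Phi> \<in> Sigma_automorphisms. (\<Phi> \<circ> f) ` carrier_of A \<subseteq> whitney ` Sigma_null"
proof (cases "carrier_of A = {}")
  case True
  have "(%L. (%x. mat 1 *v x) ` L) \<in> Sigma_automorphisms"
    unfolding Sigma_automorphisms_def by (intro CollectI exI[of _ "mat 1"]) (simp add: SU_def fun_eq_iff)
  then show ?thesis using True by blast
next
  case False
  then obtain p where p: "p \<in> carrier_of A" by blast
  note spread = global_spread[OF assms(1-4)]
  obtain G and kap :: "'p => 'n heis" and F where G: "atlas_open A G" "p \<in> G"
    "!!x. x \<in> G ==> f x = vec.span {F (heis (kap x))}"
    and cases: "clin F \<and> inj F \<or> (\<exists>T B. isom T \<and> isom B \<and> (\<forall>x. T (F x) = wq (B x)))"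
    by (rule local_polynomial_form[OF assms(1,2,4) p], rule that)
  from cases show ?thesis
  proof (elim disjE exE conjE)
    assume F: "clin F" "inj F"
    \<comment> \<open>A left inverse of F describes its range by the linear equations
      \<open>v = F (g v)\<close>, to which the spreading argument applies; the result contradicts
      nonlinearity.\<close>
    obtain g where g: "Vector_Spaces.linear (*s) (*s) g" "g \<circ> F = id"
      using vec.linear_injective_left_inverse[OF clin_imp_linear[OF F(1)] F(2)] by blast
    define P where "P i v = v $ i - F (g v) $ i" for i v
    have gc: "clin g" by (rule linear_imp_clin[OF g(1)])
    have gF: "g (F x) = x" for x using g(2) by (metis comp_apply id_apply)
    have Z: "v \<in> range F \<longleftrightarrow> (\<forall>P\<in>range P. P v = 0)" for v
    proof -
      have "v \<in> range F \<longleftrightarrow> v = F (g v)" using gF by (metis rangeE rangeI)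
      then show ?thesis unfolding P_def by (simp add: vec_eq_iff)
    qed
    have "pfv (%v. F (g v))" by (rule pfv_compose[OF clin_pfv[OF F(1)] clin_pfv[OF gc]])
    then have pfP: "pf Q" if "Q \<in> range P" for Q
      using that unfolding P_def[abs_def] pfv_def by (auto intro!: pf_intros)
    have sc: "c *s v \<in> range F" if "v \<in> range F" for c v
      using that clin_scale[OF F(1)] by (metis rangeE rangeI)
    have "f x \<subseteq> range F" if "x \<in> carrier_of A" for x
    proof (rule spread[OF Z pfP sc G(1,2) _ that])
      show "f x \<subseteq> range F" if "x \<in> G" for x unfolding G(3)[OF that] span_line using sc by blast
    qed
    moreover have "vec.subspace (range F)"
      by (rule vec.linear_subspace_image[OF clin_imp_linear[OF F(1)] vec.subspace_UNIV])
    moreover have "vec.dim (range F) = CARD('n) + 2"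
      using vec.dim_image_eq[OF clin_imp_linear[OF F(1)], of UNIV] F(2) unfolding vec_dim_card card_idx by simp
    ultimately show ?thesis using assms(5) unfolding CR_linear_def by blast
  next
    fix T :: "('n + 'n) V => ('n + 'n) V" and B :: "'n V => 'n V"
    assume T: "isom T" "isom B" "\<forall>x. T (F x) = wq (B x)"
    have Tc: "clin T" by (rule isomD(1)[OF T(1)])
    \<comment> \<open>All polynomial functions vanishing on the preimage of the cone; its defining
      equations are among them, so the common zero set is that preimage and nothing more.\<close>
    define \<P> :: "(('n + 'n) V => complex) set" where "\<P> = {P. pf P \<and> (\<forall>v. T v \<in> whitney_cone \<longrightarrow> P v = 0)}"
    have pT: "pfv T" by (rule clin_pfv[OF Tc])
    have Z: "v \<in> T -` whitney_cone \<longleftrightarrow> (\<forall>P\<in>\<P>. P v = 0)" for v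
    proof
      assume a: "\<forall>P\<in>\<P>. P v = 0"
      have "(%v. T v $ Mid (Inl i) * T v $ Mid (Inr k) - T v $ Mid (Inl k) * T v $ Mid (Inr i)) \<in> \<P>" for i k
        unfolding \<P>_def using pT unfolding pfv_def whitney_cone_def by (auto intro!: pf_intros)
      moreover have "(%v. tco (T v) * T v $ Mid (Inl i) * T v $ Mid (Inl k) -
          (0 - sco (T v) * T v $ Mid (Inr i) * T v $ Mid (Inr k))) \<in> \<P>" for i k
        unfolding \<P>_def using pT pf_compose[OF clinf_pf[OF tco_clinf] pT] pf_compose[OF clinf_pf[OF sco_clinf] pT]
        unfolding pfv_def whitney_cone_def by (auto intro!: pf_intros)
      ultimately show "v \<in> T -` whitney_cone"
        using a unfolding whitney_cone_def by (fastforce simp: eq_neg_iff_add_eq_0)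
    qed (auto simp: \<P>_def)
    have sc: "c *s v \<in> T -` whitney_cone" if "v \<in> T -` whitney_cone" for c v
    proof -
      have "c * c * c * (tco (T v) * T v $ Mid (Inl i) * T v $ Mid (Inl k)) =
          c * c * c * - (sco (T v) * T v $ Mid (Inr i) * T v $ Mid (Inr k))" for i k
        using that unfolding whitney_cone_def by simp
      then show ?thesis using that unfolding whitney_cone_def
        by (simp add: clin_scale[OF Tc] clinf_scale[OF tco_clinf] clinf_scale[OF sco_clinf] ac_simps)
    qed
    have cone: "f x \<subseteq> T -` whitney_cone" if "x \<in> carrier_of A" for x
    proof (rule spread[OF Z _ sc G(1,2) _ that])
      show "pf P" if "P \<in> \<P>" for P using that unfolding \<P>_def by blast
      show "f x \<subseteq> T -` whitney_cone" if "x \<in> G" for x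
      proof -
        have "T (c *s F (heis (kap x))) \<in> whitney_cone" for c
          unfolding clin_scale[OF Tc] T(3)[rule_format] by (rule whitney_quadratic_in_cone)
        then show ?thesis unfolding G(3)[OF that] span_line by blast
      qed
    qed
    \<comment> \<open>Replacing T by a multiple of determinant one does not change the
      lines.\<close>
    obtain T' c where T': "T' \<in> SU" "c ~= 0" "!!x. T' *v x = c *s T x" by (rule isom_SU[OF T(1)], rule that)
    have "(%x. T' *v x) ` f x \<in> whitney ` Sigma_null" if x: "x \<in> carrier_of A" for x
    proof -
      have S: "f x \<in> Sigma_null" using assms(2) x unfolding CR_submanifold_def by blast
      then obtain v where v: "v ~= 0" "f x = vec.span {v}" using CP_line unfolding Sigma_null_def by blast
      then have vf: "v \<in> f x" "herm v v = 0" using S vec.span_base unfolding Sigma_null_def by blast+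
      have "T v ~= 0" "herm (T v) (T v) = 0" "T v \<in> whitney_cone"
        using v(1) isom_eq_0[OF T(1)] isomD(2)[OF T(1)] vf cone[OF x] by auto
      then obtain z where z: "herm z z = 0" "z ~= 0" "T v = wq z" using whitney_cone_null by metis
      have "vec.span {z} \<in> Sigma_null" using Sigma_null_span[OF z(2)] z(1) by blast
      moreover have "whitney (vec.span {z}) = (%x. T' *v x) ` f x"
      proof -
        have "vec.span (wq ` vec.span {z}) = vec.span {wq z}"
        proof (intro equalityI vec.span_minimal vec.subspace_span)
          show "wq ` vec.span {z} \<subseteq> vec.span {wq z}"
            unfolding span_line by (auto simp: whitney_quadratic_scale)
          show "{wq z} \<subseteq> vec.span (wq ` vec.span {z})"
            using vec.span_base[of z "{z}"] by (auto intro: vec.span_base)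
        qed
        also have "\<dots> = (%x. T' *v x) ` f x"
        proof -
          have "(%x. T' *v x) ` f x = {(c * a) *s wq z | a. True}"
          proof -
            have "(%x. T' *v x) ` {a *s v | a. True} = {T' *v (a *s v) | a. True}" by blast
            then show ?thesis unfolding v(2) span_line by (simp add: T'(3) clin_scale[OF Tc] z(3))
          qed
          also have "\<dots> = {a *s wq z | a. True}"
            using T'(2) by (auto intro: exI[of _ "a / c" for a])
          finally show ?thesis unfolding span_line by simp
        qed
        finally show ?thesis unfolding whitney_def .
      qed
      ultimately show ?thesis by (metis imageI)
    qed
    moreover have "(%L. (%x. T' *v x) ` L) \<in> Sigma_automorphisms"
      unfolding Sigma_automorphisms_def using T'(1) by blast
    ultimately show ?thesis by (intro bexI[of _ "%L. (%x. T' *v x) ` L"]) auto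
  qed
qed

end
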